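(* Let $T$ be an integral domain, $c$ an indeterminate, and let $A^{E,B,c}_n(T)$ be an arbitrary quantized Weyl algebra over $T[c]$ as in the context, where all $\epsilon_j,\beta_{jk}\in T^\times$ are roots of unity and $\epsilon_j\ne1$ for all $j$. Let $L_1,\dots,L_n\in\mathbb Z_+$ be such that $$x_1^{L_1},y_1^{L_1},\dots,x_n^{L_n},y_n^{L_n}\in\mathcal Z(A^{E,B}_n(T)).$$ Denote $\mathcal A_n:=A^{E,B,c}_n(T)$, $\mathcal C_n:=T[c,x_1^{L_1},y_1^{L_1},\dots,x_n^{L_n},y_n^{L_n}]$, and, for $n>1$, $\mathcal A_{n-1}:=A^{E^\vee,B^\vee,c'}_{n-1}(T)$ and $\mathcal C_{n-1}:=T[c',x_2^{L_2},y_2^{L_2},\dots,x_n^{L_n},y_n^{L_n}]$; for $n=1$, $\mathcal A_0=\mathcal C_0=T[c']$. (i) The discriminant $d(\mathcal A_n/\mathcal C_n)$ is a polynomial in $c^{\gcd(L_1,\dots,L_n)}$ (with coefficients in $T[x_1^{L_1},y_1^{L_1},\dots,x_n^{L_n},y_n^{L_n}]$). (ii) By part (i) and the fact that $d_j\mid L_k$ for $j\le k$, the discriminant $d(\mathcal A_{n-1}/\mathcal C_{n-1})$ is a polynomial in $(c')^{d_1}$, denoted $d(\mathcal A_{n-1}/\mathcal C_{n-1})((c')^{d_1})$. We have \begin{align*} d(\mathcal A_n/\mathcal C_n)&=_{T^\times}\theta\,x_1^{(L_1-d_1)\Lambda}y_1^{(L_1-d_1)\Lambda}\big(c^{L_1}-(1-\epsilon_1)^{L_1}y_1^{L_1}x_1^{L_1}\big)^{(d_1-1)\Lambda/L_1}\\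 &\quad\times\prod_{i=0}^{L_1/d_1-1}\Big[d(\mathcal A_{n-1}/\mathcal C_{n-1})\big(c^{d_1}-\zeta^i(1-\epsilon_1)^{d_1}y_1^{d_1}x_1^{d_1}\big)\Big]^{d_1L_1}, \end{align*} where $\Lambda=L_1^2\cdots L_n^2$, $\theta=L_1^\Lambda\big(L_1(1-\epsilon_1)^{-d_1+1}\big)^\Lambda$, and $\zeta$ is a primitive $L_1/d_1$-st root of unity.
   Context: Notation: $\mathbb Z_+$ positive integers; an integral domain is a commutative unital ring without zero-divisors; $T^\times$ is its group of units; $\mathcal Z(R)$ is the center of $R$; $a=_{T^\times}b$ means $a=bu$ for some $u\in T^\times$. Let $E=(\epsilon_1,\dots,\epsilon_n)\in(T^\times)^n$ and $B=(\beta_{jk})\in M_n(T^\times)$ with $\beta_{jk}\beta_{kj}=1$ for $j\ne k$, $\beta_{jj}=1$. $A^{E,B,c}_n(T)$ is the unital associative $T[c]$-algebra with generators $x_1,y_1,\dots,x_n,y_n$ and relations $y_jy_k=\beta_{jk}y_ky_j$ for all $j,k$; $x_jx_k=\epsilon_j\beta_{jk}x_kx_j$ for $j<k$; $x_jy_k=\beta_{kj}y_kx_j$ for $j<k$; $x_jy_k=\epsilon_k\beta_{kj}y_kx_j$ for $j>k$; $x_jy_j-\epsilon_jy_jx_j=c+\sum_{i=1}^{j-1}(\epsilon_i-1)y_ix_i$ for all $j$. $A^{E,B}_n(T):=A^{E,B,c}_n(T)/(c-1)A^{E,B,c}_n(T)$ is the (usual) quantized Weyl algebra, i.e. the $T$-algebra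 with these relations and $c=1$. The elements $x_j^{L_j}$, $y_j^{L_j}$ are central in $A^{E,B}_n(T)$ for all $j$ if and only if they are central in $A^{E,B,c}_n(T)$. $d_j$ denotes the multiplicative order of $\epsilon_j$. $E^\vee:=(\epsilon_2,\dots,\epsilon_n)$, and $B^\vee$ is the matrix obtained from $B$ by deleting the first row and column. The generators of $A^{E^\vee,B^\vee,c'}_{n-1}(T)$ (with indeterminate $c'$ in place of $c$) are denoted $x_2,y_2,\dots,x_n,y_n$. $A^{E,B,c}_n(T)$ is a free module of rank $\Lambda$ over $\mathcal C_n$; similarly for $\mathcal A_{n-1}$ over $\mathcal C_{n-1}$. Discriminant: if an algebra $A$ is free of finite rank $M$ over a subalgebra $C\subseteq\mathcal Z(A)$, a $C$-basis gives an embedding $A\hookrightarrow M_M(C)$ (by multiplication), and the internal trace $\mathrm{tr}\colon A\to C$ is its composition with the matrix trace. $d(A/C):=\det[\mathrm{tr}(bb')]_{b\in\mathcal B,b'\in\mathcal B'}$ for any $C$-bases $\mathcal B,\mathcal B'$ of $A$; it is well defined up to units of $C$. Here $\mathcal C_n^\times=\mathcal C_{n-1}^\times=T^\times$. The elements $x_1^{d_1}$ and $y_1^{d_1}$ commute. The root of unity $\zeta$ is taken in an extension of $T$ (e.g. an algebraic closure of its fraction field), and $(1-\epsilon_1)^{-d_1+1}$ is taken in the fraction field of $T$ (one has $d_1(1-\epsilon_1)^{-d_1+1}\in T$). *)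

theory Defs
  imports
    "HOL-Library.Poly_Mapping"
    "HOL-Library.FuncSet"
    "HOL-Computational_Algebra.Polynomial"
    "HOL-Combinatorics.Permutations"
    "HOL-Algebra.QuotRing"
    "HOL-Algebra.Generated_Rings"
begin

section \<open>Free algebras\<close>

datatype gen = X (idx: nat) | Y (idx: nat)

text \<open>
  Words form a monoid under concatenation, written additively, since \<^theory>\<open>HOL-Library.Poly_Mapping\<close>
  builds the monoid algebra of a \<^class>\<open>monoid_add\<close>. So \<open>gen word \<Rightarrow>\<^sub>0 'r\<close> is the free associative
  unital \<open>'r\<close>-algebra on all the letters \<open>X j\<close>, \<open>Y j\<close>.
\<close>

datatype 'g word = Word (letters: "'g list")

instantiation word :: (type) monoid_add
begin
definition zero_word :: "'g word" where "zero_word = Word []"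
definition plus_word :: "'g word \<Rightarrow> 'g word \<Rightarrow> 'g word"
  where "plus_word u v = Word (letters u @ letters v)"
instance by standard (simp_all add: zero_word_def plus_word_def)
end

definition free_algebra :: "gen set \<Rightarrow> (gen word \<Rightarrow>\<^sub>0 'r::comm_ring_1) ring" where
  "free_algebra G =
     \<lparr> carrier = {f. \<forall>w\<in>Poly_Mapping.keys f. set (letters w) \<subseteq> G},
       mult = (*), one = 1, zero = 0, add = (+) \<rparr>"

definition fscal :: "'r \<Rightarrow> gen word \<Rightarrow>\<^sub>0 'r::comm_ring_1" where
  "fscal r = Poly_Mapping.single 0 r"

definition fgen :: "gen \<Rightarrow> gen word \<Rightarrow>\<^sub>0 'r::comm_ring_1" where
  "fgen g = Poly_Mapping.single (Word [g]) 1"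

section \<open>Quantized Weyl algebras\<close>

text \<open>
  The indices run over \<open>m, \<dots>, n\<close>. With \<open>m = 1\<close> one gets the algebra attached to \<open>E\<close>, \<open>B\<close>; with
  \<open>m = 2\<close> the one attached to \<open>E\<close> without its first entry and \<open>B\<close> without its first row and column,
  with generators named \<open>x\<^sub>2, y\<^sub>2, \<dots>, x\<^sub>n, y\<^sub>n\<close>. For \<open>m > n\<close> there are no generators and no relations,
  and the algebra is the base ring. The base ring \<open>'r\<close> and its element \<open>c\<close> are arbitrary here.
\<close>

definition gens :: "nat \<Rightarrow> nat \<Rightarrow> gen set" where
  "gens m n = {g. m \<le> idx g \<and> idx g \<le> n}"

definition qw_rels ::
  "nat \<Rightarrow> nat \<Rightarrow> (nat \<Rightarrow> 'r) \<Rightarrow> (nat \<Rightarrow> nat \<Rightarrow> 'r) \<Rightarrow> 'r \<Rightarrow> (gen word \<Rightarrow>\<^sub>0 'r::comm_ring_1) set" where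
  "qw_rels m n E B c =
     (let x = (\<lambda>j. fgen (X j)); y = (\<lambda>j. fgen (Y j)) in
       {y j * y k - fscal (B j k) * y k * y j | j k. j \<in> {m..n} \<and> k \<in> {m..n}} \<union>
       {x j * x k - fscal (E j * B j k) * x k * x j | j k. j \<in> {m..n} \<and> k \<in> {m..n} \<and> j < k} \<union>
       {x j * y k - fscal (B k j) * y k * x j | j k. j \<in> {m..n} \<and> k \<in> {m..n} \<and> j < k} \<union>
       {x j * y k - fscal (E k * B k j) * y k * x j | j k. j \<in> {m..n} \<and> k \<in> {m..n} \<and> j > k} \<union>
       {x j * y j - fscal (E j) * y j * x j
          - (fscal c + (\<Sum>i\<in>{m..<j}. fscal (E i - 1) * y i * x i)) | j. j \<in> {m..n}})"

definition qw_ideal ::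
  "nat \<Rightarrow> nat \<Rightarrow> (nat \<Rightarrow> 'r) \<Rightarrow> (nat \<Rightarrow> nat \<Rightarrow> 'r) \<Rightarrow> 'r \<Rightarrow> (gen word \<Rightarrow>\<^sub>0 'r::comm_ring_1) set" where
  "qw_ideal m n E B c = genideal (free_algebra (gens m n)) (qw_rels m n E B c)"

definition qweyl ::
  "nat \<Rightarrow> nat \<Rightarrow> (nat \<Rightarrow> 'r) \<Rightarrow> (nat \<Rightarrow> nat \<Rightarrow> 'r) \<Rightarrow> 'r \<Rightarrow> (gen word \<Rightarrow>\<^sub>0 'r::comm_ring_1) set ring" where
  "qweyl m n E B c = free_algebra (gens m n) Quot qw_ideal m n E B c"

definition qw_class ::
  "nat \<Rightarrow> nat \<Rightarrow> (nat \<Rightarrow> 'r) \<Rightarrow> (nat \<Rightarrow> nat \<Rightarrow> 'r) \<Rightarrow> 'r \<Rightarrow>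
     (gen word \<Rightarrow>\<^sub>0 'r) \<Rightarrow> (gen word \<Rightarrow>\<^sub>0 'r::comm_ring_1) set" where
  "qw_class m n E B c f = qw_ideal m n E B c +>\<^bsub>free_algebra (gens m n)\<^esub> f"

text \<open>The algebra over \<open>T[c]\<close>: the base ring is \<open>'t poly\<close>, and \<open>c\<close> is its indeterminate.\<close>

definition cweyl ::
  "nat \<Rightarrow> nat \<Rightarrow> (nat \<Rightarrow> 't) \<Rightarrow> (nat \<Rightarrow> nat \<Rightarrow> 't) \<Rightarrow> (gen word \<Rightarrow>\<^sub>0 't::idom poly) set ring" where
  "cweyl m n E B = qweyl m n (\<lambda>j. [:E j:]) (\<lambda>j k. [:B j k:]) [:0, 1:]"

definition cw_class ::
  "nat \<Rightarrow> nat \<Rightarrow> (nat \<Rightarrow> 't) \<Rightarrow> (nat \<Rightarrow> nat \<Rightarrow> 't) \<Rightarrow>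
     (gen word \<Rightarrow>\<^sub>0 't poly) \<Rightarrow> (gen word \<Rightarrow>\<^sub>0 't::idom poly) set" where
  "cw_class m n E B = qw_class m n (\<lambda>j. [:E j:]) (\<lambda>j k. [:B j k:]) [:0, 1:]"

definition cw_scal ::
  "nat \<Rightarrow> nat \<Rightarrow> (nat \<Rightarrow> 't) \<Rightarrow> (nat \<Rightarrow> nat \<Rightarrow> 't) \<Rightarrow> 't poly \<Rightarrow> (gen word \<Rightarrow>\<^sub>0 't::idom poly) set" where
  "cw_scal m n E B p = cw_class m n E B (fscal p)"

definition cw_const ::
  "nat \<Rightarrow> nat \<Rightarrow> (nat \<Rightarrow> 't) \<Rightarrow> (nat \<Rightarrow> nat \<Rightarrow> 't) \<Rightarrow> 't \<Rightarrow> (gen word \<Rightarrow>\<^sub>0 't::idom poly) set" where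
  "cw_const m n E B a = cw_scal m n E B [:a:]"

definition cw_c ::
  "nat \<Rightarrow> nat \<Rightarrow> (nat \<Rightarrow> 't) \<Rightarrow> (nat \<Rightarrow> nat \<Rightarrow> 't) \<Rightarrow> (gen word \<Rightarrow>\<^sub>0 't::idom poly) set" where
  "cw_c m n E B = cw_scal m n E B [:0, 1:]"

definition cw_gen ::
  "nat \<Rightarrow> nat \<Rightarrow> (nat \<Rightarrow> 't) \<Rightarrow> (nat \<Rightarrow> nat \<Rightarrow> 't) \<Rightarrow> gen \<Rightarrow> (gen word \<Rightarrow>\<^sub>0 't::idom poly) set" where
  "cw_gen m n E B g = cw_class m n E B (fgen g)"

definition ring_center :: "('a, 'b) ring_scheme \<Rightarrow> 'a set" where
  "ring_center R = {z \<in> carrier R. \<forall>a\<in>carrier R. z \<otimes>\<^bsub>R\<^esub> a = a \<otimes>\<^bsub>R\<^esub> z}"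

text \<open>
  \<open>T[c, x\<^sub>m^L\<^sub>m, y\<^sub>m^L\<^sub>m, \<dots>, x\<^sub>n^L\<^sub>n, y\<^sub>n^L\<^sub>n]\<close>, the subalgebra of \<open>cweyl m n E B\<close> generated by the
  powers.
\<close>

definition cw_sub ::
  "nat \<Rightarrow> nat \<Rightarrow> (nat \<Rightarrow> 't) \<Rightarrow> (nat \<Rightarrow> nat \<Rightarrow> 't) \<Rightarrow> (nat \<Rightarrow> nat) \<Rightarrow> (gen word \<Rightarrow>\<^sub>0 't::idom poly) set set" where
  "cw_sub m n E B L =
     generate_ring (cweyl m n E B)
       (range (cw_scal m n E B) \<union>
        (\<lambda>g. cw_gen m n E B g [^]\<^bsub>cweyl m n E B\<^esub> L (idx g)) ` gens m n)"

section \<open>Discriminants\<close>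

text \<open>
  \<open>A\<close> is a ring, \<open>C\<close> (the carrier of) a central subring. A basis of size \<open>M\<close> is a family \<open>b 0, \<dots>, b (M - 1)\<close>.
\<close>

definition is_basis :: "('a, 'b) ring_scheme \<Rightarrow> 'a set \<Rightarrow> nat \<Rightarrow> (nat \<Rightarrow> 'a) \<Rightarrow> bool" where
  "is_basis A C M b \<longleftrightarrow>
     (\<forall>i<M. b i \<in> carrier A) \<and>
     (\<forall>a\<in>carrier A. \<exists>!f. f \<in> {..<M} \<rightarrow>\<^sub>E C \<and> a = (\<Oplus>\<^bsub>A\<^esub>i\<in>{..<M}. f i \<otimes>\<^bsub>A\<^esub> b i))"

definition coords :: "('a, 'b) ring_scheme \<Rightarrow> 'a set \<Rightarrow> nat \<Rightarrow> (nat \<Rightarrow> 'a) \<Rightarrow> 'a \<Rightarrow> nat \<Rightarrow> 'a" where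
  "coords A C M b a =
     (THE f. f \<in> {..<M} \<rightarrow>\<^sub>E C \<and> a = (\<Oplus>\<^bsub>A\<^esub>i\<in>{..<M}. f i \<otimes>\<^bsub>A\<^esub> b i))"

text \<open>The matrix of left multiplication by \<open>a\<close> has the coordinates of \<open>a b\<^sub>j\<close> as its \<open>j\<close>-th column.\<close>

definition mult_matrix ::
  "('a, 'b) ring_scheme \<Rightarrow> 'a set \<Rightarrow> nat \<Rightarrow> (nat \<Rightarrow> 'a) \<Rightarrow> 'a \<Rightarrow> nat \<Rightarrow> nat \<Rightarrow> 'a" where
  "mult_matrix A C M b a i j = coords A C M b (a \<otimes>\<^bsub>A\<^esub> b j) i"

definition internal_trace ::
  "('a, 'b) ring_scheme \<Rightarrow> 'a set \<Rightarrow> nat \<Rightarrow> (nat \<Rightarrow> 'a) \<Rightarrow> 'a \<Rightarrow> 'a" where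
  "internal_trace A C M b a = (\<Oplus>\<^bsub>A\<^esub>i\<in>{..<M}. mult_matrix A C M b a i i)"

text \<open>The Leibniz formula in a commutative ring given by its carrier.\<close>

definition ring_det :: "('a, 'b) ring_scheme \<Rightarrow> nat \<Rightarrow> (nat \<Rightarrow> nat \<Rightarrow> 'a) \<Rightarrow> 'a" where
  "ring_det R M U =
     (\<Oplus>\<^bsub>R\<^esub>p\<in>{p. p permutes {..<M}}. [sign p] \<cdot>\<^bsub>R\<^esub> (\<Otimes>\<^bsub>R\<^esub>i\<in>{..<M}. U i (p i)))"

text \<open>
  The discriminant is defined up to a unit of \<open>C\<close>, so we say when \<open>d\<close> is a representative. The basis
  \<open>b\<^sub>0\<close> only serves to compute the trace, which does not depend on it.
\<close>

definition is_discriminant :: "('a, 'b) ring_scheme \<Rightarrow> 'a set \<Rightarrow> 'a \<Rightarrow> bool" where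
  "is_discriminant A C d \<longleftrightarrow>
     subring C A \<and> C \<subseteq> ring_center A \<and>
     (\<exists>M b\<^sub>0 b b'. is_basis A C M b\<^sub>0 \<and> is_basis A C M b \<and> is_basis A C M b' \<and>
        d = ring_det (A\<lparr>carrier := C\<rparr>) M (\<lambda>i j. internal_trace A C M b\<^sub>0 (b i \<otimes>\<^bsub>A\<^esub> b' j)))"

section \<open>Polynomials evaluated in quantized Weyl algebras\<close>

text \<open>
  An element of \<open>((gen \<Rightarrow>\<^sub>0 nat) \<Rightarrow>\<^sub>0 't) poly\<close> is a polynomial in one variable \<open>s\<close> whose coefficients
  are commutative polynomials over \<open>'t\<close> in variables named by \<open>gen\<close>.
\<close>

definition over_gens :: "gen set \<Rightarrow> ((gen \<Rightarrow>\<^sub>0 nat) \<Rightarrow>\<^sub>0 't::zero) poly \<Rightarrow> bool" where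
  "over_gens G D \<longleftrightarrow>
     (\<forall>k. \<forall>\<alpha>\<in>Poly_Mapping.keys (Polynomial.coeff D k). Poly_Mapping.keys \<alpha> \<subseteq> G)"

text \<open>
  The variables \<open>X j\<close>, \<open>Y j\<close> go to \<open>x\<^sub>j^L\<^sub>j\<close>, \<open>y\<^sub>j^L\<^sub>j\<close> in \<open>cweyl m n E B\<close>, the variable \<open>s\<close> to the
  given element, and scalars through \<open>\<phi>\<close>. The powers are central where this is used, so their
  product may be taken in the commutative monoid of central elements.
\<close>

definition cw_eval ::
  "nat \<Rightarrow> nat \<Rightarrow> (nat \<Rightarrow> 'k) \<Rightarrow> (nat \<Rightarrow> nat \<Rightarrow> 'k) \<Rightarrow> (nat \<Rightarrow> nat) \<Rightarrow> ('t \<Rightarrow> 'k) \<Rightarrow>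
     ((gen \<Rightarrow>\<^sub>0 nat) \<Rightarrow>\<^sub>0 't::zero) poly \<Rightarrow> (gen word \<Rightarrow>\<^sub>0 'k poly) set \<Rightarrow> (gen word \<Rightarrow>\<^sub>0 'k::idom poly) set" where
  "cw_eval m n E B L \<phi> D s =
     (let A = cweyl m n E B in
       \<Oplus>\<^bsub>A\<^esub>k\<in>{..Polynomial.degree D}.
         (\<Oplus>\<^bsub>A\<^esub>\<alpha>\<in>Poly_Mapping.keys (Polynomial.coeff D k).
            cw_const m n E B (\<phi> (Poly_Mapping.lookup (Polynomial.coeff D k) \<alpha>)) \<otimes>\<^bsub>A\<^esub>
            (\<Otimes>\<^bsub>A\<lparr>carrier := ring_center A\<rparr>\<^esub>g\<in>Poly_Mapping.keys \<alpha>.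
               (cw_gen m n E B g [^]\<^bsub>A\<^esub> L (idx g)) [^]\<^bsub>A\<^esub> Poly_Mapping.lookup \<alpha> g))
         \<otimes>\<^bsub>A\<^esub> s [^]\<^bsub>A\<^esub> k)"

section \<open>Extension of scalars and roots of unity\<close>

definition domain_embedding :: "('t::idom \<Rightarrow> 'k::field) \<Rightarrow> bool" where
  "domain_embedding \<phi> \<longleftrightarrow>
     inj \<phi> \<and> \<phi> 1 = 1 \<and> (\<forall>a b. \<phi> (a + b) = \<phi> a + \<phi> b) \<and> (\<forall>a b. \<phi> (a * b) = \<phi> a * \<phi> b)"

text \<open>
  The map \<open>cweyl m n E B \<rightarrow> cweyl m n (\<phi> \<circ> E) (\<phi> \<circ> B)\<close> that applies \<open>\<phi>\<close> to all coefficients. It takes a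
  coset \<open>S\<close> to the coset containing the image of \<open>S\<close>.
\<close>

definition cw_base_change ::
  "nat \<Rightarrow> nat \<Rightarrow> (nat \<Rightarrow> 't) \<Rightarrow> (nat \<Rightarrow> nat \<Rightarrow> 't) \<Rightarrow> ('t::idom \<Rightarrow> 'k::field) \<Rightarrow>
     (gen word \<Rightarrow>\<^sub>0 't poly) set \<Rightarrow> (gen word \<Rightarrow>\<^sub>0 'k poly) set" where
  "cw_base_change m n E B \<phi> S =
     qw_ideal m n (\<lambda>j. [:\<phi> (E j):]) (\<lambda>j k. [:\<phi> (B j k):]) [:0, 1:]
       <+>\<^bsub>free_algebra (gens m n)\<^esub> Poly_Mapping.map (map_poly \<phi>) ` S"

definition is_root_of_unity :: "'a::monoid_mult \<Rightarrow> bool" where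
  "is_root_of_unity a \<longleftrightarrow> (\<exists>k::nat. k > 0 \<and> a ^ k = 1)"

text \<open>Only meaningful for roots of unity.\<close>

definition mult_order :: "'a::monoid_mult \<Rightarrow> nat" where
  "mult_order a = (LEAST k. k > 0 \<and> a ^ k = 1)"

definition is_primitive_root_of_unity :: "nat \<Rightarrow> 'a::monoid_mult \<Rightarrow> bool" where
  "is_primitive_root_of_unity k z \<longleftrightarrow> k > 0 \<and> z ^ k = 1 \<and> (\<forall>i. 0 < i \<and> i < k \<longrightarrow> z ^ i \<noteq> 1)"

definition list_product :: "('a, 'b) ring_scheme \<Rightarrow> 'a list \<Rightarrow> 'a" where
  "list_product R as = foldr (\<lambda>a r. a \<otimes>\<^bsub>R\<^esub> r) as \<one>\<^bsub>R\<^esub>"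

text \<open>
  The right-hand side of the recursion, without the unit, computed in the algebra over the field \<open>'k\<close>
  with parameters \<open>E\<close>, \<open>B\<close> (the images of the original ones under \<open>\<phi>\<close>). The factors of the final
  product commute, so their order is immaterial.
\<close>

definition disc_theta :: "nat \<Rightarrow> nat \<Rightarrow> nat \<Rightarrow> 'k::field \<Rightarrow> 'k" where
  "disc_theta L1 d1 \<Lambda> \<epsilon> = of_nat L1 ^ \<Lambda> * (of_nat L1 * (1 - \<epsilon>) powi (1 - int d1)) ^ \<Lambda>"

definition disc_rhs ::
  "nat \<Rightarrow> (nat \<Rightarrow> 'k) \<Rightarrow> (nat \<Rightarrow> nat \<Rightarrow> 'k) \<Rightarrow> (nat \<Rightarrow> nat) \<Rightarrow> ('t \<Rightarrow> 'k) \<Rightarrow> 'k \<Rightarrow>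
     ((gen \<Rightarrow>\<^sub>0 nat) \<Rightarrow>\<^sub>0 't::zero) poly \<Rightarrow> (gen word \<Rightarrow>\<^sub>0 'k::field poly) set" where
  "disc_rhs n E B L \<phi> \<zeta> D =
     (let A = cweyl 1 n E B;
          x = cw_gen 1 n E B (X 1);
          y = cw_gen 1 n E B (Y 1);
          c = cw_c 1 n E B;
          const = cw_const 1 n E B;
          L1 = L 1;
          d1 = mult_order (E 1);
          \<Lambda> = (\<Prod>j\<in>{1..n}. (L j)\<^sup>2)
      in const (disc_theta L1 d1 \<Lambda> (E 1))
         \<otimes>\<^bsub>A\<^esub> x [^]\<^bsub>A\<^esub> ((L1 - d1) * \<Lambda>)
         \<otimes>\<^bsub>A\<^esub> y [^]\<^bsub>A\<^esub> ((L1 - d1) * \<Lambda>)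
         \<otimes>\<^bsub>A\<^esub> (c [^]\<^bsub>A\<^esub> L1 \<ominus>\<^bsub>A\<^esub> const ((1 - E 1) ^ L1) \<otimes>\<^bsub>A\<^esub> y [^]\<^bsub>A\<^esub> L1 \<otimes>\<^bsub>A\<^esub> x [^]\<^bsub>A\<^esub> L1)
              [^]\<^bsub>A\<^esub> ((d1 - 1) * \<Lambda> div L1)
         \<otimes>\<^bsub>A\<^esub> list_product A
              (map (\<lambda>i. cw_eval 1 n E B L \<phi> D
                         (c [^]\<^bsub>A\<^esub> d1 \<ominus>\<^bsub>A\<^esub>
                            const (\<zeta> ^ i * (1 - E 1) ^ d1) \<otimes>\<^bsub>A\<^esub> y [^]\<^bsub>A\<^esub> d1 \<otimes>\<^bsub>A\<^esub> x [^]\<^bsub>A\<^esub> d1)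
                         [^]\<^bsub>A\<^esub> (d1 * L1))
                   [0..<L1 div d1]))"

end

theory Submission
  imports Defs "HOL-Algebra.Algebraic_Closure_Type" "Jordan_Normal_Form.Determinant"
begin

text \<open>
  The algebra acts faithfully on functions on a lattice, where \<open>z = c + (\<epsilon>\<^sub>1 - 1) y\<^sub>1 x\<^sub>1\<close> is a shift. The
  elements \<open>z\<^sup>i b\<^sub>p y\<^sub>1\<^sup>k\<close>, with \<open>b\<^sub>p\<close> running through the monomials in the other generators, span a
  sublattice of full rank. Since \<open>z\<close> plays the role of \<open>c'\<close> for the other generators and
  \<open>(c\<^sup>d - z\<^sup>d)\<^sup>r = (1 - \<epsilon>\<^sub>1)\<^sup>l y\<^sub>1\<^sup>l x\<^sub>1\<^sup>l\<close>, where \<open>l = L\<^sub>1\<close>, \<open>d = d\<^sub>1\<close> and \<open>r = l / d\<close>, the Gram matrix of the sublattice becomes,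
  over the roots \<open>t\<close> of this equation, a block diagonal matrix whose blocks are the Gram matrices of the smaller
  algebra at \<open>c' = t\<close>, conjugated by a Vandermonde matrix. Part (i) holds because the algebra is graded with
  \<open>c\<close> and the \<open>y\<^sub>j\<close> of degree \<open>1\<close> and the \<open>x\<^sub>j\<close> of degree \<open>0\<close>.
\<close>

section \<open>Determinants indexed by finite sets\<close>

text \<open>That ordered monomials span is rewriting in the free algebra, but their independence
  needs a model. The difference operators are one, and since operators form a type, all later
  computation takes place among them.

  The index of the sublattice is \<open>detS I3 P\<close>, and its square has to be divided out. Its
  powers of \<open>y_1\<close> cancel against those created when exponents of \<open>y_1\<close>
  wrap around \<open>l\<close>; its powers of \<open>\<epsilon>_1 - 1\<close> account for the
  negative exponent in \<theta>. Of the two factors \<open>L_1^\<Lambda>\<close> in \<theta>, one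
  counts the \<open>l\<close> powers of \<open>y_1\<close> in each trace, the other comes from the
  Vandermonde determinant.

  The roots exist only in an algebraic closure, with \<omega> an \<open>r\<close>-th root of a
  central element, whereas the formula has in place of \<omega> the operator
  \<open>(1 - \<epsilon>_1)^d y_1^d x_1^d\<close>, which need not be central. The two can be
  exchanged because the product over the \<open>\<zeta>^i\<close> is invariant under multiplying
  \<omega> by \<zeta>, hence depends on \<open>\<omega>^r\<close> only. The Vandermonde matrix is
  invertible only if \<open>L_1\<close> is nonzero in \<open>T\<close>; otherwise both sides
  vanish.\<close>

definition detS :: "'i set \<Rightarrow> ('i \<Rightarrow> 'i \<Rightarrow> 'a::comm_ring_1) \<Rightarrow> 'a" where
  "detS I A = (\<Sum>p\<in>{p. p permutes I}. of_int (sign p) * (\<Prod>i\<in>I. A i (p i)))"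

lemma detS_cong:
  assumes "I = J" "\<And>i j. i \<in> I \<Longrightarrow> j \<in> I \<Longrightarrow> A i j = A' i j"
  shows "detS I A = detS J A'"
  unfolding detS_def assms(1)[symmetric]
  by (intro sum.cong prod.cong arg_cong2[where f="(*)"] refl) (auto simp: assms permutes_in_image)

text \<open>Conjugating permutations by the bijection preserves signs and products. This connects
  determinants of numbered matrices with those over sets of tuples, where block structure is a
  statement about components of the index.\<close>

lemma detS_reindex:
  assumes f: "bij_betw f I J" and I: "finite I"
  shows "detS I (\<lambda>i j. A (f i) (f j)) = detS J A"
proof -
  have inj: "inj_on f I" and im: "f ` I = J" using f by (auto simp: bij_betw_def)
  let ?m = "\<lambda>p. map_permutation I f p"
  have bij: "bij_betw ?m {p. p permutes I} {p. p permutes J}"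
  proof (rule bij_betw_byWitness[where f' = "\<lambda>q. map_permutation J (inv_into I f) q"])
    have g: "bij_betw (inv_into I f) J I" using bij_betw_inv_into[OF f] .
    show "\<forall>p\<in>{p. p permutes I}. map_permutation J (inv_into I f) (?m p) = p"
     using map_permutation_compose_inv[OF f] inj by simp
    show "\<forall>q\<in>{p. p permutes J}. ?m (map_permutation J (inv_into I f) q) = q"
     using map_permutation_compose_inv[OF g] im by (simp add: f_inv_into_f)
    show "?m ` {p. p permutes I} \<subseteq> {p. p permutes J}" using map_permutation_permutes[OF f] by auto
    show "(\<lambda>q. map_permutation J (inv_into I f) q) ` {p. p permutes J} \<subseteq> {p. p permutes I}"
     using map_permutation_permutes[OF g] by auto
  qed
  have "detS J A = (\<Sum>p\<in>{p. p permutes I}. of_int (sign (?m p)) * (\<Prod>j\<in>J. A j (?m p j)))"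
    unfolding detS_def by (rule sum.reindex_bij_betw[OF bij, symmetric])
  also have "\<dots> = (\<Sum>p\<in>{p. p permutes I}. of_int (sign p) * (\<Prod>i\<in>I. A (f i) (f (p i))))"
  proof (intro sum.cong refl arg_cong2[where f="(*)"])
    fix p assume "p \<in> {p. p permutes I}"
    then have p: "p permutes I" by simp
    show "of_int (sign (?m p)) = (of_int (sign p) :: 'c)" using sign_map_permutation[OF inj p I] by simp
    have "(\<Prod>j\<in>J. A j (?m p j)) = (\<Prod>i\<in>I. A (f i) (?m p (f i)))"
     by (rule prod.reindex_bij_betw[OF f, symmetric])
    also have "\<dots> = (\<Prod>i\<in>I. A (f i) (f (p i)))"
     by (intro prod.cong refl) (simp add: map_permutation_apply[OF inj])
    finally show "(\<Prod>j\<in>J. A j (?m p j)) = (\<Prod>i\<in>I. A (f i) (f (p i)))" .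
  qed
  finally show ?thesis unfolding detS_def by simp
qed

lemma detS_det: "detS {..<n} A = det (mat n n (\<lambda>(i, j). A i j))"
  unfolding detS_def det_def'[of "mat n n (\<lambda>(i, j). A i j)" n, simplified]
  by (auto simp: lessThan_atLeast0 permutes_in_image intro!: sum.cong prod.cong arg_cong2[where f="(*)"])

lemma finite_enum:
  assumes "finite I"
  obtains f where "bij_betw f {..<card I} I"
  using ex_bij_betw_nat_finite[OF assms] unfolding lessThan_atLeast0[symmetric] by blast

lemma detS_mult:
  assumes I: "finite I"
  shows "detS I (\<lambda>i j. \<Sum>k\<in>I. A i k * B k j) = detS I A * detS I B"
proof -
  obtain f where f: "bij_betw f {..<card I} I" using finite_enum[OF I] .
  let ?n = "card I"
  let ?m = "\<lambda>A. mat ?n ?n (\<lambda>(i, j). A (f i) (f j))"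
  have D: "detS I A = det (?m A)" for A :: "'a \<Rightarrow> 'a \<Rightarrow> 'b"
    using detS_reindex[OF f, of A] by (simp add: detS_det)
  have "?m (\<lambda>i j. \<Sum>k\<in>I. A i k * B k j) = ?m A * ?m B"
    by (intro eq_matI) (auto simp: scalar_prod_def sum.reindex_bij_betw[OF f, symmetric] lessThan_atLeast0[symmetric])
  then show ?thesis unfolding D by (simp add: det_mult[of _ ?n])
qed

lemma detS_transpose:
  assumes I: "finite I"
  shows "detS I (\<lambda>i j. A j i) = detS I A"
proof -
  obtain f where f: "bij_betw f {..<card I} I" using finite_enum[OF I] .
  let ?n = "card I"
  let ?m = "\<lambda>A. mat ?n ?n (\<lambda>(i, j). A (f i) (f j))"
  have D: "detS I A = det (?m A)" for A :: "'a \<Rightarrow> 'a \<Rightarrow> 'b"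
    using detS_reindex[OF f, of A] by (simp add: detS_det)
  have "?m (\<lambda>i j. A j i) = transpose_mat (?m A)" by (intro eq_matI) auto
  then show ?thesis unfolding D by (simp add: det_transpose[of _ ?n])
qed

text \<open>Only one off-diagonal block has to vanish: numbering \<open>I\<close> before
  \<open>J\<close> makes the matrix lower block triangular.\<close>

lemma detS_union:
  fixes A :: "'i \<Rightarrow> 'i \<Rightarrow> 'a::idom"
  assumes I: "finite I" and J: "finite J" and disj: "I \<inter> J = {}"
    and z: "\<And>i j. i \<in> I \<Longrightarrow> j \<in> J \<Longrightarrow> A i j = 0"
  shows "detS (I \<union> J) A = detS I A * detS J A"
proof -
  obtain f where f: "bij_betw f {..<card I} I" using finite_enum[OF I] .
  obtain g where g: "bij_betw g {..<card J} J" using finite_enum[OF J] .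
  let ?n = "card I" and ?m = "card J"
  define h where "h k = (if k < ?n then f k else g (k - ?n))" for k
  have sh: "bij_betw (\<lambda>k. k - ?n) {?n..<?n + ?m} {..<?m}"
    by (rule bij_betw_byWitness[where f'="\<lambda>k. k + ?n"]) auto
  have h1: "bij_betw h {..<?n} I" using f by (rule bij_betw_cong[THEN iffD1, rotated]) (simp add: h_def)
  have h2: "bij_betw h {?n..<?n + ?m} J"
    using bij_betw_trans[OF sh g] by (rule bij_betw_cong[THEN iffD1, rotated]) (simp add: h_def)
  have "bij_betw h ({..<?n} \<union> {?n..<?n + ?m}) (I \<union> J)" using bij_betw_combine[OF h1 h2 disj] .
  moreover have "{..<?n} \<union> {?n..<?n + ?m} = {..<?n + ?m}" by auto
  ultimately have h: "bij_betw h {..<?n + ?m} (I \<union> J)" by simp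
  let ?A1 = "mat ?n ?n (\<lambda>(i, j). A (f i) (f j))" and ?A4 = "mat ?m ?m (\<lambda>(i, j). A (g i) (g j))"
  let ?A3 = "mat ?m ?n (\<lambda>(i, j). A (g i) (f j))"
  have "mat (?n + ?m) (?n + ?m) (\<lambda>(i, j). A (h i) (h j)) = four_block_mat ?A1 (0\<^sub>m ?n ?m) ?A3 ?A4"
    using f g by (intro eq_matI) (auto simp: h_def bij_betw_def intro!: z)
  then have "detS (I \<union> J) A = det ?A1 * det ?A4"
    using detS_reindex[OF h, of A]
    by (simp add: detS_det det_four_block_mat_upper_right_zero[of ?A1 ?n _ ?m])
  then show ?thesis using detS_reindex[OF f, of A] detS_reindex[OF g, of A] by (simp add: detS_det)
qed

lemma detS_empty [simp]: "detS {} A = 1"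
  by (simp add: detS_def)

lemma detS_block_diag:
  fixes A :: "'k \<Rightarrow> 'i \<Rightarrow> 'i \<Rightarrow> 'a::idom"
  assumes K: "finite K" and I: "finite I"
  shows "detS (K \<times> I) (\<lambda>(k, i) (l, j). if k = l then A k i j else 0) = (\<Prod>k\<in>K. detS I (A k))"
  using K
proof (induction K rule: finite_induct)
  case (insert k K)
  let ?M = "\<lambda>(k, i) (l, j). if k = l then A k i j else 0"
  have "detS (insert k K \<times> I) ?M = detS ({k} \<times> I \<union> K \<times> I) ?M" by (rule detS_cong) auto
  also have "\<dots> = detS ({k} \<times> I) ?M * detS (K \<times> I) ?M"
    by (rule detS_union) (use insert I in auto)
  also have "detS ({k} \<times> I) ?M = detS I (A k)"
  proof -
    have b: "bij_betw (Pair k) I ({k} \<times> I)" by (auto simp: bij_betw_def inj_on_def)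
    show ?thesis using detS_reindex[OF b I, of ?M] by simp
  qed
  finally show ?case using insert by simp
qed simp

lemma detS_block_diag':
  fixes A :: "'k \<Rightarrow> 'i \<Rightarrow> 'i \<Rightarrow> 'a::idom"
  assumes K: "finite K" and I: "finite I"
  shows "detS (I \<times> K) (\<lambda>(i, k) (j, l). if k = l then A k i j else 0) = (\<Prod>k\<in>K. detS I (A k))"
proof -
  have b: "bij_betw prod.swap (K \<times> I) (I \<times> K)"
    by (rule bij_betw_byWitness[where f' = prod.swap]) auto
  have "detS (I \<times> K) (\<lambda>(i, k) (j, l). if k = l then A k i j else 0)
     = detS (K \<times> I) (\<lambda>(k, i) (l, j). if k = l then A k i j else 0)"
    unfolding detS_reindex[OF b finite_cartesian_product[OF K I], symmetric]
    by (rule detS_cong) (auto simp: case_prod_unfold)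
  then show ?thesis using detS_block_diag[OF K I, of A] by simp
qed

lemma detS_lower_triangular:
  fixes A :: "nat \<Rightarrow> nat \<Rightarrow> 'a::comm_ring_1"
  assumes "\<And>i j. i < n \<Longrightarrow> j < n \<Longrightarrow> i < j \<Longrightarrow> A i j = 0"
  shows "detS {..<n} A = (\<Prod>i<n. A i i)"
proof -
  have "detS {..<n} A = prod_list (diag_mat (mat n n (\<lambda>(i, j). A i j)))"
    unfolding detS_det by (rule det_lower_triangular[of n]) (use assms in auto)
  then show ?thesis
    by (simp add: diag_mat_def prod.distinct_set_conv_list[symmetric] lessThan_atLeast0 cong: map_cong)
qed

lemma detS_permute_rows:
  assumes I: "finite I" and s: "s permutes I"
  shows "detS I (\<lambda>i j. A (s i) j) = of_int (sign s) * detS I A"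
proof -
  have "detS I (\<lambda>i j. A (s i) j) = (\<Sum>p\<in>{p. p permutes I}. of_int (sign p) * (\<Prod>i\<in>I. A (s i) (p i)))"
    by (simp add: detS_def)
  also have "\<dots> = (\<Sum>p\<in>{p. p permutes I}. of_int (sign (p \<circ> s)) * (\<Prod>i\<in>I. A (s i) ((p \<circ> s) i)))"
  proof (rule sum.reindex_bij_betw[symmetric])
    have "\<And>p. (p \<circ> s) \<circ> Hilbert_Choice.inv s = p" "\<And>p. (p \<circ> Hilbert_Choice.inv s) \<circ> s = p"
     using s by (simp_all add: comp_assoc permutes_inv_o)
    then show "bij_betw (\<lambda>p. p \<circ> s) {p. p permutes I} {p. p permutes I}"
     using s by (intro bij_betw_byWitness[where f' = "\<lambda>p. p \<circ> Hilbert_Choice.inv s"])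
      (auto simp del: comp_apply intro!: permutes_compose permutes_inv)
  qed
  also have "\<dots> = (\<Sum>p\<in>{p. p permutes I}. of_int (sign s) * (of_int (sign p) * (\<Prod>i\<in>I. A i (p i))))"
  proof (intro sum.cong refl)
    fix p assume "p \<in> {p. p permutes I}"
    then have p: "p permutes I" by simp
    have "permutation p" "permutation s" using p s I permutation_permutes by blast+
    then have "sign (p \<circ> s) = sign p * sign s" by (rule sign_compose)
    moreover have "(\<Prod>i\<in>I. A (s i) ((p \<circ> s) i)) = (\<Prod>i\<in>I. A i (p i))"
     using prod.reindex_bij_betw[OF permutes_imp_bij[OF s], of "\<lambda>i. A i (p i)"] by simp
    ultimately show "of_int (sign (p \<circ> s)) * (\<Prod>i\<in>I. A (s i) ((p \<circ> s) i))
      = of_int (sign s) * (of_int (sign p) * (\<Prod>i\<in>I. A i (p i)))" by simp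
  qed
  finally show ?thesis by (simp add: detS_def sum_distrib_left)
qed

lemma detS_scale_rows: "detS I (\<lambda>i j. c i * A i j) = (\<Prod>i\<in>I. c i) * detS I A"
  by (simp add: detS_def prod.distrib sum_distrib_left algebra_simps)

lemma (in comm_ring_hom) hom_detS: "hom (detS I A) = detS I (\<lambda>i j. hom (A i j))"
  by (simp add: detS_def hom_distribs)

text \<open>The adjugate, with both products recorded. It replaces an inverse matrix over domains in
  which the determinant is nonzero without being a unit.\<close>

lemma detS_adj:
  fixes A :: "'i \<Rightarrow> 'i \<Rightarrow> 'a::comm_ring_1"
  assumes I: "finite I"
  obtains A' where "\<And>i j. i \<in> I \<Longrightarrow> j \<in> I \<Longrightarrow> (\<Sum>k\<in>I. A i k * A' k j) = (if i = j then detS I A else 0)"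
    "\<And>i j. i \<in> I \<Longrightarrow> j \<in> I \<Longrightarrow> (\<Sum>k\<in>I. A' i k * A k j) = (if i = j then detS I A else 0)"
proof -
  obtain f where f: "bij_betw f {..<card I} I" using finite_enum[OF I] .
  let ?n = "card I"
  let ?m = "mat ?n ?n (\<lambda>(i, j). A (f i) (f j))"
  have D: "detS I A = det ?m" using detS_reindex[OF f, of A] by (simp add: detS_det)
  define g where "g = inv_into {..<?n} f"
  have gb: "bij_betw g I {..<?n}" unfolding g_def using bij_betw_inv_into[OF f] .
  have g: "g i < ?n" "f (g i) = i" if "i \<in> I" for i
    using that gb f unfolding g_def by (auto simp: bij_betw_def f_inv_into_f)
  have gf: "g (f k) = k" if "k < ?n" for k
    using that f unfolding g_def bij_betw_def by simp
  define A' where "A' i j = adj_mat ?m $$ (g i, g j)" for i j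
  have adj: "adj_mat ?m \<in> carrier_mat ?n ?n" "?m * adj_mat ?m = det ?m \<cdot>\<^sub>m 1\<^sub>m ?n"
    "adj_mat ?m * ?m = det ?m \<cdot>\<^sub>m 1\<^sub>m ?n" using adj_mat[of ?m ?n] by simp_all
  show thesis
  proof
    fix i j assume ij: "i \<in> I" "j \<in> I"
    have eq: "g i = g j \<longleftrightarrow> i = j" using g ij by metis
    have "(?m * adj_mat ?m) $$ (g i, g j) = (\<Sum>k<?n. A i (f k) * A' (f k) j)"
     using g[OF ij(1)] g[OF ij(2)] adj(1) carrier_matD[OF adj(1)]
     by (simp add: scalar_prod_def A'_def lessThan_atLeast0) (intro sum.cong refl, simp add: gf)
    also have "\<dots> = (\<Sum>k\<in>I. A i k * A' k j)" by (rule sum.reindex_bij_betw[OF f])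
    finally show "(\<Sum>k\<in>I. A i k * A' k j) = (if i = j then detS I A else 0)"
     using g[OF ij(1)] g[OF ij(2)] by (auto simp: adj(2) D eq)
    have "(adj_mat ?m * ?m) $$ (g i, g j) = (\<Sum>k<?n. A' i (f k) * A (f k) j)"
     using g[OF ij(1)] g[OF ij(2)] adj(1) carrier_matD[OF adj(1)]
     by (simp add: scalar_prod_def A'_def lessThan_atLeast0) (intro sum.cong refl, simp add: gf)
    also have "\<dots> = (\<Sum>k\<in>I. A' i k * A k j)" by (rule sum.reindex_bij_betw[OF f])
    finally show "(\<Sum>k\<in>I. A' i k * A k j) = (if i = j then detS I A else 0)"
     using g[OF ij(1)] g[OF ij(2)] by (auto simp: adj(3) D eq)
  qed
qed

text \<open>The coefficient rings below are subsets \<open>S0\<close> of a polynomial type that has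
  more variables than the algebra has generators, so closure has to be tracked.\<close>

lemma detS_closed:
  assumes "\<And>i j. i \<in> I \<Longrightarrow> j \<in> I \<Longrightarrow> A i j \<in> S"
    and "0 \<in> S" "1 \<in> S" "\<And>x y. x \<in> S \<Longrightarrow> y \<in> S \<Longrightarrow> x + y \<in> S"
    "\<And>x y. x \<in> S \<Longrightarrow> y \<in> S \<Longrightarrow> x * y \<in> S" "\<And>x. x \<in> S \<Longrightarrow> - x \<in> S"
  shows "detS I A \<in> S"
proof -
  have sum: "sum f K \<in> S" if "\<And>k. k \<in> K \<Longrightarrow> f k \<in> S" for f :: "('a \<Rightarrow> 'a) \<Rightarrow> 'b" and K
    using that by (induction K rule: infinite_finite_induct) (simp_all add: assms(2,4))
  have prod: "prod f K \<in> S" if "\<And>k. k \<in> K \<Longrightarrow> f k \<in> S" for f :: "'a \<Rightarrow> 'b" and K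
    using that by (induction K rule: infinite_finite_induct) (simp_all add: assms(3,5))
  show ?thesis unfolding detS_def
  proof (rule sum)
    fix p assume "p \<in> {p. p permutes I}"
    then have "A i (p i) \<in> S" if "i \<in> I" for i
     using that by (intro assms) (auto simp: permutes_in_image)
    then have "(\<Prod>i\<in>I. A i (p i)) \<in> S" by (intro prod)
    moreover have "sign p = 1 \<or> sign p = - 1" by (rule sign_cases[of p]) simp_all
    ultimately show "of_int (sign p) * (\<Prod>i\<in>I. A i (p i)) \<in> S" using assms(6) by auto
  qed
qed

lemma detS_0_col:
  assumes "finite I" "j \<in> I" "\<And>i. i \<in> I \<Longrightarrow> A i j = 0"
  shows "detS I A = 0"
proof -
  have "(\<Prod>i\<in>I. A i (p i)) = 0" if p: "p permutes I" for p
  proof -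
    obtain i where i: "i \<in> I" "p i = j"
     using permutes_image[OF p] assms(2) by (metis imageE)
    then have "A i (p i) = 0" using assms(3) by simp
    then show ?thesis using assms(1) i(1) by (metis prod_zero)
  qed
  then show ?thesis by (simp add: detS_def)
qed

text \<open>Padding the shorter side with zeros makes the matrices square, with determinants 0 and product 1.\<close>

lemma card_le_of_right_inverse:
  fixes P :: "'i \<Rightarrow> 'j \<Rightarrow> 'a::idom"
  assumes I: "finite I" and J: "finite J"
    and PQ: "\<And>i k. i \<in> I \<Longrightarrow> k \<in> I \<Longrightarrow> (\<Sum>j\<in>J. P i j * Q j k) = (if i = k then 1 else 0)"
  shows "card I \<le> card J"
proof (rule ccontr)
  assume "\<not> card I \<le> card J"
  then have lt: "card J < card I" by simp
  obtain f where f: "bij_betw f {..<card I} I" using finite_enum[OF I] .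
  obtain g where g: "bij_betw g {..<card J} J" using finite_enum[OF J] .
  let ?P = "\<lambda>i k. if k < card J then P (f i) (g k) else 0"
  let ?Q = "\<lambda>k i. if k < card J then Q (g k) (f i) else 0"
  let ?n = "{..<card I}"
  have inj: "f i = f k \<longleftrightarrow> i = k" if "i < card I" "k < card I" for i k
    using f that by (auto simp: bij_betw_def inj_on_def)
  have "1 = detS ?n (\<lambda>i k. if i = k then 1 else (0::'a))"
    by (subst detS_lower_triangular) auto
  also have "\<dots> = detS ?n (\<lambda>i k. \<Sum>j<card I. ?P i j * ?Q j k)"
  proof (rule detS_cong)
    fix i k assume ik: "i \<in> ?n" "k \<in> ?n"
    have "(\<Sum>j<card I. ?P i j * ?Q j k) = (\<Sum>j<card J. P (f i) (g j) * Q (g j) (f k))"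
     using lt by (intro sum.mono_neutral_cong_right) auto
    also have "\<dots> = (\<Sum>j\<in>J. P (f i) j * Q j (f k))" by (rule sum.reindex_bij_betw[OF g])
    finally show "(if i = k then 1 else 0) = (\<Sum>j<card I. ?P i j * ?Q j k)"
     using ik bij_betwE[OF f] inj[of i k] by (simp add: PQ)
  qed simp
  also have "\<dots> = detS ?n ?P * detS ?n ?Q" by (rule detS_mult) simp
  also have "detS ?n ?P = 0" by (rule detS_0_col[of _ "card J"]) (use lt in auto)
  finally show False by simp
qed

lemma ex1_implies_unique: "\<exists>!x. P x \<Longrightarrow> P x \<Longrightarrow> P y \<Longrightarrow> x = y"
  by auto

section \<open>Discriminants in a typed ring\<close>

lemma hom_finsum:
  fixes h :: "'b \<Rightarrow> 'a::ab_group_add"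
  assumes "abelian_group R"
    and add: "\<And>x y. x \<in> carrier R \<Longrightarrow> y \<in> carrier R \<Longrightarrow> h (x \<oplus>\<^bsub>R\<^esub> y) = h x + h y"
    and f: "f \<in> I \<rightarrow> carrier R"
  shows "h (\<Oplus>\<^bsub>R\<^esub>i\<in>I. f i) = (\<Sum>i\<in>I. h (f i))"
proof -
  interpret abelian_group R by fact
  have "h \<zero>\<^bsub>R\<^esub> = h \<zero>\<^bsub>R\<^esub> + h \<zero>\<^bsub>R\<^esub>" using add[of "\<zero>\<^bsub>R\<^esub>" "\<zero>\<^bsub>R\<^esub>"] by simp
  then have h0: "h \<zero>\<^bsub>R\<^esub> = 0" by simp
  show ?thesis using f
  proof (induction I rule: infinite_finite_induct)
    case (insert i I)
    have m: "f \<in> I \<rightarrow> carrier R" "f i \<in> carrier R" using insert.prems by auto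
    then show ?case using insert add[of "f i" "finsum R f I"] finsum_closed[OF m(1)]
     by (simp add: finsum_insert[OF insert.hyps m])
  qed (simp_all add: h0)
qed

lemma hom_nat_pow:
  fixes h :: "'b \<Rightarrow> 'a::monoid_mult"
  assumes "monoid R"
    and mult: "\<And>x y. x \<in> carrier R \<Longrightarrow> y \<in> carrier R \<Longrightarrow> h (x \<otimes>\<^bsub>R\<^esub> y) = h x * h y"
    and one: "h \<one>\<^bsub>R\<^esub> = 1" and x: "x \<in> carrier R"
  shows "h (x [^]\<^bsub>R\<^esub> (k::nat)) = h x ^ k"
proof -
  interpret monoid R by fact
  show ?thesis by (induction k) (simp_all add: one mult x power_commutes)
qed

section \<open>Embeddings of record rings into typed rings\<close>

locale ring_embedding =
  fixes R :: "('b, 'c) ring_scheme" and h :: "'b \<Rightarrow> 'a::ring_1"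
  assumes ring: "ring R"
    and h_inj: "inj_on h (carrier R)"
    and h_add: "\<And>x y. x \<in> carrier R \<Longrightarrow> y \<in> carrier R \<Longrightarrow> h (x \<oplus>\<^bsub>R\<^esub> y) = h x + h y"
    and h_mult: "\<And>x y. x \<in> carrier R \<Longrightarrow> y \<in> carrier R \<Longrightarrow> h (x \<otimes>\<^bsub>R\<^esub> y) = h x * h y"
    and h_one: "h \<one>\<^bsub>R\<^esub> = 1"
begin

lemma h_zero: "h \<zero>\<^bsub>R\<^esub> = 0"
proof -
  interpret ring R by (rule ring)
  show ?thesis using h_add[of "\<zero>\<^bsub>R\<^esub>" "\<zero>\<^bsub>R\<^esub>"] by simp
qed

lemma h_uminus: "x \<in> carrier R \<Longrightarrow> h (\<ominus>\<^bsub>R\<^esub> x) = - h x"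
proof -
  interpret ring R by (rule ring)
  assume x: "x \<in> carrier R"
  have "h x + h (\<ominus>\<^bsub>R\<^esub> x) = 0" using h_add[of x "\<ominus>\<^bsub>R\<^esub> x"] x by (simp add: r_neg h_zero)
  then show ?thesis by (simp add: eq_neg_iff_add_eq_0 add.commute)
qed

lemma h_minus: "x \<in> carrier R \<Longrightarrow> y \<in> carrier R \<Longrightarrow> h (x \<ominus>\<^bsub>R\<^esub> y) = h x - h y"
proof -
  interpret ring R by (rule ring)
  assume "x \<in> carrier R" "y \<in> carrier R"
  then show ?thesis by (simp add: a_minus_def h_add h_uminus)
qed

lemma h_finsum: "f \<in> I \<rightarrow> carrier R \<Longrightarrow> h (\<Oplus>\<^bsub>R\<^esub>i\<in>I. f i) = (\<Sum>i\<in>I. h (f i))"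
  by (rule hom_finsum) (auto simp: h_add ring.is_abelian_group ring)

lemma h_pow: "x \<in> carrier R \<Longrightarrow> h (x [^]\<^bsub>R\<^esub> (k::nat)) = h x ^ k"
  by (rule hom_nat_pow) (auto simp: h_mult h_one ring.is_monoid ring)

lemma h_eq_iff: "x \<in> carrier R \<Longrightarrow> y \<in> carrier R \<Longrightarrow> h x = h y \<longleftrightarrow> x = y"
  using h_inj by (auto simp: inj_on_def)

end

text \<open>\<open>S0\<close> represents the central subring \<open>C\<close> inside a typed domain,
  which makes sums and determinants available there. Injectivity of \<open>\<iota>\<close> is
  demanded on \<open>S0\<close> only: in the application the type contains variables that belong to
  no generator of the algebra, and \<open>\<iota>\<close> ignores their exponents.\<close>

locale disc_model = ring_embedding R h
  for R :: "('b, 'c) ring_scheme" and h :: "'b \<Rightarrow> 'a::ring_1" +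
  fixes C :: "'b set" and S0 :: "'s::idom set" and \<iota> :: "'s \<Rightarrow> 'a"
  assumes subring: "subring C R"
    and \<iota>_add: "\<And>x y. \<iota> (x + y) = \<iota> x + \<iota> y"
    and \<iota>_mult: "\<And>x y. \<iota> (x * y) = \<iota> x * \<iota> y"
    and \<iota>_one: "\<iota> 1 = 1"
    and S0_one: "1 \<in> S0"
    and S0_add: "\<And>x y. x \<in> S0 \<Longrightarrow> y \<in> S0 \<Longrightarrow> x + y \<in> S0"
    and S0_mult: "\<And>x y. x \<in> S0 \<Longrightarrow> y \<in> S0 \<Longrightarrow> x * y \<in> S0"
    and S0_uminus: "\<And>x. x \<in> S0 \<Longrightarrow> - x \<in> S0"
    and \<iota>_inj: "inj_on \<iota> S0"
    and h_C: "h ` C = \<iota> ` S0"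
    and central: "\<And>s a. s \<in> S0 \<Longrightarrow> a \<in> carrier R \<Longrightarrow> \<iota> s * h a = h a * \<iota> s"
begin

lemma \<iota>_zero [simp]: "\<iota> 0 = 0"
  using \<iota>_add[of 0 0] by simp

lemma \<iota>_uminus: "\<iota> (- x) = - \<iota> x"
  using \<iota>_add[of x "- x"] by (simp add: eq_neg_iff_add_eq_0 add.commute)

lemma \<iota>_diff: "\<iota> (x - y) = \<iota> x - \<iota> y"
  using \<iota>_add[of x "- y"] by (simp add: \<iota>_uminus)

lemma \<iota>_sum: "\<iota> (sum f I) = (\<Sum>i\<in>I. \<iota> (f i))"
  by (induction I rule: infinite_finite_induct) (simp_all add: \<iota>_add)

lemma S0_zero: "0 \<in> S0"
  using S0_add[OF S0_one S0_uminus[OF S0_one]] by simp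

lemma S0_diff: "x \<in> S0 \<Longrightarrow> y \<in> S0 \<Longrightarrow> x - y \<in> S0"
  using S0_add[of x "- y"] S0_uminus[of y] by simp

lemma S0_sum: "(\<And>i. i \<in> I \<Longrightarrow> f i \<in> S0) \<Longrightarrow> sum f I \<in> S0"
  by (induction I rule: infinite_finite_induct) (simp_all add: S0_zero S0_add)

lemma S0_detS: "(\<And>i j. i \<in> I \<Longrightarrow> j \<in> I \<Longrightarrow> U i j \<in> S0) \<Longrightarrow> detS I U \<in> S0"
  by (rule detS_closed) (auto intro: S0_zero S0_one S0_add S0_mult S0_uminus)

lemma C_carrier: "C \<subseteq> carrier R"
  using subring by (rule subringE(1))

definition lft :: "'s \<Rightarrow> 'b" where "lft s = inv_into C h (\<iota> s)"
definition low :: "'b \<Rightarrow> 's" where "low c = inv_into S0 \<iota> (h c)"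

lemma lft: "s \<in> S0 \<Longrightarrow> lft s \<in> C" "s \<in> S0 \<Longrightarrow> h (lft s) = \<iota> s"
proof -
  assume "s \<in> S0"
  then have "\<iota> s \<in> h ` C" using h_C by auto
  then show "lft s \<in> C" "h (lft s) = \<iota> s" by (auto simp: lft_def intro: inv_into_into f_inv_into_f)
qed

lemma low: "c \<in> C \<Longrightarrow> low c \<in> S0" "c \<in> C \<Longrightarrow> \<iota> (low c) = h c"
proof -
  assume "c \<in> C"
  then have "h c \<in> \<iota> ` S0" using h_C by auto
  then show "low c \<in> S0" "\<iota> (low c) = h c" by (auto simp: low_def intro: inv_into_into f_inv_into_f)
qed

lemma C_center: "C \<subseteq> ring_center R"
proof
  fix c assume c: "c \<in> C"
  interpret ring R by (rule ring)
  have "c \<otimes>\<^bsub>R\<^esub> a = a \<otimes>\<^bsub>R\<^esub> c" if a: "a \<in> carrier R" for a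
    using central[OF low(1)[OF c] a] c a C_carrier h_inj by (auto simp: low h_mult[symmetric] inj_on_def)
  then show "c \<in> ring_center R" using c C_carrier by (auto simp: ring_center_def)
qed

definition \<A> :: "'a set" where "\<A> = h ` carrier R"

lemma \<A>I: "x \<in> carrier R \<Longrightarrow> h x \<in> \<A>"
  by (simp add: \<A>_def)

lemma \<A>_mult: "a \<in> \<A> \<Longrightarrow> b \<in> \<A> \<Longrightarrow> a * b \<in> \<A>"
proof -
  interpret ring R by (rule ring)
  show "a \<in> \<A> \<Longrightarrow> b \<in> \<A> \<Longrightarrow> a * b \<in> \<A>" by (force simp: \<A>_def h_mult[symmetric])
qed

lemma \<A>_central: "s \<in> S0 \<Longrightarrow> a \<in> \<A> \<Longrightarrow> a * \<iota> s = \<iota> s * a"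
  using central by (auto simp: \<A>_def)

lemma \<A>_scal: "s \<in> S0 \<Longrightarrow> a \<in> \<A> \<Longrightarrow> a * (\<iota> s * b) = \<iota> s * (a * b)"
  by (simp only: mult.assoc[symmetric] \<A>_central)

section \<open>Bases, coordinates and traces over the central subring\<close>

definition tbasis :: "'i set \<Rightarrow> ('i \<Rightarrow> 'a) \<Rightarrow> bool" where
  "tbasis I b \<longleftrightarrow> finite I \<and> (\<forall>i\<in>I. b i \<in> \<A>) \<and>
    (\<forall>a\<in>\<A>. \<exists>D. (\<forall>i\<in>I. D i \<in> S0) \<and> a = (\<Sum>i\<in>I. \<iota> (D i) * b i)) \<and>
    (\<forall>D. (\<forall>i\<in>I. D i \<in> S0) \<longrightarrow> (\<Sum>i\<in>I. \<iota> (D i) * b i) = 0 \<longrightarrow> (\<forall>i\<in>I. D i = 0))"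

definition co :: "'i set \<Rightarrow> ('i \<Rightarrow> 'a) \<Rightarrow> 'a \<Rightarrow> 'i \<Rightarrow> 's" where
  "co I b a = (SOME D. (\<forall>i\<in>I. D i \<in> S0) \<and> a = (\<Sum>i\<in>I. \<iota> (D i) * b i))"

definition tr :: "'i set \<Rightarrow> ('i \<Rightarrow> 'a) \<Rightarrow> 'a \<Rightarrow> 's" where
  "tr I b a = (\<Sum>i\<in>I. co I b (a * b i) i)"

lemma co:
  assumes "tbasis I b" "a \<in> \<A>"
  shows "i \<in> I \<Longrightarrow> co I b a i \<in> S0" "(\<Sum>i\<in>I. \<iota> (co I b a i) * b i) = a"
proof -
  have "\<exists>D. (\<forall>i\<in>I. D i \<in> S0) \<and> a = (\<Sum>i\<in>I. \<iota> (D i) * b i)" using assms by (auto simp: tbasis_def)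
  from someI_ex[OF this] show "i \<in> I \<Longrightarrow> co I b a i \<in> S0" "(\<Sum>i\<in>I. \<iota> (co I b a i) * b i) = a"
    by (simp_all add: co_def)
qed

lemma tbasis_indep:
  assumes "tbasis I b" and "\<And>i. i \<in> I \<Longrightarrow> D i \<in> S0" and "(\<Sum>i\<in>I. \<iota> (D i) * b i) = 0" and "i \<in> I"
  shows "D i = 0"
  using assms unfolding tbasis_def by blast

lemma tbasis_unique:
  assumes b: "tbasis I b" and "\<And>i. i \<in> I \<Longrightarrow> D i \<in> S0" "\<And>i. i \<in> I \<Longrightarrow> D' i \<in> S0"
    and eq: "(\<Sum>i\<in>I. \<iota> (D i) * b i) = (\<Sum>i\<in>I. \<iota> (D' i) * b i)" and i: "i \<in> I"
  shows "D i = D' i"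
proof -
  have "(\<Sum>i\<in>I. \<iota> (D i - D' i) * b i) = 0"
    using eq by (simp add: \<iota>_diff left_diff_distrib sum_subtractf)
  then have "D i - D' i = 0"
    by (rule tbasis_indep[OF b, rotated]) (use assms in \<open>auto intro: S0_diff\<close>)
  then show ?thesis by simp
qed

lemma co_eqI:
  assumes b: "tbasis I b" and "\<And>i. i \<in> I \<Longrightarrow> D i \<in> S0" "a = (\<Sum>i\<in>I. \<iota> (D i) * b i)" "a \<in> \<A>" "i \<in> I"
  shows "co I b a i = D i"
  by (rule tbasis_unique[OF b]) (use assms in \<open>auto simp: co\<close>)

lemma tbasis_in: "tbasis I b \<Longrightarrow> i \<in> I \<Longrightarrow> b i \<in> \<A>" and tbasis_fin: "tbasis I b \<Longrightarrow> finite I"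
  by (auto simp: tbasis_def)

lemma tr_S0: "tbasis I b \<Longrightarrow> a \<in> \<A> \<Longrightarrow> tr I b a \<in> S0"
  unfolding tr_def by (intro S0_sum co(1) \<A>_mult) (auto intro: tbasis_in[of I b])

lemma \<A>_lin:
  assumes "\<And>i. i \<in> I \<Longrightarrow> D i \<in> S0" "\<And>i. i \<in> I \<Longrightarrow> f i \<in> \<A>"
  shows "(\<Sum>i\<in>I. \<iota> (D i) * f i) \<in> \<A>"
proof -
  interpret ring R by (rule ring)
  obtain g where g: "\<And>i. i \<in> I \<Longrightarrow> g i \<in> carrier R \<and> h (g i) = f i"
  proof
    show "i \<in> I \<Longrightarrow> inv_into (carrier R) h (f i) \<in> carrier R \<and> h (inv_into (carrier R) h (f i)) = f i" for i
     using assms(2)[of i] unfolding \<A>_def by (simp add: inv_into_into f_inv_into_f)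
  qed
  have m: "(\<lambda>i. lft (D i) \<otimes>\<^bsub>R\<^esub> g i) \<in> I \<rightarrow> carrier R" using g lft(1)[OF assms(1)] C_carrier by auto
  have "h (\<Oplus>\<^bsub>R\<^esub>i\<in>I. lft (D i) \<otimes>\<^bsub>R\<^esub> g i) = (\<Sum>i\<in>I. h (lft (D i) \<otimes>\<^bsub>R\<^esub> g i))"
    by (rule h_finsum[OF m])
  also have "\<dots> = (\<Sum>i\<in>I. \<iota> (D i) * f i)"
    using g lft[OF assms(1)] C_carrier by (intro sum.cong refl) (auto simp: h_mult subset_iff)
  finally show ?thesis using \<A>I[OF finsum_closed[OF m]] by simp
qed

lemma tr_lin:
  assumes b: "tbasis I b" and K: "\<And>k. k \<in> K \<Longrightarrow> D k \<in> S0" "\<And>k. k \<in> K \<Longrightarrow> f k \<in> \<A>"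
  shows "tr I b (\<Sum>k\<in>K. \<iota> (D k) * f k) = (\<Sum>k\<in>K. D k * tr I b (f k))"
proof -
  have "co I b ((\<Sum>k\<in>K. \<iota> (D k) * f k) * b i) i = (\<Sum>k\<in>K. D k * co I b (f k * b i) i)" if i: "i \<in> I" for i
  proof (rule co_eqI[OF b, where D = "\<lambda>j. \<Sum>k\<in>K. D k * co I b (f k * b i) j"])
    have m: "f k * b i \<in> \<A>" if "k \<in> K" for k using that K i b by (auto intro: \<A>_mult tbasis_in[OF b])
    show "(\<Sum>k\<in>K. D k * co I b (f k * b i) j) \<in> S0" if "j \<in> I" for j
     using that K m b by (intro S0_sum S0_mult co(1)) auto
    have "(\<Sum>k\<in>K. \<iota> (D k) * f k) * b i = (\<Sum>k\<in>K. \<iota> (D k) * (f k * b i))"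
     by (simp add: sum_distrib_right mult.assoc)
    also have "\<dots> = (\<Sum>k\<in>K. \<iota> (D k) * (\<Sum>j\<in>I. \<iota> (co I b (f k * b i) j) * b j))"
     by (intro sum.cong refl) (simp add: co(2)[OF b m])
    also have "\<dots> = (\<Sum>j\<in>I. \<iota> (\<Sum>k\<in>K. D k * co I b (f k * b i) j) * b j)"
     unfolding sum_distrib_left \<iota>_sum sum_distrib_right \<iota>_mult mult.assoc by (rule sum.swap)
    finally show "(\<Sum>k\<in>K. \<iota> (D k) * f k) * b i = (\<Sum>j\<in>I. \<iota> (\<Sum>k\<in>K. D k * co I b (f k * b i) j) * b j)" .
    show "(\<Sum>k\<in>K. \<iota> (D k) * f k) * b i \<in> \<A>" using \<A>_lin[OF K] tbasis_in[OF b i] by (rule \<A>_mult)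
  qed fact
  then have "tr I b (\<Sum>k\<in>K. \<iota> (D k) * f k) = (\<Sum>i\<in>I. \<Sum>k\<in>K. D k * co I b (f k * b i) i)"
    by (simp add: tr_def)
  also have "\<dots> = (\<Sum>k\<in>K. D k * tr I b (f k))" unfolding tr_def sum_distrib_left by (rule sum.swap)
  finally show ?thesis .
qed

text \<open>Expanding \<open>b i\<close> in \<open>e\<close> and then back in \<open>b\<close>
  returns \<open>b i\<close>, and coordinates are unique. The index sets may still have different
  sizes here, so this also yields the invariance of the rank.\<close>

lemma basis_change:
  assumes b: "tbasis I b" and e: "tbasis J e"
    and i: "i \<in> I" and k: "k \<in> I"
  shows "(\<Sum>j\<in>J. co J e (b i) j * co I b (e j) k) = (if i = k then 1 else 0)"
proof (rule tbasis_unique[OF b, where D = "\<lambda>k. \<Sum>j\<in>J. co J e (b i) j * co I b (e j) k"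
    and D' = "\<lambda>k. if i = k then 1 else 0", OF _ _ _ k])
  show "(\<Sum>j\<in>J. co J e (b i) j * co I b (e j) k) \<in> S0" if "k \<in> I" for k
    using that i b e by (intro S0_sum S0_mult co(1)) (auto intro: tbasis_in[OF b] tbasis_in[OF e])
  have "(\<Sum>k\<in>I. \<iota> (\<Sum>j\<in>J. co J e (b i) j * co I b (e j) k) * b k)
     = (\<Sum>j\<in>J. \<iota> (co J e (b i) j) * (\<Sum>k\<in>I. \<iota> (co I b (e j) k) * b k))"
    unfolding \<iota>_sum sum_distrib_left sum_distrib_right \<iota>_mult mult.assoc by (rule sum.swap)
  also have "\<dots> = b i" using i b e by (simp add: co tbasis_in[OF b] tbasis_in[OF e])
  also have "\<dots> = (\<Sum>k\<in>I. \<iota> (if i = k then 1 else 0) * b k)"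
    using i tbasis_fin[OF b] by (simp add: if_distrib[of \<iota>] \<iota>_one if_distrib[of "\<lambda>x. x * _"] cong: if_cong)
  finally show "(\<Sum>k\<in>I. \<iota> (\<Sum>j\<in>J. co J e (b i) j * co I b (e j) k) * b k)
    = (\<Sum>k\<in>I. \<iota> (if i = k then 1 else 0) * b k)" .
qed (auto simp: S0_one S0_zero)

text \<open>Each transition matrix has a right inverse, and over a domain this bounds the two
  cardinalities by each other.\<close>

lemma tbasis_card: "tbasis I b \<Longrightarrow> tbasis J e \<Longrightarrow> card I = card J"
  by (intro antisym card_le_of_right_inverse[OF _ _ basis_change]) (auto intro: tbasis_fin)

text \<open>In the basis \<open>b\<close> the multiplication matrix is the product of
  \<open>?Q\<close>, \<open>?N\<close> and \<open>?R\<close>. Cyclicity of the trace brings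
  \<open>?R\<close> next to \<open>?Q\<close>, where \<open>basis_change\<close> collapses the
  product.\<close>

lemma tr_basis_change:
  assumes b: "tbasis I b" and e: "tbasis J e" and a: "a \<in> \<A>"
  shows "tr I b a = tr J e a"
proof -
  let ?Q = "\<lambda>j i. co J e (b j) i" and ?R = "\<lambda>i j. co I b (e i) j" and ?N = "\<lambda>i i'. co J e (a * e i) i'"
  have mem: "a * e i \<in> \<A>" if "i \<in> J" for i using that a e by (auto intro: \<A>_mult tbasis_in[OF e])
  have "co I b (a * b j) j = (\<Sum>i\<in>J. \<Sum>i'\<in>J. ?Q j i * ?N i i' * ?R i' j)" if j: "j \<in> I" for j
  proof (rule co_eqI[OF b, where D = "\<lambda>k. \<Sum>i\<in>J. \<Sum>i'\<in>J. ?Q j i * ?N i i' * ?R i' k"])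
    show "(\<Sum>i\<in>J. \<Sum>i'\<in>J. ?Q j i * ?N i i' * ?R i' k) \<in> S0" if "k \<in> I" for k
     using that j mem b e by (intro S0_sum S0_mult co(1)) (auto intro: tbasis_in[OF b] tbasis_in[OF e])
    have "a * b j = a * (\<Sum>i\<in>J. \<iota> (?Q j i) * e i)" using j b e by (simp add: co tbasis_in[OF b])
    also have "\<dots> = (\<Sum>i\<in>J. \<iota> (?Q j i) * (a * e i))"
     unfolding sum_distrib_left
     by (intro sum.cong refl \<A>_scal a co(1)[OF e] tbasis_in[OF b j])
    also have "\<dots> = (\<Sum>i\<in>J. \<iota> (?Q j i) * (\<Sum>i'\<in>J. \<iota> (?N i i') * e i'))"
     by (intro sum.cong refl) (simp add: co(2)[OF e mem])
    also have "\<dots> = (\<Sum>i\<in>J. \<iota> (?Q j i) * (\<Sum>i'\<in>J. \<iota> (?N i i') * (\<Sum>k\<in>I. \<iota> (?R i' k) * b k)))"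
     by (intro sum.cong refl arg_cong2[where f="(*)"]) (simp add: co(2)[OF b] tbasis_in[OF e])
    also have "\<dots> = (\<Sum>i\<in>J. \<Sum>i'\<in>J. \<Sum>k\<in>I. \<iota> (?Q j i * ?N i i' * ?R i' k) * b k)"
     by (simp add: sum_distrib_left \<iota>_mult mult.assoc)
    also have "\<dots> = (\<Sum>k\<in>I. \<Sum>i\<in>J. \<Sum>i'\<in>J. \<iota> (?Q j i * ?N i i' * ?R i' k) * b k)"
     by (subst (2) sum.swap, subst sum.swap) (rule refl)
    also have "\<dots> = (\<Sum>k\<in>I. \<iota> (\<Sum>i\<in>J. \<Sum>i'\<in>J. ?Q j i * ?N i i' * ?R i' k) * b k)"
     by (simp add: \<iota>_sum sum_distrib_right)
    finally show "a * b j = (\<Sum>k\<in>I. \<iota> (\<Sum>i\<in>J. \<Sum>i'\<in>J. ?Q j i * ?N i i' * ?R i' k) * b k)" .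
    show "a * b j \<in> \<A>" using a tbasis_in[OF b j] by (rule \<A>_mult)
  qed fact
  then have "tr I b a = (\<Sum>j\<in>I. \<Sum>i\<in>J. \<Sum>i'\<in>J. ?Q j i * ?N i i' * ?R i' j)" by (simp add: tr_def)
  also have "\<dots> = (\<Sum>i\<in>J. \<Sum>i'\<in>J. \<Sum>j\<in>I. ?Q j i * ?N i i' * ?R i' j)"
    by (subst sum.swap, subst (2) sum.swap) (rule refl)
  also have "\<dots> = (\<Sum>i\<in>J. \<Sum>i'\<in>J. ?N i i' * (\<Sum>j\<in>I. ?R i' j * ?Q j i))"
    by (simp add: sum_distrib_left ac_simps)
  also have "\<dots> = (\<Sum>i\<in>J. \<Sum>i'\<in>J. ?N i i' * (if i' = i then 1 else 0))"
    by (intro sum.cong refl) (simp add: basis_change[OF e b])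
  also have "\<dots> = (\<Sum>i\<in>J. \<Sum>i'\<in>J. if i' = i then ?N i i' else 0)"
    by (intro sum.cong refl) simp
  also have "\<dots> = tr J e a" using tbasis_fin[OF e] by (simp add: tr_def)
  finally show ?thesis .
qed

lemma tbasis_reindex:
  assumes f: "bij_betw f I J" and b: "tbasis J b"
  shows "tbasis I (b \<circ> f)"
  unfolding tbasis_def
proof (intro conjI ballI allI impI)
  have fI: "f i \<in> J" if "i \<in> I" for i using f that by (auto simp: bij_betw_def)
  show "finite I" using f tbasis_fin[OF b] bij_betw_finite by blast
  show "(b \<circ> f) i \<in> \<A>" if "i \<in> I" for i using that fI tbasis_in[OF b] by simp
  fix a assume a: "a \<in> \<A>"
  have "(\<Sum>i\<in>I. \<iota> (co J b a (f i)) * (b \<circ> f) i) = a"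
    using sum.reindex_bij_betw[OF f, of "\<lambda>j. \<iota> (co J b a j) * b j"] co(2)[OF b a] by simp
  then show "\<exists>D. (\<forall>i\<in>I. D i \<in> S0) \<and> a = (\<Sum>i\<in>I. \<iota> (D i) * (b \<circ> f) i)"
    using co(1)[OF b a] fI by (intro exI[of _ "\<lambda>i. co J b a (f i)"]) auto
next
  fix D i assume D: "\<forall>i\<in>I. D i \<in> S0" "(\<Sum>i\<in>I. \<iota> (D i) * (b \<circ> f) i) = 0" and i: "i \<in> I"
  let ?g = "inv_into I f"
  have g: "bij_betw ?g J I" using bij_betw_inv_into[OF f] .
  have "(\<Sum>j\<in>J. \<iota> (D (?g j)) * b j) = (\<Sum>j\<in>J. \<iota> (D (?g j)) * (b \<circ> f) (?g j))"
    using f by (intro sum.cong refl) (simp add: bij_betw_inv_into_right)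
  also have "\<dots> = 0" using sum.reindex_bij_betw[OF g, of "\<lambda>i. \<iota> (D i) * (b \<circ> f) i"] D by simp
  finally have "D (?g (f i)) = 0"
    by (rule tbasis_indep[OF b, rotated]) (use D(1) bij_betwE[OF g] bij_betwE[OF f] i in auto)
  then show "D i = 0" using bij_betw_inv_into_left[OF f i] by simp
qed

text \<open>The Gram matrix of the pair \<open>b\<close>, \<open>b'\<close> is
  \<open>?P ?G ?P'^T\<close>. The inverse transition matrices \<open>?Q\<close>, \<open>?Q'\<close>
  also have entries in \<open>S0\<close>, so the determinants of \<open>?P\<close> and
  \<open>?P'\<close> are units there. Two bases are needed because the definition of a discriminant
  permits different ones on the two sides.\<close>

lemma gram_basis_change:
  assumes e: "tbasis J e" and b: "tbasis J b" and b': "tbasis J b'"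
  shows "\<exists>u v. u \<in> S0 \<and> v \<in> S0 \<and> u * v = 1 \<and>
    detS J (\<lambda>i j. tr J e (b i * b' j)) = u * detS J (\<lambda>i j. tr J e (e i * e j))"
proof -
  let ?G = "\<lambda>i j. tr J e (e i * e j)"
  let ?P = "\<lambda>i j. co J e (b i) j" and ?P' = "\<lambda>i j. co J e (b' i) j"
  let ?Q = "\<lambda>i j. co J b (e i) j" and ?Q' = "\<lambda>i j. co J b' (e i) j"
  have fin: "finite J" using tbasis_fin[OF e] .
  have mem: "e i \<in> \<A>" "b i \<in> \<A>" "b' i \<in> \<A>" if "i \<in> J" for i using that e b b' by (auto intro: tbasis_in[OF b] tbasis_in[OF b'] tbasis_in[OF e])
  have "tr J e (b i * b' j) = (\<Sum>k\<in>J. ?P i k * (\<Sum>l\<in>J. ?G k l * ?P' j l))" if ij: "i \<in> J" "j \<in> J" for i j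
  proof -
    have "b i * b' j = (\<Sum>k\<in>J. \<iota> (?P i k) * e k) * b' j" using ij mem by (simp add: co(2)[OF e])
    then have "tr J e (b i * b' j) = tr J e (\<Sum>k\<in>J. \<iota> (?P i k) * (e k * b' j))"
     by (simp add: sum_distrib_right mult.assoc)
    also have "\<dots> = (\<Sum>k\<in>J. ?P i k * tr J e (e k * b' j))"
     using ij mem e by (intro tr_lin[OF e]) (auto intro: co \<A>_mult)
    also have "\<dots> = (\<Sum>k\<in>J. ?P i k * (\<Sum>l\<in>J. ?G k l * ?P' j l))"
    proof (intro sum.cong refl arg_cong2[where f="(*)"])
     fix k assume k: "k \<in> J"
     have "e k * b' j = e k * (\<Sum>l\<in>J. \<iota> (?P' j l) * e l)" using ij mem by (simp add: co(2)[OF e])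
     also have "\<dots> = (\<Sum>l\<in>J. \<iota> (?P' j l) * (e k * e l))"
      unfolding sum_distrib_left
      by (intro sum.cong refl \<A>_scal co(1)[OF e] mem k ij)
     finally have "tr J e (e k * b' j) = (\<Sum>l\<in>J. ?P' j l * ?G k l)"
      using k ij mem e by (simp add: tr_lin[OF e] co \<A>_mult)
     then show "tr J e (e k * b' j) = (\<Sum>l\<in>J. ?G k l * ?P' j l)" by (simp add: mult.commute)
    qed
    finally show ?thesis .
  qed
  then have "detS J (\<lambda>i j. tr J e (b i * b' j)) = detS J (\<lambda>i j. \<Sum>k\<in>J. ?P i k * (\<Sum>l\<in>J. ?G k l * ?P' j l))"
    by (intro detS_cong) auto
  also have "\<dots> = detS J ?P * (detS J ?G * detS J ?P')"
    by (simp only: detS_mult[OF fin] detS_transpose[OF fin, of ?P'])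
  finally have 1: "detS J (\<lambda>i j. tr J e (b i * b' j)) = (detS J ?P * detS J ?P') * detS J ?G"
    by (simp add: ac_simps)
  have one: "detS J (\<lambda>i j. if i = j then 1 else (0::'s)) = 1"
  proof -
    obtain f where f: "bij_betw f {..<card J} J" using finite_enum[OF fin] .
    have "detS J (\<lambda>i j. if i = j then 1 else (0::'s)) = detS {..<card J} (\<lambda>i j. if f i = f j then 1 else 0)"
     by (rule detS_reindex[OF f, symmetric]) simp
    also have "\<dots> = detS {..<card J} (\<lambda>i j. if i = j then 1 else 0)"
     using f by (intro detS_cong refl) (auto simp: bij_betw_def inj_on_def)
    also have "\<dots> = 1" by (subst detS_lower_triangular) auto
    finally show ?thesis .
  qed
  have unit: "detS J (co J e \<circ> b) * detS J (co J b \<circ> e) = 1" if b: "tbasis J b" for b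
  proof -
    have "detS J (co J e \<circ> b) * detS J (co J b \<circ> e)
      = detS J (\<lambda>i j. \<Sum>k\<in>J. (co J e \<circ> b) i k * (co J b \<circ> e) k j)"
     by (rule detS_mult[OF fin, symmetric])
    also have "\<dots> = detS J (\<lambda>i j. if i = j then 1 else 0)"
     by (intro detS_cong refl) (simp add: basis_change[OF b e])
    finally show ?thesis using one by simp
  qed
  have S: "detS J (co J e \<circ> b) \<in> S0" "detS J (co J b \<circ> e) \<in> S0" if "tbasis J b" for b
    using that e by (auto intro!: S0_detS co(1) tbasis_in[of J b] tbasis_in[OF e])
  show ?thesis
  proof (intro exI conjI)
    show "detS J ?P * detS J ?P' \<in> S0" using S(1)[OF b] S(1)[OF b'] S0_mult by (simp add: comp_def)
    show "detS J ?Q * detS J ?Q' \<in> S0" using S(2)[OF b] S(2)[OF b'] S0_mult by (simp add: comp_def)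
    show "detS J ?P * detS J ?P' * (detS J ?Q * detS J ?Q') = 1"
    proof -
     have "detS J ?P * detS J ?P' * (detS J ?Q * detS J ?Q') = (detS J ?P * detS J ?Q) * (detS J ?P' * detS J ?Q')"
      by (simp only: mult_ac)
     also have "\<dots> = 1 * 1"
      by (rule arg_cong2[where f="(*)"]) (use unit[OF b] unit[OF b'] in \<open>simp_all add: comp_def\<close>)
     finally show ?thesis by simp
    qed
  qed (rule 1)
qed

subsection \<open>Comparison with the definitions over ring records\<close>

lemma lin_carrier: "f \<in> {..<M} \<rightarrow>\<^sub>E C \<Longrightarrow> \<forall>i<M. b i \<in> carrier R \<Longrightarrow> (\<lambda>i. f i \<otimes>\<^bsub>R\<^esub> b i) \<in> {..<M} \<rightarrow> carrier R"
proof -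
  interpret ring R by (rule ring)
  show "f \<in> {..<M} \<rightarrow>\<^sub>E C \<Longrightarrow> \<forall>i<M. b i \<in> carrier R \<Longrightarrow> (\<lambda>i. f i \<otimes>\<^bsub>R\<^esub> b i) \<in> {..<M} \<rightarrow> carrier R"
    using C_carrier by (auto simp: PiE_def Pi_def subset_iff)
qed

lemma h_lin:
  assumes f: "f \<in> {..<M} \<rightarrow>\<^sub>E C" and b: "\<forall>i<M. b i \<in> carrier R"
  shows "h (\<Oplus>\<^bsub>R\<^esub>i\<in>{..<M}. f i \<otimes>\<^bsub>R\<^esub> b i) = (\<Sum>i<M. \<iota> (low (f i)) * h (b i))"
  unfolding h_finsum[OF lin_carrier[OF assms]]
  using assms C_carrier by (intro sum.cong refl) (auto simp: h_mult low PiE_def Pi_def subset_iff)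

lemma eq_lin_iff:
  assumes f: "f \<in> {..<M} \<rightarrow>\<^sub>E C" and b: "\<forall>i<M. b i \<in> carrier R" and a: "a \<in> carrier R"
  shows "a = (\<Oplus>\<^bsub>R\<^esub>i\<in>{..<M}. f i \<otimes>\<^bsub>R\<^esub> b i) \<longleftrightarrow> h a = (\<Sum>i<M. \<iota> (low (f i)) * h (b i))"
proof -
  interpret ring R by (rule ring)
  show ?thesis
    using h_lin[OF f b] h_eq_iff[OF a finsum_closed[OF lin_carrier[OF f b]]] by auto
qed

lemma low_lft: "s \<in> S0 \<Longrightarrow> low (lft s) = s"
  using lft[of s] \<iota>_inj unfolding low_def by simp

lemma lft_low: "c \<in> C \<Longrightarrow> lft (low c) = c"
  using low[of c] C_carrier h_inj unfolding lft_def by (simp add: inj_on_subset inv_into_f_f)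

lemma restrict_lft: "(\<And>i. i < M \<Longrightarrow> D i \<in> S0) \<Longrightarrow> restrict (lft \<circ> D) {..<M} \<in> {..<M} \<rightarrow>\<^sub>E C"
  using lft(1) by auto

text \<open>The record version speaks of one extensional coefficient function into \<open>C\<close>,
  the typed one of coefficients in \<open>S0\<close> on the index set; \<open>restrict\<close> and
  \<open>lft\<close> translate between them.\<close>

lemma is_basis_iff:
  "is_basis R C M b \<longleftrightarrow> (\<forall>i<M. b i \<in> carrier R) \<and> tbasis {..<M} (h \<circ> b)" (is "?L \<longleftrightarrow> ?Rt")
proof
  interpret ring R by (rule ring)
  assume L: ?L
  then have bc: "\<forall>i<M. b i \<in> carrier R"
    and ex1: "\<And>a. a \<in> carrier R \<Longrightarrow> \<exists>!f. f \<in> {..<M} \<rightarrow>\<^sub>E C \<and> a = (\<Oplus>\<^bsub>R\<^esub>i\<in>{..<M}. f i \<otimes>\<^bsub>R\<^esub> b i)"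
    by (auto simp: is_basis_def)
  have "tbasis {..<M} (h \<circ> b)" unfolding tbasis_def
  proof (intro conjI ballI allI impI)
    fix a assume "a \<in> \<A>"
    then obtain a' where a': "a' \<in> carrier R" "a = h a'" by (auto simp: \<A>_def)
    obtain f where f: "f \<in> {..<M} \<rightarrow>\<^sub>E C" "a' = (\<Oplus>\<^bsub>R\<^esub>i\<in>{..<M}. f i \<otimes>\<^bsub>R\<^esub> b i)"
     using ex1[OF a'(1)] by blast
    show "\<exists>D. (\<forall>i\<in>{..<M}. D i \<in> S0) \<and> a = (\<Sum>i<M. \<iota> (D i) * (h \<circ> b) i)"
     using f a' eq_lin_iff[OF f(1) bc a'(1)] low(1) by (intro exI[of _ "low \<circ> f"]) auto
  next
    fix D i assume D: "\<forall>i\<in>{..<M}. D i \<in> S0" "(\<Sum>i<M. \<iota> (D i) * (h \<circ> b) i) = 0" and i: "i \<in> {..<M}"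
    let ?f = "restrict (lft \<circ> D) {..<M}" and ?g = "restrict (lft \<circ> (\<lambda>_. 0)) {..<M}"
    have f: "?f \<in> {..<M} \<rightarrow>\<^sub>E C" and g: "?g \<in> {..<M} \<rightarrow>\<^sub>E C" using D by (auto simp: lft S0_zero)
    have "\<zero>\<^bsub>R\<^esub> = (\<Oplus>\<^bsub>R\<^esub>i\<in>{..<M}. ?f i \<otimes>\<^bsub>R\<^esub> b i)" "\<zero>\<^bsub>R\<^esub> = (\<Oplus>\<^bsub>R\<^esub>i\<in>{..<M}. ?g i \<otimes>\<^bsub>R\<^esub> b i)"
     using D unfolding eq_lin_iff[OF f bc zero_closed] eq_lin_iff[OF g bc zero_closed]
     by (simp_all add: low_lft h_zero S0_zero)
    \<comment> \<open>Both coefficient functions expand zero, so uniqueness of that expansion gives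
      independence.\<close>
    then have "?f = ?g" using f g by (intro ex1_implies_unique[OF ex1[OF zero_closed]]) auto
    then have "?f i = ?g i" by (rule fun_cong)
    then have "lft (D i) = lft 0" using i by simp
    then have "low (lft (D i)) = low (lft 0)" by simp
    then show "D i = 0" using i D by (simp add: low_lft S0_zero)
  qed (use bc in \<open>auto intro: \<A>I\<close>)
  then show ?Rt using bc by simp
next
  assume Rt: ?Rt
  then have bc: "\<forall>i<M. b i \<in> carrier R" and tb: "tbasis {..<M} (h \<circ> b)" by auto
  show ?L unfolding is_basis_def
  proof (intro conjI ballI)
    fix a assume a: "a \<in> carrier R"
    let ?f = "restrict (lft \<circ> co {..<M} (h \<circ> b) (h a)) {..<M}"
    have cS: "co {..<M} (h \<circ> b) (h a) i \<in> S0" if "i < M" for i using co(1)[OF tb \<A>I[OF a]] that by auto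
    have f: "?f \<in> {..<M} \<rightarrow>\<^sub>E C" by (rule restrict_lft) (rule cS)
    show "\<exists>!f. f \<in> {..<M} \<rightarrow>\<^sub>E C \<and> a = (\<Oplus>\<^bsub>R\<^esub>i\<in>{..<M}. f i \<otimes>\<^bsub>R\<^esub> b i)"
    proof (rule ex1I[of _ ?f], intro conjI f)
     show "a = (\<Oplus>\<^bsub>R\<^esub>i\<in>{..<M}. ?f i \<otimes>\<^bsub>R\<^esub> b i)"
      unfolding eq_lin_iff[OF f bc a] using co(2)[OF tb \<A>I[OF a]] by (simp add: low_lft cS)
    next
     fix g assume g: "g \<in> {..<M} \<rightarrow>\<^sub>E C \<and> a = (\<Oplus>\<^bsub>R\<^esub>i\<in>{..<M}. g i \<otimes>\<^bsub>R\<^esub> b i)"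
     then have gC: "g i \<in> C" if "i < M" for i using that by auto
     have "h a = (\<Sum>i<M. \<iota> (low (g i)) * (h \<circ> b) i)" using g eq_lin_iff[of g M b a] bc a by simp
     then have "co {..<M} (h \<circ> b) (h a) i = low (g i)" if "i < M" for i
      by (rule co_eqI[OF tb, rotated]) (use that \<A>I[OF a] gC low(1) in auto)
     then have eq: "g i = ?f i" if "i < M" for i using that lft_low[OF gC[OF that]] by simp
     show "g = ?f" by (rule PiE_ext[of g "{..<M}" "\<lambda>_. C" ?f]) (use g f eq in auto)
    qed
  qed (use bc in auto)
qed

lemma coords:
  assumes b: "is_basis R C M b" and a: "a \<in> carrier R" and i: "i < M"
  shows "coords R C M b a i \<in> C" "h (coords R C M b a i) = \<iota> (co {..<M} (h \<circ> b) (h a) i)"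
proof -
  have bc: "\<forall>i<M. b i \<in> carrier R" and tb: "tbasis {..<M} (h \<circ> b)" using b by (auto simp: is_basis_iff)
  have "\<exists>!f. f \<in> {..<M} \<rightarrow>\<^sub>E C \<and> a = (\<Oplus>\<^bsub>R\<^esub>i\<in>{..<M}. f i \<otimes>\<^bsub>R\<^esub> b i)"
    using b a by (auto simp: is_basis_def)
  from theI'[OF this] have f: "coords R C M b a \<in> {..<M} \<rightarrow>\<^sub>E C"
    "a = (\<Oplus>\<^bsub>R\<^esub>i\<in>{..<M}. coords R C M b a i \<otimes>\<^bsub>R\<^esub> b i)" by (auto simp: coords_def)
  then have fC: "coords R C M b a i \<in> C" if "i < M" for i using that by auto
  have "h a = (\<Sum>i<M. \<iota> (low (coords R C M b a i)) * (h \<circ> b) i)"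
    using f(2) unfolding eq_lin_iff[OF f(1) bc a] by simp
  then have "co {..<M} (h \<circ> b) (h a) i = low (coords R C M b a i)"
    by (rule co_eqI[OF tb, rotated]) (use \<A>I[OF a] i fC low(1) in auto)
  then show "coords R C M b a i \<in> C" "h (coords R C M b a i) = \<iota> (co {..<M} (h \<circ> b) (h a) i)"
    using fC[OF i] low by auto
qed

lemma internal_trace:
  assumes b: "is_basis R C M b" and a: "a \<in> carrier R"
  shows "internal_trace R C M b a \<in> C" "h (internal_trace R C M b a) = \<iota> (tr {..<M} (h \<circ> b) (h a))"
proof -
  interpret ring R by (rule ring)
  interpret C: subring C R by (rule subring)
  have bc: "b i \<in> carrier R" if "i < M" for i using b that by (auto simp: is_basis_def)
  have mem: "a \<otimes>\<^bsub>R\<^esub> b i \<in> carrier R" if "i < M" for i using a bc that by auto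
  have m: "(\<lambda>i. mult_matrix R C M b a i i) \<in> {..<M} \<rightarrow> C"
    using coords(1)[OF b mem] by (auto simp: mult_matrix_def)
  have sumC: "finsum R f I \<in> C" if "f \<in> I \<rightarrow> C" for f and I :: "nat set"
    using that
  proof (induction I rule: infinite_finite_induct)
    case (insert i I)
    then show ?case using C_carrier subringE(7)[OF subring]
     by (subst finsum_insert) (auto simp: Pi_def subset_iff)
  qed (use subringE(2)[OF subring] in auto)
  show "internal_trace R C M b a \<in> C" unfolding internal_trace_def by (rule sumC[OF m])
  have "h (internal_trace R C M b a) = (\<Sum>i<M. h (mult_matrix R C M b a i i))"
    unfolding internal_trace_def by (rule h_finsum) (use m C_carrier in auto)
  also have "\<dots> = (\<Sum>i<M. \<iota> (co {..<M} (h \<circ> b) (h a * (h \<circ> b) i) i))"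
    using coords(2)[OF b mem] a bc by (intro sum.cong refl) (auto simp: mult_matrix_def h_mult)
  finally show "h (internal_trace R C M b a) = \<iota> (tr {..<M} (h \<circ> b) (h a))"
    by (simp add: tr_def \<iota>_sum)
qed

lemma C_cring: "cring (R\<lparr>carrier := C\<rparr>)"
proof -
  interpret ring R by (rule ring)
  have "ring (R\<lparr>carrier := C\<rparr>)" by (rule subring_is_ring[OF subring])
  then show ?thesis
    using C_center C_carrier
    by (intro cring.intro) (auto simp: comm_monoid_axioms_def comm_monoid_def ring_def ring_center_def subset_iff
      intro!: comm_monoid.intro comm_monoid_axioms.intro)
qed

text \<open>On \<open>C\<close> the map \<open>low\<close> respects sums and products, so the
  Leibniz formula is evaluated term by term. Only the signs, which are integer multiples formed in
  the record ring, need separate treatment.\<close>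

lemma ring_det:
  assumes U: "\<And>i j. i < M \<Longrightarrow> j < M \<Longrightarrow> U i j \<in> C"
  shows "ring_det (R\<lparr>carrier := C\<rparr>) M U \<in> C"
    "h (ring_det (R\<lparr>carrier := C\<rparr>) M U) = \<iota> (detS {..<M} (\<lambda>i j. low (U i j)))"
proof -
  let ?C = "R\<lparr>carrier := C\<rparr>"
  interpret cring ?C by (rule C_cring)
  have la: "low (x \<oplus>\<^bsub>?C\<^esub> y) = low x + low y" "low (x \<otimes>\<^bsub>?C\<^esub> y) = low x * low y"
    if "x \<in> carrier ?C" "y \<in> carrier ?C" for x y
  proof -
    have xy: "x \<in> C" "y \<in> C" "x \<in> carrier R" "y \<in> carrier R" using that C_carrier by auto
    have "x \<oplus>\<^bsub>R\<^esub> y \<in> C" "x \<otimes>\<^bsub>R\<^esub> y \<in> C" using xy subringE(6,7)[OF subring] by auto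
    then have "\<iota> (low (x \<oplus>\<^bsub>R\<^esub> y)) = \<iota> (low x + low y)" "\<iota> (low (x \<otimes>\<^bsub>R\<^esub> y)) = \<iota> (low x * low y)"
     "low (x \<oplus>\<^bsub>R\<^esub> y) \<in> S0" "low (x \<otimes>\<^bsub>R\<^esub> y) \<in> S0"
     using xy by (simp_all add: low \<iota>_add \<iota>_mult h_add h_mult)
    then show "low (x \<oplus>\<^bsub>?C\<^esub> y) = low x + low y" "low (x \<otimes>\<^bsub>?C\<^esub> y) = low x * low y"
     using xy \<iota>_inj low(1) S0_add S0_mult by (auto simp: inj_on_def)
  qed
  have l1: "low \<one>\<^bsub>?C\<^esub> = 1"
    using low[of "\<one>\<^bsub>R\<^esub>"] subringE(3)[OF subring] \<iota>_inj S0_one by (auto simp: h_one \<iota>_one inj_on_def)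
  have lprod: "low (finprod ?C f I) = (\<Prod>i\<in>I. low (f i))" if "f \<in> I \<rightarrow> carrier ?C" for f and I :: "nat set"
    using that
  proof (induction I rule: infinite_finite_induct)
    case (insert i I)
    then have m: "f \<in> I \<rightarrow> carrier ?C" "f i \<in> carrier ?C" by auto
    then show ?case
     using insert la(2)[OF m(2) finprod_closed[OF m(1)]]
     by (simp only: finprod_insert[OF insert.hyps m] prod.insert[OF insert.hyps])
  qed (use l1 in simp_all)
  have lsign: "low (add_pow ?C (sign p) x) = of_int (sign p) * low x" if x: "x \<in> carrier ?C"
    for x and p :: "nat \<Rightarrow> nat"
  proof -
    have l0: "low \<zero>\<^bsub>?C\<^esub> = 0"
     using low[of "\<zero>\<^bsub>R\<^esub>"] subringE(2)[OF subring] \<iota>_inj S0_zero by (auto simp: h_zero inj_on_def)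
    have m: "low (\<ominus>\<^bsub>?C\<^esub> x) = - low x"
     using la(1)[OF x a_inv_closed[OF x]] unfolding r_neg[OF x] l0 by (simp add: eq_neg_iff_add_eq_0 add.commute)
    have "add_pow ?C (1::int) x = x" using x by (rule add.int_pow_1)
    moreover have "add_pow ?C (- 1::int) x = \<ominus>\<^bsub>?C\<^esub> x"
     using add.int_pow_neg[OF x, of 1] add.int_pow_1[OF x] by simp
    moreover have "sign p = 1 \<or> sign p = - 1" by (rule sign_cases[of p]) simp_all
    ultimately show ?thesis using m by auto
  qed
  have U': "(\<lambda>i. U i (p i)) \<in> {..<M} \<rightarrow> carrier ?C" if "p permutes {..<M}" for p
    using that U permutes_in_image[OF that] by auto
  have m: "(\<lambda>p. add_pow ?C (sign p) (\<Otimes>\<^bsub>?C\<^esub>i\<in>{..<M}. U i (p i))) \<in> {p. p permutes {..<M}} \<rightarrow> carrier ?C"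
    by (intro Pi_I add.int_pow_closed finprod_closed U') simp
  have "ring_det ?C M U \<in> carrier ?C" unfolding ring_det_def by (rule finsum_closed[OF m])
  then show C: "ring_det ?C M U \<in> C" by simp
  have "low (ring_det ?C M U) = (\<Sum>p\<in>{p. p permutes {..<M}}. low (add_pow ?C (sign p) (\<Otimes>\<^bsub>?C\<^esub>i\<in>{..<M}. U i (p i))))"
    unfolding ring_det_def by (rule hom_finsum[OF _ la(1) m]) (simp add: is_abelian_group)
  also have "\<dots> = detS {..<M} (\<lambda>i j. low (U i j))"
    unfolding detS_def
    by (intro sum.cong refl) (simp only: mem_Collect_eq lsign[OF finprod_closed[OF U']] lprod[OF U'])
  finally show "h (ring_det ?C M U) = \<iota> (detS {..<M} (\<lambda>i j. low (U i j)))"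
    using low(2)[OF C] by simp
qed

text \<open>The trace basis drops out by \<open>tr_basis_change\<close>, invariance of the rank
  makes \<open>M\<close> the cardinality of \<open>J\<close>, and the two remaining bases are
  absorbed into a unit. Hence a single convenient basis \<open>e\<close> determines all
  discriminants.\<close>

lemma is_discriminantD:
  assumes d: "is_discriminant R C d" and e: "tbasis J e"
  obtains u v where "u \<in> S0" "v \<in> S0" "u * v = 1" "h d = \<iota> (u * detS J (\<lambda>i j. tr J e (e i * e j)))"
    "d \<in> carrier R"
proof -
  interpret ring R by (rule ring)
  obtain M b0 b b' where bb: "is_basis R C M b0" "is_basis R C M b" "is_basis R C M b'"
    and d: "d = ring_det (R\<lparr>carrier := C\<rparr>) M (\<lambda>i j. internal_trace R C M b0 (b i \<otimes>\<^bsub>R\<^esub> b' j))"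
    using d by (auto simp: is_discriminant_def)
  have tb: "tbasis {..<M} (h \<circ> b0)" "tbasis {..<M} (h \<circ> b)" "tbasis {..<M} (h \<circ> b')"
    and bc: "\<And>i. i < M \<Longrightarrow> b i \<in> carrier R" "\<And>i. i < M \<Longrightarrow> b' i \<in> carrier R"
    using bb by (auto simp: is_basis_iff)
  have "card {..<M} = card J" using tbasis_card[OF tb(1) e] .
  then obtain f where f: "bij_betw f {..<M} J" using finite_enum[OF tbasis_fin[OF e]] by auto
  let ?g = "inv_into {..<M} f"
  have g: "bij_betw ?g J {..<M}" using bij_betw_inv_into[OF f] .
  have mem: "b i \<otimes>\<^bsub>R\<^esub> b' j \<in> carrier R" if "i < M" "j < M" for i j using that bc by auto
  have low_tr: "low (internal_trace R C M b0 (b i \<otimes>\<^bsub>R\<^esub> b' j)) = tr J e (h (b i) * h (b' j))"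
    if "i < M" "j < M" for i j
  proof -
    have "\<iota> (low (internal_trace R C M b0 (b i \<otimes>\<^bsub>R\<^esub> b' j))) = \<iota> (tr {..<M} (h \<circ> b0) (h (b i) * h (b' j)))"
     using internal_trace[OF bb(1) mem[OF that]] that bc by (simp add: low h_mult)
    also have "tr {..<M} (h \<circ> b0) (h (b i) * h (b' j)) = tr J e (h (b i) * h (b' j))"
     by (rule tr_basis_change[OF tb(1) e]) (use that bc in \<open>auto intro: \<A>_mult \<A>I\<close>)
    finally show ?thesis
     using \<iota>_inj low(1)[OF internal_trace(1)[OF bb(1) mem[OF that]]] tr_S0[OF e] that bc
     by (auto simp: inj_on_def \<A>_mult \<A>I)
  qed
  have "detS {..<M} (\<lambda>i j. low (internal_trace R C M b0 (b i \<otimes>\<^bsub>R\<^esub> b' j)))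
     = detS {..<M} (\<lambda>i j. tr J e (h (b i) * h (b' j)))"
    by (rule detS_cong) (auto simp: low_tr)
  also have "\<dots> = detS J (\<lambda>i j. tr J e ((h \<circ> b \<circ> ?g) i * (h \<circ> b' \<circ> ?g) j))"
    using detS_reindex[OF g, of "\<lambda>i j. tr J e (h (b i) * h (b' j))"] tbasis_fin[OF e] by simp
  finally have eq: "h d = \<iota> (detS J (\<lambda>i j. tr J e ((h \<circ> b \<circ> ?g) i * (h \<circ> b' \<circ> ?g) j)))" and dC: "d \<in> C"
    using ring_det[of M "\<lambda>i j. internal_trace R C M b0 (b i \<otimes>\<^bsub>R\<^esub> b' j)"] internal_trace(1)[OF bb(1) mem]
    by (auto simp: d)
  from gram_basis_change[OF e tbasis_reindex[OF g tb(2)] tbasis_reindex[OF g tb(3)]]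
  show thesis using that eq dC C_carrier by auto
qed

lemma is_basis_ex:
  assumes e: "tbasis J e"
  shows "\<exists>b. is_basis R C (card J) b"
proof -
  obtain f where f: "bij_betw f {..<card J} J" using finite_enum[OF tbasis_fin[OF e]] by auto
  define b where "b i = inv_into (carrier R) h (e (f i))" for i
  have b: "b i \<in> carrier R" "h (b i) = e (f i)" if "i < card J" for i
  proof -
    have "e (f i) \<in> \<A>" using that f by (auto intro!: tbasis_in[OF e] simp: bij_betw_def)
    then show "b i \<in> carrier R" "h (b i) = e (f i)" unfolding b_def \<A>_def by (auto intro: inv_into_into f_inv_into_f)
  qed
  have "(\<Sum>i<card J. \<iota> (D i) * (h \<circ> b) i) = (\<Sum>i<card J. \<iota> (D i) * (e \<circ> f) i)" for D
    by (intro sum.cong refl) (simp add: b)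
  then have "tbasis {..<card J} (h \<circ> b) \<longleftrightarrow> tbasis {..<card J} (e \<circ> f)"
    unfolding tbasis_def by (simp add: b)
  then show ?thesis using tbasis_reindex[OF f e] b by (auto simp: is_basis_iff)
qed

lemma is_discriminant_ex: "tbasis J e \<Longrightarrow> \<exists>d. is_discriminant R C d"
  using is_basis_ex[of J e] subring C_center unfolding is_discriminant_def by blast

end

no_notation Polynomials.var (\<open>X\<index>\<close>)

section \<open>Linear extension to finitely supported functions\<close>

definition lin :: "('r::zero \<Rightarrow> 'a::semiring_0) \<Rightarrow> ('w \<Rightarrow> 'a) \<Rightarrow> ('w \<Rightarrow>\<^sub>0 'r) \<Rightarrow> 'a" where
  "lin \<sigma> e f = (\<Sum>w\<in>Poly_Mapping.keys f. \<sigma> (Poly_Mapping.lookup f w) * e w)"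

lemma lin_superset:
  assumes "\<sigma> 0 = 0" "finite K" "Poly_Mapping.keys f \<subseteq> K"
  shows "lin \<sigma> e f = (\<Sum>w\<in>K. \<sigma> (Poly_Mapping.lookup f w) * e w)"
  unfolding lin_def using assms by (intro sum.mono_neutral_left) (auto simp: in_keys_iff)

lemma lin_zero [simp]: "lin \<sigma> e 0 = 0"
  by (simp add: lin_def)

lemma lin_single: "\<sigma> 0 = 0 \<Longrightarrow> lin \<sigma> e (Poly_Mapping.single w r) = \<sigma> r * e w"
  by (subst lin_superset[where K = "{w}"]) auto

lemma lin_add:
  assumes "\<sigma> 0 = 0" "\<And>a b. \<sigma> (a + b) = \<sigma> a + \<sigma> b"
  shows "lin \<sigma> e (f + g) = lin \<sigma> e f + lin \<sigma> e g"
proof -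
  let ?K = "Poly_Mapping.keys f \<union> Poly_Mapping.keys g"
  have "Poly_Mapping.keys (f + g) \<subseteq> ?K" by (rule keys_add)
  then show ?thesis
    by (simp add: lin_superset[where \<sigma>=\<sigma> and K="?K", OF assms(1)] lookup_add assms(2) distrib_right sum.distrib)
qed

lemma lin_sum:
  assumes "\<sigma> 0 = 0" "\<And>a b. \<sigma> (a + b) = \<sigma> a + \<sigma> b"
  shows "lin \<sigma> e (\<Sum>i\<in>I. f i) = (\<Sum>i\<in>I. lin \<sigma> e (f i))"
  by (induction I rule: infinite_finite_induct) (simp_all add: lin_add assms)

lemma poly_mapping_decomp: "(\<Sum>w\<in>Poly_Mapping.keys f. Poly_Mapping.single w (Poly_Mapping.lookup f w)) = f"
proof (rule poly_mapping_eqI)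
  fix k
  have "(\<Sum>w\<in>Poly_Mapping.keys f. Poly_Mapping.lookup (Poly_Mapping.single w (Poly_Mapping.lookup f w)) k)
     = (\<Sum>w\<in>Poly_Mapping.keys f. if w = k then Poly_Mapping.lookup f k else 0)"
    by (intro sum.cong refl) (auto simp: lookup_single when_def)
  also have "\<dots> = Poly_Mapping.lookup f k" by (simp add: in_keys_iff)
  finally show "Poly_Mapping.lookup (\<Sum>w\<in>Poly_Mapping.keys f. Poly_Mapping.single w (Poly_Mapping.lookup f w)) k
     = Poly_Mapping.lookup f k" by (simp add: lookup_sum)
qed

text \<open>Multiplicativity and commutation are required on the supports only, because scalars are
  known to commute with images of words in the generators of the algebra and not with those of
  arbitrary words.\<close>

lemma lin_mult:
  fixes f g :: "'w::monoid_add \<Rightarrow>\<^sub>0 'r::semiring_0" and \<sigma> :: "'r \<Rightarrow> 'a::semiring_0"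
  assumes \<sigma>: "\<sigma> 0 = 0" "\<And>a b. \<sigma> (a + b) = \<sigma> a + \<sigma> b" "\<And>a b. \<sigma> (a * b) = \<sigma> a * \<sigma> b"
    and e: "\<And>a b. a \<in> Poly_Mapping.keys f \<Longrightarrow> b \<in> Poly_Mapping.keys g \<Longrightarrow> e (a + b) = e a * e b"
    and comm: "\<And>a b. a \<in> Poly_Mapping.keys f \<Longrightarrow> b \<in> Poly_Mapping.keys g \<Longrightarrow>
     \<sigma> (Poly_Mapping.lookup g b) * e a = e a * \<sigma> (Poly_Mapping.lookup g b)"
  shows "lin \<sigma> e (f * g) = lin \<sigma> e f * lin \<sigma> e g"
proof -
  let ?l = Poly_Mapping.lookup and ?s = Poly_Mapping.single and ?k = Poly_Mapping.keys
  have "lin \<sigma> e (f * g) = lin \<sigma> e (\<Sum>a\<in>?k f. \<Sum>b\<in>?k g. ?s (a + b) (?l f a * ?l g b))"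
    by (subst (1) poly_mapping_decomp[of f, symmetric], subst (1) poly_mapping_decomp[of g, symmetric])
     (simp add: sum_product mult_single)
  also have "\<dots> = (\<Sum>a\<in>?k f. \<Sum>b\<in>?k g. \<sigma> (?l f a * ?l g b) * e (a + b))"
    by (simp add: lin_sum[where \<sigma>=\<sigma>, OF \<sigma>(1,2)] lin_single[where \<sigma>=\<sigma>, OF \<sigma>(1)])
  also have "\<dots> = (\<Sum>a\<in>?k f. \<Sum>b\<in>?k g. (\<sigma> (?l f a) * e a) * (\<sigma> (?l g b) * e b))"
  proof (intro sum.cong refl)
    fix a b assume ab: "a \<in> ?k f" "b \<in> ?k g"
    have "\<sigma> (?l f a * ?l g b) * e (a + b) = \<sigma> (?l f a) * (\<sigma> (?l g b) * e a) * e b"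
     by (simp only: \<sigma> e[OF ab] mult.assoc)
    then show "\<sigma> (?l f a * ?l g b) * e (a + b) = (\<sigma> (?l f a) * e a) * (\<sigma> (?l g b) * e b)"
     by (simp only: comm[OF ab] mult.assoc)
  qed
  also have "\<dots> = lin \<sigma> e f * lin \<sigma> e g" by (simp add: lin_def sum_product)
  finally show ?thesis .
qed

section \<open>Ordered monomials\<close>

text \<open>Pairs are ordered by index, and within a pair \<open>y\<close> stands left of
  \<open>x\<close>. In this order the relation for \<open>x_j y_j\<close> produces an ordered term,
  a scalar, and terms in smaller indices.\<close>

definition omono :: "nat \<Rightarrow> nat \<Rightarrow> (gen \<Rightarrow> 'a::monoid_mult) \<Rightarrow> (gen \<Rightarrow>\<^sub>0 nat) \<Rightarrow> 'a" where
  "omono m n v \<alpha> = prod_list (map (\<lambda>j. v (Y j) ^ Poly_Mapping.lookup \<alpha> (Y j) * v (X j) ^ Poly_Mapping.lookup \<alpha> (X j))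
     [m..<Suc n])"

lemma prod_list_eq_1: "(\<And>x. x \<in> set xs \<Longrightarrow> x = 1) \<Longrightarrow> prod_list xs = (1::'a::monoid_mult)"
  by (induction xs) auto

lemma omono_0 [simp]: "omono m n v 0 = 1"
  by (auto simp: omono_def intro!: prod_list_eq_1)

lemma omono_Suc: "m \<le> Suc n \<Longrightarrow> omono m (Suc n) v \<alpha> = omono m n v \<alpha> *
    (v (Y (Suc n)) ^ Poly_Mapping.lookup \<alpha> (Y (Suc n)) * v (X (Suc n)) ^ Poly_Mapping.lookup \<alpha> (X (Suc n)))"
  by (simp add: omono_def)

lemma omono_first: "m \<le> n \<Longrightarrow> omono m n v \<alpha> =
    v (Y m) ^ Poly_Mapping.lookup \<alpha> (Y m) * v (X m) ^ Poly_Mapping.lookup \<alpha> (X m) * omono (Suc m) n v \<alpha>"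
  by (simp add: omono_def upt_conv_Cons mult.assoc del: upt_Suc)

lemma omono_cong: "(\<And>g. g \<in> gens m n \<Longrightarrow> Poly_Mapping.lookup \<alpha> g = Poly_Mapping.lookup \<beta> g) \<Longrightarrow> omono m n v \<alpha> = omono m n v \<beta>"
  unfolding omono_def by (intro arg_cong[of _ _ prod_list] map_cong) (auto simp: gens_def)

lemma lookup_0_gens: "Poly_Mapping.keys \<alpha> \<subseteq> G \<Longrightarrow> g \<notin> G \<Longrightarrow> Poly_Mapping.lookup \<alpha> g = 0"
  by (auto simp: in_keys_iff)

lemma omono_restrict_right:
  assumes "Poly_Mapping.keys \<alpha> \<subseteq> gens m t" "t \<le> n"
  shows "omono m n v \<alpha> = omono m t v \<alpha>"
  using assms(2)
proof (induction n rule: dec_induct)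
  case (step k)
  show ?case
  proof (cases "m \<le> Suc k")
    case True
    then show ?thesis using step lookup_0_gens[OF assms(1)] by (simp add: omono_Suc gens_def)
  next
    case False
    then show ?thesis using step by (simp add: omono_def)
  qed
qed simp

section \<open>Quotients of free algebras\<close>

abbreviation car :: "gen set \<Rightarrow> (gen word \<Rightarrow>\<^sub>0 'r::comm_ring_1) set" where
  "car G \<equiv> carrier (free_algebra G)"

lemma car_iff: "f \<in> car G \<longleftrightarrow> (\<forall>w\<in>Poly_Mapping.keys f. set (letters w) \<subseteq> G)"
  by (simp add: free_algebra_def)

lemma letters_add [simp]: "letters (u + v) = letters u @ letters v"
  by (simp add: plus_word_def)

lemma letters_0 [simp]: "letters 0 = []"
  by (simp add: zero_word_def)

lemma Word_Nil: "Word [] = 0"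
  by (simp add: zero_word_def)

lemma car_add: "f \<in> car G \<Longrightarrow> g \<in> car G \<Longrightarrow> f + g \<in> car G"
  using keys_add[of f g] by (auto simp: car_iff)

lemma car_mult: "f \<in> car G \<Longrightarrow> g \<in> car G \<Longrightarrow> f * g \<in> car G"
  using keys_mult[of f g] by (fastforce simp: car_iff)

lemma keys_uminus [simp]: "Poly_Mapping.keys (- f) = Poly_Mapping.keys (f :: _ \<Rightarrow>\<^sub>0 'r::ab_group_add)"
  by (auto simp: in_keys_iff)

lemma car_uminus: "f \<in> car G \<Longrightarrow> - f \<in> car G"
  by (simp add: car_iff)

lemma car_diff: "f \<in> car G \<Longrightarrow> g \<in> car G \<Longrightarrow> f - g \<in> car G"
  using car_add[of f G "- g"] by (simp add: car_uminus)

lemma car_0 [simp]: "0 \<in> car G" and car_1 [simp]: "1 \<in> car G"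
  by (auto simp: car_iff)

lemma car_fscal [simp]: "fscal r \<in> car G"
  by (auto simp: car_iff fscal_def split: if_splits)

lemma car_fgen [simp]: "g \<in> G \<Longrightarrow> fgen g \<in> car G"
  by (auto simp: car_iff fgen_def split: if_splits)

lemma car_sum: "(\<And>i. i \<in> I \<Longrightarrow> f i \<in> car G) \<Longrightarrow> sum f I \<in> car G"
  by (induction I rule: infinite_finite_induct) (simp_all add: car_add)

lemma car_power: "f \<in> car G \<Longrightarrow> f ^ k \<in> car G"
  by (induction k) (simp_all add: car_mult)

lemmas car_intros = car_add car_mult car_uminus car_diff car_0 car_1 car_fscal car_fgen car_sum car_power

lemma free_algebra_simps [simp]:
  "f \<otimes>\<^bsub>free_algebra G\<^esub> g = f * g" "f \<oplus>\<^bsub>free_algebra G\<^esub> g = f + g"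
  "\<one>\<^bsub>free_algebra G\<^esub> = 1" "\<zero>\<^bsub>free_algebra G\<^esub> = 0"
  by (simp_all add: free_algebra_def)

lemma ring_free_algebra: "ring (free_algebra G :: (gen word \<Rightarrow>\<^sub>0 'r::comm_ring_1) ring)"
proof (rule ringI)
  show "abelian_group (free_algebra G :: (gen word \<Rightarrow>\<^sub>0 'r) ring)"
  proof (rule abelian_groupI)
    fix f :: "gen word \<Rightarrow>\<^sub>0 'r" assume "f \<in> car G"
    then show "\<exists>y\<in>car G. y \<oplus>\<^bsub>free_algebra G\<^esub> f = \<zero>\<^bsub>free_algebra G\<^esub>"
     by (intro bexI[of _ "- f"] car_uminus) auto
  qed (auto simp: car_add algebra_simps)
  show "monoid (free_algebra G :: (gen word \<Rightarrow>\<^sub>0 'r) ring)"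
    by (rule monoidI) (auto simp: car_mult algebra_simps)
qed (auto simp: algebra_simps)

lemma fscal_add: "fscal (a + b) = fscal a + fscal b"
  by (simp add: fscal_def single_add)

lemma fscal_mult: "fscal (a * b) = fscal a * fscal b"
  by (simp add: fscal_def mult_single)

lemma fscal_0 [simp]: "fscal 0 = 0" and fscal_1 [simp]: "fscal 1 = 1"
  by (simp_all add: fscal_def)

lemma fscal_uminus: "fscal (- a) = - fscal a"
  by (simp add: fscal_def single_uminus)

lemma fscal_comm: "f * fscal r = fscal r * f"
proof -
  have "(\<Sum>w\<in>Poly_Mapping.keys f. Poly_Mapping.single w (Poly_Mapping.lookup f w)) * fscal r
     = fscal r * (\<Sum>w\<in>Poly_Mapping.keys f. Poly_Mapping.single w (Poly_Mapping.lookup f w))"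
    by (simp add: sum_distrib_left sum_distrib_right fscal_def mult_single mult.commute)
  then show ?thesis by (simp add: poly_mapping_decomp)
qed

lemma fscal_left_comm: "f * (fscal r * g) = fscal r * (f * g)"
  by (metis fscal_comm mult.assoc)

lemma power_left_commutes: "a ^ k * (a * b) = a * (a ^ k * (b::'a::monoid_mult))"
  by (simp only: mult.assoc[symmetric] power_commutes)

locale qw_scalars =
  fixes m n :: nat and E :: "nat \<Rightarrow> 'r::comm_ring_1" and B :: "nat \<Rightarrow> nat \<Rightarrow> 'r" and c :: 'r
  assumes m_pos: "1 \<le> m"
begin

abbreviation "G \<equiv> gens m n"
abbreviation "F \<equiv> (free_algebra G :: (gen word \<Rightarrow>\<^sub>0 'r) ring)"
abbreviation "I \<equiv> qw_ideal m n E B c"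
abbreviation "Q \<equiv> qweyl m n E B c"
abbreviation "cls \<equiv> qw_class m n E B c"

lemma rels_car: "qw_rels m n E B c \<subseteq> car G"
  unfolding qw_rels_def Let_def
  by (auto intro!: car_intros simp: gens_def)

lemma I_ideal: "ideal I F"
  unfolding qw_ideal_def by (rule ring.genideal_ideal[OF ring_free_algebra rels_car])

lemma I_car: "f \<in> I \<Longrightarrow> f \<in> car G"
  using ideal.Icarr[OF I_ideal] .

lemma I_rel: "f \<in> qw_rels m n E B c \<Longrightarrow> f \<in> I"
  using ring.genideal_self[OF ring_free_algebra rels_car] unfolding qw_ideal_def by auto

lemma I_0: "0 \<in> I"
  using additive_subgroup.zero_closed[OF ideal.axioms(1)[OF I_ideal]] by (simp add: free_algebra_def)

lemma I_add: "f \<in> I \<Longrightarrow> g \<in> I \<Longrightarrow> f + g \<in> I"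
  using additive_subgroup.a_closed[OF ideal.axioms(1)[OF I_ideal], of f g] by (simp add: free_algebra_def)

lemma I_mult_left: "f \<in> I \<Longrightarrow> g \<in> car G \<Longrightarrow> g * f \<in> I"
  using ideal.I_l_closed[OF I_ideal, of f g] by (simp add: free_algebra_def)

lemma I_mult_right: "f \<in> I \<Longrightarrow> g \<in> car G \<Longrightarrow> f * g \<in> I"
  using ideal.I_r_closed[OF I_ideal, of f g] by (simp add: free_algebra_def)

lemma I_uminus: "f \<in> I \<Longrightarrow> - f \<in> I"
  using I_mult_left[of f "- 1"] by (simp add: car_uminus)

definition eqv :: "(gen word \<Rightarrow>\<^sub>0 'r) \<Rightarrow> (gen word \<Rightarrow>\<^sub>0 'r) \<Rightarrow> bool" (infix "\<approx>" 50) where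
  "f \<approx> g \<longleftrightarrow> f \<in> car G \<and> g \<in> car G \<and> f - g \<in> I"

lemma eqv_refl: "f \<in> car G \<Longrightarrow> f \<approx> f"
  by (simp add: eqv_def I_0)

lemma eqv_sym: "f \<approx> g \<Longrightarrow> g \<approx> f"
  using I_uminus[of "f - g"] by (auto simp: eqv_def)

lemma eqv_trans [trans]: "f \<approx> g \<Longrightarrow> g \<approx> k \<Longrightarrow> f \<approx> k"
  using I_add[of "f - g" "g - k"] by (auto simp: eqv_def)

lemma eqv_add: "f \<approx> g \<Longrightarrow> f' \<approx> g' \<Longrightarrow> f + f' \<approx> g + g'"
  using I_add[of "f - g" "f' - g'"] by (auto simp: eqv_def car_add algebra_simps)

lemma eqv_mult: assumes "f \<approx> g" "f' \<approx> g'" shows "f * f' \<approx> g * g'"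
proof -
  have "(f - g) * f' + g * (f' - g') \<in> I"
    using assms by (intro I_add I_mult_left I_mult_right) (auto simp: eqv_def)
  then show ?thesis using assms by (auto simp: eqv_def car_mult algebra_simps)
qed

lemma eqv_mult_left: "f \<approx> g \<Longrightarrow> k \<in> car G \<Longrightarrow> k * f \<approx> k * g"
  by (rule eqv_mult[OF eqv_refl])

lemma eqv_mult_right: "f \<approx> g \<Longrightarrow> k \<in> car G \<Longrightarrow> f * k \<approx> g * k"
  by (rule eqv_mult[OF _ eqv_refl])

lemma eqv_sum: "(\<And>i. i \<in> K \<Longrightarrow> f i \<approx> g i) \<Longrightarrow> sum f K \<approx> sum g K"
  by (induction K rule: infinite_finite_induct) (simp_all add: eqv_refl eqv_add)

lemma eqv_car: "f \<approx> g \<Longrightarrow> f \<in> car G" "f \<approx> g \<Longrightarrow> g \<in> car G"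
  by (auto simp: eqv_def)

lemma cls_alt: "cls f = (\<lambda>i. i + f) ` I"
  by (auto simp: qw_class_def a_r_coset_def' free_algebra_def)

lemma cls_self: "f \<in> cls f"
  using I_0 by (auto simp: cls_alt intro!: image_eqI[of _ _ 0])

lemma cls_eq_iff: "f \<in> car G \<Longrightarrow> g \<in> car G \<Longrightarrow> cls f = cls g \<longleftrightarrow> f - g \<in> I"
proof
  assume "f \<in> car G" "g \<in> car G" "cls f = cls g"
  then have "f \<in> cls g" using cls_self[of f] by simp
  then show "f - g \<in> I" by (auto simp: cls_alt)
next
  assume fg: "f - g \<in> I"
  have "cls f \<subseteq> cls g" if "f - g \<in> I" for f g
  proof
    fix k assume "k \<in> cls f"
    then obtain i where "i \<in> I" "k = i + f" by (auto simp: cls_alt)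
    then have "i + (f - g) \<in> I" "k = (i + (f - g)) + g" using that I_add by auto
    then show "k \<in> cls g" unfolding cls_alt by blast
  qed
  from this[OF fg] this[of g f] I_uminus[OF fg] show "cls f = cls g" by auto
qed

lemma ring_Q: "ring Q"
  unfolding qweyl_def by (rule ideal.quotient_is_ring[OF I_ideal])

lemma carrier_Q: "carrier Q = cls ` car G"
  unfolding qweyl_def FactRing_def by (auto simp: A_RCOSETS_def' qw_class_def)

lemma cls_hom: "cls \<in> Ring.ring_hom F Q"
  using ideal.rcos_ring_hom[OF I_ideal] unfolding qweyl_def qw_class_def .

lemma cls_add: "f \<in> car G \<Longrightarrow> g \<in> car G \<Longrightarrow> cls (f + g) = cls f \<oplus>\<^bsub>Q\<^esub> cls g"
  using ring_hom_add[OF cls_hom, of f g] by (simp add: free_algebra_def)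

lemma cls_mult: "f \<in> car G \<Longrightarrow> g \<in> car G \<Longrightarrow> cls (f * g) = cls f \<otimes>\<^bsub>Q\<^esub> cls g"
  using ring_hom_mult[OF cls_hom, of f g] by (simp add: free_algebra_def)

lemma cls_one: "cls 1 = \<one>\<^bsub>Q\<^esub>"
  using ring_hom_one[OF cls_hom] by (simp add: free_algebra_def)

lemma cls_closed: "f \<in> car G \<Longrightarrow> cls f \<in> carrier Q"
  by (simp add: carrier_Q)

end

section \<open>Ordered monomials span the algebra\<close>

text \<open>Sorting moves generators of smaller index to the left, which is the reverse of the
  direction in which some of the relations are stated; hence the inverses of \<open>E j\<close> and
  \<open>B j k\<close>.\<close>

locale qw_spanning = qw_scalars m n E B c
  for m n :: nat and E :: "nat \<Rightarrow> 'r::comm_ring_1" and B :: "nat \<Rightarrow> nat \<Rightarrow> 'r" and c :: 'r +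
  fixes E' :: "nat \<Rightarrow> 'r"
  assumes E': "\<And>j. j \<in> {m..n} \<Longrightarrow> E j * E' j = 1"
    and B_inv: "\<And>j k. j \<in> {m..n} \<Longrightarrow> k \<in> {m..n} \<Longrightarrow> j \<noteq> k \<Longrightarrow> B j k * B k j = 1"
begin

abbreviation x :: "nat \<Rightarrow> gen word \<Rightarrow>\<^sub>0 'r" where "x j \<equiv> fgen (X j)"
abbreviation y :: "nat \<Rightarrow> gen word \<Rightarrow>\<^sub>0 'r" where "y j \<equiv> fgen (Y j)"

lemma x_car: "m \<le> j \<Longrightarrow> j \<le> n \<Longrightarrow> x j \<in> car G" and y_car: "m \<le> j \<Longrightarrow> j \<le> n \<Longrightarrow> y j \<in> car G"
  by (simp_all add: gens_def)

lemma eqvI: "f \<in> car G \<Longrightarrow> g \<in> car G \<Longrightarrow> f - g \<in> qw_rels m n E B c \<Longrightarrow> f \<approx> g"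
  by (simp add: eqv_def I_rel)

lemma rel_yy: "m \<le> j \<Longrightarrow> j \<le> n \<Longrightarrow> m \<le> k \<Longrightarrow> k \<le> n \<Longrightarrow> y j * y k \<approx> fscal (B j k) * (y k * y j)"
proof (rule eqvI)
  assume a: "m \<le> j" "j \<le> n" "m \<le> k" "k \<le> n"
  have "y j * y k - fscal (B j k) * y k * y j \<in> qw_rels m n E B c"
    unfolding qw_rels_def Let_def
    apply (rule UnI1,rule UnI1,rule UnI1,rule UnI1)
    using a by (intro CollectI exI[of _ j] exI[of _ k] conjI) auto
  then show "y j * y k - fscal (B j k) * (y k * y j) \<in> qw_rels m n E B c" by (simp add: mult.assoc)
qed (auto intro!: car_intros simp: gens_def)

lemma rel_xx: "m \<le> j \<Longrightarrow> j < k \<Longrightarrow> k \<le> n \<Longrightarrow> x j * x k \<approx> fscal (E j * B j k) * (x k * x j)"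
proof (rule eqvI)
  assume a: "m \<le> j" "j < k" "k \<le> n"
  have "x j * x k - fscal (E j * B j k) * x k * x j \<in> qw_rels m n E B c"
    unfolding qw_rels_def Let_def
    apply (rule UnI1,rule UnI1,rule UnI1,rule UnI2)
    using a by (intro CollectI exI[of _ j] exI[of _ k] conjI) auto
  then show "x j * x k - fscal (E j * B j k) * (x k * x j) \<in> qw_rels m n E B c" by (simp add: mult.assoc)
qed (auto intro!: car_intros simp: gens_def)

lemma rel_xy: "m \<le> j \<Longrightarrow> j < k \<Longrightarrow> k \<le> n \<Longrightarrow> x j * y k \<approx> fscal (B k j) * (y k * x j)"
proof (rule eqvI)
  assume a: "m \<le> j" "j < k" "k \<le> n"
  have "x j * y k - fscal (B k j) * y k * x j \<in> qw_rels m n E B c"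
    unfolding qw_rels_def Let_def
    apply (rule UnI1,rule UnI1,rule UnI2)
    using a by (intro CollectI exI[of _ j] exI[of _ k] conjI) auto
  then show "x j * y k - fscal (B k j) * (y k * x j) \<in> qw_rels m n E B c" by (simp add: mult.assoc)
qed (auto intro!: car_intros simp: gens_def)

lemma rel_xy': "m \<le> k \<Longrightarrow> k < j \<Longrightarrow> j \<le> n \<Longrightarrow> x j * y k \<approx> fscal (E k * B k j) * (y k * x j)"
proof (rule eqvI)
  assume a: "m \<le> k" "k < j" "j \<le> n"
  have "x j * y k - fscal (E k * B k j) * y k * x j \<in> qw_rels m n E B c"
    unfolding qw_rels_def Let_def
    apply (rule UnI1,rule UnI2)
    using a by (intro CollectI exI[of _ j] exI[of _ k] conjI) auto
  then show "x j * y k - fscal (E k * B k j) * (y k * x j) \<in> qw_rels m n E B c" by (simp add: mult.assoc)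
qed (auto intro!: car_intros simp: gens_def)

text \<open>For the pair of index \<open>t\<close> this element plays the role that \<open>c\<close>
  has for the first pair: it commutes with both generators of the pair, see
  \<open>Zf_comm\<close>.\<close>

definition Zf :: "nat \<Rightarrow> gen word \<Rightarrow>\<^sub>0 'r" where
  "Zf t = fscal c + (\<Sum>i\<in>{m..<t}. fscal (E i - 1) * (y i * x i))"

lemma Zf_car: "t \<le> Suc n \<Longrightarrow> Zf t \<in> car G"
  by (auto simp: Zf_def gens_def intro!: car_intros)

lemma rel_xy_same: "m \<le> j \<Longrightarrow> j \<le> n \<Longrightarrow> x j * y j \<approx> fscal (E j) * (y j * x j) + Zf j"
proof (rule eqvI)
  assume j: "m \<le> j" "j \<le> n"
  have "x j * y j - (fscal (E j) * (y j * x j) + Zf j)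
     = x j * y j - fscal (E j) * y j * x j - (fscal c + (\<Sum>i\<in>{m..<j}. fscal (E i - 1) * y i * x i))"
    by (simp add: Zf_def mult.assoc)
  then show "x j * y j - (fscal (E j) * (y j * x j) + Zf j) \<in> qw_rels m n E B c"
    using j unfolding qw_rels_def Let_def by (intro UnI2 CollectI exI[of _ j] conjI) simp_all
qed (auto intro!: car_add car_mult x_car y_car Zf_car car_fscal)

lemma rel_inv:
  assumes "f \<approx> fscal r * g" "r * r' = 1" "g \<in> car G"
  shows "g \<approx> fscal r' * f"
proof -
  have "fscal r' * f \<approx> fscal r' * (fscal r * g)" by (rule eqv_mult_left[OF assms(1)]) simp
  also have "fscal r' * (fscal r * g) = fscal (r * r') * g" by (simp only: mult.commute[of r r'] fscal_mult mult.assoc)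
  finally show ?thesis using assms(2) by (simp add: eqv_sym)
qed

lemma comm_gen:
  assumes "m \<le> i" "i < t" "t \<le> n" "u = X t \<or> u = Y t" "g = X i \<or> g = Y i"
  shows "\<exists>r. fgen u * fgen g \<approx> fscal r * (fgen g * fgen u)"
proof -
  have a: "m \<le> t" "i \<le> n" using assms by auto
  have cars: "y t * x i \<in> car G" "x t * x i \<in> car G" using assms a by (auto intro!: car_mult x_car y_car)
  have "\<exists>r. y t * y i \<approx> fscal r * (y i * y t)" using rel_yy[of t i] assms a by auto
  moreover have "\<exists>r. x t * y i \<approx> fscal r * (y i * x t)" using rel_xy'[of i t] assms a by auto
  moreover have "\<exists>r. y t * x i \<approx> fscal r * (x i * y t)"
    using rel_inv[OF rel_xy[of i t], of "B i t"] B_inv[of t i] assms a cars by auto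
  moreover have "\<exists>r. x t * x i \<approx> fscal r * (x i * x t)"
  proof -
    have "E i * B i t * (E' i * B t i) = (E i * E' i) * (B i t * B t i)" by (simp add: mult_ac)
    also have "\<dots> = 1" using E'[of i] B_inv[of i t] assms a by simp
    finally show ?thesis using rel_inv[OF rel_xx[of i t], of "E' i * B t i"] assms a cars by auto
  qed
  ultimately show ?thesis using assms(4,5) by blast
qed

lemma comm_gen_power:
  assumes "fgen u * fgen g \<approx> fscal r * (fgen g * fgen u)" "u \<in> G" "g \<in> G"
  shows "\<exists>r. fgen u ^ a * fgen g \<approx> fscal r * (fgen g * fgen u ^ a)"
proof (induction a)
  case 0
  show ?case by (rule exI[of _ 1]) (simp add: eqv_refl assms)
next
  case (Suc a)
  then obtain s where s: "fgen u ^ a * fgen g \<approx> fscal s * (fgen g * fgen u ^ a)" by auto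
  have "fgen u * (fgen u ^ a * fgen g) \<approx> fgen u * (fscal s * (fgen g * fgen u ^ a))"
    by (rule eqv_mult_left[OF s]) (simp add: assms)
  also have "fgen u * (fscal s * (fgen g * fgen u ^ a)) = fscal s * ((fgen u * fgen g) * fgen u ^ a)"
    by (simp add: fscal_left_comm[of "fgen u"] mult.assoc)
  also have "\<dots> \<approx> fscal s * ((fscal r * (fgen g * fgen u)) * fgen u ^ a)"
    by (intro eqv_mult_left eqv_mult_right assms(1) car_power car_fgen car_fscal assms(2))
  also have "\<dots> = fscal (s * r) * (fgen g * fgen u ^ Suc a)"
    by (simp add: fscal_mult mult.assoc)
  finally show ?case by (auto simp: mult.assoc)
qed

text \<open>Passing \<open>y i\<close> and passing \<open>x i\<close> cost mutually inverse scalars,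
  so each product \<open>y i * x i\<close> with \<open>i < t\<close> commutes with the generators of
  index \<open>t\<close>.\<close>

lemma Zf_comm:
  assumes t: "m \<le> t" "t \<le> n" and u: "u = X t \<or> u = Y t"
  shows "fgen u * Zf t \<approx> Zf t * fgen u"
proof -
  have uG: "fgen u \<in> car G" using t u by (auto simp: gens_def)
  have "fgen u * (fscal (E i - 1) * (y i * x i)) \<approx> fscal (E i - 1) * (y i * x i) * fgen u"
    if i: "i \<in> {m..<t}" for i
  proof -
    have xy: "x i \<in> car G" "y i \<in> car G" "x t \<in> car G" "y t \<in> car G" using i t by (auto simp: gens_def)
    have "\<exists>r. fgen u * y i \<approx> fscal r * (y i * fgen u) \<and> x i * fgen u \<approx> fscal r * (fgen u * x i)"
     using u rel_xx[of i t] rel_xy'[of i t] rel_yy[of t i] rel_xy[of i t] i t by auto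
    then obtain r where r: "fgen u * y i \<approx> fscal r * (y i * fgen u)" "x i * fgen u \<approx> fscal r * (fgen u * x i)"
     by auto
    have "fgen u * (y i * x i) = (fgen u * y i) * x i" by (simp add: mult.assoc)
    also have "\<dots> \<approx> (fscal r * (y i * fgen u)) * x i" by (rule eqv_mult_right[OF r(1) xy(1)])
    also have "\<dots> = y i * (fscal r * (fgen u * x i))" by (simp add: mult.assoc fscal_left_comm[of "y i"])
    also have "\<dots> \<approx> y i * (x i * fgen u)" by (rule eqv_mult_left[OF eqv_sym[OF r(2)] xy(2)])
    finally have "fgen u * (y i * x i) \<approx> y i * x i * fgen u" by (simp add: mult.assoc)
    from eqv_mult_left[OF this car_fscal, of "E i - 1"] show ?thesis
     by (simp add: mult.assoc fscal_left_comm[of "fgen u"])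
  qed
  then have "fgen u * fscal c + (\<Sum>i\<in>{m..<t}. fgen u * (fscal (E i - 1) * (y i * x i)))
    \<approx> fscal c * fgen u + (\<Sum>i\<in>{m..<t}. fscal (E i - 1) * (y i * x i) * fgen u)"
    by (intro eqv_add eqv_sum) (simp_all add: fscal_comm[of "fgen u"] eqv_refl[OF car_mult[OF car_fscal uG]])
  then show ?thesis unfolding Zf_def by (simp add: distrib_left distrib_right sum_distrib_left sum_distrib_right)
qed

lemma comm_power:
  assumes "f * g \<approx> g * f" "f \<in> car G" "g \<in> car G"
  shows "f ^ a * g \<approx> g * f ^ a"
proof (induction a)
  case (Suc a)
  have "f * (f ^ a * g) \<approx> f * (g * f ^ a)" by (rule eqv_mult_left[OF Suc assms(2)])
  also have "f * (g * f ^ a) = (f * g) * f ^ a" by (simp add: mult.assoc)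
  also have "\<dots> \<approx> (g * f) * f ^ a" by (rule eqv_mult_right[OF assms(1) car_power[OF assms(2)]])
  finally show ?case by (simp add: mult.assoc)
qed (simp add: eqv_refl assms)

text \<open>For spanning it is enough that some scalars exist. The clause for \<open>b = 0\<close>
  excludes a spurious term, since \<open>b - 1\<close> truncates there.\<close>

lemma x_power_y:
  assumes t: "m \<le> t" "t \<le> n"
  shows "\<exists>r r'. (b = 0 \<longrightarrow> r' = 0) \<and>
    x t ^ b * y t \<approx> fscal r * (y t * x t ^ b) + fscal r' * (Zf t * x t ^ (b - 1))"
proof (induction b)
  case 0
  show ?case by (rule exI[of _ 1], rule exI[of _ 0]) (simp add: eqv_refl y_car t)
next
  case (Suc b)
  then obtain r r' where r': "b = 0 \<longrightarrow> r' = 0"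
    and IH: "x t ^ b * y t \<approx> fscal r * (y t * x t ^ b) + fscal r' * (Zf t * x t ^ (b - 1))" by auto
  have cx: "x t \<in> car G" and cy: "y t \<in> car G" and cZ: "Zf t \<in> car G"
    using t x_car y_car Zf_car by auto
  have xx: "fscal r' * (x t * x t ^ (b - 1)) = fscal r' * x t ^ b"
    using r' by (cases b) simp_all
  have "x t ^ Suc b * y t = x t * (x t ^ b * y t)" by (simp add: mult.assoc)
  also have "\<dots> \<approx> x t * (fscal r * (y t * x t ^ b) + fscal r' * (Zf t * x t ^ (b - 1)))"
    by (rule eqv_mult_left[OF IH cx])
  also have "\<dots> = fscal r * ((x t * y t) * x t ^ b) + fscal r' * ((x t * Zf t) * x t ^ (b - 1))"
    by (simp add: distrib_left fscal_left_comm[of "x t"] mult.assoc)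
  also have "\<dots> \<approx> fscal r * ((fscal (E t) * (y t * x t) + Zf t) * x t ^ b) + fscal r' * ((Zf t * x t) * x t ^ (b - 1))"
    by (intro eqv_add eqv_mult_left eqv_mult_right rel_xy_same Zf_comm t car_fscal car_power cx) auto
  also have "\<dots> = fscal (r * E t) * (y t * x t ^ Suc b) + fscal r * (Zf t * x t ^ b) + Zf t * (fscal r' * (x t * x t ^ (b - 1)))"
    by (simp add: distrib_left distrib_right fscal_left_comm[of "Zf t"] fscal_mult mult.assoc)
  also have "\<dots> = fscal (r * E t) * (y t * x t ^ Suc b) + fscal (r + r') * (Zf t * x t ^ b)"
    unfolding xx by (simp add: distrib_right fscal_left_comm[of "Zf t"] fscal_add add.assoc)
  finally show ?case by (intro exI[of _ "r * E t"] exI[of _ "r + r'"]) simp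
qed

abbreviation fg :: "gen \<Rightarrow> gen word \<Rightarrow>\<^sub>0 'r" where "fg \<equiv> fgen"
abbreviation Emon :: "(gen \<Rightarrow>\<^sub>0 nat) \<Rightarrow> gen word \<Rightarrow>\<^sub>0 'r" where "Emon \<equiv> omono m n fg"

text \<open>The filtration by the largest index allowed in the ordered monomials; it carries the
  induction in \<open>Sp_closed\<close>.\<close>

definition Sp :: "nat \<Rightarrow> (gen word \<Rightarrow>\<^sub>0 'r) set" where
  "Sp t = {f. \<exists>P. (\<forall>\<alpha>\<in>Poly_Mapping.keys P. Poly_Mapping.keys \<alpha> \<subseteq> gens m t) \<and> f \<approx> lin fscal Emon P}"

lemma omono_car: "omono m t fg \<alpha> \<in> car (gens m t)"
proof -
  have P: "prod_list xs \<in> car H" if "\<And>f. f \<in> set xs \<Longrightarrow> f \<in> car H" for xs :: "(gen word \<Rightarrow>\<^sub>0 'r) list" and H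
    using that by (induction xs) (auto intro: car_mult)
  show ?thesis unfolding omono_def by (rule P) (auto intro!: car_mult car_power simp: gens_def)
qed

lemma lin_car: "lin fscal Emon P \<in> car G"
  unfolding lin_def by (intro car_sum car_mult omono_car) auto

lemma SpI_mono: "Poly_Mapping.keys \<alpha> \<subseteq> gens m t \<Longrightarrow> Emon \<alpha> \<in> Sp t"
  unfolding Sp_def
  by (rule CollectI, rule exI[of _ "Poly_Mapping.single \<alpha> 1"]) (auto simp: lin_single eqv_refl omono_car)

lemma Sp_eqv: "f \<approx> g \<Longrightarrow> g \<in> Sp t \<Longrightarrow> f \<in> Sp t"
  unfolding Sp_def by (auto intro: eqv_trans)

lemma Sp_add: "f \<in> Sp t \<Longrightarrow> g \<in> Sp t \<Longrightarrow> f + g \<in> Sp t"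
proof -
  assume "f \<in> Sp t" "g \<in> Sp t"
  then obtain P P' where "\<forall>\<alpha>\<in>Poly_Mapping.keys P. Poly_Mapping.keys \<alpha> \<subseteq> gens m t" "f \<approx> lin fscal Emon P"
    "\<forall>\<alpha>\<in>Poly_Mapping.keys P'. Poly_Mapping.keys \<alpha> \<subseteq> gens m t" "g \<approx> lin fscal Emon P'" by (auto simp: Sp_def)
  then show ?thesis unfolding Sp_def
    using keys_add[of P P']
    by (intro CollectI exI[of _ "P + P'"]) (auto simp: lin_add fscal_add eqv_add)
qed

lemma lin_scale: "fscal r * lin fscal Emon P = lin fscal Emon (Poly_Mapping.map ((*) r) P)"
proof -
  have "Poly_Mapping.keys (Poly_Mapping.map ((*) r) P) \<subseteq> Poly_Mapping.keys P"
    by (auto simp: in_keys_iff Poly_Mapping.map.rep_eq when_def)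
  then show ?thesis
    by (subst lin_superset[of fscal "Poly_Mapping.keys P" "Poly_Mapping.map ((*) r) P"])
     (auto simp: lin_def sum_distrib_left Poly_Mapping.map.rep_eq when_def fscal_mult mult.assoc in_keys_iff intro!: sum.cong)
qed

lemma Sp_scale: "f \<in> Sp t \<Longrightarrow> fscal r * f \<in> Sp t"
proof -
  assume "f \<in> Sp t"
  then obtain P where P: "\<forall>\<alpha>\<in>Poly_Mapping.keys P. Poly_Mapping.keys \<alpha> \<subseteq> gens m t" "f \<approx> lin fscal Emon P"
    by (auto simp: Sp_def)
  have "Poly_Mapping.keys (Poly_Mapping.map ((*) r) P) \<subseteq> Poly_Mapping.keys P"
    by (auto simp: in_keys_iff Poly_Mapping.map.rep_eq when_def)
  then show ?thesis unfolding Sp_def using P eqv_mult_left[OF P(2) car_fscal, of r]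
    by (intro CollectI exI[of _ "Poly_Mapping.map ((*) r) P"]) (auto simp: lin_scale)
qed

lemma Sp_0: "0 \<in> Sp t"
  unfolding Sp_def by (rule CollectI, rule exI[of _ 0]) (simp add: eqv_refl)

lemma Sp_sum: "(\<And>i. i \<in> K \<Longrightarrow> f i \<in> Sp t) \<Longrightarrow> sum f K \<in> Sp t"
  by (induction K rule: infinite_finite_induct) (simp_all add: Sp_0 Sp_add)

lemma Sp_induct:
  assumes f: "f \<in> Sp t" and k: "k \<in> car G"
    and omono: "\<And>\<alpha>. Poly_Mapping.keys \<alpha> \<subseteq> gens m t \<Longrightarrow> Emon \<alpha> * k \<in> Sp s"
  shows "f * k \<in> Sp s"
proof -
  obtain P where P: "\<forall>\<alpha>\<in>Poly_Mapping.keys P. Poly_Mapping.keys \<alpha> \<subseteq> gens m t" "f \<approx> lin fscal Emon P"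
    using f by (auto simp: Sp_def)
  have "lin fscal Emon P * k = (\<Sum>\<alpha>\<in>Poly_Mapping.keys P. fscal (Poly_Mapping.lookup P \<alpha>) * (Emon \<alpha> * k))"
    by (simp add: lin_def sum_distrib_right mult.assoc)
  also have "\<dots> \<in> Sp s" using P(1) by (intro Sp_sum Sp_scale omono) auto
  finally show ?thesis using eqv_mult_right[OF P(2) k] Sp_eqv by blast
qed

lemma Sp_car: "f \<in> Sp t \<Longrightarrow> f \<in> car G"
  by (auto simp: Sp_def eqv_def)

lemma Sp_mult_top:
  assumes t: "m \<le> Suc t" "Suc t \<le> n" and f: "f \<in> Sp t"
  shows "f * (y (Suc t) ^ a * x (Suc t) ^ b) \<in> Sp (Suc t)"
proof (rule Sp_induct[OF f])
  show "y (Suc t) ^ a * x (Suc t) ^ b \<in> car G" using t by (auto intro!: car_mult car_power simp: gens_def)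
  fix \<alpha> :: "gen \<Rightarrow>\<^sub>0 nat" assume \<alpha>: "Poly_Mapping.keys \<alpha> \<subseteq> gens m t"
  let ?\<beta> = "\<alpha> + (Poly_Mapping.single (Y (Suc t)) a + Poly_Mapping.single (X (Suc t)) b)"
  have top: "X (Suc t) \<notin> gens m t" "Y (Suc t) \<notin> gens m t" by (auto simp: gens_def)
  have sub: "gens m t \<subseteq> gens m (Suc t)" "X (Suc t) \<in> gens m (Suc t)" "Y (Suc t) \<in> gens m (Suc t)"
    using t by (auto simp: gens_def)
  have \<beta>: "Poly_Mapping.keys ?\<beta> \<subseteq> gens m (Suc t)"
    using \<alpha> sub keys_add[of \<alpha> "Poly_Mapping.single (Y (Suc t)) a + Poly_Mapping.single (X (Suc t)) b"]
     keys_add[of "Poly_Mapping.single (Y (Suc t)) a" "Poly_Mapping.single (X (Suc t)) b"]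
    by (auto split: if_splits)
  have "Emon ?\<beta> = omono m (Suc t) fg ?\<beta>" by (rule omono_restrict_right[OF \<beta> t(2)])
  also have "\<dots> = omono m t fg ?\<beta> * (y (Suc t) ^ a * x (Suc t) ^ b)"
    using t top lookup_0_gens[OF \<alpha>] by (simp add: omono_Suc lookup_add lookup_single)
  also have "omono m t fg ?\<beta> = omono m t fg \<alpha>"
    by (rule omono_cong) (auto simp: lookup_add lookup_single when_def gens_def)
  also have "\<dots> = Emon \<alpha>" using omono_restrict_right[OF \<alpha>, of n fg] t by simp
  finally show "Emon \<alpha> * (y (Suc t) ^ a * x (Suc t) ^ b) \<in> Sp (Suc t)" using SpI_mono[OF \<beta>] by simp
qed

lemma omono_split_top:
  assumes t: "m \<le> Suc t" "Suc t \<le> n" and \<alpha>: "Poly_Mapping.keys \<alpha> \<subseteq> gens m (Suc t)"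
  obtains f a b where "f \<in> Sp t" "Emon \<alpha> = f * (y (Suc t) ^ a * x (Suc t) ^ b)"
proof -
  have fin: "finite {g. (if g \<in> gens m t then Poly_Mapping.lookup \<alpha> g else 0) \<noteq> 0}"
    by (rule finite_subset[OF _ finite_keys[of \<alpha>]]) (auto simp: in_keys_iff)
  define \<beta> where "\<beta> = Abs_poly_mapping (\<lambda>g. if g \<in> gens m t then Poly_Mapping.lookup \<alpha> g else 0)"
  have l\<beta>: "Poly_Mapping.lookup \<beta> g = (if g \<in> gens m t then Poly_Mapping.lookup \<alpha> g else 0)" for g
    unfolding \<beta>_def using fin by (simp add: lookup_Abs_poly_mapping)
  have k\<beta>: "Poly_Mapping.keys \<beta> \<subseteq> gens m t" by (auto simp: in_keys_iff l\<beta> split: if_splits)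
  have "Emon \<alpha> = omono m (Suc t) fg \<alpha>" by (rule omono_restrict_right[OF \<alpha> t(2)])
  also have "\<dots> = omono m t fg \<alpha> * (y (Suc t) ^ Poly_Mapping.lookup \<alpha> (Y (Suc t)) * x (Suc t) ^ Poly_Mapping.lookup \<alpha> (X (Suc t)))"
    by (rule omono_Suc[OF t(1)])
  also have "omono m t fg \<alpha> = omono m t fg \<beta>" by (rule omono_cong) (simp add: l\<beta>)
  also have "\<dots> = Emon \<beta>" using omono_restrict_right[OF k\<beta>, of n fg] t by simp
  finally show thesis using that SpI_mono[OF k\<beta>] by blast
qed

lemma gens_Suc:
  assumes "m \<le> Suc t"
  shows "gens m (Suc t) = insert (X (Suc t)) (insert (Y (Suc t)) (gens m t))"
proof (rule Set.set_eqI)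
  fix g show "g \<in> gens m (Suc t) \<longleftrightarrow> g \<in> insert (X (Suc t)) (insert (Y (Suc t)) (gens m t))"
    using assms by (cases g) (auto simp: gens_def le_Suc_eq)
qed

text \<open>A generator of smaller index moves left past the top pair up to a scalar and is absorbed
  by induction. The top \<open>x\<close> only raises an exponent. The top \<open>y\<close> has to
  pass a power of \<open>x\<close>; the extra term contains \<open>Zf\<close>, which moves left past
  the powers of \<open>y\<close> into the span of the smaller indices.\<close>

lemma Sp_closed: "t \<le> n \<Longrightarrow> f \<in> Sp t \<Longrightarrow> g \<in> gens m t \<Longrightarrow> f * fgen g \<in> Sp t"
proof (induction t arbitrary: f g)
  case 0
  then show ?case using m_pos by (auto simp: gens_def)
next
  case (Suc t)
  have t: "m \<le> Suc t" "Suc t \<le> n" using Suc.prems by (auto simp: gens_def)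
  let ?x = "x (Suc t)" and ?y = "y (Suc t)"
  have cx: "?x \<in> car G" and cy: "?y \<in> car G" using t by (auto simp: gens_def)
  have gG: "g \<in> G" using Suc.prems by (auto simp: gens_def)
  \<comment> \<open>\<open>Zf (Suc t)\<close> involves indices up to \<open>t\<close> only, so the
    induction hypothesis applies twice to each summand.\<close>
  have Zf_Sp: "p * Zf (Suc t) \<in> Sp t" if p: "p \<in> Sp t" for p
  proof -
    have "p * Zf (Suc t) = fscal c * p + (\<Sum>i\<in>{m..<Suc t}. fscal (E i - 1) * ((p * y i) * x i))"
     by (simp add: Zf_def distrib_left sum_distrib_left fscal_comm[of p] fscal_left_comm[of p] mult.assoc)
    also have "\<dots> \<in> Sp t"
     using p t by (intro Sp_add Sp_sum Sp_scale Suc.IH) (auto simp: gens_def)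
    finally show ?thesis .
  qed
  show ?case
  proof (rule Sp_induct[OF Suc.prems(2)])
    show "fgen g \<in> car G" using gG by simp
    fix \<alpha> :: "gen \<Rightarrow>\<^sub>0 nat" assume "Poly_Mapping.keys \<alpha> \<subseteq> gens m (Suc t)"
    then obtain p a b where p: "p \<in> Sp t" and \<alpha>: "Emon \<alpha> = p * (?y ^ a * ?x ^ b)"
     using omono_split_top[OF t] by metis
    have cp: "p \<in> car G" using Sp_car[OF p] .
    consider "g = X (Suc t)" | "g = Y (Suc t)" | "g \<in> gens m t" using Suc.prems(3) gens_Suc[OF t(1)] by auto
    then show "Emon \<alpha> * fgen g \<in> Sp (Suc t)"
    proof cases
     case 1
     then have "Emon \<alpha> * fgen g = p * (?y ^ a * ?x ^ Suc b)" by (simp add: \<alpha> mult.assoc power_commutes)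
     then show ?thesis by (simp only: Sp_mult_top[OF t p])
    next
     case 2
     obtain r r' where r: "?x ^ b * ?y \<approx> fscal r * (?y * ?x ^ b) + fscal r' * (Zf (Suc t) * ?x ^ (b - 1))"
      using x_power_y[OF t] by blast
     have yZ: "?y ^ a * Zf (Suc t) \<approx> Zf (Suc t) * ?y ^ a"
      by (rule comm_power[OF Zf_comm[OF t]]) (use cy t in \<open>auto intro: Zf_car\<close>)
     have "Emon \<alpha> * fgen g = (p * ?y ^ a) * (?x ^ b * ?y)" by (simp add: \<alpha> 2 mult.assoc)
     also have "\<dots> \<approx> (p * ?y ^ a) * (fscal r * (?y * ?x ^ b) + fscal r' * (Zf (Suc t) * ?x ^ (b - 1)))"
      by (intro eqv_mult_left[OF r] car_mult car_power cp cy)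
     also have "\<dots> = fscal r * (p * (?y ^ Suc a * ?x ^ b)) + fscal r' * (p * ((?y ^ a * Zf (Suc t)) * ?x ^ (b - 1)))"
      by (simp add: distrib_left fscal_left_comm[of p] fscal_left_comm[of "?y ^ a"] mult.assoc power_left_commutes)
     also have "\<dots> \<approx> fscal r * (p * (?y ^ Suc a * ?x ^ b)) + fscal r' * (p * ((Zf (Suc t) * ?y ^ a) * ?x ^ (b - 1)))"
      by (intro eqv_add eqv_mult_left eqv_mult_right yZ eqv_refl car_intros cp cx cy car_power car_mult)
     also have "\<dots> = fscal r * (p * (?y ^ Suc a * ?x ^ b)) + fscal r' * ((p * Zf (Suc t)) * (?y ^ a * ?x ^ (b - 1)))"
      by (simp add: mult.assoc)
     finally show ?thesis
      by (rule Sp_eqv) (intro Sp_add Sp_scale Sp_mult_top t Zf_Sp p)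
    next
     case 3
     then have i: "m \<le> idx g" "idx g < Suc t" "g = X (idx g) \<or> g = Y (idx g)"
      by (auto simp: gens_def) (cases g; simp)
     have tG: "X (Suc t) \<in> G" "Y (Suc t) \<in> G" using t by (auto simp: gens_def)
     obtain r1 where r1: "?x ^ b * fgen g \<approx> fscal r1 * (fgen g * ?x ^ b)"
      using comm_gen[OF i(1,2) t(2) _ i(3), of "X (Suc t)"] comm_gen_power tG gG by blast
     obtain r2 where r2: "?y ^ a * fgen g \<approx> fscal r2 * (fgen g * ?y ^ a)"
      using comm_gen[OF i(1,2) t(2) _ i(3), of "Y (Suc t)"] comm_gen_power tG gG by blast
     have "Emon \<alpha> * fgen g = (p * ?y ^ a) * (?x ^ b * fgen g)" by (simp add: \<alpha> mult.assoc)
     also have "\<dots> \<approx> (p * ?y ^ a) * (fscal r1 * (fgen g * ?x ^ b))"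
      by (intro eqv_mult_left[OF r1] car_mult car_power cp cy)
     also have "\<dots> = fscal r1 * (p * ((?y ^ a * fgen g) * ?x ^ b))" by (simp add: fscal_left_comm[of p] fscal_left_comm[of "?y ^ a"] mult.assoc)
     also have "\<dots> \<approx> fscal r1 * (p * ((fscal r2 * (fgen g * ?y ^ a)) * ?x ^ b))"
      by (intro eqv_mult_left eqv_mult_right r2 car_intros cp cx car_power)
     also have "\<dots> = fscal r1 * (fscal r2 * ((p * fgen g) * (?y ^ a * ?x ^ b)))"
      by (simp add: fscal_left_comm[of p] fscal_left_comm[of "?y ^ a"] mult.assoc)
     finally show ?thesis
      by (rule Sp_eqv) (intro Sp_scale Sp_mult_top t Suc.IH p, use 3 t in auto)
    qed
  qed
qed

lemma word_split: "(Poly_Mapping.single (Word (ws @ [g])) 1 :: gen word \<Rightarrow>\<^sub>0 'r) = Poly_Mapping.single (Word ws) 1 * fgen g"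
  by (simp add: fgen_def mult_single plus_word_def)

lemma pbw_spanning:
  assumes f: "f \<in> car G"
  obtains P where "\<forall>\<alpha>\<in>Poly_Mapping.keys P. Poly_Mapping.keys \<alpha> \<subseteq> G" "f \<approx> lin fscal Emon P"
proof -
  have w: "(Poly_Mapping.single (Word ws) 1 :: gen word \<Rightarrow>\<^sub>0 'r) \<in> Sp n" if "set ws \<subseteq> G" for ws
    using that
  proof (induction ws rule: rev_induct)
    case Nil
    show ?case using SpI_mono[of 0 n] by (simp add: Word_Nil)
  next
    case (snoc g ws)
    then show ?case unfolding word_split by (intro Sp_closed) auto
  qed
  have "f = (\<Sum>w\<in>Poly_Mapping.keys f. fscal (Poly_Mapping.lookup f w) * Poly_Mapping.single (Word (letters w)) 1)"
    by (simp add: fscal_def mult_single poly_mapping_decomp)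
  also have "\<dots> \<in> Sp n" using f by (intro Sp_sum Sp_scale w) (auto simp: car_iff)
  finally show thesis using that by (auto simp: Sp_def)
qed

end

section \<open>Faithful representations in a typed ring\<close>

text \<open>A solution of the relations whose ordered monomials are independent. Together with
  spanning this makes the representation faithful and turns the ordered monomials into a basis of
  the abstract algebra.\<close>

locale qw_rep = qw_spanning m n E B c E'
  for m n :: nat and E :: "nat \<Rightarrow> 'r::comm_ring_1" and B :: "nat \<Rightarrow> nat \<Rightarrow> 'r" and c :: 'r and E' +
  fixes \<sigma> :: "'r \<Rightarrow> 'a::ring_1" and v :: "gen \<Rightarrow> 'a"
  assumes \<sigma>_add: "\<And>a b. \<sigma> (a + b) = \<sigma> a + \<sigma> b" and \<sigma>_mult: "\<And>a b. \<sigma> (a * b) = \<sigma> a * \<sigma> b"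
    and \<sigma>_one: "\<sigma> 1 = 1"
    and \<sigma>_comm: "\<And>g r. g \<in> gens m n \<Longrightarrow> \<sigma> r * v g = v g * \<sigma> r"
    and v_yy: "\<And>j k. m \<le> j \<Longrightarrow> j \<le> n \<Longrightarrow> m \<le> k \<Longrightarrow> k \<le> n \<Longrightarrow> v (Y j) * v (Y k) = \<sigma> (B j k) * v (Y k) * v (Y j)"
    and v_xx: "\<And>j k. m \<le> j \<Longrightarrow> j < k \<Longrightarrow> k \<le> n \<Longrightarrow> v (X j) * v (X k) = \<sigma> (E j * B j k) * v (X k) * v (X j)"
    and v_xy: "\<And>j k. m \<le> j \<Longrightarrow> j < k \<Longrightarrow> k \<le> n \<Longrightarrow> v (X j) * v (Y k) = \<sigma> (B k j) * v (Y k) * v (X j)"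
    and v_xy': "\<And>j k. m \<le> k \<Longrightarrow> k < j \<Longrightarrow> j \<le> n \<Longrightarrow> v (X j) * v (Y k) = \<sigma> (E k * B k j) * v (Y k) * v (X j)"
    and v_same: "\<And>j. m \<le> j \<Longrightarrow> j \<le> n \<Longrightarrow> v (X j) * v (Y j) - \<sigma> (E j) * v (Y j) * v (X j)
     = \<sigma> c + (\<Sum>i\<in>{m..<j}. \<sigma> (E i - 1) * v (Y i) * v (X i))"
    and pbw_indep: "\<And>P. (\<forall>\<alpha>\<in>Poly_Mapping.keys P. Poly_Mapping.keys \<alpha> \<subseteq> gens m n) \<Longrightarrow>
     lin \<sigma> (omono m n v) P = 0 \<Longrightarrow> P = 0"
begin

lemma \<sigma>_zero: "\<sigma> 0 = 0"
  using \<sigma>_add[of 0 0] by simp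

definition ev :: "(gen word \<Rightarrow>\<^sub>0 'r) \<Rightarrow> 'a" where
  "ev = lin \<sigma> (\<lambda>w. prod_list (map v (letters w)))"

lemma ev_add: "ev (f + g) = ev f + ev g"
  unfolding ev_def by (rule lin_add[where \<sigma> = \<sigma>, OF \<sigma>_zero \<sigma>_add])

lemma ev_zero [simp]: "ev 0 = 0"
  by (simp add: ev_def)

lemma ev_uminus: "ev (- f) = - ev f"
  using ev_add[of f "- f"] by (simp add: eq_neg_iff_add_eq_0 add.commute)

lemma ev_diff: "ev (f - g) = ev f - ev g"
  using ev_add[of f "- g"] by (simp add: ev_uminus)

lemma ev_sum: "ev (\<Sum>i\<in>K. f i) = (\<Sum>i\<in>K. ev (f i))"
  by (induction K rule: infinite_finite_induct) (simp_all add: ev_add)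

lemma ev_mult: "f \<in> car G \<Longrightarrow> ev (f * g) = ev f * ev g"
proof -
  assume f: "f \<in> car G"
  have "\<sigma> r * prod_list (map v ws) = prod_list (map v ws) * \<sigma> r" if "set ws \<subseteq> G" for r ws
    using that
  proof (induction ws)
    case (Cons g ws)
    have "\<sigma> r * (v g * prod_list (map v ws)) = v g * (\<sigma> r * prod_list (map v ws))"
     using Cons.prems \<sigma>_comm[of g r] by (simp add: mult.assoc[symmetric])
    then show ?case using Cons by (simp add: mult.assoc)
  qed simp
  then show ?thesis unfolding ev_def using f
    by (intro lin_mult) (auto simp: \<sigma>_zero \<sigma>_add \<sigma>_mult car_iff)
qed

lemma ev_fscal: "ev (fscal r) = \<sigma> r"
  by (simp add: ev_def fscal_def lin_single[where \<sigma> = \<sigma>, OF \<sigma>_zero])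

lemma ev_fgen: "ev (fgen g) = v g"
  by (simp add: ev_def fgen_def lin_single[where \<sigma> = \<sigma>, OF \<sigma>_zero] \<sigma>_one)

lemma ev_one: "ev 1 = 1"
  using ev_fscal[of 1] by (simp add: \<sigma>_one)

lemma ev_power: "f \<in> car G \<Longrightarrow> ev (f ^ k) = ev f ^ k"
  by (induction k) (simp_all add: ev_one ev_mult)

lemma ker_ideal: "ideal {f \<in> car G. ev f = 0} F"
proof (rule idealI[OF ring_free_algebra])
  show "subgroup {f \<in> car G. ev f = 0} (add_monoid F)"
  proof (rule group.subgroupI)
    show "group (add_monoid F)"
     using ring.is_abelian_group[OF ring_free_algebra] by (rule abelian_group.a_group)
    fix a assume a: "a \<in> {f \<in> car G. ev f = 0}"
    have "inv\<^bsub>add_monoid F\<^esub> a = - a"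
    proof -
     interpret R: ring F by (rule ring_free_algebra)
     show ?thesis using R.minus_equality[of "- a" a] a car_uminus[of a] by (auto simp: a_inv_def)
    qed
    then show "inv\<^bsub>add_monoid F\<^esub> a \<in> {f \<in> car G. ev f = 0}" using a by (simp add: car_uminus ev_uminus)
  next
    show "{f \<in> car G. ev f = 0} \<noteq> {}" using car_0 ev_zero by blast
  qed (auto simp: ev_add car_add)
qed (auto simp: ev_mult car_mult)

lemma rels_ker: "qw_rels m n E B c \<subseteq> {f \<in> car G. ev f = 0}"
proof -
  have xc: "x j \<in> car G" "y j \<in> car G" if "m \<le> j" "j \<le> n" for j using that by (auto intro: x_car y_car)
  note s = ev_diff ev_add ev_mult ev_sum ev_fscal ev_fgen xc car_mult
  have "ev (y j * y k - fscal (B j k) * y k * y j) = 0" if "m \<le> j" "j \<le> n" "m \<le> k" "k \<le> n" for j k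
    using that by (simp add: s v_yy)
  moreover have "ev (x j * x k - fscal (E j * B j k) * x k * x j) = 0" if "m \<le> j" "j < k" "k \<le> n" for j k
    using that by (simp add: s v_xx)
  moreover have "ev (x j * y k - fscal (B k j) * y k * x j) = 0" if "m \<le> j" "j < k" "k \<le> n" for j k
    using that by (simp add: s v_xy)
  moreover have "ev (x j * y k - fscal (E k * B k j) * y k * x j) = 0" if "m \<le> k" "k < j" "j \<le> n" for j k
    using that by (simp add: s v_xy')
  moreover have "ev (x j * y j - fscal (E j) * y j * x j - (fscal c + (\<Sum>i\<in>{m..<j}. fscal (E i - 1) * y i * x i))) = 0"
    if "m \<le> j" "j \<le> n" for j
    using that v_same[OF that] by (simp add: s)
  ultimately have "\<forall>f\<in>qw_rels m n E B c. ev f = 0" unfolding qw_rels_def Let_def by auto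
  then show ?thesis using rels_car by auto
qed

lemma ev_I: "f \<in> I \<Longrightarrow> ev f = 0"
  using ring.genideal_minimal[OF ring_free_algebra ker_ideal rels_ker] unfolding qw_ideal_def by auto

lemma ev_eqv: "f \<approx> g \<Longrightarrow> ev f = ev g"
  using ev_I[of "f - g"] by (simp add: eqv_def ev_diff)

lemma ev_omono: "ev (Emon \<alpha>) = omono m n v \<alpha>"
proof -
  have P: "ev (prod_list fs) = prod_list (map ev fs)" if "\<And>f. f \<in> set fs \<Longrightarrow> f \<in> car G" for fs
    using that by (induction fs) (auto simp: ev_one ev_mult)
  have "ev (Emon \<alpha>) = prod_list (map ev (map (\<lambda>j. y j ^ Poly_Mapping.lookup \<alpha> (Y j) * x j ^ Poly_Mapping.lookup \<alpha> (X j)) [m..<Suc n]))"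
    unfolding omono_def by (rule P) (auto intro!: car_mult car_power x_car y_car)
  also have "\<dots> = omono m n v \<alpha>"
    unfolding omono_def map_map
    by (intro arg_cong[of _ _ prod_list] map_cong refl) (auto simp: ev_mult ev_power ev_fgen car_power x_car y_car)
  finally show ?thesis .
qed

lemma ev_lin: "ev (lin fscal Emon P) = lin \<sigma> (omono m n v) P"
  by (simp add: lin_def ev_sum ev_mult ev_fscal ev_omono)

text \<open>Modulo the ideal every element is a combination of ordered monomials; if its value
  vanishes, independence kills all coefficients.\<close>

lemma ev_eq_0_iff: "f \<in> car G \<Longrightarrow> ev f = 0 \<longleftrightarrow> f \<in> I"
proof
  assume f: "f \<in> car G" "ev f = 0"
  obtain P where P: "\<forall>\<alpha>\<in>Poly_Mapping.keys P. Poly_Mapping.keys \<alpha> \<subseteq> G" "f \<approx> lin fscal Emon P"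
    using pbw_spanning[OF f(1)] .
  then have "P = 0" using f(2) ev_eqv[OF P(2)] by (intro pbw_indep) (simp_all add: ev_lin)
  then show "f \<in> I" using P(2) by (simp add: eqv_def)
qed (rule ev_I)

text \<open>The choice of a representative is harmless, because \<open>ev\<close> vanishes on the
  ideal.\<close>

definition hh :: "(gen word \<Rightarrow>\<^sub>0 'r) set \<Rightarrow> 'a" where
  "hh S = ev (SOME f. f \<in> S)"

lemma hh_mem: "f \<in> car G \<Longrightarrow> g \<in> cls f \<Longrightarrow> ev g = ev f"
  by (auto simp: cls_alt ev_add ev_I)

lemma hh_cls: "f \<in> car G \<Longrightarrow> hh (cls f) = ev f"
  unfolding hh_def by (rule hh_mem) (auto intro: someI cls_self)

lemma embedding: "ring_embedding Q hh"
proof (rule ring_embedding.intro)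
  show "ring Q" by (rule ring_Q)
  show "inj_on hh (carrier Q)"
  proof (rule inj_onI)
    fix S S' assume "S \<in> carrier Q" "S' \<in> carrier Q" and eq: "hh S = hh S'"
    then obtain f g where fg: "f \<in> car G" "g \<in> car G" "S = cls f" "S' = cls g" by (auto simp: carrier_Q)
    then have "ev (f - g) = 0" using eq by (simp add: hh_cls ev_diff)
    then show "S = S'" using fg by (simp add: cls_eq_iff ev_eq_0_iff car_diff)
  qed
  show "hh \<one>\<^bsub>Q\<^esub> = 1" by (simp add: cls_one[symmetric] hh_cls ev_one)
qed (auto simp: carrier_Q cls_add[symmetric] cls_mult[symmetric] hh_cls ev_add ev_mult car_add car_mult)

lemma hh_image: "hh ` carrier Q = {lin \<sigma> (omono m n v) P |P. \<forall>\<alpha>\<in>Poly_Mapping.keys P. Poly_Mapping.keys \<alpha> \<subseteq> G}"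
proof (intro Set.equalityI subsetI)
  fix a assume "a \<in> hh ` carrier Q"
  then obtain f where f: "f \<in> car G" "a = ev f" by (auto simp: carrier_Q hh_cls)
  obtain P where P: "\<forall>\<alpha>\<in>Poly_Mapping.keys P. Poly_Mapping.keys \<alpha> \<subseteq> G" "f \<approx> lin fscal Emon P"
    using pbw_spanning[OF f(1)] .
  then show "a \<in> {lin \<sigma> (omono m n v) P |P. \<forall>\<alpha>\<in>Poly_Mapping.keys P. Poly_Mapping.keys \<alpha> \<subseteq> G}"
    using f ev_eqv[OF P(2)] by (auto simp: ev_lin)
next
  fix a assume "a \<in> {lin \<sigma> (omono m n v) P |P. \<forall>\<alpha>\<in>Poly_Mapping.keys P. Poly_Mapping.keys \<alpha> \<subseteq> G}"
  then obtain P where "a = ev (lin fscal Emon P)" by (auto simp: ev_lin)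
  then show "a \<in> hh ` carrier Q" using hh_cls[OF lin_car, of P] cls_closed[OF lin_car, of P] by (metis imageI)
qed

end

section \<open>A quantum torus\<close>

text \<open>Linear operators on functions on the lattice of exponent vectors. All functions are
  allowed, so shifts need no support condition, and one lattice serves for every
  \<open>n\<close>.\<close>

typedef (overloaded) 'k op = "{F :: ((gen \<Rightarrow> int) \<Rightarrow> 'k::field) \<Rightarrow> (gen \<Rightarrow> int) \<Rightarrow> 'k.
    (\<forall>f g. F (\<lambda>v. f v + g v) = (\<lambda>v. F f v + F g v)) \<and> (\<forall>a f. F (\<lambda>v. a * f v) = (\<lambda>v. a * F f v))}"
  by (rule exI[of _ "\<lambda>f. f"]) simp

setup_lifting type_definition_op

instantiation op :: (field) ring_1
begin
lift_definition zero_op :: "'a op" is "\<lambda>f v. 0" by simp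
lift_definition one_op :: "'a op" is "\<lambda>f. f" by simp
lift_definition plus_op :: "'a op \<Rightarrow> 'a op \<Rightarrow> 'a op" is "\<lambda>F G f v. F f v + G f v"
  by (auto simp: fun_eq_iff algebra_simps)
lift_definition minus_op :: "'a op \<Rightarrow> 'a op \<Rightarrow> 'a op" is "\<lambda>F G f v. F f v - G f v"
  by (auto simp: fun_eq_iff algebra_simps)
lift_definition uminus_op :: "'a op \<Rightarrow> 'a op" is "\<lambda>F f v. - F f v"
  by (auto simp: fun_eq_iff algebra_simps)
lift_definition times_op :: "'a op \<Rightarrow> 'a op \<Rightarrow> 'a op" is "\<lambda>F G f. F (G f)"
  by simp
instance
proof
  fix a b c :: "'a op"
  have R: "a = b" if "Rep_op a = Rep_op b" for a b :: "'a op" using that by (simp add: Rep_op_inject)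
  have L: "Rep_op a (\<lambda>v. f v + g v) = (\<lambda>v. Rep_op a f v + Rep_op a g v)" for a :: "'a op" and f g
    using Rep_op[of a] by simp
  note rep = zero_op.rep_eq one_op.rep_eq plus_op.rep_eq minus_op.rep_eq uminus_op.rep_eq times_op.rep_eq
  show "(0::'a op) \<noteq> 1"
  proof
    assume "(0::'a op) = 1"
    then have "Rep_op (0::'a op) (\<lambda>_. 1) (\<lambda>_. 0) = Rep_op (1::'a op) (\<lambda>_. 1) (\<lambda>_. 0)" by simp
    then show False by (simp add: rep)
  qed
  show "a * b * c = a * (b * c)" "1 * a = a" "a * 1 = a" by (rule R; simp add: rep)+
  show "a + b + c = a + (b + c)" "a + b = b + a" "0 + a = a" "- a + a = 0" "a - b = a + - b"
    by (rule R; simp add: rep add_ac)+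
  show "(a + b) * c = a * c + b * c" "a * (b + c) = a * b + a * c" by (rule R; simp add: rep L)+
qed
end

lift_definition app :: "'k::field op \<Rightarrow> ((gen \<Rightarrow> int) \<Rightarrow> 'k) \<Rightarrow> (gen \<Rightarrow> int) \<Rightarrow> 'k" is "\<lambda>F. F" .

lemma app_eqI: "(\<And>f v. app a f v = app b f v) \<Longrightarrow> a = b"
  by (simp add: app.rep_eq Rep_op_inject[symmetric] ext)
lemma app_plus: "app a (\<lambda>v. f v + g v) v = app a f v + app a g v" by transfer simp
lemma app_smult: "app a (\<lambda>v. k * f v) v = k * app a f v" by transfer simp
lemma app_add: "app (a + b) f v = app a f v + app b f v" by transfer simp
lemma app_diff: "app (a - b) f v = app a f v - app b f v" by transfer simp
lemma app_uminus: "app (- a) f v = - app a f v" by transfer simp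
lemma app_zero: "app 0 f v = 0" by transfer simp
lemma app_one: "app 1 f v = f v" by transfer simp
lemma app_mult: "app (a * b) f v = app a (app b f) v" by transfer simp
lift_definition kap :: "'k::field \<Rightarrow> 'k op" is "\<lambda>a f v. a * f v"
  by (auto simp: algebra_simps)
text \<open>A weighted shift. These operators multiply like monomials in a quantum torus whose
  scalars may depend on the lattice point.\<close>

lift_definition mon :: "((gen \<Rightarrow> int) \<Rightarrow> 'k::field) \<Rightarrow> (gen \<Rightarrow> int) \<Rightarrow> 'k op" is "\<lambda>\<chi> u f v. \<chi> v * f (\<lambda>g. v g + u g)"
  by (auto simp: algebra_simps)

lemma app_kap': "app (kap k) f v = k * f v" by transfer simp
lemma app_kap: "app (kap k * a) f v = k * app a f v" by (simp add: app_mult app_kap')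
lemma app_mon: "app (mon \<chi> u) f v = \<chi> v * f (\<lambda>g. v g + u g)" by transfer simp
lemma app_sum: "app (\<Sum>i\<in>I. a i) f v = (\<Sum>i\<in>I. app (a i) f v)"
  by (induction I rule: infinite_finite_induct) (simp_all add: app_add app_zero)

lemmas app_simps = app_add app_diff app_uminus app_zero app_one app_mult app_kap' app_mon

lemma kap_add: "kap (a + b) = kap a + kap b" by (rule app_eqI) (simp add: app_simps algebra_simps)
lemma kap_mult: "kap (a * b) = kap a * kap b" by (rule app_eqI) (simp add: app_simps algebra_simps)
lemma kap_1 [simp]: "kap 1 = 1" by (rule app_eqI) (simp add: app_simps)
lemma kap_0 [simp]: "kap 0 = 0" by (rule app_eqI) (simp add: app_simps)
lemma kap_uminus: "kap (- a) = - kap a" by (rule app_eqI) (simp add: app_simps)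
lemma kap_diff: "kap (a - b) = kap a - kap b" by (rule app_eqI) (simp add: app_simps algebra_simps)
lemma kap_comm: "a * kap k = kap k * a"
proof (rule app_eqI)
  fix f v
  have "app (kap k) f = (\<lambda>v. k * f v)" by (simp add: fun_eq_iff app_kap')
  then show "app (a * kap k) f v = app (kap k * a) f v" by (simp add: app_mult app_smult app_kap')
qed
lemma kap_power: "kap (a ^ k) = kap a ^ k" by (induction k) (simp_all add: kap_mult)

lemma mon_mult: "mon \<chi> u * mon \<chi>' u' = mon (\<lambda>v. \<chi> v * \<chi>' (\<lambda>g. v g + u g)) (\<lambda>g. u g + u' g)"
  by (rule app_eqI) (simp add: app_simps add.assoc)
lemma kap_mon: "kap k * mon \<chi> u = mon (\<lambda>v. k * \<chi> v) u"
  by (rule app_eqI) (simp add: app_simps)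
lemma mon_1: "(\<And>v. \<chi> v = 1) \<Longrightarrow> (\<And>g. u g = 0) \<Longrightarrow> mon \<chi> u = 1"
  by (rule app_eqI) (simp add: app_simps)
lemma mon_uminus: "- mon \<chi> u = mon (\<lambda>v. - \<chi> v) u"
  by (rule app_eqI) (simp add: app_simps)
lemma mon_cong: "(\<And>v. \<chi> v = \<chi>' v) \<Longrightarrow> (\<And>g. u g = u' g) \<Longrightarrow> mon \<chi> u = mon \<chi>' u'"
  by (rule app_eqI) (simp add: app_simps)

definition dlt :: "gen \<Rightarrow> gen \<Rightarrow> int" where "dlt g h = (if h = g then 1 else 0)"

text \<open>
  The parameter \<open>s\<close> is 1 or 0. For \<open>s = 0\<close> the operator \<open>zz 0\<close> is the identity, which gives the algebra
  specialized at \<open>c = 1\<close>.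
\<close>

locale torus =
  fixes n :: nat and s :: int and e :: "nat \<Rightarrow> 'k::field" and b :: "nat \<Rightarrow> nat \<Rightarrow> 'k"
  assumes e0: "\<And>j. 1 \<le> j \<Longrightarrow> j \<le> n \<Longrightarrow> e j \<noteq> 0" and e1: "\<And>j. 1 \<le> j \<Longrightarrow> j \<le> n \<Longrightarrow> e j \<noteq> 1"
    and b_inv: "\<And>j k. 1 \<le> j \<Longrightarrow> j \<le> n \<Longrightarrow> 1 \<le> k \<Longrightarrow> k \<le> n \<Longrightarrow> b j k * b k j = 1"
    and b_diag: "\<And>j. 1 \<le> j \<Longrightarrow> j \<le> n \<Longrightarrow> b j j = 1"
begin

lemma b0: "1 \<le> j \<Longrightarrow> j \<le> n \<Longrightarrow> 1 \<le> k \<Longrightarrow> k \<le> n \<Longrightarrow> b j k \<noteq> 0"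
  using b_inv[of j k] by auto

text \<open>The weight of \<open>yy k\<close> is dictated by two demands: a shift along
  \<open>Y j\<close> with \<open>j < k\<close> must produce the factor \<open>b j k\<close>, and a
  shift along \<open>X i\<close> with \<open>k \<le> i\<close> the factor \<open>e k\<close>, which
  lets \<open>zz i\<close> skew-commute with \<open>yy k\<close>.\<close>

definition lam :: "nat \<Rightarrow> (gen \<Rightarrow> int) \<Rightarrow> 'k" where
  "lam k v = (\<Prod>j\<in>{1..<k}. b j k powi v (Y j)) * e k powi (\<Sum>j\<in>{k..n}. v (X j))"

definition yy :: "nat \<Rightarrow> 'k op" where "yy k = mon (lam k) (dlt (Y k))"
definition yi :: "nat \<Rightarrow> 'k op" where "yi k = mon (\<lambda>v. 1 / lam k v) (\<lambda>g. - dlt (Y k) g)"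
definition zsh :: "nat \<Rightarrow> gen \<Rightarrow> int" where "zsh j = (\<lambda>g. (if j = 0 then s else 1) * dlt (X j) g)"
definition zz :: "nat \<Rightarrow> 'k op" where "zz j = mon (\<lambda>_. 1) (zsh j)"
text \<open>The solution of \<open>z_j = z_{j-1} + (e_j - 1) y_j x_j\<close> for \<open>x_j\<close>;
  this is where \<open>e j \<noteq> 1\<close> enters.\<close>

definition xx :: "nat \<Rightarrow> 'k op" where "xx j = kap (1 / (e j - 1)) * yi j * (zz j - zz (j - 1))"

lemma lam_nz: "1 \<le> k \<Longrightarrow> k \<le> n \<Longrightarrow> lam k v \<noteq> 0"
  by (auto simp: lam_def b0 e0)

lemma lam_shift_Y:
  assumes k: "1 \<le> k" "k \<le> n" and j: "1 \<le> j"
  shows "lam k (\<lambda>g. v g + dlt (Y j) g) = lam k v * (if j < k then b j k else 1)"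
proof -
  have "(\<Prod>i\<in>{1..<k}. b i k powi (v (Y i) + dlt (Y j) (Y i)))
     = (\<Prod>i\<in>{1..<k}. b i k powi v (Y i) * (if i = j then b i k else 1))"
    using k b0 by (intro prod.cong refl) (auto simp: dlt_def power_int_add)
  also have "\<dots> = (\<Prod>i\<in>{1..<k}. b i k powi v (Y i)) * (if j < k then b j k else 1)"
    using j by (auto simp: prod.distrib)
  finally show ?thesis by (simp add: lam_def dlt_def)
qed

lemma lam_shift_Z:
  assumes k: "1 \<le> k" "k \<le> n" and j: "j \<le> n"
  shows "lam k (\<lambda>g. v g + zsh j g) = lam k v * (if k \<le> j then e k else 1)"
proof -
  have "(\<Sum>i\<in>{k..n}. v (X i) + zsh j (X i)) = (\<Sum>i\<in>{k..n}. v (X i)) + (\<Sum>i\<in>{k..n}. if i = j then 1 else 0)"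
    using k by (subst sum.distrib[symmetric], intro sum.cong refl) (auto simp: zsh_def dlt_def)
  also have "(\<Sum>i\<in>{k..n}. if i = j then 1 else 0) = (if k \<le> j then 1 else (0::int))" using j by simp
  finally show ?thesis using k e0[of k] by (simp add: lam_def zsh_def dlt_def power_int_add)
qed

lemma yy_yy:
  assumes "1 \<le> j" "j \<le> n" "1 \<le> k" "k \<le> n"
  shows "yy j * yy k = kap (b j k) * yy k * yy j"
  unfolding yy_def mon_mult kap_mon
  using assms b_inv[of j k] b_inv[of k j] b_diag
  by (intro mon_cong) (auto simp: lam_shift_Y algebra_simps not_less dest: le_neq_implies_less)

lemma yy_yi: "1 \<le> k \<Longrightarrow> k \<le> n \<Longrightarrow> yy k * yi k = 1"
  unfolding yy_def yi_def mon_mult by (rule mon_1) (auto simp: lam_shift_Y lam_nz)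

lemma yi_yy: "1 \<le> k \<Longrightarrow> k \<le> n \<Longrightarrow> yi k * yy k = 1"
proof -
  assume k: "1 \<le> k" "k \<le> n"
  have "lam k (\<lambda>g. v g - dlt (Y k) g) = lam k v" for v
    using lam_shift_Y[OF k k(1), of "\<lambda>g. v g - dlt (Y k) g"] by simp
  then show ?thesis unfolding yy_def yi_def mon_mult by (intro mon_1) (auto simp: lam_nz[OF k])
qed

lemma zz_zz: "zz i * zz j = zz j * zz i"
  unfolding zz_def mon_mult by (rule mon_cong) auto

lemma zz_yy: "1 \<le> k \<Longrightarrow> k \<le> n \<Longrightarrow> i \<le> n \<Longrightarrow> zz i * yy k = kap (if k \<le> i then e k else 1) * yy k * zz i"
  unfolding zz_def yy_def mon_mult kap_mon by (rule mon_cong) (auto simp: lam_shift_Z)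

lemma kap_left: "a * (kap k * c) = kap k * (a * c)"
  by (metis kap_comm mult.assoc)

lemma kap_kap: "kap k * (kap l * c) = kap (k * l) * c"
  by (simp only: kap_mult mult.assoc)

lemma yi_zz:
  assumes k: "1 \<le> k" "k \<le> n" "i \<le> n"
  shows "yi k * zz i = kap (if k \<le> i then e k else 1) * (zz i * yi k)"
proof -
  have "yi k * zz i = yi k * (zz i * yy k) * yi k" by (simp add: mult.assoc yy_yi[OF k(1,2)])
  also have "\<dots> = kap (if k \<le> i then e k else 1) * ((yi k * yy k) * (zz i * yi k))"
    unfolding zz_yy[OF k] by (simp only: mult.assoc kap_left[of "yi k"])
  finally show ?thesis by (simp add: yi_yy[OF k(1,2)])
qed

lemma yi_yy':
  assumes "1 \<le> j" "j \<le> n" "1 \<le> k" "k \<le> n"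
  shows "yi j * yy k = kap (b k j) * (yy k * yi j)"
proof -
  have "yi j * yy k = yi j * (yy k * yy j) * yi j" by (simp add: mult.assoc yy_yi[OF assms(1,2)])
  also have "\<dots> = kap (b k j) * ((yi j * yy j) * (yy k * yi j))"
    unfolding yy_yy[OF assms(3,4,1,2)] by (simp only: mult.assoc kap_left[of "yi j"])
  finally show ?thesis by (simp add: yi_yy[OF assms(1,2)])
qed

lemma yi_yi:
  assumes "1 \<le> j" "j \<le> n" "1 \<le> k" "k \<le> n"
  shows "yi j * yi k = kap (b j k) * (yi k * yi j)"
proof -
  have "yi k * yi j = (yi k * (yi j * yy k)) * yi k" by (simp add: mult.assoc yy_yi[OF assms(3,4)])
  also have "\<dots> = kap (b k j) * ((yi k * yy k) * (yi j * yi k))"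
    unfolding yi_yy'[OF assms] by (simp only: mult.assoc kap_left[of "yi k"])
  finally have "kap (b j k) * (yi k * yi j) = kap (b j k * b k j) * (yi j * yi k)"
    by (simp add: yi_yy[OF assms(3,4)] kap_mult mult.assoc)
  then show ?thesis using b_inv[OF assms] by simp
qed

definition dd :: "nat \<Rightarrow> 'k op" where "dd j = zz j - zz (j - 1)"

lemma yy_xx: "1 \<le> j \<Longrightarrow> j \<le> n \<Longrightarrow> yy j * xx j = kap (1 / (e j - 1)) * dd j"
  unfolding xx_def dd_def by (simp only: mult.assoc kap_left[of "yy j"]) (simp only: mult.assoc[symmetric] yy_yi, simp)

lemma zz_step: "1 \<le> j \<Longrightarrow> j \<le> n \<Longrightarrow> zz j = zz (j - 1) + kap (e j - 1) * (yy j * xx j)"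
  using e1[of j] by (simp add: yy_xx mult.assoc[symmetric] kap_mult[symmetric] dd_def)

text \<open>Telescoping of \<open>zz_step\<close>. The sum is the right-hand side of the last
  defining relation, with \<open>zz (m - 1)\<close> in the role of the central parameter.\<close>

lemma zz_sum:
  assumes "1 \<le> m" "m \<le> j" "j \<le> Suc n"
  shows "zz (j - 1) = zz (m - 1) + (\<Sum>i\<in>{m..<j}. kap (e i - 1) * (yy i * xx i))"
  using assms(2,3)
proof (induction j rule: dec_induct)
  case (step j)
  then show ?case using zz_step[of j] assms(1) by (simp add: add.assoc)
qed simp

lemma xx_yy_same:
  assumes j: "1 \<le> j" "j \<le> n"
  shows "xx j * yy j = kap (e j) * (yy j * xx j) + zz (j - 1)"
proof -
  have "xx j * yy j = kap (1 / (e j - 1)) * (yi j * (zz j * yy j - zz (j - 1) * yy j))"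
    by (simp add: xx_def mult.assoc left_diff_distrib)
  also have "zz j * yy j - zz (j - 1) * yy j = yy j * (kap (e j) * zz j - zz (j - 1))"
  proof -
    have "\<not> j \<le> j - 1" using j by simp
    then show ?thesis using zz_yy[OF j, of j] zz_yy[OF j, of "j - 1"] j
     by (simp only: right_diff_distrib mult.assoc kap_left[of "yy j"] if_False) simp
  qed
  also have "yi j * (yy j * (kap (e j) * zz j - zz (j - 1))) = kap (e j) * zz j - zz (j - 1)"
    by (simp add: mult.assoc[symmetric] yi_yy[OF j])
  also have "\<dots> = kap (e j) * dd j + kap (e j - 1) * zz (j - 1)"
    by (simp add: dd_def kap_diff algebra_simps)
  also have "kap (1 / (e j - 1)) * \<dots> = kap (e j) * (kap (1 / (e j - 1)) * dd j) + zz (j - 1)"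
    using e1[OF j] by (simp add: distrib_left mult.assoc[symmetric] kap_mult[symmetric] mult.commute)
  finally show ?thesis by (simp add: yy_xx[OF j])
qed

lemma xx_yy:
  assumes j: "1 \<le> j" "j \<le> n" and k: "1 \<le> k" "k \<le> n" and ne: "j \<noteq> k"
  shows "xx j * yy k = kap ((if k < j then e k else 1) * b k j) * (yy k * xx j)"
proof -
  let ?q = "if k < j then e k else 1"
  have "dd j * yy k = kap ?q * (yy k * dd j)"
    using j k ne by (auto simp: dd_def zz_yy left_diff_distrib right_diff_distrib mult.assoc)
  then have "xx j * yy k = kap (1 / (e j - 1)) * (yi j * (kap ?q * (yy k * dd j)))"
    by (simp add: xx_def mult.assoc dd_def)
  also have "\<dots> = kap (1 / (e j - 1)) * (kap ?q * ((yi j * yy k) * dd j))"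
    by (simp only: kap_left[of "yi j"] mult.assoc)
  also have "\<dots> = kap (?q * b k j) * (yy k * (kap (1 / (e j - 1)) * (yi j * dd j)))"
    unfolding yi_yy'[OF j k] kap_left[of "yy k"] by (simp only: kap_kap mult_ac)
  finally show ?thesis by (simp add: xx_def mult.assoc dd_def)
qed

lemma dd_dd: "dd j * dd k = dd k * dd j"
  unfolding dd_def left_diff_distrib right_diff_distrib
    zz_zz[of k j] zz_zz[of k "j - 1"] zz_zz[of "k - 1" j] zz_zz[of "k - 1" "j - 1"]
  by (simp add: algebra_simps)

lemma xx_xx:
  assumes j: "1 \<le> j" and jk: "j < k" and k: "k \<le> n"
  shows "xx j * xx k = kap (e j * b j k) * (xx k * xx j)"
proof -
  have 1: "dd j * yi k = yi k * dd j"
    using j jk k by (auto simp: dd_def yi_zz left_diff_distrib right_diff_distrib)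
  have 2: "yi j * dd k = kap (e j) * (dd k * yi j)"
    using j jk k by (auto simp: dd_def yi_zz left_diff_distrib right_diff_distrib)
  let ?w = "kap (1 / (e j - 1))" and ?w' = "kap (1 / (e k - 1))"
  have "xx j * xx k = ?w * (yi j * (dd j * (?w' * (yi k * dd k))))"
    by (simp add: xx_def mult.assoc dd_def)
  also have "\<dots> = ?w * (?w' * (yi j * ((dd j * yi k) * dd k)))"
    by (simp only: kap_left[of "yi j"] kap_left[of "dd j"] mult.assoc)
  also have "\<dots> = ?w * (?w' * ((yi j * yi k) * (dd k * dd j)))"
    unfolding 1 by (simp only: mult.assoc dd_dd[of j k])
  also have "\<dots> = ?w * (?w' * (kap (b j k) * (yi k * ((yi j * dd k) * dd j))))"
    using yi_yi[of j k] j jk k by (simp add: mult.assoc)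
  also have "\<dots> = ?w * (?w' * (kap (b j k) * (kap (e j) * (yi k * (dd k * (yi j * dd j))))))"
    unfolding 2 by (simp only: mult.assoc kap_left[of "yi k"])
  also have "\<dots> = kap (e j * b j k) * (?w' * (yi k * (dd k * (?w * (yi j * dd j)))))"
    by (simp only: kap_left[of "yi k"] kap_left[of "dd k"] kap_kap mult_ac)
  also have "\<dots> = kap (e j * b j k) * (xx k * xx j)" by (simp add: xx_def mult.assoc dd_def)
  finally show ?thesis .
qed

lemma zz_xx:
  assumes k: "1 \<le> k" "k \<le> n" and i: "i \<le> n"
  shows "xx k * zz i = kap (if k \<le> i then e k else 1) * (zz i * xx k)"
proof -
  have c: "dd k * zz i = zz i * dd k" by (simp add: dd_def left_diff_distrib right_diff_distrib zz_zz[of i])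
  have "xx k * zz i = kap (1 / (e k - 1)) * (yi k * (dd k * zz i))"
    by (simp add: xx_def mult.assoc dd_def)
  also have "\<dots> = kap (1 / (e k - 1)) * ((yi k * zz i) * dd k)" by (simp only: c mult.assoc)
  also have "\<dots> = kap (if k \<le> i then e k else 1) * (zz i * (kap (1 / (e k - 1)) * (yi k * dd k)))"
    unfolding yi_zz[OF k i] by (simp only: kap_left[of "zz i"] kap_kap mult_ac)
  finally show ?thesis by (simp add: xx_def mult.assoc dd_def)
qed

end

section \<open>Leading terms and linear independence\<close>

text \<open>The factor increases with \<open>j\<close>, so \<open>zz j\<close> outweighs
  \<open>zz (j - 1)\<close> and the leading part of \<open>xx j\<close> is a single shift. The
  offset makes \<open>zz (m - 1)\<close> weightless.\<close>

definition wt :: "nat \<Rightarrow> nat \<Rightarrow> (gen \<Rightarrow> int) \<Rightarrow> int" where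
  "wt n m u = (\<Sum>j\<in>{0..n}. (int j - (int m - 1)) * u (X j))"

lemma wt_add: "wt n m (\<lambda>g. u g + u' g) = wt n m u + wt n m u'"
  by (simp add: wt_def sum.distrib[symmetric] distrib_left)

inductive low :: "((gen \<Rightarrow> int) \<Rightarrow> int) \<Rightarrow> int \<Rightarrow> 'k::field op \<Rightarrow> bool" for W w where
  low_0: "low W w 0"
| low_mon: "low W w a \<Longrightarrow> W u < w \<Longrightarrow> low W w (mon \<chi> u + a)"

lemma low_add: "low W w a \<Longrightarrow> low W w b \<Longrightarrow> low W w (a + b)"
  by (induction rule: low.induct) (auto simp: add.assoc intro: low_mon)

lemma low_mon1: "W u < w \<Longrightarrow> low W w (mon \<chi> u)"
  using low_mon[OF low_0, of W u w] by simp

locale additive_weight =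
  fixes W :: "(gen \<Rightarrow> int) \<Rightarrow> int"
  assumes W_add: "W (\<lambda>g. u g + u' g) = W u + W u'"
begin

lemma low_mon_left: "low W w a \<Longrightarrow> low W (W u + w) (mon \<chi> u * a)"
  by (induction rule: low.induct) (auto simp: distrib_left mon_mult W_add intro!: low_0 low_mon)

lemma low_mon_right: "low W w a \<Longrightarrow> low W (w + W u) (a * mon \<chi> u)"
  by (induction rule: low.induct) (auto simp: distrib_right mon_mult W_add intro!: low_0 low_mon)

lemma low_less: "low W w a \<Longrightarrow> w \<le> w' \<Longrightarrow> low W w' a"
  by (induction rule: low.induct) (auto intro!: low_0 low_mon)

lemma low_mult: "low W w a \<Longrightarrow> low W w' b \<Longrightarrow> low W (w + w') (a * b)"
proof (induction rule: low.induct)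
  case (low_mon a u \<chi>)
  have "low W (w + w') (mon \<chi> u * b)"
    using low_mon by (intro low_less[OF low_mon_left]) auto
  then show ?case using low_mon by (simp add: distrib_right low_add)
qed (simp add: low_0)

lemma low_app:
  assumes "low W w a" "w \<le> W u"
  shows "app a (\<lambda>v. if v = u then 1 else 0) (\<lambda>_. 0) = 0"
  using assms by (induction rule: low.induct) (auto simp: app_zero app_add app_mon)

definition lead :: "(gen \<Rightarrow> int) \<Rightarrow> 'k::field op \<Rightarrow> bool" where
  "lead u a \<longleftrightarrow> (\<exists>\<chi> a'. (\<forall>v. \<chi> v \<noteq> 0) \<and> low W (W u) a' \<and> a = mon \<chi> u + a')"

lemma lead_mon: "(\<And>v. \<chi> v \<noteq> 0) \<Longrightarrow> lead u (mon \<chi> u)"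
  unfolding lead_def by (rule exI[of _ \<chi>], rule exI[of _ 0]) (simp add: low_0)

lemma lead_mult:
  assumes "lead u a" "lead u' b"
  shows "lead (\<lambda>g. u g + u' g) (a * b)"
proof -
  obtain \<chi> a' where a: "\<forall>v. \<chi> v \<noteq> 0" "low W (W u) a'" "a = mon \<chi> u + a'" using assms(1) by (auto simp: lead_def)
  obtain \<chi>' b' where b: "\<forall>v. \<chi>' v \<noteq> 0" "low W (W u') b'" "b = mon \<chi>' u' + b'" using assms(2) by (auto simp: lead_def)
  have eq: "a * b = mon (\<lambda>v. \<chi> v * \<chi>' (\<lambda>g. v g + u g)) (\<lambda>g. u g + u' g) + (mon \<chi> u * b' + a' * mon \<chi>' u' + a' * b')"
    by (simp add: a b distrib_left distrib_right mon_mult add.assoc)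
  show ?thesis unfolding lead_def eq
  proof (intro exI conjI)
    show "\<forall>v. \<chi> v * \<chi>' (\<lambda>g. v g + u g) \<noteq> 0" using a(1) b(1) by simp
    show "low W (W (\<lambda>g. u g + u' g)) (mon \<chi> u * b' + a' * mon \<chi>' u' + a' * b')"
     unfolding W_add by (intro low_add low_mon_left low_mon_right low_mult a b)
  qed simp
qed

lemma lead_one: "lead (\<lambda>_. 0) (1 :: 'k::field op)"
proof -
  have "mon (\<lambda>_. 1) (\<lambda>_. 0) = (1 :: 'k op)" by (rule mon_1) auto
  then show ?thesis using lead_mon[of "\<lambda>_. 1::'k" "\<lambda>_. 0"] by simp
qed

lemma lead_power: "lead u a \<Longrightarrow> lead (\<lambda>g. int k * u g) (a ^ k)"
proof (induction k)
  case 0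
  then show ?case using lead_one by simp
next
  case (Suc k)
  then show ?case using lead_mult[OF Suc.prems Suc.IH] by (simp add: algebra_simps)
qed

text \<open>Applied to the indicator function of a point and evaluated at the origin, an operator
  returns the weight with which it shifts by that point.\<close>

lemma lead_app:
  assumes "lead u a"
  shows "app a (\<lambda>v. if v = u then 1 else 0) (\<lambda>_. 0) \<noteq> 0"
    "W u \<le> W u' \<Longrightarrow> u' \<noteq> u \<Longrightarrow> app a (\<lambda>v. if v = u' then 1 else 0) (\<lambda>_. 0) = 0"
proof -
  obtain \<chi> a' where a: "\<forall>v. \<chi> v \<noteq> 0" "low W (W u) a'" "a = mon \<chi> u + a'" using assms by (auto simp: lead_def)
  show "app a (\<lambda>v. if v = u then 1 else 0) (\<lambda>_. 0) \<noteq> 0"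
    using a low_app[OF a(2), of u] by (simp add: app_add app_mon)
  show "app a (\<lambda>v. if v = u' then 1 else 0) (\<lambda>_. 0) = 0" if "W u \<le> W u'" "u' \<noteq> u"
    using that low_app[OF a(2) that(1)] by (auto simp: a(3) app_add app_mon)
qed

lemma lead_nonzero: "lead u a \<Longrightarrow> a \<noteq> 0"
  using lead_app(1)[of u a] by (auto simp: app_zero)

text \<open>Among the terms with nonzero coefficient take one of maximal weight and test at its
  exponent \<open>u x0\<close>. The other terms are at most as heavy, and by injectivity of
  \<open>u\<close> they lead at a different exponent, so the test does not see them.\<close>

lemma lead_independent:
  assumes S: "finite S" and l: "\<And>x. x \<in> S \<Longrightarrow> lead (u x) (a x)" and inj: "inj_on u S"
    and z: "(\<Sum>x\<in>S. kap (t x) * a x) = 0" and x: "x \<in> S"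
  shows "t x = 0"
proof (rule ccontr)
  assume "t x \<noteq> 0"
  let ?S = "{x \<in> S. t x \<noteq> 0}"
  have fin: "finite ?S" using S by simp
  have "Max ((\<lambda>x. W (u x)) ` ?S) \<in> (\<lambda>x. W (u x)) ` ?S" using fin x \<open>t x \<noteq> 0\<close> by (intro Max_in) auto
  then obtain x0 where x0: "x0 \<in> ?S" and mx: "W (u x0) = Max ((\<lambda>x. W (u x)) ` ?S)" by auto
  let ?d = "\<lambda>v. if v = u x0 then 1 else 0"
  have "0 = (\<Sum>x\<in>S. t x * app (a x) ?d (\<lambda>_. 0))" using arg_cong[OF z, of "\<lambda>a. app a ?d (\<lambda>_. 0)"]
    by (simp add: app_sum app_kap app_zero)
  also have "\<dots> = (\<Sum>x\<in>S. if x = x0 then t x0 * app (a x0) ?d (\<lambda>_. 0) else 0)"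
  proof (intro sum.cong refl)
    fix x assume x: "x \<in> S"
    show "t x * app (a x) ?d (\<lambda>_. 0) = (if x = x0 then t x0 * app (a x0) ?d (\<lambda>_. 0) else 0)"
    proof (cases "x = x0 \<or> t x = 0")
     case True then show ?thesis using x0 by auto
    next
     case False
     then have "W (u x) \<le> W (u x0)" unfolding mx using fin x by (intro Max_ge) auto
     moreover have "u x0 \<noteq> u x" using False inj x x0 by (auto simp: inj_on_def)
     ultimately show ?thesis using False lead_app(2)[OF l[OF x]] by simp
    qed
  qed
  also have "\<dots> = t x0 * app (a x0) ?d (\<lambda>_. 0)" using S x0 by simp
  finally show False using x0 lead_app(1)[OF l[of x0]] by auto
qed

end

lemma additive_weight_wt: "additive_weight (wt n m)"
  by unfold_locales (rule wt_add)

section \<open>Leading exponents of ordered monomials\<close>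

context torus
begin

definition vv :: "gen \<Rightarrow> 'k op" where "vv g = (case g of X j \<Rightarrow> xx j | Y j \<Rightarrow> yy j)"

lemma vv_simps [simp]: "vv (X j) = xx j" "vv (Y j) = yy j"
  by (simp_all add: vv_def)

text \<open>Since \<open>x_j\<close> leads with \<open>y_j^(-1) z_j\<close>, the coordinate at
  \<open>X j\<close> records the exponent of \<open>x_j\<close>, and the one at \<open>Y j\<close>
  the difference of the exponents of \<open>y_j\<close> and \<open>x_j\<close>. The coordinate at
  \<open>X (m - 1)\<close> remains free to record the power of \<open>zz (m - 1)\<close>.\<close>

definition lexp :: "nat \<Rightarrow> nat \<Rightarrow> (gen \<Rightarrow>\<^sub>0 nat) \<Rightarrow> gen \<Rightarrow> int" where
  "lexp m k \<alpha> g = (case g of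
     X j \<Rightarrow> (if m \<le> j \<and> j \<le> n then int (Poly_Mapping.lookup \<alpha> (X j)) else 0)
    | Y j \<Rightarrow> (if m \<le> j \<and> j \<le> n then int (Poly_Mapping.lookup \<alpha> (Y j)) - int (Poly_Mapping.lookup \<alpha> (X j)) else 0))
    + int k * zsh (m - 1) g"

context
  fixes m :: nat
  assumes m: "1 \<le> m" "s = 0 \<Longrightarrow> m = 1"
begin

interpretation w: additive_weight "wt n m" by (rule additive_weight_wt)

lemma wt_zsh: "j \<le> n \<Longrightarrow> wt n m (zsh j) = (if j = 0 then s else 1) * (int j - (int m - 1))"
proof -
  assume j: "j \<le> n"
  have "wt n m (zsh j) = (\<Sum>i\<in>{0..n}. if i = j then (if j = 0 then s else 1) * (int j - (int m - 1)) else 0)"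
    unfolding wt_def by (intro sum.cong refl) (auto simp: zsh_def dlt_def)
  then show ?thesis using j by simp
qed

lemma wt_dlt_Y: "wt n m (\<lambda>g. - dlt (Y k) g) = 0" "wt n m (dlt (Y k)) = 0"
  by (simp_all add: wt_def dlt_def)

lemma lead_yy: "1 \<le> j \<Longrightarrow> j \<le> n \<Longrightarrow> w.lead (dlt (Y j)) (yy j)"
  unfolding yy_def by (rule w.lead_mon) (rule lam_nz)

lemma lead_zz: "w.lead (zsh j) (zz j)"
  unfolding zz_def by (rule w.lead_mon) simp

lemma lead_xx:
  assumes j: "m \<le> j" "j \<le> n"
  shows "w.lead (\<lambda>g. - dlt (Y j) g + zsh j g) (xx j)"
proof -
  have j1: "1 \<le> j" using m j by simp
  let ?c = "1 / (e j - 1)"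
  let ?\<chi> = "\<lambda>v. ?c * (1 / lam j v) * 1"
  have eq: "xx j = mon ?\<chi> (\<lambda>g. - dlt (Y j) g + zsh j g) + mon (\<lambda>v. - ?\<chi> v) (\<lambda>g. - dlt (Y j) g + zsh (j - 1) g)"
    unfolding xx_def zz_def yi_def
    by (simp only: right_diff_distrib mon_mult kap_mon mon_uminus[symmetric]) (simp only: diff_conv_add_uminus)
  have "wt n m (\<lambda>g. - dlt (Y j) g + zsh (j - 1) g) < wt n m (\<lambda>g. - dlt (Y j) g + zsh j g)"
  proof (cases "j = 1")
    case True
    then have "m = 1" using j m by simp
    then show ?thesis unfolding wt_add wt_dlt_Y using wt_zsh[of 0] wt_zsh[of 1] j True by simp
  next
    case False
    then show ?thesis unfolding wt_add wt_dlt_Y using j j1 by (simp add: wt_zsh)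
  qed
  then have "low (wt n m) (wt n m (\<lambda>g. - dlt (Y j) g + zsh j g)) (mon (\<lambda>v. - ?\<chi> v) (\<lambda>g. - dlt (Y j) g + zsh (j - 1) g))"
    by (rule low_mon1)
  then show ?thesis unfolding w.lead_def eq using lam_nz[OF j1 j(2)] e1[OF j1 j(2)] by (intro exI conjI) auto
qed

lemma lead_mono: "w.lead (lexp m k \<alpha>) (omono m n vv \<alpha> * zz (m - 1) ^ k)"
proof -
  define fe where "fe j = (\<lambda>g. int (Poly_Mapping.lookup \<alpha> (Y j)) * dlt (Y j) g
     + int (Poly_Mapping.lookup \<alpha> (X j)) * (- dlt (Y j) g + zsh j g))" for j
  have factor: "w.lead (fe j) (vv (Y j) ^ Poly_Mapping.lookup \<alpha> (Y j) * vv (X j) ^ Poly_Mapping.lookup \<alpha> (X j))"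
    if "m \<le> j" "j \<le> n" for j
    unfolding vv_simps fe_def using that m
    by (intro w.lead_mult w.lead_power lead_yy lead_xx) auto
  have pl: "w.lead (\<lambda>g. \<Sum>j\<leftarrow>js. fe j g) (prod_list (map (\<lambda>j. vv (Y j) ^ Poly_Mapping.lookup \<alpha> (Y j) * vv (X j) ^ Poly_Mapping.lookup \<alpha> (X j)) js))"
    if "\<And>j. j \<in> set js \<Longrightarrow> m \<le> j \<and> j \<le> n" for js
    using that by (induction js) (auto simp: w.lead_one intro!: w.lead_mult factor[unfolded vv_simps])
  have "w.lead (\<lambda>g. (\<Sum>j\<leftarrow>[m..<Suc n]. fe j g) + int k * zsh (m - 1) g) (omono m n vv \<alpha> * zz (m - 1) ^ k)"
    unfolding omono_def by (intro w.lead_mult w.lead_power lead_zz pl) auto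
  moreover have "(\<Sum>j\<leftarrow>[m..<Suc n]. fe j g) + int k * zsh (m - 1) g = lexp m k \<alpha> g" for g
  proof -
    have "(\<Sum>j\<leftarrow>[m..<Suc n]. fe j g) = (\<Sum>j\<in>{m..n}. fe j g)"
     by (subst sum_list_distinct_conv_sum_set) (simp_all del: upt_Suc add: atLeastLessThanSuc_atLeastAtMost)
    also have "\<dots> = (\<Sum>j\<in>{m..n}. if j = idx g then fe j g else 0)"
     by (intro sum.cong refl) (cases g; auto simp: fe_def dlt_def zsh_def)
    also have "\<dots> = (if m \<le> idx g \<and> idx g \<le> n then fe (idx g) g else 0)" by simp
    finally show ?thesis using m(1) by (cases g) (auto simp: fe_def lexp_def dlt_def zsh_def)
  qed
  ultimately show ?thesis by (simp only: ext)
qed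

lemma omono_nonzero: "omono m n vv \<alpha> \<noteq> 0"
  using w.lead_nonzero[OF lead_mono[of 0 \<alpha>]] by simp

text \<open>The leading exponents are distinct, which is read off coordinate by coordinate. For
  \<open>s = 0\<close> the operator \<open>zz 0\<close> is the identity, so its power leaves no
  trace and has to be fixed at zero.\<close>

lemma pbw_independent:
  assumes s: "s = 1 \<or> (\<forall>x\<in>S. snd x = 0)" and S: "finite S" and sub: "\<And>\<alpha> k. (\<alpha>, k) \<in> S \<Longrightarrow> Poly_Mapping.keys \<alpha> \<subseteq> gens m n"
    and z: "(\<Sum>(\<alpha>, k)\<in>S. kap (t \<alpha> k) * (omono m n vv \<alpha> * zz (m - 1) ^ k)) = 0" and x: "(\<alpha>, k) \<in> S"
  shows "t \<alpha> k = 0"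
proof -
  have inj: "inj_on (\<lambda>(\<alpha>, k). lexp m k \<alpha>) S"
  proof (rule inj_onI, clarify)
    fix \<alpha> k \<beta> l assume mem: "(\<alpha>, k) \<in> S" "(\<beta>, l) \<in> S" and eq: "lexp m k \<alpha> = lexp m l \<beta>"
    have "lexp m k \<alpha> (X (m - 1)) = lexp m l \<beta> (X (m - 1))" using eq by simp
    moreover have "\<not> m \<le> m - 1" using m(1) by simp
    ultimately have h: "\<not> m \<le> m - 1" "lexp m k \<alpha> (X (m - 1)) = lexp m l \<beta> (X (m - 1))" by simp_all
    have kl: "k = l"
    proof (cases "s = 1")
     case True
     then show ?thesis using h unfolding lexp_def zsh_def dlt_def by (auto split: if_splits)
    next
     case False
     then have "\<forall>x\<in>S. snd x = 0" using s by blast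
     then have "snd (\<alpha>, k) = 0" "snd (\<beta>, l) = 0" using mem by blast+
     then show ?thesis by simp
    qed
    have X: "Poly_Mapping.lookup \<alpha> (X j) = Poly_Mapping.lookup \<beta> (X j)" if "m \<le> j" "j \<le> n" for j
     using fun_cong[OF eq, of "X j"] that kl by (simp add: lexp_def)
    have "Poly_Mapping.lookup \<alpha> (Y j) = Poly_Mapping.lookup \<beta> (Y j)" if "m \<le> j" "j \<le> n" for j
     using fun_cong[OF eq, of "Y j"] that kl X[OF that] by (simp add: lexp_def)
    then have "Poly_Mapping.lookup \<alpha> g = Poly_Mapping.lookup \<beta> g" for g
     using X lookup_0_gens[OF sub[OF mem(1)], of g] lookup_0_gens[OF sub[OF mem(2)], of g]
     by (cases g; cases "g \<in> gens m n") (auto simp: gens_def)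
    then show "\<alpha> = \<beta> \<and> k = l" using kl by (auto intro: poly_mapping_eqI)
  qed
  have "(case (\<alpha>, k) of (\<alpha>, k) \<Rightarrow> t \<alpha> k) = 0"
    by (rule w.lead_independent[OF S _ inj _ x, where a = "\<lambda>(\<alpha>, k). omono m n vv \<alpha> * zz (m - 1) ^ k"])
     (use z lead_mono in \<open>auto simp: case_prod_unfold\<close>)
  then show ?thesis by simp
qed

end

end

section \<open>Evaluation of polynomials in noncommutative rings\<close>

lemma commute_power: "a * b = b * a \<Longrightarrow> a ^ k * b = b * (a ^ k :: 'a::monoid_mult)"
  by (rule power_commuting_commutes)

lemma commute_mult: "a * c = c * a \<Longrightarrow> b * c = c * b \<Longrightarrow> (a * b) * c = c * (a * b :: 'a::semigroup_mult)"
  by (metis mult.assoc)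

lemma commute_mult2:
  assumes "a * c = c * a" "a * d = d * a" "b * c = c * b" "b * d = d * (b :: 'a::semigroup_mult)"
  shows "(a * b) * (c * d) = (c * d) * (a * b)"
proof (rule commute_mult)
  show "a * (c * d) = (c * d) * a" using commute_mult[of c a d] assms by simp
  show "b * (c * d) = (c * d) * b" using commute_mult[of c b d] assms by simp
qed

lemma commute_sum: "(\<And>i. i \<in> I \<Longrightarrow> f i * c = c * f i) \<Longrightarrow> sum f I * c = c * (sum f I :: 'a::semiring_0)"
  by (simp add: sum_distrib_left sum_distrib_right)

lemma commute_prod_list: "(\<And>a. a \<in> set xs \<Longrightarrow> a * c = c * a) \<Longrightarrow> prod_list xs * c = c * (prod_list xs :: 'a::monoid_mult)"
  by (induction xs) (auto intro!: commute_mult)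

definition peval :: "('c::zero \<Rightarrow> 'a::semiring_1) \<Rightarrow> 'a \<Rightarrow> 'c poly \<Rightarrow> 'a" where
  "peval \<psi> z p = (\<Sum>k\<le>Polynomial.degree p. \<psi> (Polynomial.coeff p k) * z ^ k)"

lemma peval_bound:
  assumes "\<psi> 0 = 0" "Polynomial.degree p \<le> N"
  shows "peval \<psi> z p = (\<Sum>k\<le>N. \<psi> (Polynomial.coeff p k) * z ^ k)"
  unfolding peval_def using assms by (intro sum.mono_neutral_left) (auto simp: Polynomial.coeff_eq_0)

lemma peval_0: "\<psi> 0 = 0 \<Longrightarrow> peval \<psi> z 0 = 0"
  by (simp add: peval_def)

lemma peval_pCons: "\<psi> 0 = 0 \<Longrightarrow> peval \<psi> z (pCons a p) = \<psi> a + peval \<psi> z p * z"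
proof -
  assume 0: "\<psi> 0 = 0"
  have "peval \<psi> z (pCons a p) = (\<Sum>k\<le>Suc (Polynomial.degree p). \<psi> (Polynomial.coeff (pCons a p) k) * z ^ k)"
    by (rule peval_bound[where \<psi> = \<psi>, OF 0]) simp
  then show ?thesis
    by (subst (asm) sum.atMost_Suc_shift) (simp add: peval_def sum_distrib_right mult.assoc power_commutes)
qed

lemma peval_const: "\<psi> 0 = 0 \<Longrightarrow> peval \<psi> z [:a:] = \<psi> a"
  by (simp add: peval_pCons peval_0)

lemma peval_var: "\<psi> 0 = 0 \<Longrightarrow> \<psi> 1 = 1 \<Longrightarrow> peval \<psi> z [:0, 1:] = z"
  by (simp add: peval_pCons peval_0)

text \<open>The target need not be commutative; evaluation is multiplicative because
  \<open>z\<close> commutes with the images of the coefficients. Instances occur with values in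
  operators, in polynomial rings and in fields.\<close>

locale peval_hom =
  fixes \<psi> :: "'c::comm_ring_1 \<Rightarrow> 'a::ring_1" and z :: 'a
  assumes \<psi>_add: "\<psi> (a + b) = \<psi> a + \<psi> b" and \<psi>_mult: "\<psi> (a * b) = \<psi> a * \<psi> b" and \<psi>_one: "\<psi> 1 = 1"
    and \<psi>_comm: "\<psi> a * z = z * \<psi> a"
begin

lemma \<psi>_zero: "\<psi> 0 = 0"
  using \<psi>_add[of 0 0] by simp

abbreviation "pe \<equiv> peval \<psi> z"

lemmas pe_pCons = peval_pCons[where \<psi> = \<psi>, OF \<psi>_zero]
lemmas pe_0 = peval_0[where \<psi> = \<psi>, OF \<psi>_zero]
lemmas pe_const = peval_const[where \<psi> = \<psi>, OF \<psi>_zero]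
lemmas pe_var = peval_var[where \<psi> = \<psi>, OF \<psi>_zero \<psi>_one]
lemmas pe_bound = peval_bound[where \<psi> = \<psi>, OF \<psi>_zero]

lemma pe_add: "pe (p + q) = pe p + pe q"
proof -
  let ?N = "max (Polynomial.degree p) (Polynomial.degree q)"
  show ?thesis
    by (simp add: pe_bound[of p ?N] pe_bound[of q ?N] pe_bound[of "p + q" ?N] degree_add_le
      \<psi>_add distrib_right sum.distrib)
qed

lemma pe_one: "pe 1 = 1"
  using pe_const[of z 1] by (simp add: \<psi>_one one_pCons)

lemma pe_smult: "pe (Polynomial.smult a p) = \<psi> a * pe p"
  by (induction p) (simp_all add: pe_0 pe_pCons \<psi>_mult distrib_left mult.assoc)

lemma pe_comm: "(\<And>a. \<psi> a * w = w * \<psi> a) \<Longrightarrow> z * w = w * z \<Longrightarrow> pe p * w = w * pe p"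
  unfolding peval_def by (intro commute_sum commute_mult commute_power) auto

lemma pe_comm_z: "pe p * z = z * pe p"
  by (rule pe_comm) (rule \<psi>_comm, rule refl)

lemma pe_mult: "pe (p * q) = pe p * pe q"
proof (induction p)
  case (pCons a p)
  have "pe (pCons a p * q) = \<psi> a * pe q + pe (p * q) * z"
    by (simp add: pe_add pe_smult pe_pCons \<psi>_zero)
  also have "\<dots> = pe (pCons a p) * pe q"
    by (simp add: pCons pe_pCons distrib_right mult.assoc pe_comm_z[of q])
  finally show ?case .
qed (simp add: pe_0)

lemma pe_power: "pe (p ^ k) = pe p ^ k"
  by (induction k) (simp_all add: pe_one pe_mult)

lemma pe_sum: "pe (sum f I) = (\<Sum>i\<in>I. pe (f i))"
  by (induction I rule: infinite_finite_induct) (simp_all add: pe_0 pe_add)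

lemma pe_uminus: "pe (- p) = - pe p"
  using pe_add[of p "- p"] by (simp add: pe_0 eq_neg_iff_add_eq_0 add.commute)

lemma pe_diff: "pe (p - q) = pe p - pe q"
  using pe_add[of p "- q"] by (simp add: pe_uminus)

lemma pe_monom: "pe (Polynomial.monom a k) = \<psi> a * z ^ k"
proof (induction k)
  case (Suc k)
  then show ?case by (simp add: Polynomial.monom_Suc pe_pCons \<psi>_zero mult.assoc power_commutes)
qed (simp add: Polynomial.monom_0 pe_const)

end

section \<open>Products of commuting families\<close>

lemma prod_list_factor:
  assumes "\<And>i j. i \<in> set js \<Longrightarrow> j \<in> set js \<Longrightarrow> c i * f j = f j * (c i :: 'a::monoid_mult)"
  shows "prod_list (map (\<lambda>j. c j * f j) js) = prod_list (map c js) * prod_list (map f js)"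
  using assms
proof (induction js)
  case (Cons i js)
  have "prod_list (map c js) * f i = f i * prod_list (map c js)"
    by (rule commute_prod_list) (use Cons.prems in auto)
  then have "(c i * f i) * (prod_list (map c js) * prod_list (map f js)) = (c i * prod_list (map c js)) * (f i * prod_list (map f js))"
    by (metis mult.assoc)
  then show ?case using Cons by simp
qed simp

lemma omono_commute:
  assumes "\<And>g. g \<in> gens m n \<Longrightarrow> v g * c = c * v g"
  shows "omono m n v \<alpha> * c = c * omono m n v \<alpha>"
  unfolding omono_def
  by (rule commute_prod_list) (use assms in \<open>auto simp: gens_def intro!: commute_mult commute_power\<close>)

lemma omono_add:
  assumes c: "\<And>g g'. g \<in> gens m n \<Longrightarrow> g' \<in> gens m n \<Longrightarrow> v g * v g' = v g' * v g"
  shows "omono m n v (\<alpha> + \<beta>) = omono m n v \<alpha> * omono m n v \<beta>"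
proof -
  let ?f = "\<lambda>\<alpha> j. v (Y j) ^ Poly_Mapping.lookup \<alpha> (Y j) * v (X j) ^ Poly_Mapping.lookup \<alpha> (X j)"
  have cp: "v g ^ k * v g' ^ l = v g' ^ l * v g ^ k" if "g \<in> gens m n" "g' \<in> gens m n" for g g' k l
    using c[OF that] by (intro commute_power) (metis commute_power)
  have "omono m n v (\<alpha> + \<beta>) = prod_list (map (\<lambda>j. ?f \<alpha> j * ?f \<beta> j) [m..<Suc n])"
    unfolding omono_def
  proof (intro arg_cong[of _ _ prod_list] map_cong refl)
    fix j assume "j \<in> set [m..<Suc n]"
    then have j: "X j \<in> gens m n" "Y j \<in> gens m n" by (auto simp: gens_def simp del: upt_Suc)
    have "?f \<alpha> j * ?f \<beta> j = v (Y j) ^ Poly_Mapping.lookup \<alpha> (Y j) * (v (X j) ^ Poly_Mapping.lookup \<alpha> (X j)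
      * v (Y j) ^ Poly_Mapping.lookup \<beta> (Y j)) * v (X j) ^ Poly_Mapping.lookup \<beta> (X j)" by (simp add: mult.assoc)
    then show "v (Y j) ^ Poly_Mapping.lookup (\<alpha> + \<beta>) (Y j) * v (X j) ^ Poly_Mapping.lookup (\<alpha> + \<beta>) (X j) = ?f \<alpha> j * ?f \<beta> j"
     unfolding cp[OF j] by (simp add: lookup_add power_add mult.assoc)
  qed
  also have "\<dots> = omono m n v \<alpha> * omono m n v \<beta>"
    unfolding omono_def
    by (rule prod_list_factor) (auto simp: gens_def simp del: upt_Suc intro!: commute_mult2 cp)
  finally show ?thesis .
qed

section \<open>The algebra over a domain embedded in a field\<close>

lemma geometric_vanish:
  fixes q :: "'k::field"
  assumes "q \<noteq> 1" "q ^ k = 1"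
  shows "(\<Sum>i<k. q ^ i) = 0"
  using assms by (simp add: sum_gp_strict)

text \<open>The last two assumptions are the arithmetic content of centrality of the powers;
  \<open>qweyl_orders\<close> derives them from the hypothesis of the theorem.\<close>

locale weyl =
  fixes \<phi> :: "'t::idom \<Rightarrow> 'k::field" and n :: nat and E :: "nat \<Rightarrow> 't" and B :: "nat \<Rightarrow> nat \<Rightarrow> 't" and L :: "nat \<Rightarrow> nat"
  assumes emb: "domain_embedding \<phi>"
    and E_unit: "\<And>j. 1 \<le> j \<Longrightarrow> j \<le> n \<Longrightarrow> \<exists>u. E j * u = 1"
    and E_ne: "\<And>j. 1 \<le> j \<Longrightarrow> j \<le> n \<Longrightarrow> E j \<noteq> 1"
    and B_inv: "\<And>j k. 1 \<le> j \<Longrightarrow> j \<le> n \<Longrightarrow> 1 \<le> k \<Longrightarrow> k \<le> n \<Longrightarrow> B j k * B k j = 1"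
    and B_diag: "\<And>j. 1 \<le> j \<Longrightarrow> j \<le> n \<Longrightarrow> B j j = 1"
    and L_pos: "\<And>j. 1 \<le> j \<Longrightarrow> j \<le> n \<Longrightarrow> 0 < L j"
    and BL: "\<And>j k. 1 \<le> j \<Longrightarrow> j \<le> n \<Longrightarrow> 1 \<le> k \<Longrightarrow> k \<le> n \<Longrightarrow> B j k ^ L j = 1"
    and EL: "\<And>j k. 1 \<le> j \<Longrightarrow> j \<le> k \<Longrightarrow> k \<le> n \<Longrightarrow> E j ^ L k = 1"
begin

lemma \<phi>_add: "\<phi> (a + b) = \<phi> a + \<phi> b" and \<phi>_mult: "\<phi> (a * b) = \<phi> a * \<phi> b" and \<phi>_one [simp]: "\<phi> 1 = 1"
  and \<phi>_inj: "inj \<phi>"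
  using emb by (auto simp: domain_embedding_def)

lemma \<phi>_zero [simp]: "\<phi> 0 = 0"
  using \<phi>_add[of 0 0] by (metis add.right_neutral add_left_cancel)

lemma \<phi>_eq_0 [simp]: "\<phi> a = 0 \<longleftrightarrow> a = 0"
  using \<phi>_inj \<phi>_zero by (metis injD)

lemma \<phi>_eq_1 [simp]: "\<phi> a = 1 \<longleftrightarrow> a = 1"
  using \<phi>_inj \<phi>_one by (metis injD)

lemma \<phi>_power: "\<phi> (a ^ k) = \<phi> a ^ k"
  by (induction k) (simp_all add: \<phi>_mult)

lemma \<phi>_uminus: "\<phi> (- a) = - \<phi> a"
  using \<phi>_add[of a "- a"] by (simp add: eq_neg_iff_add_eq_0 add.commute)

lemma \<phi>_diff: "\<phi> (a - b) = \<phi> a - \<phi> b"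
  using \<phi>_add[of a "- b"] by (simp add: \<phi>_uminus)

abbreviation ee :: "nat \<Rightarrow> 'k" where "ee j \<equiv> \<phi> (E j)"
abbreviation bb :: "nat \<Rightarrow> nat \<Rightarrow> 'k" where "bb j k \<equiv> \<phi> (B j k)"

lemma torus: "torus n ee bb"
proof
  fix j assume j: "1 \<le> j" "j \<le> n"
  show "ee j \<noteq> 0" using E_unit[OF j] by auto
  show "ee j \<noteq> 1" using E_ne[OF j] by simp
  show "bb j j = 1" using B_diag[OF j] by simp
  show "bb j k * bb k j = 1" if "1 \<le> k" "k \<le> n" for k using B_inv[OF j that] by (simp add: \<phi>_mult[symmetric])
qed

sublocale torus n 1 ee bb by (rule torus)

lemma bL: "1 \<le> j \<Longrightarrow> j \<le> n \<Longrightarrow> 1 \<le> k \<Longrightarrow> k \<le> n \<Longrightarrow> bb j k ^ L j = 1"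
  using BL[of j k] by (simp add: \<phi>_power[symmetric])

lemma bL': "1 \<le> j \<Longrightarrow> j \<le> n \<Longrightarrow> 1 \<le> k \<Longrightarrow> k \<le> n \<Longrightarrow> bb k j ^ L j = 1"
  using bL[of j k] b_inv[of j k] power_mult_distrib[of "bb j k" "bb k j" "L j"] by simp

lemma eL: "1 \<le> j \<Longrightarrow> j \<le> k \<Longrightarrow> k \<le> n \<Longrightarrow> ee j ^ L k = 1"
  using EL[of j k] by (simp add: \<phi>_power[symmetric])

lemma qcomm_left: "a * c = kap q * (c * a) \<Longrightarrow> a ^ k * c = kap (q ^ k) * (c * a ^ k)"
proof (induction k)
  case (Suc k)
  have "a ^ Suc k * c = a * (a ^ k * c)" by (simp add: mult.assoc)
  also have "\<dots> = kap (q ^ k) * ((a * c) * a ^ k)" by (simp only: Suc.IH[OF Suc.prems] kap_left[of a] mult.assoc)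
  also have "\<dots> = kap (q ^ k) * ((kap q * (c * a)) * a ^ k)" by (simp only: Suc.prems)
  also have "\<dots> = kap (q ^ Suc k) * (c * a ^ Suc k)" by (simp add: mult.assoc kap_kap mult.commute)
  finally show ?case .
qed simp

lemma qcomm_right: "a * c = kap q * (c * a) \<Longrightarrow> a * c ^ k = kap (q ^ k) * (c ^ k * a)"
proof (induction k)
  case (Suc k)
  have "a * c ^ Suc k = (a * c) * c ^ k" by (simp add: mult.assoc)
  also have "\<dots> = kap q * (c * (a * c ^ k))" by (simp add: Suc.prems mult.assoc)
  also have "\<dots> = kap (q ^ Suc k) * (c ^ Suc k * a)" by (simp add: Suc kap_left[of c] mult.assoc kap_kap)
  finally show ?case .
qed simp

text \<open>The correction term carries a q-integer \<open>1 + e + ... + e^k\<close>, which vanishes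
  when \<open>k + 1\<close> is a multiple of the order of \<open>e\<close>.\<close>

lemma xx_power_yy:
  assumes j: "1 \<le> j" "j \<le> n"
  shows "xx j ^ Suc k * yy j = kap (ee j ^ Suc k) * (yy j * xx j ^ Suc k) + kap (\<Sum>i<Suc k. ee j ^ i) * (zz (j - 1) * xx j ^ k)"
proof (induction k)
  case 0
  show ?case using xx_yy_same[OF j] by simp
next
  case (Suc k)
  have "\<not> j \<le> j - 1" using j by simp
  then have zx: "xx j * zz (j - 1) = zz (j - 1) * xx j" using zz_xx[of j "j - 1"] j by simp
  have "xx j ^ Suc (Suc k) * yy j = xx j * (xx j ^ Suc k * yy j)" by (simp add: mult.assoc)
  also have "\<dots> = kap (ee j ^ Suc k) * ((xx j * yy j) * xx j ^ Suc k) + kap (\<Sum>i<Suc k. ee j ^ i) * ((xx j * zz (j - 1)) * xx j ^ k)"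
    unfolding Suc by (simp only: distrib_left kap_left[of "xx j"] mult.assoc)
  also have "\<dots> = kap (ee j ^ Suc k) * (kap (ee j) * (yy j * (xx j * xx j ^ Suc k)) + zz (j - 1) * xx j ^ Suc k) + kap (\<Sum>i<Suc k. ee j ^ i) * (zz (j - 1) * xx j ^ Suc k)"
    unfolding zx xx_yy_same[OF j] by (simp add: distrib_right mult.assoc)
  also have "\<dots> = kap (ee j ^ Suc (Suc k)) * (yy j * xx j ^ Suc (Suc k)) + kap (\<Sum>i<Suc (Suc k). ee j ^ i) * (zz (j - 1) * xx j ^ Suc k)"
    by (simp add: distrib_left distrib_right kap_kap kap_add mult.commute add_ac)
  finally show ?case .
qed

lemma xx_yy_power:
  assumes j: "1 \<le> j" "j \<le> n"
  shows "xx j * yy j ^ Suc k = kap (ee j ^ Suc k) * (yy j ^ Suc k * xx j) + kap (\<Sum>i<Suc k. ee j ^ i) * (yy j ^ k * zz (j - 1))"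
proof (induction k)
  case 0
  show ?case using xx_yy_same[OF j] by simp
next
  case (Suc k)
  have "\<not> j \<le> j - 1" using j by simp
  then have zy: "zz (j - 1) * yy j = yy j * zz (j - 1)" using zz_yy[of j "j - 1"] j by simp
  have "xx j * yy j ^ Suc (Suc k) = (xx j * yy j ^ Suc k) * yy j" by (simp only: power_Suc2 mult.assoc)
  also have "\<dots> = kap (ee j ^ Suc k) * (yy j ^ Suc k * (xx j * yy j)) + kap (\<Sum>i<Suc k. ee j ^ i) * (yy j ^ k * (zz (j - 1) * yy j))"
    unfolding Suc by (simp only: distrib_right mult.assoc)
  also have "\<dots> = kap (ee j ^ Suc k) * (kap (ee j) * ((yy j ^ Suc k * yy j) * xx j) + yy j ^ Suc k * zz (j - 1))
     + kap (\<Sum>i<Suc k. ee j ^ i) * ((yy j ^ k * yy j) * zz (j - 1))"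
    unfolding zy xx_yy_same[OF j] by (simp only: distrib_left mult.assoc kap_left[of "yy j ^ Suc k"])
  also have "\<dots> = kap (ee j ^ Suc (Suc k)) * (yy j ^ Suc (Suc k) * xx j) + kap (\<Sum>i<Suc (Suc k). ee j ^ i) * (yy j ^ Suc k * zz (j - 1))"
    by (simp only: power_Suc2[symmetric]) (simp add: distrib_left distrib_right kap_kap kap_add mult.commute add_ac)
  finally show ?case .
qed

definition uu :: "gen \<Rightarrow> 'k op" where "uu g = vv g ^ L (idx g)"

lemma uu_vv_same:
  assumes j: "1 \<le> j" "j \<le> n"
  shows "xx j ^ L j * yy j = yy j * xx j ^ L j" "xx j * yy j ^ L j = yy j ^ L j * xx j"
proof -
  obtain k where k: "L j = Suc k" using L_pos[OF j] gr0_implies_Suc by blast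
  have "(\<Sum>i<Suc k. ee j ^ i) = 0" unfolding k[symmetric]
    by (rule geometric_vanish) (use e1[OF j] eL[of j j] j in auto)
  moreover have "ee j ^ Suc k = 1" unfolding k[symmetric] using eL[of j j] j by simp
  ultimately show "xx j ^ L j * yy j = yy j * xx j ^ L j" "xx j * yy j ^ L j = yy j ^ L j * xx j"
    using xx_power_yy[OF j, of k] xx_yy_power[OF j, of k] unfolding k by simp_all
qed

text \<open>For different indices the commutation scalar is a product of some \<open>bb\<close> and
  possibly some \<open>ee\<close>, each of which becomes 1 under the power \<open>L j\<close>. For
  equal indices the q-integer vanishes instead.\<close>

lemma uu_vv:
  assumes g: "g \<in> gens 1 n" and g': "g' \<in> gens 1 n"
  shows "uu g * vv g' = vv g' * uu g"
proof -
  define j k where "j = idx g" and "k = idx g'"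
  have j: "1 \<le> j" "j \<le> n" and k: "1 \<le> k" "k \<le> n" using g g' by (auto simp: gens_def j_def k_def)
  have YY: "yy j ^ L j * yy k = yy k * yy j ^ L j"
    using qcomm_left[of "yy j" "yy k" "bb j k" "L j"] yy_yy[OF j k] bL[OF j k] by (simp add: mult.assoc)
  have YX: "yy j ^ L j * xx k = xx k * yy j ^ L j"
  proof (cases "j = k")
    case True then show ?thesis using uu_vv_same(2)[OF k] by simp
  next
    case False
    let ?q = "(if j < k then ee j else 1) * bb j k"
    have "?q ^ L j = 1" using bL[OF j k] eL[of j j] j by (simp add: power_mult_distrib)
    then show ?thesis using qcomm_right[OF xx_yy[OF k j False[symmetric]], of "L j"] by simp
  qed
  have XY: "xx j ^ L j * yy k = yy k * xx j ^ L j"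
  proof (cases "j = k")
    case True then show ?thesis using uu_vv_same(1)[OF k] by simp
  next
    case False
    let ?q = "(if k < j then ee k else 1) * bb k j"
    have "?q ^ L j = 1" using bL'[OF j k] eL[of k j] j k by (simp add: power_mult_distrib)
    then show ?thesis using qcomm_left[OF xx_yy[OF j k False], of "L j"] by simp
  qed
  have XX: "xx j ^ L j * xx k = xx k * xx j ^ L j"
  proof -
    consider "j < k" | "j = k" | "k < j" by linarith
    then show ?thesis
    proof cases
     case 1
     have "(ee j * bb j k) ^ L j = 1" using bL[OF j k] eL[of j j] j by (simp add: power_mult_distrib)
     then show ?thesis using qcomm_left[OF xx_xx[OF j(1) 1 k(2)], of "L j"] by simp
    next
     case 2 then show ?thesis by (simp add: power_commutes)
    next
     case 3
     have "(ee k * bb k j) ^ L j = 1" using bL'[OF j k] eL[of k j] j k 3 by (simp add: power_mult_distrib)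
     then show ?thesis using qcomm_right[OF xx_xx[OF k(1) 3 j(2)], of "L j"] by simp
    qed
  qed
  show ?thesis using YY YX XY XX unfolding j_def k_def uu_def by (cases g; cases g') auto
qed

lemma uu_zz:
  assumes g: "g \<in> gens 1 n" and i: "i \<le> n"
  shows "uu g * zz i = zz i * uu g"
proof -
  define k where "k = idx g"
  have k: "1 \<le> k" "k \<le> n" using g by (auto simp: gens_def k_def)
  let ?q = "if k \<le> i then ee k else 1"
  have q: "?q ^ L k = 1" using eL[of k k] k by simp
  have "xx k ^ L k * zz i = zz i * xx k ^ L k" using qcomm_left[OF zz_xx[OF k i], of "L k"] q by simp
  moreover have "zz i * yy k ^ L k = yy k ^ L k * zz i"
    using qcomm_right[of "zz i" "yy k" ?q "L k"] zz_yy[OF k i] q by (simp add: mult.assoc)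
  ultimately show ?thesis unfolding uu_def k_def by (cases g) auto
qed

lemma gens_mono: "m' \<le> m \<Longrightarrow> gens m n \<subseteq> gens m' n"
  by (auto simp: gens_def)

lemma uu_uu: "g \<in> gens 1 n \<Longrightarrow> g' \<in> gens 1 n \<Longrightarrow> uu g * uu g' = uu g' * uu g"
  unfolding uu_def[of g'] by (metis commute_power uu_vv)

definition cm :: "nat \<Rightarrow> (gen \<Rightarrow>\<^sub>0 nat) \<Rightarrow> 'k op" where "cm m = omono m n uu"

lemma cm_add: "1 \<le> m \<Longrightarrow> cm m (\<alpha> + \<beta>) = cm m \<alpha> * cm m \<beta>"
  unfolding cm_def by (rule omono_add) (use gens_mono[of 1 m] uu_uu in auto)

lemma cm_0 [simp]: "cm m 0 = 1"
  by (simp add: cm_def)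

lemma cm_vv: "1 \<le> m \<Longrightarrow> g \<in> gens 1 n \<Longrightarrow> cm m \<alpha> * vv g = vv g * cm m \<alpha>"
  unfolding cm_def by (rule omono_commute) (use gens_mono[of 1 m] uu_vv in auto)

lemma cm_zz: "1 \<le> m \<Longrightarrow> i \<le> n \<Longrightarrow> cm m \<alpha> * zz i = zz i * cm m \<alpha>"
  unfolding cm_def by (rule omono_commute) (use gens_mono[of 1 m] uu_zz in auto)

text \<open>Division of the exponents by \<open>L\<close>: the powers \<open>uu\<close> commute with
  all generators and can be collected in front.\<close>

lemma omono_split:
  assumes m: "1 \<le> m"
    and \<gamma>: "\<And>g. g \<in> gens m n \<Longrightarrow> Poly_Mapping.lookup \<gamma> g = L (idx g) * Poly_Mapping.lookup \<beta> g + Poly_Mapping.lookup \<rho> g"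
  shows "omono m n vv \<gamma> = cm m \<beta> * omono m n vv \<rho>"
proof -
  let ?c = "\<lambda>j. uu (Y j) ^ Poly_Mapping.lookup \<beta> (Y j) * uu (X j) ^ Poly_Mapping.lookup \<beta> (X j)"
  let ?f = "\<lambda>j. vv (Y j) ^ Poly_Mapping.lookup \<rho> (Y j) * vv (X j) ^ Poly_Mapping.lookup \<rho> (X j)"
  have cp: "uu g ^ k * vv g' ^ l = vv g' ^ l * uu g ^ k" if "g \<in> gens m n" "g' \<in> gens m n" for g g' k l
    using uu_vv[of g g'] gens_mono[OF m] that by (intro commute_power) (metis commute_power in_mono)
  have "omono m n vv \<gamma> = prod_list (map (\<lambda>j. ?c j * ?f j) [m..<Suc n])"
    unfolding omono_def
  proof (intro arg_cong[of _ _ prod_list] map_cong refl)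
    fix j assume "j \<in> set [m..<Suc n]"
    then have j: "X j \<in> gens m n" "Y j \<in> gens m n" by (auto simp: gens_def simp del: upt_Suc)
    have "?c j * ?f j = uu (Y j) ^ Poly_Mapping.lookup \<beta> (Y j) * (uu (X j) ^ Poly_Mapping.lookup \<beta> (X j)
      * vv (Y j) ^ Poly_Mapping.lookup \<rho> (Y j)) * vv (X j) ^ Poly_Mapping.lookup \<rho> (X j)" by (simp add: mult.assoc)
    also have "\<dots> = (uu (Y j) ^ Poly_Mapping.lookup \<beta> (Y j) * vv (Y j) ^ Poly_Mapping.lookup \<rho> (Y j)) *
      (uu (X j) ^ Poly_Mapping.lookup \<beta> (X j) * vv (X j) ^ Poly_Mapping.lookup \<rho> (X j))"
     unfolding cp[OF j] by (simp add: mult.assoc)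
    finally show "vv (Y j) ^ Poly_Mapping.lookup \<gamma> (Y j) * vv (X j) ^ Poly_Mapping.lookup \<gamma> (X j) = ?c j * ?f j"
     using \<gamma>[OF j(1)] \<gamma>[OF j(2)] by (simp add: uu_def power_add power_mult)
  qed
  also have "\<dots> = cm m \<beta> * omono m n vv \<rho>"
    unfolding omono_def cm_def
    by (rule prod_list_factor) (auto simp: gens_def simp del: upt_Suc vv_simps intro!: commute_mult2 cp)
  finally show ?thesis .
qed

end

section \<open>The algebra as a free module over the central polynomial ring\<close>

lemma finite_gens: "finite (gens m n)" and gens_alt: "gens m n = X ` {m..n} \<union> Y ` {m..n}"
proof -
  show "gens m n = X ` {m..n} \<union> Y ` {m..n}"
  proof (rule Set.set_eqI)
    fix g show "g \<in> gens m n \<longleftrightarrow> g \<in> X ` {m..n} \<union> Y ` {m..n}" by (cases g) (auto simp: gens_def)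
  qed
  then show "finite (gens m n)" by simp
qed

definition fpm :: "gen set \<Rightarrow> (gen \<Rightarrow> nat) \<Rightarrow> gen \<Rightarrow>\<^sub>0 nat" where
  "fpm G f = Abs_poly_mapping (\<lambda>g. if g \<in> G then f g else 0)"

lemma lookup_fpm: "finite G \<Longrightarrow> Poly_Mapping.lookup (fpm G f) g = (if g \<in> G then f g else 0)"
proof -
  assume "finite G"
  then have "finite {g. (if g \<in> G then f g else 0) \<noteq> 0}" by (rule rev_finite_subset) (auto split: if_splits)
  then show ?thesis unfolding fpm_def by (simp add: lookup_Abs_poly_mapping)
qed

lemma keys_fpm: "finite G \<Longrightarrow> Poly_Mapping.keys (fpm G f) \<subseteq> G"
  by (auto simp: in_keys_iff lookup_fpm split: if_splits)

lemma over_gens_add: "over_gens G p \<Longrightarrow> over_gens G q \<Longrightarrow> over_gens G (p + q :: ((gen \<Rightarrow>\<^sub>0 nat) \<Rightarrow>\<^sub>0 't::comm_ring_1) poly)"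
  using keys_add unfolding over_gens_def by (fastforce simp: Polynomial.coeff_add)

lemma over_gens_uminus: "over_gens G p \<Longrightarrow> over_gens G (- p :: ((gen \<Rightarrow>\<^sub>0 nat) \<Rightarrow>\<^sub>0 't::comm_ring_1) poly)"
  by (simp add: over_gens_def)

lemma over_gens_0: "over_gens G (0 :: ((gen \<Rightarrow>\<^sub>0 nat) \<Rightarrow>\<^sub>0 't::comm_ring_1) poly)"
  by (simp add: over_gens_def)

lemma keys_sum_subset:
  "(\<And>i. i \<in> I \<Longrightarrow> Poly_Mapping.keys (f i) \<subseteq> S) \<Longrightarrow> Poly_Mapping.keys (sum f I :: 'a \<Rightarrow>\<^sub>0 'b::comm_monoid_add) \<subseteq> S"
proof (induction I rule: infinite_finite_induct)
  case (insert i I)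
  have "Poly_Mapping.keys (f i + sum f I) \<subseteq> S" by (rule order_trans[OF keys_add]) (use insert in auto)
  then show ?case using insert by simp
qed auto

lemma over_gens_mult:
  assumes p: "over_gens G p" and q: "over_gens G q"
  shows "over_gens G (p * q :: ((gen \<Rightarrow>\<^sub>0 nat) \<Rightarrow>\<^sub>0 't::comm_ring_1) poly)"
proof -
  have "Poly_Mapping.keys (Polynomial.coeff (p * q) k) \<subseteq> {\<alpha>. Poly_Mapping.keys \<alpha> \<subseteq> G}" for k
    unfolding Polynomial.coeff_mult
  proof (rule keys_sum_subset)
    fix i
    show "Poly_Mapping.keys (Polynomial.coeff p i * Polynomial.coeff q (k - i)) \<subseteq> {\<alpha>. Poly_Mapping.keys \<alpha> \<subseteq> G}"
    proof
     fix \<alpha> assume "\<alpha> \<in> Poly_Mapping.keys (Polynomial.coeff p i * Polynomial.coeff q (k - i))"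
     then obtain a b where "a \<in> Poly_Mapping.keys (Polynomial.coeff p i)" "b \<in> Poly_Mapping.keys (Polynomial.coeff q (k - i))" "\<alpha> = a + b"
      using keys_mult[of "Polynomial.coeff p i" "Polynomial.coeff q (k - i)"] by auto
     moreover from this have "Poly_Mapping.keys a \<subseteq> G" "Poly_Mapping.keys b \<subseteq> G"
      using p q unfolding over_gens_def by blast+
     ultimately show "\<alpha> \<in> {\<alpha>. Poly_Mapping.keys \<alpha> \<subseteq> G}" using keys_add[of a b] by blast
    qed
  qed
  then show ?thesis by (auto simp: over_gens_def)
qed

lemma over_gens_monom: "Poly_Mapping.keys \<alpha> \<subseteq> G \<Longrightarrow> over_gens G (Polynomial.monom (Poly_Mapping.single \<alpha> t) k)"
  by (auto simp: over_gens_def split: if_splits)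

lemma over_gens_1: "over_gens G (1 :: ((gen \<Rightarrow>\<^sub>0 nat) \<Rightarrow>\<^sub>0 't::comm_ring_1) poly)"
  using over_gens_monom[of 0 G "1::'t" 0] by (simp add: Polynomial.monom_0 one_pCons single_one)

lemma over_gens_sum: "(\<And>i. i \<in> I \<Longrightarrow> over_gens G (f i)) \<Longrightarrow> over_gens G (sum f I :: ((gen \<Rightarrow>\<^sub>0 nat) \<Rightarrow>\<^sub>0 't::comm_ring_1) poly)"
  by (induction I rule: infinite_finite_induct) (simp_all add: over_gens_0 over_gens_add)

text \<open>Any linear order would do. It induces a linear order on exponent vectors compatible with
  addition, so polynomials in these variables form an integral domain and have extremal
  monomials.\<close>

instantiation gen :: linorder
begin
definition "less_eq_gen g h \<longleftrightarrow> (case (g, h) of (X i, X j) \<Rightarrow> i \<le> j | (X i, Y j) \<Rightarrow> True | (Y i, X j) \<Rightarrow> False | (Y i, Y j) \<Rightarrow> i \<le> j)"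
definition "less_gen g (h :: gen) \<longleftrightarrow> g \<le> h \<and> \<not> h \<le> g"
instance
  by standard (auto simp: less_eq_gen_def less_gen_def split: gen.splits)
end

text \<open>One ring of operators serves all these algebras; the parameter is
  \<open>zz (m - 1)\<close>. In particular the algebra for \<open>m = 2\<close> sits inside the one
  for \<open>m = 1\<close>, with \<open>c'\<close> acting as \<open>zz 1\<close>. The bound
  \<open>Suc n\<close> admits an algebra without generators.\<close>

locale weyl_at = weyl \<phi> n E B L
  for \<phi> :: "'t::idom \<Rightarrow> 'k::field" and n :: nat and E :: "nat \<Rightarrow> 't" and B :: "nat \<Rightarrow> nat \<Rightarrow> 't" and L :: "nat \<Rightarrow> nat" +
  fixes m :: nat
  assumes m1: "1 \<le> m" and mn: "m \<le> Suc n"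
begin

abbreviation "G \<equiv> gens m n"
definition zc :: "'k op" where "zc = zz (m - 1)"

lemma G1: "g \<in> G \<Longrightarrow> g \<in> gens 1 n"
  using gens_mono[OF m1] by auto

definition ke :: "'t \<Rightarrow> 'k op" where "ke a = kap (\<phi> a)"

lemma ke_add: "ke (a + b) = ke a + ke b" and ke_mult: "ke (a * b) = ke a * ke b" and ke_1 [simp]: "ke 1 = 1"
  and ke_0 [simp]: "ke 0 = 0"
  by (simp_all add: ke_def \<phi>_add \<phi>_mult kap_add kap_mult)

lemma ke_comm: "a' * ke a = ke a * a'"
  unfolding ke_def by (rule kap_comm)

lemma ke_left: "a' * (ke a * c) = ke a * (a' * c)"
  unfolding ke_def by (rule kap_left)

definition sig :: "'t poly \<Rightarrow> 'k op" where "sig = peval ke zc"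

sublocale S: peval_hom ke zc
  by unfold_locales (simp_all add: ke_add ke_mult ke_comm[of zc])

lemma sig_simps: "sig (p + q) = sig p + sig q" "sig (p * q) = sig p * sig q" "sig 1 = 1" "sig 0 = 0"
  "sig [:a:] = ke a" "sig [:0, 1:] = zc"
  unfolding sig_def by (simp_all only: S.pe_add S.pe_mult S.pe_one S.pe_0 S.pe_const S.pe_var)

lemma zc_vv:
  assumes "g \<in> G"
  shows "zc * vv g = vv g * zc"
proof (cases g)
  case (X j)
  then have j: "1 \<le> j" "j \<le> n" "m - 1 \<le> n" "\<not> j \<le> m - 1" using assms m1 by (auto simp: gens_def)
  then show ?thesis using zz_xx[OF j(1-3)] X unfolding zc_def by (simp only: if_False) simp
next
  case (Y j)
  then have j: "1 \<le> j" "j \<le> n" "m - 1 \<le> n" "\<not> j \<le> m - 1" using assms m1 by (auto simp: gens_def)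
  then show ?thesis using zz_yy[OF j(1-3)] Y unfolding zc_def by (simp only: if_False) simp
qed

lemma sig_vv: "g \<in> G \<Longrightarrow> sig p * vv g = vv g * sig p"
  unfolding sig_def by (rule S.pe_comm) (simp_all add: ke_comm[of "vv g"] zc_vv)

lemma zc_omono: "zc * omono m n vv \<alpha> = omono m n vv \<alpha> * zc"
  by (rule omono_commute[symmetric]) (simp add: zc_vv)

lemma pbw_family:
  assumes I: "finite I" and sub: "\<And>i. i \<in> I \<Longrightarrow> Poly_Mapping.keys (\<alpha> i) \<subseteq> G"
    and inj: "inj_on (\<lambda>i. (\<alpha> i, k i)) I"
    and z: "(\<Sum>i\<in>I. kap (t i) * (omono m n vv (\<alpha> i) * zc ^ k i)) = 0" and i: "i \<in> I"
  shows "t i = 0"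
proof -
  let ?f = "\<lambda>i. (\<alpha> i, k i)"
  let ?t = "\<lambda>a l. t (inv_into I ?f (a, l))"
  have inv: "inv_into I ?f (?f i) = i" if "i \<in> I" for i using inj that by (rule inv_into_f_f)
  have "(\<Sum>(a, l)\<in>?f ` I. kap (?t a l) * (omono m n vv a * zc ^ l))
     = (\<Sum>i\<in>I. kap (t (inv_into I ?f (?f i))) * (omono m n vv (\<alpha> i) * zc ^ k i))"
    by (simp add: sum.reindex[OF inj] case_prod_unfold)
  also have "\<dots> = 0" using z inv by (simp cong: sum.cong)
  finally have "(\<Sum>(a, l)\<in>?f ` I. kap (?t a l) * (omono m n vv a * zz (m - 1) ^ l)) = 0" by (simp only: zc_def)
  from pbw_independent[OF m1 _ disjI1[OF refl] _ _ this, of "\<alpha> i" "k i"] have "?t (\<alpha> i) (k i) = 0" using I sub i by auto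
  then show ?thesis using inv[OF i] by simp
qed

definition E' :: "nat \<Rightarrow> 't poly" where "E' j = [:SOME u. E j * u = 1:]"

lemma E': "j \<in> {m..n} \<Longrightarrow> [:E j:] * E' j = 1"
proof -
  assume "j \<in> {m..n}"
  then have "\<exists>u. E j * u = 1" using E_unit m1 by auto
  from someI_ex[OF this] show ?thesis by (simp add: E'_def one_pCons mult.commute)
qed

lemma omono_lin: "lin sig (omono m n vv) P = (\<Sum>(\<alpha>, k)\<in>Poly_Mapping.keys P \<times> {..Max (insert 0 (Polynomial.degree ` Poly_Mapping.lookup P ` Poly_Mapping.keys P))}.
    kap (\<phi> (Polynomial.coeff (Poly_Mapping.lookup P \<alpha>) k)) * (omono m n vv \<alpha> * zc ^ k))"
proof -
  let ?N = "Max (insert 0 (Polynomial.degree ` Poly_Mapping.lookup P ` Poly_Mapping.keys P))"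
  have "lin sig (omono m n vv) P = (\<Sum>\<alpha>\<in>Poly_Mapping.keys P. \<Sum>k\<le>?N. kap (\<phi> (Polynomial.coeff (Poly_Mapping.lookup P \<alpha>) k)) * (omono m n vv \<alpha> * zc ^ k))"
    unfolding lin_def
  proof (intro sum.cong refl)
    fix \<alpha> assume "\<alpha> \<in> Poly_Mapping.keys P"
    then have d: "Polynomial.degree (Poly_Mapping.lookup P \<alpha>) \<le> ?N" by (intro Max_ge) auto
    have c: "zc ^ k * omono m n vv \<alpha> = omono m n vv \<alpha> * zc ^ k" for k by (rule commute_power[OF zc_omono])
    show "sig (Poly_Mapping.lookup P \<alpha>) * omono m n vv \<alpha>
     = (\<Sum>k\<le>?N. kap (\<phi> (Polynomial.coeff (Poly_Mapping.lookup P \<alpha>) k)) * (omono m n vv \<alpha> * zc ^ k))"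
     unfolding sig_def S.pe_bound[OF d] ke_def by (simp add: sum_distrib_right mult.assoc c)
  qed
  then show ?thesis by (simp add: sum.cartesian_product)
qed

text \<open>The operators satisfy the defining relations with \<open>zc\<close> for the
  indeterminate, so \<open>cweyl m n E B\<close> acts faithfully.\<close>

sublocale rep: qw_rep m n "\<lambda>j. [:E j:]" "\<lambda>j k. [:B j k:]" "[:0, 1:]" E' sig vv
proof
  show "1 \<le> m" by (rule m1)
  show "[:E j:] * E' j = 1" if "j \<in> {m..n}" for j using E'[OF that] .
  show "[:B j k:] * [:B k j:] = 1" if "j \<in> {m..n}" "k \<in> {m..n}" "j \<noteq> k" for j k
    using B_inv[of j k] that m1 by (simp add: one_pCons mult.commute)
  show "sig (a + b) = sig a + sig b" "sig (a * b) = sig a * sig b" for a b by (rule sig_simps)+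
  show "sig 1 = 1" by (rule sig_simps)
  show "sig r * vv g = vv g * sig r" if "g \<in> gens m n" for g r using sig_vv[OF that] .
  show "vv (Y j) * vv (Y k) = sig [:B j k:] * vv (Y k) * vv (Y j)" if "m \<le> j" "j \<le> n" "m \<le> k" "k \<le> n" for j k
    using yy_yy[of j k] that m1 by (simp add: sig_simps ke_def)
  show "vv (X j) * vv (X k) = sig ([:E j:] * [:B j k:]) * vv (X k) * vv (X j)" if "m \<le> j" "j < k" "k \<le> n" for j k
    using xx_xx[of j k] that m1 unfolding sig_simps by (simp add: ke_def kap_mult mult.assoc)
  show "vv (X j) * vv (Y k) = sig [:B k j:] * vv (Y k) * vv (X j)" if "m \<le> j" "j < k" "k \<le> n" for j k
    using xx_yy[of j k] that m1 by (simp add: sig_simps ke_def mult.assoc)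
  show "vv (X j) * vv (Y k) = sig ([:E k:] * [:B k j:]) * vv (Y k) * vv (X j)" if "m \<le> k" "k < j" "j \<le> n" for j k
    using xx_yy[of j k] that m1 unfolding sig_simps by (simp add: ke_def kap_mult mult.assoc)
  show "vv (X j) * vv (Y j) - sig [:E j:] * vv (Y j) * vv (X j)
     = sig [:0, 1:] + (\<Sum>i\<in>{m..<j}. sig ([:E i:] - 1) * vv (Y i) * vv (X i))" if "m \<le> j" "j \<le> n" for j
  proof -
    have "sig ([:E i:] - 1) = kap (ee i - 1)" for i
     using sig_simps(5)[of "E i - 1"] by (simp add: one_pCons ke_def \<phi>_diff)
    then show ?thesis using xx_yy_same[of j] zz_sum[of m j] that m1 by (simp add: sig_simps ke_def mult.assoc zc_def)
  qed
  \<comment> \<open>Coefficients are expanded in powers of \<open>zc\<close> up to a common degree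
    bound, which reduces the claim to independence over pairs of an exponent vector and a
    degree.\<close>
  fix P assume P: "\<forall>\<alpha>\<in>Poly_Mapping.keys P. Poly_Mapping.keys \<alpha> \<subseteq> gens m n" and z: "lin sig (omono m n vv) P = 0"
  let ?N = "Max (insert 0 (Polynomial.degree ` Poly_Mapping.lookup P ` Poly_Mapping.keys P))"
  have z0: "\<phi> (Polynomial.coeff (Poly_Mapping.lookup P \<alpha>) k) = 0" if "\<alpha> \<in> Poly_Mapping.keys P" "k \<le> ?N" for \<alpha> k
  proof -
    have "(case (\<alpha>, k) of (\<alpha>, k) \<Rightarrow> \<phi> (Polynomial.coeff (Poly_Mapping.lookup P \<alpha>) k)) = 0"
     by (rule pbw_family[where I = "Poly_Mapping.keys P \<times> {..?N}" and \<alpha> = fst and k = snd])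
      (use P z that in \<open>auto simp: omono_lin case_prod_unfold\<close>)
    then show ?thesis by simp
  qed
  have "Poly_Mapping.lookup P \<alpha> = 0" for \<alpha>
  proof (cases "\<alpha> \<in> Poly_Mapping.keys P")
    case True
    then have "Polynomial.degree (Poly_Mapping.lookup P \<alpha>) \<le> ?N" by (intro Max_ge) auto
    then have "Polynomial.lead_coeff (Poly_Mapping.lookup P \<alpha>) = 0" using z0[OF True] by simp
    then show ?thesis by simp
  qed (simp add: in_keys_iff)
  then show "P = 0" by (intro poly_mapping_eqI) simp
qed

lemma cweyl_Q: "cweyl m n E B = qweyl m n (\<lambda>j. [:E j:]) (\<lambda>j k. [:B j k:]) [:0, 1:]"
  by (simp add: cweyl_def)

abbreviation "R \<equiv> cweyl m n E B"
abbreviation "hh \<equiv> rep.hh"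

lemma emb_R: "ring_embedding R hh"
  unfolding cweyl_Q by (rule rep.embedding)

sublocale emb: ring_embedding R hh
  by (rule emb_R)

lemma hh_scal: "hh (cw_scal m n E B p) = sig p" and scal_carrier: "cw_scal m n E B p \<in> carrier R"
  unfolding cw_scal_def cw_class_def cweyl_Q by (auto simp: rep.hh_cls rep.ev_fscal intro: rep.cls_closed)

lemma hh_const: "hh (cw_const m n E B a) = ke a" and const_carrier: "cw_const m n E B a \<in> carrier R"
  unfolding cw_const_def by (simp_all add: hh_scal scal_carrier sig_simps)

lemma hh_c: "hh (cw_c m n E B) = zc" and c_carrier: "cw_c m n E B \<in> carrier R"
  unfolding cw_c_def by (simp_all add: hh_scal scal_carrier sig_simps)

lemma hh_gen: "g \<in> G \<Longrightarrow> hh (cw_gen m n E B g) = vv g" and gen_carrier: "g \<in> G \<Longrightarrow> cw_gen m n E B g \<in> carrier R"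
  unfolding cw_gen_def cw_class_def cweyl_Q by (auto simp: rep.hh_cls rep.ev_fgen intro: rep.cls_closed)

subsection \<open>The central polynomial ring\<close>

definition iota0 :: "((gen \<Rightarrow>\<^sub>0 nat) \<Rightarrow>\<^sub>0 't) \<Rightarrow> 'k op" where "iota0 = lin ke (cm m)"
text \<open>The outer variable goes to the parameter \<open>zc\<close>, the inner variables to the
  central powers \<open>uu g\<close>. With the parameter outermost, claims about the degree in
  \<open>c\<close> are claims about coefficients of a univariate polynomial.\<close>

definition iota :: "((gen \<Rightarrow>\<^sub>0 nat) \<Rightarrow>\<^sub>0 't) poly \<Rightarrow> 'k op" where "iota = peval iota0 zc"
definition S0 :: "((gen \<Rightarrow>\<^sub>0 nat) \<Rightarrow>\<^sub>0 't) poly set" where "S0 = {D. over_gens G D}"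

lemma iota0_add: "iota0 (p + q) = iota0 p + iota0 q"
  unfolding iota0_def by (rule lin_add) (simp_all add: ke_add)

lemma iota0_mult: "iota0 (p * q) = iota0 p * iota0 q"
  unfolding iota0_def by (rule lin_mult) (simp_all add: ke_add ke_mult cm_add[OF m1] ke_comm[of "cm m \<alpha>" for \<alpha>])

lemma iota0_single: "iota0 (Poly_Mapping.single \<alpha> a) = ke a * cm m \<alpha>"
  unfolding iota0_def by (rule lin_single) simp

lemma iota0_1: "iota0 1 = 1"
  using iota0_single[of 0 1] by simp

lemma iota0_comm: "(\<And>\<alpha>. cm m \<alpha> * w = w * cm m \<alpha>) \<Longrightarrow> iota0 p * w = w * iota0 p"
  unfolding iota0_def lin_def by (intro commute_sum commute_mult) (simp_all add: ke_comm[of w])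

sublocale C: peval_hom iota0 zc
  by unfold_locales (use mn in \<open>simp_all add: iota0_add iota0_mult iota0_1 iota0_comm cm_zz[OF m1] zc_def\<close>)

lemma iota_comm: "(\<And>\<alpha>. cm m \<alpha> * w = w * cm m \<alpha>) \<Longrightarrow> zc * w = w * zc \<Longrightarrow> iota p * w = w * iota p"
  unfolding iota_def by (rule C.pe_comm) (simp_all add: iota0_comm)

lemma iota_vv: "g \<in> G \<Longrightarrow> iota p * vv g = vv g * iota p"
  by (rule iota_comm) (simp_all add: zc_vv cm_vv[OF m1 G1])

lemma iota_zc: "iota p * zc = zc * iota p"
  by (rule iota_comm) (use mn in \<open>simp_all add: cm_zz[OF m1] zc_def\<close>)

lemma iota_omono: "iota p * omono m n vv \<alpha> = omono m n vv \<alpha> * iota p"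
  by (rule omono_commute[symmetric]) (simp add: iota_vv)

lemma iota_sig: "iota p * sig q = sig q * iota p"
  unfolding sig_def by (rule S.pe_comm[symmetric]) (simp_all add: ke_comm[of "iota p"] iota_zc)

lemma iota_monom: "iota (Polynomial.monom (Poly_Mapping.single \<beta> a) k) = ke a * (cm m \<beta> * zc ^ k)"
  unfolding iota_def C.pe_monom iota0_single by (simp add: mult.assoc)

lemma iota_const: "iota [:a:] = iota0 a"
  unfolding iota_def by (rule C.pe_const)

lemma iota_simps: "iota (p + q) = iota p + iota q" "iota (p * q) = iota p * iota q" "iota 1 = 1" "iota 0 = 0"
  "iota (p ^ k) = iota p ^ k" "iota (sum f I) = (\<Sum>i\<in>I. iota (f i))" "iota (p - q) = iota p - iota q" "iota (- p) = - iota p"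
  unfolding iota_def by (simp_all only: C.pe_add C.pe_mult C.pe_one C.pe_0 C.pe_power C.pe_sum C.pe_diff C.pe_uminus)

lemma iota_expand:
  assumes "Polynomial.degree D \<le> N" "finite K" "\<And>k. Poly_Mapping.keys (Polynomial.coeff D k) \<subseteq> K"
  shows "iota D = (\<Sum>k\<le>N. \<Sum>\<beta>\<in>K. kap (\<phi> (Poly_Mapping.lookup (Polynomial.coeff D k) \<beta>)) * (cm m \<beta> * zc ^ k))"
  unfolding iota_def C.pe_bound[OF assms(1)]
  by (intro sum.cong refl)
    (simp add: iota0_def lin_superset[where \<sigma> = ke and K = K, OF ke_0 assms(2,3)] sum_distrib_right mult.assoc ke_def)

definition expo :: "(gen \<Rightarrow>\<^sub>0 nat) \<Rightarrow> (gen \<Rightarrow>\<^sub>0 nat) \<Rightarrow> gen \<Rightarrow>\<^sub>0 nat" where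
  "expo \<beta> \<rho> = fpm G (\<lambda>g. L (idx g) * Poly_Mapping.lookup \<beta> g + Poly_Mapping.lookup \<rho> g)"

lemma keys_expo: "Poly_Mapping.keys (expo \<beta> \<rho>) \<subseteq> G"
  unfolding expo_def by (rule keys_fpm[OF finite_gens])

lemma omono_expo: "omono m n vv (expo \<beta> \<rho>) = cm m \<beta> * omono m n vv \<rho>"
  by (rule omono_split[OF m1]) (simp add: expo_def lookup_fpm finite_gens)

definition Box :: "(gen \<Rightarrow>\<^sub>0 nat) set" where
  "Box = {\<rho>. Poly_Mapping.keys \<rho> \<subseteq> G \<and> (\<forall>g\<in>G. Poly_Mapping.lookup \<rho> g < L (idx g))}"

lemma L_pos_G: "g \<in> G \<Longrightarrow> 0 < L (idx g)"
  using L_pos m1 by (auto simp: gens_def)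

lemma bij_Box: "bij_betw (\<lambda>\<rho>. restrict (Poly_Mapping.lookup \<rho>) G) Box (PiE G (\<lambda>g. {..<L (idx g)}))"
proof (rule bij_betwI[where g = "fpm G"])
  show "(\<lambda>\<rho>. restrict (Poly_Mapping.lookup \<rho>) G) \<in> Box \<rightarrow> PiE G (\<lambda>g. {..<L (idx g)})"
    by (auto simp: Box_def)
  show "fpm G \<in> PiE G (\<lambda>g. {..<L (idx g)}) \<rightarrow> Box"
    using keys_fpm[OF finite_gens] by (auto simp: Box_def lookup_fpm finite_gens PiE_def Pi_def)
  fix \<rho> assume "\<rho> \<in> Box"
  then have "Poly_Mapping.lookup \<rho> g = 0" if "g \<notin> G" for g using that by (auto simp: Box_def in_keys_iff)
  then show "fpm G (restrict (Poly_Mapping.lookup \<rho>) G) = \<rho>"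
    by (intro poly_mapping_eqI) (simp add: lookup_fpm finite_gens)
next
  fix f assume "f \<in> PiE G (\<lambda>g. {..<L (idx g)})"
  then show "restrict (Poly_Mapping.lookup (fpm G f)) G = f"
    by (auto simp: fun_eq_iff lookup_fpm finite_gens PiE_def extensional_def)
qed

lemma finite_Box: "finite Box"
  using bij_betw_finite[OF bij_Box] finite_PiE[OF finite_gens, of m n "\<lambda>g. {..<L (idx g)}"] by simp

lemma card_Box: "card Box = (\<Prod>j\<in>{m..n}. (L j)\<^sup>2)"
proof -
  have "card Box = (\<Prod>g\<in>G. L (idx g))"
    using bij_betw_same_card[OF bij_Box] by (simp add: card_PiE finite_gens)
  also have "\<dots> = (\<Prod>g\<in>X ` {m..n}. L (idx g)) * (\<Prod>g\<in>Y ` {m..n}. L (idx g))"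
    unfolding gens_alt by (rule prod.union_disjoint) auto
  also have "\<dots> = (\<Prod>j\<in>{m..n}. (L j)\<^sup>2)"
    by (simp add: prod.reindex inj_on_def power2_eq_square prod.distrib)
  finally show ?thesis .
qed

lemma expo_inj:
  assumes "expo \<beta> \<rho> = expo \<beta>' \<rho>'" "\<rho> \<in> Box" "\<rho>' \<in> Box" "Poly_Mapping.keys \<beta> \<subseteq> G" "Poly_Mapping.keys \<beta>' \<subseteq> G"
  shows "\<beta> = \<beta>' \<and> \<rho> = \<rho>'"
proof -
  have eq: "Poly_Mapping.lookup \<beta> g = Poly_Mapping.lookup \<beta>' g \<and> Poly_Mapping.lookup \<rho> g = Poly_Mapping.lookup \<rho>' g" for g
  proof (cases "g \<in> G")
    case True
    let ?l = "L (idx g)"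
    have "Poly_Mapping.lookup (expo \<beta> \<rho>) g = Poly_Mapping.lookup (expo \<beta>' \<rho>') g" using assms(1) by simp
    then have e: "?l * Poly_Mapping.lookup \<beta> g + Poly_Mapping.lookup \<rho> g = ?l * Poly_Mapping.lookup \<beta>' g + Poly_Mapping.lookup \<rho>' g"
     using True by (simp add: expo_def lookup_fpm finite_gens)
    have r: "Poly_Mapping.lookup \<rho> g < ?l" "Poly_Mapping.lookup \<rho>' g < ?l" using assms True by (auto simp: Box_def)
    have "(?l * Poly_Mapping.lookup \<beta> g + Poly_Mapping.lookup \<rho> g) div ?l = Poly_Mapping.lookup \<beta> g"
     "(?l * Poly_Mapping.lookup \<beta>' g + Poly_Mapping.lookup \<rho>' g) div ?l = Poly_Mapping.lookup \<beta>' g"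
     using r by simp_all
    then have "Poly_Mapping.lookup \<beta> g = Poly_Mapping.lookup \<beta>' g" unfolding e by simp
    then show ?thesis using e by simp
  next
    case False
    then show ?thesis
     using assms(2-5) lookup_0_gens[of \<beta> G g] lookup_0_gens[of \<beta>' G g] lookup_0_gens[of \<rho> G g] lookup_0_gens[of \<rho>' G g]
     by (auto simp: Box_def)
  qed
  then show ?thesis by (auto intro: poly_mapping_eqI)
qed

text \<open>A term is given by \<open>(\<rho>, k, \<beta>)\<close>, and division by \<open>L\<close>
  recovers \<open>\<beta>\<close> and \<open>\<rho>\<close> from the exponent
  \<open>L \<beta> + \<rho>\<close>. So the claim is independence of ordered monomials times powers
  of \<open>zc\<close>.\<close>

lemma iota_basis_indep:
  assumes D: "\<And>\<rho>. \<rho> \<in> Box \<Longrightarrow> D \<rho> \<in> S0" and z: "(\<Sum>\<rho>\<in>Box. iota (D \<rho>) * omono m n vv \<rho>) = 0" and \<rho>: "\<rho> \<in> Box"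
  shows "D \<rho> = 0"
proof -
  define N where "N = Max (insert 0 ((\<lambda>\<rho>. Polynomial.degree (D \<rho>)) ` Box))"
  define K where "K = (\<Union>\<rho>\<in>Box. \<Union>k\<le>N. Poly_Mapping.keys (Polynomial.coeff (D \<rho>) k))"
  have finK: "finite K" unfolding K_def using finite_Box by auto
  have deg: "Polynomial.degree (D \<rho>) \<le> N" if "\<rho> \<in> Box" for \<rho>
    unfolding N_def using that finite_Box by (intro Max_ge) auto
  have keys: "Poly_Mapping.keys (Polynomial.coeff (D \<rho>) k) \<subseteq> K" if "\<rho> \<in> Box" for \<rho> k
  proof (cases "k \<le> N")
    case False
    then have "Polynomial.coeff (D \<rho>) k = 0" using deg[OF that] by (intro Polynomial.coeff_eq_0) simp
    then show ?thesis by simp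
  qed (use that in \<open>auto simp: K_def\<close>)
  have KG: "Poly_Mapping.keys \<beta> \<subseteq> G" if "\<beta> \<in> K" for \<beta> using that D by (fastforce simp: K_def S0_def over_gens_def)
  let ?t = "\<lambda>(\<rho>, k, \<beta>). \<phi> (Poly_Mapping.lookup (Polynomial.coeff (D \<rho>) k) \<beta>)"
  have "0 = (\<Sum>\<rho>\<in>Box. \<Sum>k\<le>N. \<Sum>\<beta>\<in>K. kap (\<phi> (Poly_Mapping.lookup (Polynomial.coeff (D \<rho>) k) \<beta>)) * (omono m n vv (expo \<beta> \<rho>) * zc ^ k))"
    unfolding z[symmetric]
  proof (intro sum.cong refl)
    fix \<rho> assume "\<rho> \<in> Box"
    have c: "zc ^ k * omono m n vv \<rho> = omono m n vv \<rho> * zc ^ k" for k by (rule commute_power[OF zc_omono])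
    show "iota (D \<rho>) * omono m n vv \<rho> = (\<Sum>k\<le>N. \<Sum>\<beta>\<in>K. kap (\<phi> (Poly_Mapping.lookup (Polynomial.coeff (D \<rho>) k) \<beta>)) * (omono m n vv (expo \<beta> \<rho>) * zc ^ k))"
     unfolding iota_expand[OF deg[OF \<open>\<rho> \<in> Box\<close>] finK keys[OF \<open>\<rho> \<in> Box\<close>]] omono_expo
     by (simp add: sum_distrib_right mult.assoc c)
  qed
  also have "\<dots> = (\<Sum>i\<in>Box \<times> {..N} \<times> K. kap (?t i) * (omono m n vv (expo (snd (snd i)) (fst i)) * zc ^ fst (snd i)))"
    by (simp add: sum.cartesian_product case_prod_unfold)
  finally have z': "(\<Sum>i\<in>Box \<times> {..N} \<times> K. kap (?t i) * (omono m n vv (expo (snd (snd i)) (fst i)) * zc ^ fst (snd i))) = 0" by simp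
  have inj: "inj_on (\<lambda>i. (expo (snd (snd i)) (fst i), fst (snd i))) (Box \<times> {..N} \<times> K)"
  proof (rule inj_onI)
    fix i i' assume i: "i \<in> Box \<times> {..N} \<times> K" "i' \<in> Box \<times> {..N} \<times> K"
     and eq: "(expo (snd (snd i)) (fst i), fst (snd i)) = (expo (snd (snd i')) (fst i'), fst (snd i'))"
    have mem: "snd (snd i) \<in> K" "snd (snd i') \<in> K" "fst i \<in> Box" "fst i' \<in> Box" using i by auto
    have "snd (snd i) = snd (snd i') \<and> fst i = fst i'"
     by (rule expo_inj) (use mem KG[OF mem(1)] KG[OF mem(2)] eq in simp_all)
    then show "i = i'" using eq by (auto simp: prod_eq_iff)
  qed
  have finI: "finite (Box \<times> {..N} \<times> K)" using finK finite_Box by simp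
  have "?t (\<rho>, k, \<beta>) = 0" if "k \<le> N" "\<beta> \<in> K" for k \<beta>
    by (rule pbw_family[OF finI keys_expo inj z']) (use \<rho> that in simp)
  then have t: "Poly_Mapping.lookup (Polynomial.coeff (D \<rho>) k) \<beta> = 0" if "k \<le> N" "\<beta> \<in> K" for k \<beta> using that by simp
  have "Polynomial.coeff (D \<rho>) k = 0" for k
  proof (rule poly_mapping_eqI)
    fix \<beta> show "Poly_Mapping.lookup (Polynomial.coeff (D \<rho>) k) \<beta> = Poly_Mapping.lookup 0 \<beta>"
    proof (cases "k \<le> N \<and> \<beta> \<in> K")
     case True then show ?thesis using t by simp
    next
     case False
     then show ?thesis using keys[OF \<rho>, of k] deg[OF \<rho>] Polynomial.coeff_eq_0[of "D \<rho>" k]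
      by (cases "k \<le> N") (auto simp: in_keys_iff)
    qed
  qed
  then show ?thesis by (simp add: poly_eq_iff)
qed

text \<open>An equation in the centre is an equation between multiples of the basis element with
  exponent 0.\<close>

lemma iota_inj: "inj_on iota S0"
proof (rule inj_onI)
  fix D D' assume D: "D \<in> S0" "D' \<in> S0" "iota D = iota D'"
  have 0: "0 \<in> Box" using L_pos_G by (auto simp: Box_def)
  let ?D = "\<lambda>\<rho> :: gen \<Rightarrow>\<^sub>0 nat. if \<rho> = 0 then D - D' else 0"
  have "D - D' \<in> S0" using D over_gens_add[of G D "- D'"] by (simp add: S0_def over_gens_uminus)
  then have a1: "?D \<rho> \<in> S0" for \<rho> by (simp add: S0_def over_gens_0)
  have a2: "(\<Sum>\<rho>\<in>Box. iota (?D \<rho>) * omono m n vv \<rho>) = 0"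
    using D by (intro sum.neutral) (simp add: iota_simps)
  have "?D 0 = 0" by (rule iota_basis_indep[where D = ?D, OF a1 a2 0])
  then show "D = D'" by simp
qed

lemma subring_cw_sub: "subring (cw_sub m n E B L) R"
  and cw_sub_gens: "range (cw_scal m n E B) \<union> (\<lambda>g. cw_gen m n E B g [^]\<^bsub>R\<^esub> L (idx g)) ` G \<subseteq> carrier R"
proof -
  interpret ring R by (rule emb.ring)
  show 1: "range (cw_scal m n E B) \<union> (\<lambda>g. cw_gen m n E B g [^]\<^bsub>R\<^esub> L (idx g)) ` G \<subseteq> carrier R"
    using scal_carrier gen_carrier by auto
  show "subring (cw_sub m n E B L) R" unfolding cw_sub_def by (rule generate_ring_is_subring[OF 1])
qed

text \<open>One inclusion is an induction over the generated subring; for the other, each ingredient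
  of \<open>iota\<close> is the image of an element of the subring.\<close>

lemma hh_cw_sub: "hh ` cw_sub m n E B L = iota ` S0"
proof (intro Set.equalityI subsetI)
  interpret ring R by (rule emb.ring)
  note car = generate_ring_in_carrier[OF cw_sub_gens]
  fix a assume "a \<in> hh ` cw_sub m n E B L"
  then obtain c where "c \<in> generate_ring R (range (cw_scal m n E B) \<union> (\<lambda>g. cw_gen m n E B g [^]\<^bsub>R\<^esub> L (idx g)) ` G)"
    "a = hh c" by (auto simp: cw_sub_def)
  moreover from this(1) have "hh c \<in> iota ` S0"
  proof (induction rule: generate_ring.induct)
    case one
    show ?case using emb.h_one iota_simps(3) over_gens_1 by (force simp: S0_def)
  next
    case (incl c)
    then consider p where "c = cw_scal m n E B p" | g where "g \<in> G" "c = cw_gen m n E B g [^]\<^bsub>R\<^esub> L (idx g)" by auto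
    then show ?case
    proof cases
     case 1
     let ?D = "\<Sum>k\<le>Polynomial.degree p. Polynomial.monom (Poly_Mapping.single 0 (Polynomial.coeff p k)) k"
     have "hh c = sig p" by (simp add: 1 hh_scal)
     also have "\<dots> = iota ?D" by (simp add: sig_def peval_def iota_simps iota_monom)
     finally have "hh c = iota ?D" .
     moreover have "?D \<in> S0" unfolding S0_def by (auto intro!: over_gens_sum over_gens_monom)
     ultimately show ?thesis by blast
    next
     case 2
     have "cm m (Poly_Mapping.single g 1) = uu g"
     proof -
      have "omono m n uu (Poly_Mapping.single g 1) = prod_list (map (\<lambda>j. if j = idx g then uu g else 1) [m..<Suc n])"
       unfolding omono_def
       by (intro arg_cong[of _ _ prod_list] map_cong refl) (cases g; auto simp: lookup_single when_def)
      also have "\<dots> = uu g"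
      proof -
       have PL: "prod_list (map (\<lambda>j. if j = i then u else 1) js) = (if i \<in> set js then u else 1)"
        if "distinct js" for js i and u :: "'k op" using that by (induction js) auto
       show ?thesis using 2(1) PL[of "[m..<Suc n]" "idx g" "uu g"] by (simp add: gens_def less_Suc_eq_le del: upt_Suc)
      qed
      finally show ?thesis by (simp add: cm_def)
     qed
     then have "hh c = iota (Polynomial.monom (Poly_Mapping.single (Poly_Mapping.single g 1) 1) 0)"
      unfolding iota_monom by (simp add: 2 emb.h_pow gen_carrier hh_gen uu_def)
     moreover have "Polynomial.monom (Poly_Mapping.single (Poly_Mapping.single g 1) 1) 0 \<in> S0"
      unfolding S0_def using 2 by (auto intro!: over_gens_monom)
     ultimately show ?thesis by blast
    qed
  next
    case (a_inv c)
    then obtain D where "D \<in> S0" "hh c = iota D" by auto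
    then have "hh (\<ominus>\<^bsub>R\<^esub> c) = iota (- D)" "- D \<in> S0"
     using emb.h_uminus[OF car[OF a_inv.hyps]] iota_simps(8)[of D] over_gens_uminus[of G D] by (simp_all add: S0_def)
    then show ?case by (metis imageI)
  next
    case (eng_add c c')
    then obtain D D' where "D \<in> S0" "hh c = iota D" "D' \<in> S0" "hh c' = iota D'" by auto
    then have "hh (c \<oplus>\<^bsub>R\<^esub> c') = iota (D + D')" "D + D' \<in> S0"
     using emb.h_add[OF car[OF eng_add.hyps(1)] car[OF eng_add.hyps(2)]] iota_simps(1)[of D D'] over_gens_add[of G D D']
     by (simp_all add: S0_def)
    then show ?case by (metis imageI)
  next
    case (eng_mult c c')
    then obtain D D' where "D \<in> S0" "hh c = iota D" "D' \<in> S0" "hh c' = iota D'" by auto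
    then have "hh (c \<otimes>\<^bsub>R\<^esub> c') = iota (D * D')" "D * D' \<in> S0"
     using emb.h_mult[OF car[OF eng_mult.hyps(1)] car[OF eng_mult.hyps(2)]] iota_simps(2)[of D D'] over_gens_mult[of G D D']
     by (simp_all add: S0_def)
    then show ?case by (metis imageI)
  qed
  ultimately show "a \<in> iota ` S0" by simp
next
  let ?C = "cw_sub m n E B L"
  interpret ring R by (rule emb.ring)
  have CC: "?C \<subseteq> carrier R" using subring_cw_sub by (rule subringE(1))
  have h0: "0 \<in> hh ` ?C" using emb.h_zero subringE(2)[OF subring_cw_sub] by (metis imageI)
  have h1: "1 \<in> hh ` ?C" using emb.h_one subringE(3)[OF subring_cw_sub] by (metis imageI)
  have ha: "a + b \<in> hh ` ?C" if ab: "a \<in> hh ` ?C" "b \<in> hh ` ?C" for a b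
  proof -
    obtain c d where cd: "c \<in> ?C" "d \<in> ?C" "a = hh c" "b = hh d" using ab by auto
    then have "a + b = hh (c \<oplus>\<^bsub>R\<^esub> d)" using emb.h_add[OF subsetD[OF CC cd(1)] subsetD[OF CC cd(2)]] cd(3,4) by simp
    then show ?thesis using cd subringE(7)[OF subring_cw_sub] by blast
  qed
  have hm: "a * b \<in> hh ` ?C" if ab: "a \<in> hh ` ?C" "b \<in> hh ` ?C" for a b
  proof -
    obtain c d where cd: "c \<in> ?C" "d \<in> ?C" "a = hh c" "b = hh d" using ab by auto
    then have "a * b = hh (c \<otimes>\<^bsub>R\<^esub> d)" using emb.h_mult[OF subsetD[OF CC cd(1)] subsetD[OF CC cd(2)]] cd(3,4) by simp
    then show ?thesis using cd subringE(6)[OF subring_cw_sub] by blast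
  qed
  have hp: "a ^ k \<in> hh ` ?C" if "a \<in> hh ` ?C" for a k using that by (induction k) (auto intro: h1 hm)
  have hs: "sum f J \<in> hh ` ?C" if "\<And>j. j \<in> J \<Longrightarrow> f j \<in> hh ` ?C" for f and J :: "'z set"
    using that by (induction J rule: infinite_finite_induct) (auto intro: h0 ha)
  have hl: "prod_list as \<in> hh ` ?C" if "\<And>a. a \<in> set as \<Longrightarrow> a \<in> hh ` ?C" for as
    using that by (induction as) (auto intro: h1 hm)
  have hu: "uu g \<in> hh ` ?C" if g: "g \<in> G" for g
  proof -
    have "cw_gen m n E B g [^]\<^bsub>R\<^esub> L (idx g) \<in> ?C" unfolding cw_sub_def using g by (auto intro: generate_ring.incl)
    moreover have "hh (cw_gen m n E B g [^]\<^bsub>R\<^esub> L (idx g)) = uu g"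
     using g by (simp add: emb.h_pow gen_carrier hh_gen uu_def)
    ultimately show ?thesis by (metis imageI)
  qed
  have hsc: "sig p \<in> hh ` ?C" for p
  proof -
    have "cw_scal m n E B p \<in> ?C" unfolding cw_sub_def by (auto intro: generate_ring.incl)
    then show ?thesis using hh_scal[of p] by (metis imageI)
  qed
  have hcm: "cm m \<alpha> \<in> hh ` ?C" for \<alpha>
    unfolding cm_def omono_def by (rule hl) (auto simp: gens_def simp del: upt_Suc intro!: hm hp hu)
  fix a assume "a \<in> iota ` S0"
  then obtain D where a: "a = iota D" by auto
  show "a \<in> hh ` ?C"
    unfolding a iota_def peval_def iota0_def lin_def
    by (intro hs hm hp hcm) (use hsc[of "[:_:]"] hsc[of "[:0, 1:]"] in \<open>simp_all add: sig_simps\<close>)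
qed

lemma hh_elem: "a \<in> hh ` carrier R \<longleftrightarrow> (\<exists>P. (\<forall>\<alpha>\<in>Poly_Mapping.keys P. Poly_Mapping.keys \<alpha> \<subseteq> G) \<and> a = lin sig (omono m n vv) P)"
  unfolding cweyl_Q rep.hh_image by auto

lemma iota_central: "a \<in> carrier R \<Longrightarrow> iota s * hh a = hh a * iota s"
proof -
  assume "a \<in> carrier R"
  then obtain P where "hh a = lin sig (omono m n vv) P" using hh_elem[of "hh a"] by auto
  moreover have "lin sig (omono m n vv) P * iota s = iota s * lin sig (omono m n vv) P"
    unfolding lin_def by (intro commute_sum commute_mult) (simp_all add: iota_sig iota_omono)
  ultimately show ?thesis by simp
qed

text \<open>From here on, discriminants of \<open>cweyl m n E B\<close> are computed with operators
  and commutative polynomials.\<close>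

sublocale dm: disc_model R hh "cw_sub m n E B L" S0 iota
proof (intro disc_model.intro disc_model_axioms.intro emb_R subring_cw_sub iota_inj hh_cw_sub iota_central)
qed (simp_all add: iota_simps(1-3) S0_def over_gens_1 over_gens_add over_gens_mult over_gens_uminus)

abbreviation "ev \<equiv> omono m n vv"

lemma omono_in: "Poly_Mapping.keys \<alpha> \<subseteq> G \<Longrightarrow> ev \<alpha> \<in> dm.\<A>"
  unfolding dm.\<A>_def hh_elem
  by (intro exI[of _ "Poly_Mapping.single \<alpha> 1"]) (simp add: lin_single sig_simps)

lemma sig_cm: "\<exists>D\<in>S0. sig p * cm m \<beta> = iota D" if "Poly_Mapping.keys \<beta> \<subseteq> G"
proof -
  let ?D = "\<Sum>k\<le>Polynomial.degree p. Polynomial.monom (Poly_Mapping.single \<beta> (Polynomial.coeff p k)) k"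
  have c: "zc ^ k * cm m \<beta> = cm m \<beta> * zc ^ k" for k
    by (rule commute_power) (use mn in \<open>simp add: cm_zz[OF m1] zc_def\<close>)
  have "iota ?D = sig p * cm m \<beta>"
    unfolding iota_simps iota_monom sig_def peval_def by (simp add: sum_distrib_right mult.assoc c)
  moreover have "?D \<in> S0" unfolding S0_def using that by (auto intro!: over_gens_sum over_gens_monom)
  ultimately show ?thesis by metis
qed

text \<open>For spanning, each exponent is split into quotient and remainder by \<open>L\<close>,
  and the terms with equal remainder are collected.\<close>

lemma tbasis_Box: "dm.tbasis Box ev"
  unfolding dm.tbasis_def
proof (intro conjI ballI allI impI)
  show "finite Box" by (rule finite_Box)
  show "ev \<rho> \<in> dm.\<A>" if "\<rho> \<in> Box" for \<rho> using that by (intro omono_in) (simp add: Box_def)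
  show "D \<rho> = 0" if "\<forall>\<rho>\<in>Box. D \<rho> \<in> S0" "(\<Sum>\<rho>\<in>Box. iota (D \<rho>) * ev \<rho>) = 0" "\<rho> \<in> Box" for D \<rho>
    using iota_basis_indep[of D] that by blast
  fix a assume "a \<in> dm.\<A>"
  then obtain P where P: "\<forall>\<alpha>\<in>Poly_Mapping.keys P. Poly_Mapping.keys \<alpha> \<subseteq> G" "a = lin sig ev P"
    unfolding dm.\<A>_def hh_elem by auto
  let ?r = "\<lambda>\<alpha>. fpm G (\<lambda>g. Poly_Mapping.lookup \<alpha> g mod L (idx g))"
  let ?q = "\<lambda>\<alpha>. fpm G (\<lambda>g. Poly_Mapping.lookup \<alpha> g div L (idx g))"
  have r: "?r \<alpha> \<in> Box" for \<alpha>
    using L_pos_G keys_fpm[OF finite_gens] by (auto simp: Box_def lookup_fpm finite_gens)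
  have split: "ev \<alpha> = cm m (?q \<alpha>) * ev (?r \<alpha>)" for \<alpha>
    by (rule omono_split[OF m1]) (simp add: lookup_fpm finite_gens)
  have "\<forall>\<alpha>. \<exists>D. D \<in> S0 \<and> sig (Poly_Mapping.lookup P \<alpha>) * cm m (?q \<alpha>) = iota D"
    using sig_cm[OF keys_fpm[OF finite_gens]] by blast
  from choice[OF this] obtain D where
    D: "\<And>\<alpha>. D \<alpha> \<in> S0" "\<And>\<alpha>. sig (Poly_Mapping.lookup P \<alpha>) * cm m (?q \<alpha>) = iota (D \<alpha>)" by blast
  have "a = (\<Sum>\<alpha>\<in>Poly_Mapping.keys P. iota (D \<alpha>) * ev (?r \<alpha>))"
    unfolding P(2) lin_def by (intro sum.cong refl) (subst split, simp only: D(2)[symmetric] mult.assoc)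
  also have "\<dots> = (\<Sum>\<rho>\<in>Box. \<Sum>\<alpha>\<in>{\<alpha> \<in> Poly_Mapping.keys P. ?r \<alpha> = \<rho>}. iota (D \<alpha>) * ev (?r \<alpha>))"
    using r by (intro sum.group[symmetric]) (auto simp: finite_Box)
  also have "\<dots> = (\<Sum>\<rho>\<in>Box. iota (\<Sum>\<alpha>\<in>{\<alpha> \<in> Poly_Mapping.keys P. ?r \<alpha> = \<rho>}. D \<alpha>) * ev \<rho>)"
    by (intro sum.cong refl) (simp add: iota_simps sum_distrib_right)
  finally show "\<exists>D. (\<forall>\<rho>\<in>Box. D \<rho> \<in> S0) \<and> a = (\<Sum>\<rho>\<in>Box. iota (D \<rho>) * ev \<rho>)"
    using D(1) by (intro exI[of _ "\<lambda>\<rho>. \<Sum>\<alpha>\<in>{\<alpha> \<in> Poly_Mapping.keys P. ?r \<alpha> = \<rho>}. D \<alpha>"]) (auto intro: dm.S0_sum)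
qed

end

section \<open>Units of the polynomial ring\<close>

text \<open>If a sum of exponents arises in one way only, its coefficient in the product is a
  product of two nonzero elements and cannot cancel.\<close>

lemma lookup_mult_extremal:
  fixes f h :: "(gen \<Rightarrow>\<^sub>0 nat) \<Rightarrow>\<^sub>0 't::idom"
  assumes a: "a \<in> Poly_Mapping.keys f" and b: "b \<in> Poly_Mapping.keys h"
    and ex: "\<And>a' b'. a' \<in> Poly_Mapping.keys f \<Longrightarrow> b' \<in> Poly_Mapping.keys h \<Longrightarrow> a' + b' = a + b \<Longrightarrow> a' = a \<and> b' = b"
  shows "a + b \<in> Poly_Mapping.keys (f * h)"
proof -
  let ?l = Poly_Mapping.lookup
  have "f * h = (\<Sum>a'\<in>Poly_Mapping.keys f. \<Sum>b'\<in>Poly_Mapping.keys h. Poly_Mapping.single (a' + b') (?l f a' * ?l h b'))"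
    by (subst poly_mapping_decomp[of f, symmetric], subst poly_mapping_decomp[of h, symmetric])
     (simp add: sum_product mult_single)
  then have "?l (f * h) (a + b) = (\<Sum>a'\<in>Poly_Mapping.keys f. \<Sum>b'\<in>Poly_Mapping.keys h.
     if a' = a then (if b' = b then ?l f a * ?l h b else 0) else 0)"
    by (simp only: lookup_sum) (intro sum.cong refl, use ex in \<open>auto simp: lookup_single when_def\<close>)
  also have "\<dots> = (\<Sum>a'\<in>Poly_Mapping.keys f. if a' = a then ?l f a * ?l h b else 0)"
    using b by (intro sum.cong refl) auto
  also have "\<dots> = ?l f a * ?l h b" using a by simp
  finally show ?thesis using a b by (simp add: in_keys_iff)
qed

text \<open>The product of the two largest monomials and that of the two smallest ones both survive
  in \<open>f * h = 1\<close>. Exponents being nonnegative, all four are the monomial 1.\<close>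

lemma pm_unit:
  fixes f h :: "(gen \<Rightarrow>\<^sub>0 nat) \<Rightarrow>\<^sub>0 't::idom"
  assumes fh: "f * h = 1"
  obtains a where "f = Poly_Mapping.single 0 a" "a dvd 1"
proof -
  let ?F = "Poly_Mapping.keys f" and ?H = "Poly_Mapping.keys h"
  have "f \<noteq> 0" "h \<noteq> 0" using fh by auto
  then have ne: "?F \<noteq> {}" "?H \<noteq> {}" by auto
  have z: "a = 0 \<and> b = 0" if "a + b = 0" for a b :: "gen \<Rightarrow>\<^sub>0 nat"
  proof -
    have "Poly_Mapping.lookup a k = 0 \<and> Poly_Mapping.lookup b k = 0" for k
     using arg_cong[OF that, of "\<lambda>c. Poly_Mapping.lookup c k"] by (simp add: lookup_add)
    then show ?thesis by (auto intro: poly_mapping_eqI)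
  qed
  have key1: "c \<in> Poly_Mapping.keys (f * h) \<Longrightarrow> c = 0" for c unfolding fh by (simp split: if_splits)
  have "Max ?F + Max ?H \<in> Poly_Mapping.keys (f * h)"
  proof (rule lookup_mult_extremal)
    fix a b assume ab: "a \<in> ?F" "b \<in> ?H" "a + b = Max ?F + Max ?H"
    have le: "a \<le> Max ?F" "b \<le> Max ?H" using ab by auto
    show "a = Max ?F \<and> b = Max ?H"
    proof (rule ccontr)
     assume "\<not> ?thesis"
     then have "a < Max ?F \<or> b < Max ?H" using le by auto
     then have "a + b < Max ?F + Max ?H" using le by (auto intro: add_less_le_mono add_le_less_mono)
     then show False using ab by simp
    qed
  qed (use ne in auto)
  then have mx: "Max ?F = 0" "Max ?H = 0" using z key1 by blast+
  have "Min ?F + Min ?H \<in> Poly_Mapping.keys (f * h)"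
  proof (rule lookup_mult_extremal)
    fix a b assume ab: "a \<in> ?F" "b \<in> ?H" "a + b = Min ?F + Min ?H"
    have le: "Min ?F \<le> a" "Min ?H \<le> b" using ab by auto
    show "a = Min ?F \<and> b = Min ?H"
    proof (rule ccontr)
     assume "\<not> ?thesis"
     then have "Min ?F < a \<or> Min ?H < b" using le by auto
     then have "Min ?F + Min ?H < a + b" using le by (auto intro: add_less_le_mono add_le_less_mono)
     then show False using ab by simp
    qed
  qed (use ne in auto)
  then have mn: "Min ?F = 0" "Min ?H = 0" using z key1 by blast+
  have "a = 0" if "a \<in> ?F" for a using Max_ge[OF finite_keys that] Min_le[OF finite_keys that] mx mn by simp
  then have F: "?F \<subseteq> {0}" by auto
  have "a = 0" if "a \<in> ?H" for a using Max_ge[OF finite_keys that] Min_le[OF finite_keys that] mx mn by simp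
  then have H: "?H \<subseteq> {0}" by auto
  have f: "f = Poly_Mapping.single 0 (Poly_Mapping.lookup f 0)"
    using F by (intro poly_mapping_eqI) (auto simp: lookup_single when_def in_keys_iff subset_iff)
  have h: "h = Poly_Mapping.single 0 (Poly_Mapping.lookup h 0)"
    using H by (intro poly_mapping_eqI) (auto simp: lookup_single when_def in_keys_iff subset_iff)
  have "Poly_Mapping.single 0 (Poly_Mapping.lookup f 0 * Poly_Mapping.lookup h 0) = (1 :: (gen \<Rightarrow>\<^sub>0 nat) \<Rightarrow>\<^sub>0 't)"
    using fh by (subst (asm) f, subst (asm) h) (simp add: mult_single)
  then have "Poly_Mapping.lookup f 0 * Poly_Mapping.lookup h 0 = 1"
    by (metis lookup_one_zero lookup_single_eq)
  then show thesis using that[OF f] by (metis dvdI)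
qed

lemma poly_pm_unit:
  fixes p q :: "((gen \<Rightarrow>\<^sub>0 nat) \<Rightarrow>\<^sub>0 't::idom) poly"
  assumes "p * q = 1"
  obtains a where "p = [:Poly_Mapping.single 0 a:]" "a dvd 1"
proof -
  have "p \<noteq> 0" "q \<noteq> 0" using assms by auto
  then have "Polynomial.degree p + Polynomial.degree q = 0" using assms by (metis degree_mult_eq degree_1)
  then obtain f h where fh: "p = [:f:]" "q = [:h:]" by (auto elim!: degree_eq_zeroE)
  then have "f * h = 1" using assms by (simp add: one_pCons mult.commute)
  then show thesis using pm_unit that fh by metis
qed

section \<open>Homogeneity of the discriminant\<close>

text \<open>Exponents of the outer variable are prescribed modulo \<open>q\<close> only, because the
  powers \<open>y_j^(L_j)\<close> have degree divisible by \<open>q\<close> and must count as degree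
  0. Weights are integers since differences of weights occur.\<close>

definition hmon :: "nat \<Rightarrow> int \<Rightarrow> 'c::zero poly \<Rightarrow> bool" where
  "hmon q w p \<longleftrightarrow> (\<forall>k. Polynomial.coeff p k \<noteq> 0 \<longrightarrow> int q dvd int k - w)"

lemma dvd_trans_diff: "int q dvd a - b \<Longrightarrow> int q dvd b - c \<Longrightarrow> int q dvd a - c"
  using dvd_add[of "int q" "a - b" "b - c"] by simp

lemma hmon_mult: "hmon q w p \<Longrightarrow> hmon q w' p' \<Longrightarrow> hmon q (w + w') (p * p' :: 'c::comm_ring_1 poly)"
  unfolding hmon_def
proof (intro allI impI)
  fix k assume h: "\<forall>k. Polynomial.coeff p k \<noteq> 0 \<longrightarrow> int q dvd int k - w" "\<forall>k. Polynomial.coeff p' k \<noteq> 0 \<longrightarrow> int q dvd int k - w'"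
    and "Polynomial.coeff (p * p') k \<noteq> 0"
  then have "\<exists>i\<le>k. Polynomial.coeff p i * Polynomial.coeff p' (k - i) \<noteq> 0"
    unfolding Polynomial.coeff_mult by (metis (no_types, lifting) atMost_iff sum.neutral)
  then obtain i where i: "i \<le> k" "Polynomial.coeff p i \<noteq> 0" "Polynomial.coeff p' (k - i) \<noteq> 0"
    by (metis mult_zero_left mult_zero_right)
  then have "int q dvd (int i - w) + (int (k - i) - w')" using h by (intro dvd_add) auto
  then show "int q dvd int k - (w + w')" using i(1) by (simp add: of_nat_diff algebra_simps)
qed

lemma hmon_sum: "(\<And>i. i \<in> I \<Longrightarrow> hmon q w (f i)) \<Longrightarrow> hmon q w (sum f I)"
  unfolding hmon_def Polynomial.coeff_sum by (metis (no_types, lifting) sum.neutral)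

lemma hmon_1: "hmon q 0 (1::'c::comm_ring_1 poly)"
  by (auto simp: hmon_def coeff_pCons one_pCons split: nat.splits)

lemma hmon_prod: "(\<And>i. i \<in> I \<Longrightarrow> hmon q (w i) (f i :: 'c::comm_ring_1 poly)) \<Longrightarrow> hmon q (sum w I) (prod f I)"
  by (induction I rule: infinite_finite_induct) (auto intro: hmon_mult hmon_1)

lemma hmon_cong: "hmon q w p \<Longrightarrow> int q dvd w - w' \<Longrightarrow> hmon q w' p"
  unfolding hmon_def using dvd_trans_diff by blast

text \<open>A permutation meets every row weight and every column weight exactly once, so all terms
  of the Leibniz formula have the same weight.\<close>

lemma hmon_detS:
  fixes A :: "'i \<Rightarrow> 'i \<Rightarrow> 'c::comm_ring_1 poly"
  assumes I: "finite I" and A: "\<And>i j. i \<in> I \<Longrightarrow> j \<in> I \<Longrightarrow> hmon q (w i + w j) (A i j)"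
  shows "hmon q (2 * (\<Sum>i\<in>I. w i)) (detS I A)"
  unfolding detS_def
proof (rule hmon_sum)
  fix p assume "p \<in> {p. p permutes I}"
  then have p: "p permutes I" by simp
  have "hmon q (\<Sum>i\<in>I. w i + w (p i)) (\<Prod>i\<in>I. A i (p i))"
    using p by (intro hmon_prod A) (auto simp: permutes_in_image)
  moreover have "(\<Sum>i\<in>I. w (p i)) = (\<Sum>i\<in>I. w i)" using sum.permute[OF p, of w] by (simp add: comp_def)
  ultimately have h: "hmon q (2 * (\<Sum>i\<in>I. w i)) (\<Prod>i\<in>I. A i (p i))" by (simp add: sum.distrib)
  have "hmon q 0 (of_int (sign p) :: 'c poly)"
    using hmon_1[of q] by (rule_tac sign_cases[of p]) (auto simp: hmon_def)
  from hmon_mult[OF this h] show "hmon q (2 * (\<Sum>i\<in>I. w i)) (of_int (sign p) * (\<Prod>i\<in>I. A i (p i)))" by simp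
qed

lemma hmon_pcompose:
  fixes p :: "'c::comm_ring_1 poly"
  assumes q: "0 < q" and h: "hmon q 0 p"
  defines "D \<equiv> \<Sum>k\<le>Polynomial.degree p. Polynomial.monom (Polynomial.coeff p (q * k)) k"
  shows "Polynomial.coeff D k = Polynomial.coeff p (q * k)"
    and "p = pcompose D (Polynomial.monom 1 q)"
proof -
  show c: "Polynomial.coeff D k = Polynomial.coeff p (q * k)" for k
  proof -
    have "Polynomial.coeff D k = (\<Sum>i\<le>Polynomial.degree p. if i = k then Polynomial.coeff p (q * k) else 0)"
     unfolding D_def Polynomial.coeff_sum by (intro sum.cong refl) auto
    also have "\<dots> = Polynomial.coeff p (q * k)"
    proof (cases "k \<le> Polynomial.degree p")
     case False
     moreover have "k \<le> q * k" using q by simp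
     ultimately have "Polynomial.degree p < q * k" by linarith
     then show ?thesis using False by (simp add: Polynomial.coeff_eq_0)
    qed simp
    finally show ?thesis .
  qed
  have "pcompose D (Polynomial.monom 1 q) = (\<Sum>k\<le>Polynomial.degree p. Polynomial.monom (Polynomial.coeff p (q * k)) (q * k))"
    unfolding D_def pcompose_sum
    by (intro sum.cong refl)
     (simp add: pcompose_altdef map_poly_monom poly_monom monom_power Polynomial.smult_monom)
  moreover have "p = (\<Sum>k\<le>Polynomial.degree p. Polynomial.monom (Polynomial.coeff p (q * k)) (q * k))"
  proof (rule poly_eqI)
    fix l
    have "Polynomial.coeff (\<Sum>k\<le>Polynomial.degree p. Polynomial.monom (Polynomial.coeff p (q * k)) (q * k)) l
      = (\<Sum>k\<le>Polynomial.degree p. if q * k = l then Polynomial.coeff p l else 0)"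
     unfolding Polynomial.coeff_sum by (intro sum.cong refl) auto
    also have "\<dots> = Polynomial.coeff p l"
    proof (cases "Polynomial.coeff p l = 0")
     case False
     then have "int q dvd int l - 0" using h by (auto simp: hmon_def)
     then obtain k where k: "l = q * k" by (auto simp: of_nat_dvd_iff elim: dvdE)
     have "l \<le> Polynomial.degree p" using False by (rule Polynomial.le_degree)
     then have "k \<le> Polynomial.degree p" using k q by (metis le_trans mult_le_mono1 nat_mult_1 Suc_leI One_nat_def)
     then show ?thesis using k q by simp
    qed (auto intro: sum.neutral)
    finally show "Polynomial.coeff p l = Polynomial.coeff (\<Sum>k\<le>Polynomial.degree p. Polynomial.monom (Polynomial.coeff p (q * k)) (q * k)) l" by simp
  qed
  ultimately show "p = pcompose D (Polynomial.monom 1 q)" by simp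
qed

text \<open>An operator is homogeneous of weight \<open>w\<close> modulo \<open>q\<close> if it shifts the grading of functions by \<open>w\<close>.\<close>

definition prj :: "((gen \<Rightarrow> int) \<Rightarrow> int) \<Rightarrow> nat \<Rightarrow> int \<Rightarrow> 'k::field op" where
  "prj W q r = mon (\<lambda>v. if int q dvd W v - r then 1 else 0) (\<lambda>_. 0)"

definition homo :: "((gen \<Rightarrow> int) \<Rightarrow> int) \<Rightarrow> nat \<Rightarrow> int \<Rightarrow> 'k::field op \<Rightarrow> bool" where
  "homo W q w a \<longleftrightarrow> (\<forall>r. prj W q r * a = a * prj W q (r + w))"

lemma homo_mult: "homo W q w a \<Longrightarrow> homo W q w' b \<Longrightarrow> homo W q (w + w') (a * b)"
  unfolding homo_def by (metis (no_types, lifting) add.assoc mult.assoc)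

lemma homo_add: "homo W q w a \<Longrightarrow> homo W q w b \<Longrightarrow> homo W q w (a + b)"
  unfolding homo_def by (simp add: distrib_left distrib_right)

lemma homo_0: "homo W q w 0"
  by (simp add: homo_def)

lemma homo_sum: "(\<And>i. i \<in> I \<Longrightarrow> homo W q w (f i)) \<Longrightarrow> homo W q w (sum f I)"
  by (induction I rule: infinite_finite_induct) (auto intro: homo_0 homo_add)

lemma homo_kap: "homo W q 0 (kap k)"
  by (simp add: homo_def kap_comm)

lemma homo_1: "homo W q 0 1"
  using homo_kap[of W q 1] by simp

lemma homo_power: "homo W q w a \<Longrightarrow> homo W q (int k * w) (a ^ k)"
proof (induction k)
  case (Suc k)
  then show ?case using homo_mult[OF Suc.prems Suc.IH[OF Suc.prems]] by (simp add: distrib_right)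
qed (simp add: homo_1)

lemma prj_cong: "int q dvd r - r' \<Longrightarrow> prj W q r = prj W q r'"
proof -
  assume d: "int q dvd r - r'"
  have "int q dvd W v - r \<longleftrightarrow> int q dvd W v - r'" for v
    using dvd_trans_diff[OF _ d, of "W v"] dvd_trans_diff[of q "W v" r' r] d by (metis dvd_minus_iff minus_diff_eq)
  then show ?thesis by (simp add: prj_def)
qed

lemma homo_cong: "homo W q w a \<Longrightarrow> int q dvd w - w' \<Longrightarrow> homo W q w' a"
  unfolding homo_def using prj_cong by (metis add_diff_cancel_left)

text \<open>The projection onto the class of \<open>v\<close> can be moved through \<open>a\<close>,
  so at \<open>v\<close> only the values of \<open>f\<close> on one residue class matter.\<close>

lemma homo_app:
  assumes "homo W q w a"
  shows "app a f v = app a (\<lambda>u. if int q dvd W u - (W v + w) then f u else 0) v"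
proof -
  have "app (prj W q (W v) * a) f v = app (a * prj W q (W v + w)) f v" using assms by (simp add: homo_def)
  moreover have "app (prj W q (W v + w)) f = (\<lambda>u. if int q dvd W u - (W v + w) then f u else 0)"
    by (simp add: fun_eq_iff prj_def app_mon)
  ultimately show ?thesis by (simp add: app_mult) (simp add: prj_def app_mon)
qed

text \<open>Restricting the test function to the class demanded by \<open>w'\<close> leaves summands
  of that weight unchanged and annihilates the others, incongruent classes being disjoint.\<close>

lemma homo_component:
  fixes a :: "'i \<Rightarrow> 'k::field op"
  assumes I: "finite I" and a: "\<And>i. i \<in> I \<Longrightarrow> homo W q (w i) (a i)" and A: "homo W q w' (\<Sum>i\<in>I. a i)"
  shows "(\<Sum>i\<in>I. a i) = (\<Sum>i\<in>I. if int q dvd w i - w' then a i else 0)"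
proof (rule app_eqI)
  fix f :: "(gen \<Rightarrow> int) \<Rightarrow> 'k" and v
  let ?f = "\<lambda>u. if int q dvd W u - (W v + w') then f u else 0"
  have "app (\<Sum>i\<in>I. a i) f v = (\<Sum>i\<in>I. app (a i) ?f v)"
    unfolding homo_app[OF A, of f v] by (rule app_sum)
  also have "\<dots> = (\<Sum>i\<in>I. app (if int q dvd w i - w' then a i else 0) f v)"
  proof (intro sum.cong refl)
    fix i assume i: "i \<in> I"
    show "app (a i) ?f v = app (if int q dvd w i - w' then a i else 0) f v"
    proof (cases "int q dvd w i - w'")
     case True
     then have "homo W q w' (a i)" using a[OF i] by (rule homo_cong[rotated])
     then show ?thesis using True homo_app[of W q w' "a i" f v] by simp
    next
     case False
     have "\<not> (int q dvd W u - (W v + w i) \<and> int q dvd W u - (W v + w'))" for u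
     proof
      assume "int q dvd W u - (W v + w i) \<and> int q dvd W u - (W v + w')"
      then have "int q dvd (W u - (W v + w')) - (W u - (W v + w i))"
       using dvd_diff[of "int q" "W u - (W v + w')" "W u - (W v + w i)"] by blast
      then show False using False by simp
     qed
     then have "(\<lambda>u. if int q dvd W u - (W v + w i) then ?f u else 0) = (\<lambda>u. 0 * f u)" by (auto simp: fun_eq_iff)
     then show ?thesis using False homo_app[OF a[OF i], of ?f v] app_smult[of "a i" 0 f v] by (simp add: app_zero)
    qed
  qed
  finally show "app (\<Sum>i\<in>I. a i) f v = app (\<Sum>i\<in>I. if int q dvd w i - w' then a i else 0) f v"
    by (simp add: app_sum)
qed

lemma homo_mon:
  assumes "\<And>v. W (\<lambda>g. v g + u g) = W v + W u"
  shows "homo W q (W u) (mon \<chi> u)"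
  unfolding homo_def prj_def mon_mult by (intro allI mon_cong) (auto simp: assms)

section \<open>The grading of the algebra and of its trace form\<close>

context weyl_at
begin

text \<open>Shifts along \<open>Y j\<close> and along \<open>X j\<close> count alike:
  \<open>yy j\<close> and \<open>zz j\<close> get degree 1, hence \<open>yi j\<close> degree -1 and
  \<open>xx j\<close> degree 0.\<close>

definition Wd :: "(gen \<Rightarrow> int) \<Rightarrow> int" where
  "Wd v = (\<Sum>j\<in>{0..n}. v (Y j) + v (X j))"

lemma Wd_add: "Wd (\<lambda>g. v g + u g) = Wd v + Wd u"
  unfolding Wd_def sum.distrib[symmetric] by (intro sum.cong refl) simp

lemma homo_yy: "j \<le> n \<Longrightarrow> homo Wd q 1 (yy j)" and homo_yi: "j \<le> n \<Longrightarrow> homo Wd q (- 1) (yi j)"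
  and homo_zz: "j \<le> n \<Longrightarrow> homo Wd q 1 (zz j)"
proof -
  assume j: "j \<le> n"
  have 1: "Wd (dlt (Y j)) = 1" "Wd (\<lambda>g. - dlt (Y j) g) = - 1" "Wd (zsh j) = 1"
    using j by (simp_all add: Wd_def dlt_def zsh_def sum_negf)
  show "homo Wd q 1 (yy j)" "homo Wd q (- 1) (yi j)" "homo Wd q 1 (zz j)"
    unfolding yy_def yi_def zz_def
    using homo_mon[where W = Wd and u = "dlt (Y j)", OF Wd_add] homo_mon[where W = Wd and u = "\<lambda>g. - dlt (Y j) g", OF Wd_add]
     homo_mon[where W = Wd and u = "zsh j", OF Wd_add] by (simp_all only: 1)
qed

lemma homo_xx: "j \<le> n \<Longrightarrow> homo Wd q 0 (xx j)"
proof -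
  assume j: "j \<le> n"
  have "homo Wd q 1 (zz j + kap (- 1) * zz (j - 1))"
    using homo_mult[OF homo_kap homo_zz[of "j - 1"], of q "- 1"] j by (intro homo_add homo_zz) auto
  then have "homo Wd q 1 (zz j - zz (j - 1))" by (simp add: kap_uminus)
  from homo_mult[OF homo_mult[OF homo_kap homo_yi[OF j]] this] show ?thesis unfolding xx_def by simp
qed

definition wt1 :: "(gen \<Rightarrow>\<^sub>0 nat) \<Rightarrow> int" where "wt1 \<alpha> = (\<Sum>j\<in>{m..n}. int (Poly_Mapping.lookup \<alpha> (Y j)))"

lemma homo_omono_gen:
  assumes "\<And>j. j \<in> {m..n} \<Longrightarrow> homo Wd q (w j) (v (Y j))" "\<And>j. j \<in> {m..n} \<Longrightarrow> homo Wd q 0 (v (X j))"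
  shows "homo Wd q (\<Sum>j\<in>{m..n}. int (Poly_Mapping.lookup \<alpha> (Y j)) * w j) (omono m n v \<alpha>)"
proof -
  have pl: "homo Wd q (\<Sum>j\<leftarrow>js. int (Poly_Mapping.lookup \<alpha> (Y j)) * w j)
     (prod_list (map (\<lambda>j. v (Y j) ^ Poly_Mapping.lookup \<alpha> (Y j) * v (X j) ^ Poly_Mapping.lookup \<alpha> (X j)) js))"
    if "set js \<subseteq> {m..n}" for js
    using that
  proof (induction js)
    case (Cons j js)
    have "homo Wd q (int (Poly_Mapping.lookup \<alpha> (Y j)) * w j + int (Poly_Mapping.lookup \<alpha> (X j)) * 0)
     (v (Y j) ^ Poly_Mapping.lookup \<alpha> (Y j) * v (X j) ^ Poly_Mapping.lookup \<alpha> (X j))"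
     using Cons.prems assms by (intro homo_mult homo_power) auto
    from homo_mult[OF this] show ?case using Cons by simp
  qed (simp add: homo_1)
  have "(\<Sum>j\<leftarrow>[m..<Suc n]. int (Poly_Mapping.lookup \<alpha> (Y j)) * w j) = (\<Sum>j\<in>{m..n}. int (Poly_Mapping.lookup \<alpha> (Y j)) * w j)"
    by (subst sum_list_distinct_conv_sum_set) (simp_all del: upt_Suc add: atLeastLessThanSuc_atLeastAtMost)
  then show ?thesis using pl[of "[m..<Suc n]"] unfolding omono_def by (simp del: upt_Suc add: atLeastLessThanSuc_atLeastAtMost)
qed

lemma homo_ev: "homo Wd q (wt1 \<alpha>) (ev \<alpha>)"
  using homo_omono_gen[of q "\<lambda>_. 1" vv \<alpha>] homo_yy homo_xx by (simp add: wt1_def)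

context
  fixes q :: nat
  assumes q0: "0 < q" and qL: "\<And>j. j \<in> {m..n} \<Longrightarrow> q dvd L j"
begin

lemma homo_cm: "homo Wd q 0 (cm m \<beta>)"
proof -
  have "homo Wd q (\<Sum>j\<in>{m..n}. int (Poly_Mapping.lookup \<beta> (Y j)) * 0) (omono m n uu \<beta>)"
  proof (rule homo_omono_gen)
    fix j assume j: "j \<in> {m..n}"
    then have "homo Wd q (int (L j) * 1) (yy j ^ L j)" by (intro homo_power homo_yy) simp
    then show "homo Wd q 0 (uu (Y j))" unfolding uu_def using qL[OF j] by (auto intro: homo_cong)
    have "homo Wd q (int (L j) * 0) (xx j ^ L j)" using j by (intro homo_power homo_xx) simp
    then show "homo Wd q 0 (uu (X j))" unfolding uu_def by simp
  qed
  then show ?thesis by (simp add: cm_def)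
qed

lemma homo_iota_monom: "homo Wd q (int k) (iota (Polynomial.monom a k))"
proof -
  have "homo Wd q 0 (iota0 a)" unfolding iota0_def lin_def ke_def
    using homo_mult[OF homo_kap homo_cm] by (intro homo_sum) simp
  moreover have "homo Wd q (int k * 1) (zc ^ k)" unfolding zc_def using mn by (intro homo_power homo_zz) simp
  ultimately show ?thesis unfolding iota_def C.pe_monom using homo_mult by fastforce
qed

text \<open>Dropping all components of the wrong degree from the expansion of \<open>a\<close> does
  not change \<open>a\<close>, so by uniqueness there were none.\<close>

lemma co_hmon:
  assumes a: "a \<in> dm.\<A>" and h: "homo Wd q w a" and \<tau>: "\<tau> \<in> Box"
  shows "hmon q (w - wt1 \<tau>) (dm.co Box ev a \<tau>)"
proof -
  let ?s = "dm.co Box ev a"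
  define N where "N = Max (insert 0 ((\<lambda>\<rho>. Polynomial.degree (?s \<rho>)) ` Box))"
  have deg: "Polynomial.degree (?s \<rho>) \<le> N" if "\<rho> \<in> Box" for \<rho>
    unfolding N_def using that finite_Box by (intro Max_ge) auto
  have poly_sum: "p = (\<Sum>k\<le>N. Polynomial.monom (Polynomial.coeff p k) k)" if "Polynomial.degree p \<le> N"
    for p :: "((gen \<Rightarrow>\<^sub>0 nat) \<Rightarrow>\<^sub>0 't) poly"
    using poly_as_sum_of_monoms'[OF that] by simp
  define s' where "s' \<rho> = (\<Sum>k\<le>N. if int q dvd (int k + wt1 \<rho>) - w then Polynomial.monom (Polynomial.coeff (?s \<rho>) k) k else 0)" for \<rho>
  let ?I = "Box \<times> {..N}"
  let ?a = "\<lambda>(\<rho>, k). iota (Polynomial.monom (Polynomial.coeff (?s \<rho>) k) k) * ev \<rho>"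
  have SS: "?s \<rho> \<in> S0" if "\<rho> \<in> Box" for \<rho> using dm.co(1)[OF tbasis_Box a that] .
  have mS: "Polynomial.monom (Polynomial.coeff (?s \<rho>) k) k \<in> S0" if "\<rho> \<in> Box" for \<rho> k
    using SS[OF that] by (auto simp: S0_def over_gens_def split: if_splits)
  have eq: "a = (\<Sum>i\<in>?I. ?a i)"
  proof -
    have "a = (\<Sum>\<rho>\<in>Box. iota (?s \<rho>) * ev \<rho>)" using dm.co(2)[OF tbasis_Box a] by simp
    also have "\<dots> = (\<Sum>\<rho>\<in>Box. \<Sum>k\<le>N. iota (Polynomial.monom (Polynomial.coeff (?s \<rho>) k) k) * ev \<rho>)"
    proof (intro sum.cong refl)
     fix \<rho> assume "\<rho> \<in> Box"
     show "iota (?s \<rho>) * ev \<rho> = (\<Sum>k\<le>N. iota (Polynomial.monom (Polynomial.coeff (?s \<rho>) k) k) * ev \<rho>)"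
      by (subst (1) poly_sum[OF deg[OF \<open>\<rho> \<in> Box\<close>]]) (simp add: iota_simps sum_distrib_right)
    qed
    finally show ?thesis by (simp add: sum.cartesian_product)
  qed
  have hc: "homo Wd q (int (snd i) + wt1 (fst i)) (?a i)" for i
    unfolding case_prod_unfold by (rule homo_mult[OF homo_iota_monom homo_ev])
  have finI: "finite ?I" using finite_Box by simp
  have hA: "homo Wd q w (\<Sum>i\<in>?I. ?a i)" unfolding eq[symmetric] by (rule h)
  have "(\<Sum>i\<in>?I. ?a i) = (\<Sum>i\<in>?I. if int q dvd (int (snd i) + wt1 (fst i)) - w then ?a i else 0)"
    by (rule homo_component[OF finI hc hA])
  then have "a = (\<Sum>i\<in>?I. if int q dvd (int (snd i) + wt1 (fst i)) - w then ?a i else 0)"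
    by (rule trans[OF eq])
  also have "\<dots> = (\<Sum>\<rho>\<in>Box. iota (s' \<rho>) * ev \<rho>)"
    unfolding s'_def iota_simps sum_distrib_right sum.cartesian_product
    by (intro sum.cong refl) (auto simp: iota_simps)
  finally have "a = (\<Sum>\<rho>\<in>Box. iota (s' \<rho>) * ev \<rho>)" .
  then have "?s \<tau> = s' \<tau>"
    by (rule dm.co_eqI[OF tbasis_Box _ _ a \<tau>, rotated])
     (auto simp: s'_def intro!: dm.S0_sum mS dm.S0_zero)
  moreover have "hmon q (w - wt1 \<tau>) (s' \<tau>)"
    unfolding s'_def by (rule hmon_sum) (auto simp: hmon_def algebra_simps)
  ultimately show ?thesis by simp
qed

text \<open>A diagonal entry compares \<open>a * ev \<tau>\<close> with \<open>ev \<tau>\<close>, so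
  the weight of \<open>ev \<tau>\<close> cancels.\<close>

lemma tr_hmon:
  assumes a: "a \<in> dm.\<A>" and h: "homo Wd q w a"
  shows "hmon q w (dm.tr Box ev a)"
  unfolding dm.tr_def
proof (rule hmon_sum)
  fix \<tau> assume \<tau>: "\<tau> \<in> Box"
  have "hmon q (w + wt1 \<tau> - wt1 \<tau>) (dm.co Box ev (a * ev \<tau>) \<tau>)"
    by (rule co_hmon) (use a h \<tau> homo_ev tbasis_Box dm.tbasis_in in \<open>auto intro!: dm.\<A>_mult homo_mult\<close>)
  then show "hmon q w (dm.co Box ev (a * ev \<tau>) \<tau>)" by simp
qed

text \<open>The involution \<open>L - 1 - \<rho>\<close> of the box pairs weights to a constant, so
  twice the sum is a multiple of the size of the box.\<close>

lemma wt1_sum: "int q dvd 2 * (\<Sum>\<rho>\<in>Box. wt1 \<rho>)"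
proof -
  let ?r = "\<lambda>\<rho>. fpm G (\<lambda>g. L (idx g) - 1 - Poly_Mapping.lookup \<rho> g)"
  have rB: "?r \<rho> \<in> Box" for \<rho>
    using keys_fpm[OF finite_gens] L_pos_G by (auto simp: Box_def lookup_fpm finite_gens less_imp_diff_less)
  have rr: "?r (?r \<rho>) = \<rho>" if "\<rho> \<in> Box" for \<rho>
  proof (rule poly_mapping_eqI)
    fix g
    show "Poly_Mapping.lookup (?r (?r \<rho>)) g = Poly_Mapping.lookup \<rho> g"
    proof (cases "g \<in> G")
     case True
     then have "Poly_Mapping.lookup \<rho> g < L (idx g)" using that by (auto simp: Box_def)
     then show ?thesis using True by (simp add: lookup_fpm finite_gens)
    next
     case False
     then show ?thesis using that lookup_0_gens[of \<rho> G g] by (simp add: Box_def lookup_fpm finite_gens)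
    qed
  qed
  have "bij_betw ?r Box Box" by (rule bij_betw_byWitness[where f' = ?r]) (use rB rr in auto)
  then have "(\<Sum>\<rho>\<in>Box. wt1 (?r \<rho>)) = (\<Sum>\<rho>\<in>Box. wt1 \<rho>)" by (rule sum.reindex_bij_betw)
  then have "2 * (\<Sum>\<rho>\<in>Box. wt1 \<rho>) = (\<Sum>\<rho>\<in>Box. wt1 \<rho> + wt1 (?r \<rho>))" by (simp add: sum.distrib)
  also have "\<dots> = (\<Sum>\<rho>\<in>Box. \<Sum>j\<in>{m..n}. int (L j) - 1)"
  proof (intro sum.cong refl)
    fix \<rho> assume \<rho>: "\<rho> \<in> Box"
    show "wt1 \<rho> + wt1 (?r \<rho>) = (\<Sum>j\<in>{m..n}. int (L j) - 1)"
     unfolding wt1_def sum.distrib[symmetric]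
    proof (intro sum.cong refl)
     fix j assume "j \<in> {m..n}"
     then have g: "Y j \<in> G" by (simp add: gens_def)
     then have "Poly_Mapping.lookup \<rho> (Y j) < L j" using \<rho> by (force simp: Box_def)
     then show "int (Poly_Mapping.lookup \<rho> (Y j)) + int (Poly_Mapping.lookup (?r \<rho>) (Y j)) = int (L j) - 1"
      using g by (simp add: lookup_fpm finite_gens)
    qed
  qed
  also have "\<dots> = int (card Box) * (\<Sum>j\<in>{m..n}. int (L j) - 1)" by simp
  \<comment> \<open>If there is a generator, a single factor \<open>(L m)^2\<close> of the size of
    the box is divisible by \<open>q\<close>; otherwise the sum over \<open>j\<close> is
    empty.\<close>
  also have "int q dvd \<dots>"
  proof (cases "m \<le> n")
    case True
    have "q dvd (L m)\<^sup>2" using qL[of m] True by (simp add: power2_eq_square)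
    also have "(L m)\<^sup>2 dvd card Box" unfolding card_Box using True by (intro dvd_prodI) auto
    finally show ?thesis by simp
  qed simp
  finally show ?thesis .
qed

text \<open>The Gram determinant of the standard basis, with which every discriminant is
  compared.\<close>

definition delta :: "((gen \<Rightarrow>\<^sub>0 nat) \<Rightarrow>\<^sub>0 't) poly" where
  "delta = detS Box (\<lambda>\<rho> \<tau>. dm.tr Box ev (ev \<rho> * ev \<tau>))"

lemma delta_hmon: "hmon q 0 delta"
proof -
  have "hmon q (2 * (\<Sum>\<rho>\<in>Box. wt1 \<rho>)) delta"
    unfolding delta_def
  proof (rule hmon_detS[OF finite_Box])
    fix \<rho> \<tau> assume "\<rho> \<in> Box" "\<tau> \<in> Box"
    then show "hmon q (wt1 \<rho> + wt1 \<tau>) (dm.tr Box ev (ev \<rho> * ev \<tau>))"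
     using dm.tbasis_in[OF tbasis_Box] by (intro tr_hmon dm.\<A>_mult homo_mult homo_ev) auto
  qed
  then show ?thesis by (rule hmon_cong) (use wt1_sum in simp)
qed

end

end

section \<open>The Gram matrix of a sublattice\<close>

text \<open>\<open>P\<close> is invertible over the fraction field only. Multiplying by its adjugate
  and cancelling the determinant at the end stays inside the domain.\<close>

lemma trace_similar:
  fixes P :: "'i \<Rightarrow> 'i \<Rightarrow> 'a::idom"
  assumes I: "finite I" and d: "detS I P \<noteq> 0"
    and PM: "\<And>i j. i \<in> I \<Longrightarrow> j \<in> I \<Longrightarrow> (\<Sum>k\<in>I. P i k * M k j) = (\<Sum>k\<in>I. N i k * P k j)"
  shows "(\<Sum>i\<in>I. M i i) = (\<Sum>i\<in>I. N i i)"
proof -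
  obtain A where A: "\<And>i j. i \<in> I \<Longrightarrow> j \<in> I \<Longrightarrow> (\<Sum>k\<in>I. P i k * A k j) = (if i = j then detS I P else 0)"
    "\<And>i j. i \<in> I \<Longrightarrow> j \<in> I \<Longrightarrow> (\<Sum>k\<in>I. A i k * P k j) = (if i = j then detS I P else 0)"
    using detS_adj[OF I, of P] by blast
  have "detS I P * (\<Sum>i\<in>I. M i i) = (\<Sum>i\<in>I. \<Sum>k\<in>I. (if i = k then detS I P else 0) * M k i)"
    using I by (simp add: sum_distrib_left if_distrib[of "\<lambda>a. a * _"] cong: if_cong)
  also have "\<dots> = (\<Sum>i\<in>I. \<Sum>k\<in>I. (\<Sum>l\<in>I. A i l * P l k) * M k i)"
    by (intro sum.cong refl) (simp only: A(2))
  also have "\<dots> = (\<Sum>i\<in>I. \<Sum>l\<in>I. A i l * (\<Sum>k\<in>I. P l k * M k i))"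
    unfolding sum_distrib_left sum_distrib_right mult.assoc by (rule sum.cong[OF refl]) (rule sum.swap)
  also have "\<dots> = (\<Sum>i\<in>I. \<Sum>l\<in>I. A i l * (\<Sum>k\<in>I. N l k * P k i))"
    by (intro sum.cong refl) (simp only: PM)
  also have "\<dots> = (\<Sum>i\<in>I. \<Sum>l\<in>I. \<Sum>k\<in>I. N l k * (P k i * A i l))"
    unfolding sum_distrib_left by (intro sum.cong refl) (simp only: mult_ac)
  also have "\<dots> = (\<Sum>l\<in>I. \<Sum>i\<in>I. \<Sum>k\<in>I. N l k * (P k i * A i l))" by (rule sum.swap)
  also have "\<dots> = (\<Sum>l\<in>I. \<Sum>k\<in>I. N l k * (\<Sum>i\<in>I. P k i * A i l))"
    unfolding sum_distrib_left by (rule sum.cong[OF refl]) (rule sum.swap)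
  also have "\<dots> = (\<Sum>l\<in>I. \<Sum>k\<in>I. N l k * (if k = l then detS I P else 0))"
    by (intro sum.cong refl) (simp only: A(1))
  also have "\<dots> = detS I P * (\<Sum>i\<in>I. N i i)"
    using I by (simp add: sum_distrib_left if_distrib[of "\<lambda>a. _ * a"] mult.commute cong: if_cong)
  finally show ?thesis using d by simp
qed

text \<open>Coefficients of the remainder of \<open>z\<^sup>m\<close> modulo the relation \<open>z\<^sup>l = \<Sum> N\<^sub>i z\<^sup>i\<close>.\<close>

primrec rem_coeff :: "nat \<Rightarrow> (nat \<Rightarrow> 'c::comm_ring_1) \<Rightarrow> nat \<Rightarrow> nat \<Rightarrow> 'c" where
  "rem_coeff l N 0 = (\<lambda>i. if i = 0 then 1 else 0)"
| "rem_coeff l N (Suc m) = (\<lambda>i. (if i = 0 then 0 else rem_coeff l N m (i - 1)) + rem_coeff l N m (l - 1) * N i)"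

lemma (in peval_hom) rem_coeff:
  assumes l: "0 < l" and N: "z ^ l = (\<Sum>i<l. \<psi> (N i) * z ^ i)"
  shows "z ^ m = (\<Sum>i<l. \<psi> (rem_coeff l N m i) * z ^ i)"
proof -
  obtain l' where l': "l = Suc l'" using l gr0_implies_Suc by blast
  show ?thesis
  proof (induction m)
    case 0
    have "(\<Sum>i<l. \<psi> (rem_coeff l N 0 i) * z ^ i) = (\<Sum>i<l. if i = 0 then 1 else 0)"
     by (intro sum.cong refl) (simp add: \<psi>_one \<psi>_zero)
    then show ?case using l by simp
  next
    case (Suc m)
    let ?r = "rem_coeff l N m"
    have "z ^ Suc m = (\<Sum>i<l. \<psi> (?r i) * z ^ i) * z" by (simp only: power_Suc2 Suc.IH[symmetric])
    also have "\<dots> = (\<Sum>i<Suc l'. \<psi> (?r i) * z ^ Suc i)"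
     unfolding l' by (simp only: sum_distrib_right mult.assoc power_Suc2)
    also have "\<dots> = (\<Sum>i<l'. \<psi> (?r i) * z ^ Suc i) + \<psi> (?r l') * z ^ l" by (simp add: l')
    also have "\<dots> = (\<Sum>i<l. \<psi> (if i = 0 then 0 else ?r (i - 1)) * z ^ i) + (\<Sum>i<l. \<psi> (?r (l - 1) * N i) * z ^ i)"
    proof -
     have "(\<Sum>i<l. \<psi> (if i = 0 then 0 else ?r (i - 1)) * z ^ i) = (\<Sum>i<l'. \<psi> (?r i) * z ^ Suc i)"
      unfolding l' sum.lessThan_Suc_shift by (simp add: \<psi>_zero)
     moreover have "\<psi> (?r l') * z ^ l = (\<Sum>i<l. \<psi> (?r (l - 1) * N i) * z ^ i)"
      unfolding N sum_distrib_left by (simp add: l' \<psi>_mult mult.assoc)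
     ultimately show ?thesis by simp
    qed
    also have "\<dots> = (\<Sum>i<l. \<psi> (rem_coeff l N (Suc m) i) * z ^ i)"
     unfolding sum.distrib[symmetric] rem_coeff.simps \<psi>_add distrib_right ..
    finally show ?case .
  qed
qed

lemma rem_coeff_in:
  assumes "\<And>i. N i \<in> S" "0 \<in> S" "1 \<in> S" "\<And>x y. x \<in> S \<Longrightarrow> y \<in> S \<Longrightarrow> x + y \<in> S" "\<And>x y. x \<in> S \<Longrightarrow> y \<in> S \<Longrightarrow> x * y \<in> S"
  shows "rem_coeff l N m i \<in> S"
  using assms by (induction m arbitrary: i) auto

lemma omono_single:
  assumes "g \<in> gens m n"
  shows "omono m n v (Poly_Mapping.single g k) = v g ^ k"
proof -
  have "omono m n v (Poly_Mapping.single g k) = prod_list (map (\<lambda>j. if j = idx g then v g ^ k else 1) [m..<Suc n])"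
    unfolding omono_def
    by (intro arg_cong[of _ _ prod_list] map_cong refl) (cases g; auto simp: lookup_single when_def)
  also have "\<dots> = v g ^ k"
  proof -
    have PL: "prod_list (map (\<lambda>j. if j = i then u else 1) js) = (if i \<in> set js then u else 1)"
     if "distinct js" for js i and u :: 'a using that by (induction js) auto
    show ?thesis using assms PL[of "[m..<Suc n]" "idx g" "v g ^ k"] by (simp add: gens_def less_Suc_eq_le del: upt_Suc)
  qed
  finally show ?thesis .
qed

lemma mod_add_cancel:
  assumes "(b + k) mod l = (b + k') mod (l :: nat)" "k < l" "k' < l"
  shows "k = k'"
proof -
  have le: "k2 = k1" if k: "k1 \<le> k2" "k2 < l" "(b + k2) mod l = (b + k1) mod l" for k1 k2
  proof (rule ccontr)
    assume ne: "k2 \<noteq> k1"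
    have "(b + k2) mod l = (b + k1) mod l \<longleftrightarrow> l dvd (b + k2) - (b + k1)"
     by (rule mod_eq_dvd_iff_nat) (use k(1) in simp)
    then have "l dvd k2 - k1" using k(3) by simp
    then have "l \<le> k2 - k1" by (rule dvd_imp_le) (use ne k(1) in simp)
    then show False using k(2) by simp
  qed
  show ?thesis
  proof (cases "k \<le> k'")
    case True
    from le[OF True assms(3) assms(1)[symmetric]] show ?thesis by (rule sym)
  next
    case False
    then have "k' \<le> k" by simp
    from le[OF this assms(2,1)] show ?thesis .
  qed
qed

section \<open>The sublattice and its transition matrix\<close>

locale weyl_lattice = weyl \<phi> n E B L
  for \<phi> :: "'t::idom \<Rightarrow> 'k::field" and n :: nat and E :: "nat \<Rightarrow> 't" and B :: "nat \<Rightarrow> nat \<Rightarrow> 't" and L :: "nat \<Rightarrow> nat" +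
  assumes n1: "1 \<le> n"
begin

declare One_nat_def [simp del]

sublocale A1: weyl_at \<phi> n E B L 1 using n1 by unfold_locales auto
text \<open>For \<open>n = 1\<close> this instance has no generators and is the base ring
  \<open>T[c']\<close>.\<close>

sublocale A2: weyl_at \<phi> n E B L 2 using n1 by unfold_locales auto

abbreviation y :: "'k op" where "y \<equiv> yy 1"
abbreviation x :: "'k op" where "x \<equiv> xx 1"
abbreviation z :: "'k op" where "z \<equiv> zz 1"
abbreviation c :: "'k op" where "c \<equiv> zz 0"
abbreviation l :: nat where "l \<equiv> L 1"
abbreviation e :: 't where "e \<equiv> E 1"
abbreviation "Bx \<equiv> A2.Box"
abbreviation "ke \<equiv> A1.ke"
abbreviation "\<iota> \<equiv> A1.iota"
abbreviation b :: "(gen \<Rightarrow>\<^sub>0 nat) \<Rightarrow> 'k op" where "b \<equiv> A2.ev"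

text \<open>Constants; \<open>cc\<close> and \<open>gg\<close> below are the variables that
  \<open>\<iota>\<close> sends to \<open>c\<close> and to the central powers
  \<open>uu g\<close>.\<close>

definition cst :: "'t \<Rightarrow> ((gen \<Rightarrow>\<^sub>0 nat) \<Rightarrow>\<^sub>0 't) poly" where "cst a = [:Poly_Mapping.single 0 a:]"
definition cc :: "((gen \<Rightarrow>\<^sub>0 nat) \<Rightarrow>\<^sub>0 't) poly" where "cc = [:0, 1:]"
definition gg :: "gen \<Rightarrow> ((gen \<Rightarrow>\<^sub>0 nat) \<Rightarrow>\<^sub>0 't) poly" where "gg g = [:Poly_Mapping.single (Poly_Mapping.single g 1) 1:]"
abbreviation "YY \<equiv> gg (Y 1)"

lemma l0: "0 < l" using L_pos[of 1] n1 by simp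
lemma one: "(1::nat) \<le> 1" "1 \<le> n" "0 \<le> n" using n1 by auto

lemma zc1: "A1.zc = c" and zc2: "A2.zc = z"
  unfolding A1.zc_def A2.zc_def by (simp_all add: One_nat_def)

lemma z_y: "z * y = ke e * (y * z)"
  using zz_yy[OF one(1,2,2)] by (simp add: A1.ke_def mult.assoc)

lemma c_y: "c * y = y * c" and c_x: "c * x = x * c"
  using zz_yy[OF one(1,2,3)] zz_xx[OF one(1,2,3)] by simp_all

lemma z_step: "z = c + ke (e - 1) * (y * x)"
  using zz_step[OF one(1,2)] by (simp add: A1.ke_def \<phi>_diff)

lemma uY: "uu (Y 1) = y ^ l" and uX: "uu (X 1) = x ^ l"
  by (simp_all add: uu_def)

lemma \<iota>_cst: "\<iota> (cst a) = ke a"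
  unfolding cst_def A1.iota_const A1.iota0_single by simp

lemma \<iota>_cc: "\<iota> cc = c"
  unfolding cc_def A1.iota_def A1.C.pe_var by (rule zc1)

lemma \<iota>_gg: "g \<in> gens 1 n \<Longrightarrow> \<iota> (gg g) = uu g"
  unfolding gg_def A1.iota_const A1.iota0_single cm_def by (subst omono_single) auto

lemma gY: "Y 1 \<in> gens 1 n" and gX: "X 1 \<in> gens 1 n" using n1 by (auto simp: gens_def)

lemma \<iota>_YY: "\<iota> YY = y ^ l" and \<iota>_XX: "\<iota> (gg (X 1)) = x ^ l"
  using \<iota>_gg[OF gY] \<iota>_gg[OF gX] by (simp_all add: uY uX)

lemma S0_iff: "D \<in> A1.S0 \<longleftrightarrow> over_gens (gens 1 n) D" by (simp add: A1.S0_def)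

lemma cst_S0: "cst a \<in> A1.S0" and cc_S0: "cc \<in> A1.S0" and gg_S0: "g \<in> gens 1 n \<Longrightarrow> gg g \<in> A1.S0"
  using over_gens_monom[of 0 "gens 1 n" a 0] over_gens_monom[of 0 "gens 1 n" "1::'t" 1]
    over_gens_monom[of "Poly_Mapping.single g 1" "gens 1 n" "1::'t" 0]
  by (simp_all add: S0_iff cst_def cc_def gg_def Polynomial.monom_0 Polynomial.monom_altdef single_one)

lemma S0_power: "p \<in> A1.S0 \<Longrightarrow> p ^ k \<in> A1.S0"
  by (induction k) (auto intro: A1.dm.S0_one A1.dm.S0_mult)

lemma cst_simps: "cst (a * a') = cst a * cst a'" "cst 1 = 1" "cst 0 = 0" "cst (a + a') = cst a + cst a'"
  by (simp_all add: cst_def mult_single single_add one_pCons single_one mult.commute)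

lemma cst_power: "cst (a ^ k) = cst a ^ k" by (induction k) (simp_all add: cst_simps)
lemma cst_prod: "cst (prod f I) = (\<Prod>i\<in>I. cst (f i))" by (induction I rule: infinite_finite_induct) (simp_all add: cst_simps)
lemma cst_eq_0: "cst a = 0 \<longleftrightarrow> a = 0" by (simp add: cst_def) (metis lookup_single_eq lookup_zero single_zero)

lemma \<iota>_left: "w \<in> A1.dm.\<A> \<Longrightarrow> s \<in> A1.S0 \<Longrightarrow> w * (\<iota> s * w') = \<iota> s * (w * w')"
  using A1.dm.\<A>_scal by blast

lemma \<iota>_vv: "g \<in> gens 1 n \<Longrightarrow> \<iota> s * vv g = vv g * \<iota> s"
  by (rule A1.iota_vv)

lemma \<iota>_y: "\<iota> s * y = y * \<iota> s" and \<iota>_x: "\<iota> s * x = x * \<iota> s"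
  using \<iota>_vv[OF gY, of s] \<iota>_vv[OF gX, of s] by simp_all

lemma \<iota>_z: "\<iota> s * z = z * \<iota> s"
  by (rule A1.iota_comm) (use n1 in \<open>simp_all add: cm_zz zc1 zz_zz[of 0]\<close>)

lemma g21: "g \<in> gens 2 n \<Longrightarrow> g \<in> gens 1 n" by (simp add: gens_def)

lemma \<iota>_b: "\<iota> s * b p = b p * \<iota> s"
  by (rule omono_commute[symmetric]) (rule \<iota>_vv[OF g21, symmetric])

lemma \<iota>_zb: "z ^ a * (b p * (\<iota> s * w)) = \<iota> s * (z ^ a * (b p * w))"
proof -
  have h: "\<iota> s * z ^ a = z ^ a * \<iota> s" using commute_power[of z "\<iota> s" a] \<iota>_z[of s] by simp
  have 1: "b p * (\<iota> s * w) = \<iota> s * (b p * w)" by (simp only: mult.assoc[symmetric] \<iota>_b)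
  have 2: "z ^ a * (\<iota> s * w') = \<iota> s * (z ^ a * w')" for w' by (simp only: mult.assoc[symmetric] h)
  show ?thesis unfolding 1 2 ..
qed

lemma z_b: "z * b p = b p * z"
  using A2.zc_omono by (simp add: zc2)

lemma b_z: "b p * (z ^ k * w) = z ^ k * (b p * w)"
  by (simp only: mult.assoc[symmetric] commute_power[OF z_b])

lemma b_A: "p \<in> Bx \<Longrightarrow> b p \<in> A2.dm.\<A>"
  using A2.dm.tbasis_in[OF A2.tbasis_Box] .

text \<open>Scalars by which elements commute with \<open>y\<close>.\<close>

definition qcy :: "'k op \<Rightarrow> bool" where "qcy w \<longleftrightarrow> (\<exists>u v. u * v = 1 \<and> w * y = ke u * (y * w))"

lemma qcy_1: "qcy 1" unfolding qcy_def by (intro exI[of _ 1]) simp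

lemma qcy_mult: "qcy a \<Longrightarrow> qcy a' \<Longrightarrow> qcy (a * a')"
  unfolding qcy_def
proof (elim exE conjE)
  fix u v u' v' assume uv: "u * v = 1" "a * y = ke u * (y * a)" "u' * v' = 1" "a' * y = ke u' * (y * a')"
  have "a * a' * y = a * (ke u' * (y * a'))" by (simp only: mult.assoc uv(4))
  also have "\<dots> = ke u' * ((a * y) * a')" by (simp only: A1.ke_left[of a] mult.assoc)
  also have "\<dots> = ke (u' * u) * (y * (a * a'))" by (simp only: uv(2) mult.assoc A1.ke_mult)
  finally have "a * a' * y = ke (u' * u) * (y * (a * a'))" .
  moreover have "u' * u * (v * v') = (u * v) * (u' * v')" by (simp only: mult_ac)
  then have "u' * u * (v * v') = 1" using uv by simp
  ultimately show "\<exists>u v. u * v = 1 \<and> a * a' * y = ke u * (y * (a * a'))" by blast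
qed

lemma qcy_power: "qcy a \<Longrightarrow> qcy (a ^ k)"
  by (induction k) (auto intro: qcy_1 qcy_mult)

lemma qcy_z: "qcy z"
  using z_y E_unit[of 1] n1 unfolding qcy_def by auto

lemma qcy_vv: "g \<in> gens 2 n \<Longrightarrow> qcy (vv g)"
proof (cases g)
  case (Y j)
  assume "g \<in> gens 2 n"
  then have j: "1 \<le> j" "j \<le> n" using Y by (auto simp: gens_def)
  show ?thesis using yy_yy[OF j one(1,2)] B_inv[OF j one(1,2)] Y
    unfolding qcy_def by (auto simp: A1.ke_def mult.assoc)
next
  case (X j)
  assume "g \<in> gens 2 n"
  then have j: "1 \<le> j" "j \<le> n" "j \<noteq> 1" "1 < j" using X by (auto simp: gens_def)
  have "vv g * y = ke (E 1 * B 1 j) * (y * vv g)"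
    using xx_yy[OF j(1,2) one(1,2) j(3)] X j(4) by (simp add: A1.ke_def \<phi>_mult)
  moreover obtain u where "E 1 * u = 1" using E_unit[OF one(1,2)] by blast
  moreover have "E 1 * B 1 j * (u * B j 1) = (E 1 * u) * (B 1 j * B j 1)" by (simp only: mult_ac)
  ultimately have "E 1 * B 1 j * (u * B j 1) = 1" "vv g * y = ke (E 1 * B 1 j) * (y * vv g)"
    using B_inv[OF one(1,2) j(1,2)] by simp_all
  then show ?thesis unfolding qcy_def by blast
qed

lemma qcy_b: "qcy (b p)"
proof -
  have "qcy (prod_list ws)" if "\<And>w. w \<in> set ws \<Longrightarrow> qcy w" for ws
    using that by (induction ws) (auto intro: qcy_1 qcy_mult)
  note PL = this
  have "qcy (yy j)" "qcy (xx j)" if "2 \<le> j" "j < Suc n" for j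
    using qcy_vv[of "Y j"] qcy_vv[of "X j"] that by (simp_all add: gens_def)
  then show ?thesis unfolding omono_def
    by (intro PL) (auto simp del: upt_Suc intro!: qcy_mult qcy_power)
qed

lemma qcy_comm:
  assumes "qcy w"
  shows "\<exists>u v. u * v = 1 \<and> w * y ^ k = ke u * (y ^ k * w) \<and> y ^ k * w = ke v * (w * y ^ k)"
proof -
  obtain u v where uv: "u * v = 1" "w * y = ke u * (y * w)" using assms by (auto simp: qcy_def)
  have 1: "w * y ^ k = ke (u ^ k) * (y ^ k * w)"
    using qcomm_right[of w y "\<phi> u" k] uv by (simp add: A1.ke_def \<phi>_power)
  have m: "u ^ k * v ^ k = 1" unfolding power_mult_distrib[symmetric] uv(1) by simp
  then have m': "v ^ k * u ^ k = 1" by (simp only: mult.commute)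
  have "y ^ k * w = ke (v ^ k) * (w * y ^ k)"
    unfolding 1 by (simp only: mult.assoc[symmetric] A1.ke_mult[symmetric] m' A1.ke_1 mult_1_left)
  then show ?thesis using 1 m by blast
qed

lemma yl_comm: "g \<in> gens 1 n \<Longrightarrow> y ^ l * vv g = vv g * y ^ l"
  using uu_vv[OF gY, of g] by (simp only: uY)

lemma yl_z: "y ^ l * z = z * y ^ l"
  using uu_zz[OF gY one(2)] by (simp only: uY)

lemma yl_b: "y ^ l * b p = b p * y ^ l"
  by (rule omono_commute[symmetric]) (rule yl_comm[OF g21, symmetric])

text \<open>The exact value 1 for multiples of \<open>l\<close> is recorded because only such
  \<open>K\<close> contribute to traces, and there the scalar must not vary along the
  diagonal.\<close>

lemma scal_ex: "\<exists>u. u dvd 1 \<and> (l dvd K \<longrightarrow> u = 1) \<and> y ^ K * (z ^ a * b p) = ke u * (z ^ a * b p * y ^ K)"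
proof (cases "l dvd K")
  case True
  then obtain h where h: "K = l * h" by auto
  have "y ^ l * (z ^ a * b p) = z ^ a * b p * y ^ l"
  proof -
    have h: "y ^ l * z ^ a = z ^ a * y ^ l" using commute_power[of z "y ^ l" a] yl_z by simp
    have "y ^ l * (z ^ a * b p) = z ^ a * (y ^ l * b p)" by (simp only: mult.assoc[symmetric] h)
    then show ?thesis by (simp only: yl_b mult.assoc)
  qed
  then have "y ^ K * (z ^ a * b p) = z ^ a * b p * y ^ K" unfolding h power_mult by (rule commute_power)
  then show ?thesis by (intro exI[of _ 1]) simp
next
  case False
  obtain u v where uv: "u * v = 1" "y ^ K * (z ^ a * b p) = ke v * (z ^ a * b p * y ^ K)"
    using qcy_comm[OF qcy_mult[OF qcy_power[OF qcy_z] qcy_b], of a p K] by blast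
  have "v dvd 1" using uv(1) by (metis dvd_triv_right)
  then show ?thesis using False uv(2) by blast
qed

definition sc :: "nat \<Rightarrow> nat \<Rightarrow> (gen \<Rightarrow>\<^sub>0 nat) \<Rightarrow> 't" where
  "sc K a p = (SOME u. u dvd 1 \<and> (l dvd K \<longrightarrow> u = 1) \<and> y ^ K * (z ^ a * b p) = ke u * (z ^ a * b p * y ^ K))"

lemma sc: "sc K a p dvd 1" "l dvd K \<Longrightarrow> sc K a p = 1" "y ^ K * (z ^ a * b p) = ke (sc K a p) * (z ^ a * b p * y ^ K)"
  using someI_ex[OF scal_ex[of K a p]] unfolding sc_def by auto

lemma bsc_ex: "\<exists>u. u dvd 1 \<and> b p * y ^ k = ke u * (y ^ k * b p)"
proof -
  obtain u v where uv: "u * v = 1" "b p * y ^ k = ke u * (y ^ k * b p)" using qcy_comm[OF qcy_b, of p k] by blast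
  have "u dvd 1" using uv(1) by (metis dvd_triv_left)
  then show ?thesis using uv(2) by blast
qed

definition bsc :: "(gen \<Rightarrow>\<^sub>0 nat) \<Rightarrow> nat \<Rightarrow> 't" where
  "bsc p k = (SOME u. u dvd 1 \<and> b p * y ^ k = ke u * (y ^ k * b p))"

lemma bsc: "bsc p k dvd 1" "b p * y ^ k = ke (bsc p k) * (y ^ k * b p)"
  using someI_ex[OF bsc_ex[of p k]] unfolding bsc_def by auto

text \<open>The index \<open>(k, p, i)\<close> stands for \<open>y\<^sup>(\<^sup>i\<^sup>+\<^sup>k\<^sup>) x\<^sup>i b\<^sub>p\<close> in the basis, the exponent of \<open>y\<close> being
  reduced modulo \<open>l\<close>, and for \<open>z\<^sup>i b\<^sub>p y\<^sup>k\<close> in the sublattice.\<close>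

definition I3 :: "(nat \<times> (gen \<Rightarrow>\<^sub>0 nat) \<times> nat) set" where "I3 = {..<l} \<times> (Bx \<times> {..<l})"
definition ebas :: "nat \<times> (gen \<Rightarrow>\<^sub>0 nat) \<times> nat \<Rightarrow> 'k op" where
  "ebas = (\<lambda>(k, p, i). y ^ ((i + k) mod l) * (x ^ i * b p))"
definition fbas :: "nat \<times> (gen \<Rightarrow>\<^sub>0 nat) \<times> nat \<Rightarrow> 'k op" where
  "fbas = (\<lambda>(k, p, i). z ^ i * (b p * y ^ k))"

definition ix :: "nat \<times> (gen \<Rightarrow>\<^sub>0 nat) \<times> nat \<Rightarrow> gen \<Rightarrow>\<^sub>0 nat" where
  "ix = (\<lambda>(k, p, i). Poly_Mapping.single (Y 1) ((i + k) mod l) + Poly_Mapping.single (X 1) i + p)"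

lemma fin3: "finite I3" by (simp add: I3_def A2.finite_Box)

lemma Bx_lookup: "p \<in> Bx \<Longrightarrow> Poly_Mapping.lookup p (Y 1) = 0" "p \<in> Bx \<Longrightarrow> Poly_Mapping.lookup p (X 1) = 0"
  using lookup_0_gens[of p "gens 2 n"] by (auto simp: A2.Box_def gens_def)

lemma ev_ix: "p \<in> Bx \<Longrightarrow> A1.ev (ix (k, p, i)) = ebas (k, p, i)"
proof -
  assume p: "p \<in> Bx"
  have "omono 2 n vv (ix (k, p, i)) = b p"
    by (rule omono_cong) (auto simp: ix_def lookup_add lookup_single when_def gens_def)
  then show ?thesis using omono_first[of 1 n vv "ix (k, p, i)"] n1 Bx_lookup[OF p]
    by (simp add: ebas_def ix_def lookup_add lookup_single mult.assoc numeral_2_eq_2)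
qed

lemma card_Bx: "card A1.Box = l * (l * card Bx)"
proof -
  have "{1..n} = insert 1 {2..n}" using n1 by auto
  then show ?thesis by (simp add: A1.card_Box A2.card_Box power2_eq_square)
qed

text \<open>The exponents of \<open>x\<close> and \<open>y\<close> recover \<open>i\<close> and then
  \<open>k\<close>, as adding \<open>i\<close> modulo \<open>l\<close> is injective. Surjectivity
  follows by counting.\<close>

lemma bij_ix: "bij_betw ix I3 A1.Box"
proof -
  have inj: "inj_on ix I3"
  proof (rule inj_onI)
    fix i i' assume i: "i \<in> I3" "i' \<in> I3" and eq: "ix i = ix i'"
    obtain k p a k' p' a' where k: "i = (k, p, a)" "i' = (k', p', a')" by (metis prod_cases3)
    have B: "p \<in> Bx" "p' \<in> Bx" "k < l" "k' < l" using i by (auto simp: I3_def k)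
    have lk: "Poly_Mapping.lookup (ix i) g = Poly_Mapping.lookup (ix i') g" for g by (simp add: eq)
    have a: "a = a'" using lk[of "X 1"] B Bx_lookup by (simp add: k ix_def lookup_add lookup_single)
    have "(a + k) mod l = (a + k') mod l" using lk[of "Y 1"] B Bx_lookup a by (simp add: k ix_def lookup_add lookup_single)
    then have "k = k'" using mod_add_cancel B by blast
    moreover have "p = p'" using eq a calculation by (simp add: k ix_def)
    ultimately show "i = i'" using a k by simp
  qed
  moreover have "ix ` I3 = A1.Box"
  proof (rule card_subset_eq[OF A1.finite_Box])
    show "ix ` I3 \<subseteq> A1.Box"
    proof
     fix \<rho> assume "\<rho> \<in> ix ` I3"
     then obtain k p a where r: "\<rho> = ix (k, p, a)" "k < l" "p \<in> Bx" "a < l" by (auto simp: I3_def)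
     have lk: "Poly_Mapping.lookup \<rho> g = (if g = Y 1 then (a + k) mod l else if g = X 1 then a else Poly_Mapping.lookup p g)" for g
      using Bx_lookup[OF r(3)] by (simp add: r(1) ix_def lookup_add lookup_single when_def)
     have p: "Poly_Mapping.keys p \<subseteq> gens 2 n" "\<And>g. g \<in> gens 2 n \<Longrightarrow> Poly_Mapping.lookup p g < L (idx g)"
      using r(3) by (auto simp: A2.Box_def)
     have "Poly_Mapping.keys \<rho> \<subseteq> gens 1 n"
     proof
      fix g assume "g \<in> Poly_Mapping.keys \<rho>"
      then have g: "Poly_Mapping.lookup \<rho> g \<noteq> 0" by (simp add: in_keys_iff)
      show "g \<in> gens 1 n"
      proof (cases "g = Y 1 \<or> g = X 1")
       case False
       then have "g \<in> Poly_Mapping.keys p" using g by (simp add: in_keys_iff lk)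
       then show ?thesis using p(1) g21 by blast
      qed (use gX gY in blast)
     qed
     moreover have "Poly_Mapping.lookup \<rho> g < L (idx g)" if g: "g \<in> gens 1 n" for g
     proof (cases "g = Y 1 \<or> g = X 1")
      case True
      then show ?thesis using l0 r(2-4) by (auto simp: lk)
     next
      case False
      then have "g \<in> gens 2 n" using g by (cases g) (auto simp: gens_def)
      then show ?thesis using False p(2) by (simp add: lk)
     qed
     ultimately show "\<rho> \<in> A1.Box" by (simp add: A1.Box_def)
    qed
    show "card (ix ` I3) = card A1.Box"
     unfolding card_image[OF inj] card_Bx by (simp add: I3_def card_cartesian_product mult_ac)
  qed
  ultimately show ?thesis by (simp add: bij_betw_def)
qed

lemma tbasis3: "A1.dm.tbasis I3 ebas"
proof -
  have "A1.dm.tbasis I3 (A1.ev \<circ> ix)" by (rule A1.dm.tbasis_reindex[OF bij_ix A1.tbasis_Box])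
  moreover have "(A1.ev \<circ> ix) i = ebas i" if "i \<in> I3" for i
    using that ev_ix by (auto simp: I3_def)
  ultimately show ?thesis unfolding A1.dm.tbasis_def by (simp cong: sum.cong)
qed

text \<open>Expansion of \<open>z\<^sup>i y\<^sup>k\<close> in the elements \<open>y\<^sup>b\<^sup>+\<^sup>k x\<^sup>b\<close>.\<close>

primrec pz :: "nat \<Rightarrow> nat \<Rightarrow> nat \<Rightarrow> ((gen \<Rightarrow>\<^sub>0 nat) \<Rightarrow>\<^sub>0 't) poly" where
  "pz k 0 = (\<lambda>b. if b = 0 then 1 else 0)"
| "pz k (Suc i) = (\<lambda>b. cst (e ^ (b + k)) * cc * pz k i b +
    (if b = 0 then 0 else cst (e ^ (b - 1 + k) * (e - 1)) * pz k i (b - 1)))"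

lemma pz_above: "i < b' \<Longrightarrow> pz k i b' = 0"
  by (induction i arbitrary: b') auto

text \<open>The step from \<open>i\<close> to \<open>i + 1\<close> contributes
  \<open>e^(i + k) (e - 1)\<close>. These diagonal entries are the source of the powers of
  \<open>e - 1\<close> in the index of the sublattice.\<close>

lemma pz_diag: "pz k i i = cst ((\<Prod>b<i. e ^ (b + k)) * (e - 1) ^ i)"
  by (induction i) (simp_all add: cst_simps pz_above mult_ac)

lemma pz_S0: "pz k i b' \<in> A1.S0"
  by (induction i arbitrary: b')
    (auto intro!: A1.dm.S0_add A1.dm.S0_mult cst_S0 cc_S0 A1.dm.S0_zero A1.dm.S0_one)

lemma z_yx: "z * (y ^ j * x ^ a) = \<iota> (cst (e ^ j) * cc) * (y ^ j * x ^ a) + \<iota> (cst (e ^ j * (e - 1))) * (y ^ Suc j * x ^ Suc a)"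
proof -
  have zy: "z * y ^ j = ke (e ^ j) * (y ^ j * z)"
    using qcomm_right[of z y "\<phi> e" j] z_y by (simp add: A1.ke_def \<phi>_power)
  have c: "y ^ j * c = c * y ^ j" using commute_power[of y c j] c_y by simp
  have "z * (y ^ j * x ^ a) = ke (e ^ j) * (y ^ j * (z * x ^ a))"
    by (simp only: mult.assoc[symmetric] zy)
  also have "z * x ^ a = c * x ^ a + ke (e - 1) * (y * x ^ Suc a)"
    by (subst z_step) (simp add: distrib_right mult.assoc)
  also have "y ^ j * (c * x ^ a + ke (e - 1) * (y * x ^ Suc a)) = c * (y ^ j * x ^ a) + ke (e - 1) * (y ^ Suc j * x ^ Suc a)"
    unfolding distrib_left A1.ke_left[of "y ^ j"] power_Suc2[of y] mult.assoc[symmetric] c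
    by (simp only: A1.ke_comm[of "y ^ j"])
  finally show ?thesis
    unfolding A1.iota_simps \<iota>_cst \<iota>_cc A1.ke_mult by (simp only: distrib_left mult.assoc)
qed

lemma z_expand: "z ^ i * y ^ k = (\<Sum>a\<le>i. \<iota> (pz k i a) * (y ^ (a + k) * x ^ a))"
proof (induction i)
  case 0
  then show ?case by (simp add: A1.iota_simps)
next
  case (Suc i)
  let ?m = "\<lambda>a. y ^ (a + k) * x ^ a"
  have "z ^ Suc i * y ^ k = (\<Sum>a\<le>i. z * (\<iota> (pz k i a) * ?m a))"
    by (simp only: power_Suc mult.assoc Suc.IH sum_distrib_left)
  also have "\<dots> = (\<Sum>a\<le>i. \<iota> (pz k i a) * (z * ?m a))"
    by (intro sum.cong refl) (simp only: mult.assoc[symmetric] \<iota>_z)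
  also have "\<dots> = (\<Sum>a\<le>i. \<iota> (cst (e ^ (a + k)) * cc * pz k i a) * ?m a)
     + (\<Sum>a\<le>i. \<iota> (cst (e ^ (a + k) * (e - 1)) * pz k i a) * ?m (Suc a))"
    unfolding sum.distrib[symmetric]
  proof (intro sum.cong refl)
    fix a
    show "\<iota> (pz k i a) * (z * ?m a) = \<iota> (cst (e ^ (a + k)) * cc * pz k i a) * ?m a
      + \<iota> (cst (e ^ (a + k) * (e - 1)) * pz k i a) * ?m (Suc a)"
     unfolding z_yx distrib_left add_Suc
     by (simp only: A1.iota_simps(2)[symmetric] mult.assoc[symmetric]) (simp only: mult_ac)
  qed
  also have "(\<Sum>a\<le>i. \<iota> (cst (e ^ (a + k)) * cc * pz k i a) * ?m a) = (\<Sum>a\<le>Suc i. \<iota> (cst (e ^ (a + k)) * cc * pz k i a) * ?m a)"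
    by (simp add: pz_above A1.iota_simps)
  also have "(\<Sum>a\<le>i. \<iota> (cst (e ^ (a + k) * (e - 1)) * pz k i a) * ?m (Suc a))
    = (\<Sum>a\<le>Suc i. \<iota> (if a = 0 then 0 else cst (e ^ (a - 1 + k) * (e - 1)) * pz k i (a - 1)) * ?m a)"
    by (subst sum.atMost_Suc_shift) (simp add: A1.iota_simps)
  also have "(\<Sum>a\<le>Suc i. \<iota> (cst (e ^ (a + k)) * cc * pz k i a) * ?m a)
    + (\<Sum>a\<le>Suc i. \<iota> (if a = 0 then 0 else cst (e ^ (a - 1 + k) * (e - 1)) * pz k i (a - 1)) * ?m a)
    = (\<Sum>a\<le>Suc i. \<iota> (pz k (Suc i) a) * ?m a)"
    unfolding sum.distrib[symmetric] distrib_right[symmetric] A1.iota_simps(1)[symmetric] pz.simps ..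
  finally show ?case .
qed

text \<open>The transition matrix from \<open>fbas\<close> to \<open>ebas\<close>: block diagonal in
  \<open>k\<close> and \<open>p\<close>, triangular in the last index. The power of
  \<open>YY\<close> comes from reducing the exponent of \<open>y\<close> modulo
  \<open>l\<close>.\<close>

definition P :: "nat \<times> (gen \<Rightarrow>\<^sub>0 nat) \<times> nat \<Rightarrow> nat \<times> (gen \<Rightarrow>\<^sub>0 nat) \<times> nat \<Rightarrow> ((gen \<Rightarrow>\<^sub>0 nat) \<Rightarrow>\<^sub>0 't) poly" where
  "P = (\<lambda>(k, i) (k', j). if k = k' then (\<lambda>(p, i) (q, a). if p = q then cst (bsc p k) * pz k i a * YY ^ ((a + k) div l) else 0) i j else 0)"

lemma P_S0: "P i j \<in> A1.S0"
  unfolding P_def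
  by (auto simp: split_beta intro!: A1.dm.S0_mult cst_S0 pz_S0 S0_power gg_S0 gY A1.dm.S0_zero)

lemma yred: "y ^ j = \<iota> (YY ^ (j div l)) * y ^ (j mod l)"
  unfolding A1.iota_simps \<iota>_YY power_mult[symmetric] power_add[symmetric] by simp

lemma f_P: "i \<in> I3 \<Longrightarrow> fbas i = (\<Sum>j\<in>I3. \<iota> (P i j) * ebas j)"
proof -
  assume i: "i \<in> I3"
  obtain k p a where k: "i = (k, p, a)" by (metis prod_cases3)
  have m: "k < l" "p \<in> Bx" "a < l" using i by (auto simp: k I3_def)
  have "fbas i = ke (bsc p k) * (z ^ a * y ^ k * b p)"
    by (simp only: k fbas_def prod.case bsc(2) A1.ke_left[of "z ^ a"] mult.assoc)
  also have "\<dots> = (\<Sum>a'\<le>a. \<iota> (cst (bsc p k) * pz k a a' * YY ^ ((a' + k) div l)) * (y ^ ((a' + k) mod l) * (x ^ a' * b p)))"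
    unfolding z_expand sum_distrib_left sum_distrib_right
  proof (intro sum.cong refl)
    fix a'
    show "ke (bsc p k) * (\<iota> (pz k a a') * (y ^ (a' + k) * x ^ a') * b p) =
     \<iota> (cst (bsc p k) * pz k a a' * YY ^ ((a' + k) div l)) * (y ^ ((a' + k) mod l) * (x ^ a' * b p))"
     by (subst yred) (simp only: A1.iota_simps(2) \<iota>_cst mult.assoc)
  qed
  also have "\<dots> = (\<Sum>a'<l. \<iota> (cst (bsc p k) * pz k a a' * YY ^ ((a' + k) div l)) * (y ^ ((a' + k) mod l) * (x ^ a' * b p)))"
    using m by (intro sum.mono_neutral_left) (auto simp: pz_above A1.iota_simps not_le)
  also have "\<dots> = (\<Sum>j\<in>(\<lambda>a'. (k, p, a')) ` {..<l}. \<iota> (P i j) * ebas j)"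
    by (subst sum.reindex) (auto simp: inj_on_def P_def ebas_def k)
  also have "\<dots> = (\<Sum>j\<in>I3. \<iota> (P i j) * ebas j)"
    using m by (intro sum.mono_neutral_left fin3) (auto simp: I3_def P_def k A1.iota_simps)
  finally show ?thesis .
qed

lemma f_A: "i \<in> I3 \<Longrightarrow> fbas i \<in> A1.dm.\<A>"
  unfolding f_P by (rule A1.dm.\<A>_lin) (auto simp: P_S0 A1.dm.tbasis_in[OF tbasis3])

end

text \<open>The homogeneous form of \<open>X\<^sup>d - 1 = \<Prod> (X - e\<^sup>s)\<close>.\<close>

lemma roots_of_unity_prod:
  fixes e a :: "'f::idom"
  assumes d: "0 < d" "e ^ d = 1" "\<And>k. 0 < k \<Longrightarrow> k < d \<Longrightarrow> e ^ k \<noteq> 1" and a: "a \<noteq> 0"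
  shows "(\<Prod>s<d. [:- (e ^ s * a), 1:]) = Polynomial.monom 1 d - [:a ^ d:]"
proof -
  let ?p = "\<Prod>s<d. [:- (e ^ s * a), 1:]" and ?q = "Polynomial.monom 1 d - [:a ^ d:] :: 'f poly"
  have inj: "inj_on (\<lambda>s. e ^ s * a) {..<d}"
  proof (rule linorder_inj_onI)
    fix s t assume st: "s < t" "s \<in> {..<d}" "t \<in> {..<d}"
    have "e ^ s \<noteq> 0" using d(1,2) by (metis power_0_left power_eq_0_iff zero_neq_one neq0_conv)
    moreover have "e ^ t = e ^ s * e ^ (t - s)" using st by (simp add: power_add[symmetric])
    moreover have "e ^ (t - s) \<noteq> 1" using d(3)[of "t - s"] st by auto
    ultimately show "e ^ s * a \<noteq> e ^ t * a" using a by simp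
  qed auto
  have dp: "Polynomial.degree ?p = d" by (subst degree_prod_eq_sum_degree) auto
  have mp: "Polynomial.lead_coeff ?p = 1" by (simp add: lead_coeff_prod)
  have c0: "Polynomial.coeff [:a ^ d:] d = 0" using d(1) by (intro Polynomial.coeff_eq_0) simp
  have dq: "Polynomial.degree ?q = d"
  proof (rule antisym)
    show "Polynomial.degree ?q \<le> d" by (intro degree_diff_le) (auto simp: degree_monom_eq)
    show "d \<le> Polynomial.degree ?q" using c0 by (intro le_degree) simp
  qed
  have "?p - ?q = 0"
  proof (rule ccontr)
    assume ne: "?p - ?q \<noteq> 0"
    have "(\<lambda>s. e ^ s * a) ` {..<d} \<subseteq> {t. poly (?p - ?q) t = 0}"
    proof
     fix t assume "t \<in> (\<lambda>s. e ^ s * a) ` {..<d}"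
     then obtain s where s: "s < d" "t = e ^ s * a" by auto
     have "poly ?p t = 0" using s by (auto simp: poly_prod)
     moreover have "t ^ d = (e ^ d) ^ s * a ^ d" unfolding s(2) power_mult_distrib power_mult[symmetric] by (simp only: mult.commute)
     ultimately show "t \<in> {t. poly (?p - ?q) t = 0}" using d(2) by (simp add: poly_monom)
    qed
    from card_mono[OF poly_roots_finite[OF ne] this]
    have "d \<le> Polynomial.degree (?p - ?q)" using card_poly_roots_bound[OF ne] by (simp add: card_image[OF inj])
    moreover have "Polynomial.degree (?p - ?q) < d"
    proof -
     have "Polynomial.coeff (?p - ?q) d = 0" using mp dp c0 by simp
     moreover have "Polynomial.degree (?p - ?q) \<le> d" by (rule degree_diff_le) (simp_all only: dp dq order_refl)
     ultimately show ?thesis using ne by (metis le_neq_implies_less leading_coeff_0_iff)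
    qed
    ultimately show False by simp
  qed
  then show ?thesis by simp
qed

lemma (in peval_hom) pe_prod_list: "pe (prod_list ps) = prod_list (map pe ps)"
  by (induction ps) (simp_all add: pe_one pe_mult)

lemma (in peval_hom) \<psi>_uminus: "\<psi> (- a) = - \<psi> a"
  using \<psi>_add[of a "- a"] by (simp add: \<psi>_zero eq_neg_iff_add_eq_0 add.commute)

lemma (in peval_hom) monic_relation:
  assumes "Polynomial.degree F = l" "Polynomial.lead_coeff F = 1" "pe F = 0"
  shows "z ^ l = (\<Sum>i<l. \<psi> (- Polynomial.coeff F i) * z ^ i)"
proof -
  have "(\<Sum>i<l. \<psi> (Polynomial.coeff F i) * z ^ i) + z ^ l = 0"
    using pe_bound[of F l] assms by (simp add: lessThan_Suc_atMost[symmetric] \<psi>_one)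
  then show ?thesis by (simp add: \<psi>_uminus sum_negf eq_neg_iff_add_eq_0 add.commute)
qed

lemma prod_lessThan_list: "(\<Prod>s<k. f s) = prod_list (map f [0..<k])" for f :: "nat \<Rightarrow> 'a::comm_monoid_mult"
  by (induction k) (simp_all add: mult.commute)

lemma commuting_power_mult: "a * b = b * a \<Longrightarrow> (a * b) ^ k = a ^ k * (b ^ k :: 'a::monoid_mult)"
proof (induction k)
  case (Suc k)
  have "b * a ^ k = a ^ k * b" by (rule commute_power[OF Suc.prems, symmetric])
  then have "a * b * (a ^ k * b ^ k) = a * a ^ k * (b * b ^ k)" by (metis mult.assoc)
  then show ?case using Suc by simp
qed simp

section \<open>The equation of degree l for z over the centre\<close>

context weyl_lattice
begin

abbreviation d :: nat where "d \<equiv> mult_order e"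
abbreviation r :: nat where "r \<equiv> l div d"
text \<open>The \<open>r\<close>-th power of the operator \<open>w0\<close> below, as an element of
  the central polynomial ring.\<close>

definition W :: "((gen \<Rightarrow>\<^sub>0 nat) \<Rightarrow>\<^sub>0 't) poly" where "W = cst ((1 - e) ^ l) * (YY * gg (X 1))"

lemma d: "0 < d" "e ^ d = 1" "\<And>k. 0 < k \<Longrightarrow> e ^ k = 1 \<Longrightarrow> d \<le> k"
proof -
  have ex: "0 < l \<and> e ^ l = 1" using EL[of 1 1] n1 l0 by auto
  show "0 < d" "e ^ d = 1" using LeastI[of "\<lambda>k. 0 < k \<and> e ^ k = 1" l, OF ex] by (auto simp: mult_order_def)
  show "d \<le> k" if "0 < k" "e ^ k = 1" for k unfolding mult_order_def using that by (auto intro: Least_le)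
qed

lemma e_pow: "e ^ k = 1 \<longleftrightarrow> d dvd k"
proof
  assume k: "e ^ k = 1"
  have "e ^ k = (e ^ d) ^ (k div d) * e ^ (k mod d)" by (simp only: power_mult[symmetric] power_add[symmetric] mult_div_mod_eq)
  then have "e ^ (k mod d) = 1" using k d(2) by simp
  moreover have "k mod d < d" using d(1) by simp
  ultimately show "d dvd k" using d(3)[of "k mod d"] by (metis leD mod_0_imp_dvd neq0_conv)
next
  assume "d dvd k"
  then show "e ^ k = 1" using d(2) by (auto simp: power_mult)
qed

lemma d_dvd: "1 \<le> j \<Longrightarrow> j \<le> n \<Longrightarrow> d dvd L j"
  using EL[of 1 j] e_pow by auto

lemma dr: "l = d * r" and r0: "0 < r"
  using d_dvd[OF one(1,2)] l0 by (auto simp: dvd_mult_div_cancel intro: Nat.gr0I)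

lemma x_z: "x * z = ke e * (z * x)"
  using zz_xx[OF one(1,2,2)] by (simp add: A1.ke_def)

text \<open>From \<open>(1 - e) y x = c - z\<close> one gets \<open>(1 - e)\<^sup>k y\<^sup>k x\<^sup>k\<close> as a product of \<open>c - e\<^sup>-\<^sup>s z\<close>; the
  powers of \<open>e\<close> are cleared below.\<close>

lemma yx: "ke (1 - e) * (y * x) = c - z"
proof -
  have "ke (1 - e) + ke (e - 1) = 0" by (simp only: A1.ke_add[symmetric]) simp
  then have "ke (1 - e) * (y * x) + ke (e - 1) * (y * x) = 0" by (simp only: distrib_right[symmetric]) simp
  then show ?thesis using z_step by (simp add: algebra_simps eq_neg_iff_add_eq_0)
qed

lemma y_z': "ke (e ^ k) * (y ^ k * z) = z * y ^ k"
  using qcomm_right[of z y "\<phi> e" k] z_y by (simp add: A1.ke_def \<phi>_power)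

lemma comm_cz: "(ke a * c - z) * (ke a' * c - z) = (ke a' * c - z) * (ke a * c - z)"
proof -
  have h1: "(ke a * c) * (ke a' * c) = (ke a' * c) * (ke a * c)"
    by (rule commute_mult2) (rule A1.ke_comm[of "ke a", symmetric] A1.ke_comm[of c] A1.ke_comm[of c, symmetric] A1.ke_comm[of "ke a"] refl)+
  have h2: "(ke a * c) * z = z * (ke a * c)" for a
    by (rule commute_mult[OF A1.ke_comm[symmetric] zz_zz])
  have h3: "P - u - (v - w) = P - v - (u - w)" for P u v w :: "'k op" by (simp add: algebra_simps)
  show ?thesis unfolding left_diff_distrib right_diff_distrib h2 h1 by (rule h3)
qed

lemma yx_power: "ke ((1 - e) ^ k * (\<Prod>s<k. e ^ s)) * (y ^ k * x ^ k) = (\<Prod>s\<leftarrow>[0..<k]. ke (e ^ s) * c - z)"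
proof (induction k)
  case 0
  then show ?case by simp
next
  case (Suc k)
  have cy: "c * y ^ k = y ^ k * c" by (rule commute_power[OF c_y[symmetric], symmetric])
  have "ke (e ^ k) * (y ^ k * (c - z)) = (ke (e ^ k) * c - z) * y ^ k"
    unfolding right_diff_distrib left_diff_distrib y_z' mult.assoc cy ..
  moreover have "ke ((1 - e) * e ^ k) * (y ^ Suc k * x) = ke (e ^ k) * (y ^ k * (ke (1 - e) * (y * x)))"
    by (simp only: mult.commute[of "1 - e"] A1.ke_mult A1.ke_left[of "y ^ k"] power_Suc2 mult.assoc)
  ultimately have k: "ke ((1 - e) * e ^ k) * (y ^ Suc k * x) = (ke (e ^ k) * c - z) * y ^ k" by (simp only: yx)
  have comm: "(ke (e ^ k) * c - z) * w = w * (ke (e ^ k) * c - z)" if "w = (\<Prod>s\<leftarrow>[0..<k]. ke (e ^ s) * c - z)" for w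
    unfolding that
    by (rule commute_prod_list[symmetric]) (auto intro: comm_cz)
  have "(1 - e) ^ Suc k * (\<Prod>s<Suc k. e ^ s) = (1 - e) ^ k * (\<Prod>s<k. e ^ s) * ((1 - e) * e ^ k)"
    by (simp only: power_Suc prod.lessThan_Suc mult_ac)
  then have "ke ((1 - e) ^ Suc k * (\<Prod>s<Suc k. e ^ s)) * (y ^ Suc k * x ^ Suc k)
     = ke ((1 - e) ^ k * (\<Prod>s<k. e ^ s)) * ((ke ((1 - e) * e ^ k) * (y ^ Suc k * x)) * x ^ k)"
    by (simp only: A1.ke_mult[of _ "(1 - e) * e ^ k"] power_Suc[of x] mult.assoc[where 'a = "'k op"])
  also have "\<dots> = (ke (e ^ k) * c - z) * (ke ((1 - e) ^ k * (\<Prod>s<k. e ^ s)) * (y ^ k * x ^ k))"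
    unfolding k by (simp only: mult.assoc[where 'a = "'k op"] A1.ke_left[of "ke (e ^ k) * c - z"])
  also have "\<dots> = (\<Prod>s\<leftarrow>[0..<Suc k]. ke (e ^ s) * c - z)"
    unfolding Suc.IH using comm by simp
  finally show ?case .
qed

lemma sig_uminus: "A1.sig (- p) = - A1.sig p"
  by (simp only: A1.sig_def A1.S.pe_uminus)

lemma sig_z: "A1.sig p * z = z * A1.sig p"
  unfolding A1.sig_def by (rule A1.S.pe_comm) (simp_all add: A1.ke_comm[of z] zc1 zz_zz[of 0 1])

lemma ke_uminus: "ke (- a) = - ke a"
  by (simp add: A1.ke_def \<phi>_uminus kap_uminus)

text \<open>For \<open>k = d\<close> the product in \<open>yx_power\<close> runs over all
  \<open>d\<close>-th roots of unity and equals \<open>(-1)^d (z^d - c^d)\<close>. The factor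
  \<open>\<Prod> e^s\<close> on the other side is a sign, found by evaluating the same factorization
  at 0.\<close>

lemma zd: "z ^ d = c ^ d - ke ((1 - e) ^ d) * (y ^ d * x ^ d)"
proof -
  \<comment> \<open>The factorization takes place in polynomials over \<open>T[c]\<close> and is
    then evaluated at \<open>z\<close>, which commutes with the image of
    \<open>T[c]\<close>.\<close>
  interpret Z: peval_hom A1.sig z
    by unfold_locales (simp_all only: A1.sig_simps sig_z)
  let ?e = "[:e:] :: 't poly" and ?a = "[:0, 1:] :: 't poly"
  have ek: "?e ^ k = [:e ^ k:]" for k by (rule poly_const_pow)
  have d': "e ^ k \<noteq> 1" if "0 < k" "k < d" for k using d(3)[of k] that by auto
  have R: "(\<Prod>s<d. [:- (?e ^ s * ?a), 1:]) = Polynomial.monom 1 d - [:?a ^ d:]"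
    by (rule roots_of_unity_prod) (use d d' in \<open>auto simp: ek one_pCons\<close>)
  have neg: "[:?e ^ s * ?a, - 1:] = (- 1) * [:- (?e ^ s * ?a), 1:]" for s by simp
  have "(\<Prod>s<d. [:?e ^ s * ?a, - 1:]) = (- 1) ^ d * (Polynomial.monom 1 d - [:?a ^ d:])"
    unfolding neg prod.distrib R by simp
  then have "Z.pe (prod_list (map (\<lambda>s. [:?e ^ s * ?a, - 1:]) [0..<d])) = Z.pe ((- 1) ^ d * (Polynomial.monom 1 d - [:?a ^ d:]))"
    unfolding prod_lessThan_list by (rule arg_cong)
  moreover have "Z.pe [:?e ^ s * ?a, - 1:] = ke (e ^ s) * c - z" for s
    unfolding Z.pe_pCons Z.pe_const Z.pe_0 ek by (simp only: A1.sig_simps sig_uminus zc1) simp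
  moreover have sp: "A1.sig (p ^ k) = A1.sig p ^ k" for p k by (simp only: A1.sig_def A1.S.pe_power)
  have "Z.pe (Polynomial.monom 1 d - [:?a ^ d:]) = z ^ d - c ^ d"
    unfolding Z.pe_diff Z.pe_const Z.pe_monom sp by (simp only: A1.sig_simps zc1) simp
  ultimately have "(\<Prod>s\<leftarrow>[0..<d]. ke (e ^ s) * c - z) = (- 1) ^ d * (z ^ d - c ^ d)"
    unfolding Z.pe_prod_list Z.pe_mult Z.pe_power Z.pe_uminus Z.pe_one by (simp add: comp_def)
  then have main: "ke ((1 - e) ^ d * (\<Prod>s<d. e ^ s)) * (y ^ d * x ^ d) = (- 1) ^ d * (z ^ d - c ^ d)"
    by (simp only: yx_power)
  \<comment> \<open>With \<open>a = 1\<close> and the argument 0 the monomial vanishes because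
    \<open>d > 0\<close>.\<close>
  have "poly (\<Prod>s<d. [:- (e ^ s * 1), 1:]) 0 = poly (Polynomial.monom 1 d - [:1 ^ d:]) 0"
    by (rule arg_cong[where f = "\<lambda>p. poly p 0"], rule roots_of_unity_prod) (use d d' in auto)
  then have Q: "(- 1) ^ d * (\<Prod>s<d. e ^ s) = - 1"
    using d(1) by (simp add: poly_prod poly_monom prod_uminus zero_power)
  show ?thesis
  proof (cases "even d")
    case True
    then have "(\<Prod>s<d. e ^ s) = - 1" using Q by simp
    then show ?thesis using main True by (simp add: ke_uminus algebra_simps)
  next
    case False
    then have "(\<Prod>s<d. e ^ s) = 1" using Q by simp
    then show ?thesis using main False by (simp add: algebra_simps)
  qed
qed

text \<open>Within the first pair no factor \<open>bb\<close> occurs, so the order \<open>d\<close>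
  of \<open>e\<close> suffices in place of \<open>l\<close>.\<close>

lemma xd_y: "x ^ d * y = y * x ^ d"
proof -
  obtain k where k: "d = Suc k" using d(1) gr0_implies_Suc by blast
  have "\<phi> e \<noteq> 1" using E_ne[OF one(1,2)] by simp
  moreover have ed: "\<phi> e ^ d = 1" using d(2) \<phi>_power[of e d] by simp
  ultimately have "(\<Sum>i<d. \<phi> e ^ i) = 0" by (rule geometric_vanish)
  then show ?thesis using xx_power_yy[OF one(1,2), of k] ed by (simp only: k[symmetric] kap_0 kap_1 mult_zero_left) simp
qed

lemma ydxd: "y ^ d * x ^ d = x ^ d * y ^ d"
  by (rule commute_power) (rule xd_y[symmetric])

lemma c_ke: "ke a * c = c * ke a" by (rule A1.ke_comm[symmetric])

definition w0 :: "'k op" where "w0 = ke ((1 - e) ^ d) * (y ^ d * x ^ d)"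

lemma w0_power: "w0 ^ r = \<iota> W"
proof -
  have "w0 ^ r = ke ((1 - e) ^ d) ^ r * (y ^ d * x ^ d) ^ r"
    unfolding w0_def by (rule commuting_power_mult) (rule A1.ke_comm[symmetric])
  also have "(y ^ d * x ^ d) ^ r = y ^ l * x ^ l"
    unfolding commuting_power_mult[OF ydxd] power_mult[symmetric] dr[symmetric] ..
  also have "ke ((1 - e) ^ d) ^ r = ke ((1 - e) ^ l)"
    unfolding A1.ke_def kap_power[symmetric] \<phi>_power[symmetric] power_mult[symmetric] dr[symmetric] ..
  finally show ?thesis unfolding W_def A1.iota_simps \<iota>_cst \<iota>_YY \<iota>_XX .
qed

lemma z_rel: "(z ^ d - c ^ d) ^ r = (- 1) ^ r * \<iota> W"
proof -
  have "z ^ d - c ^ d = - w0" unfolding zd w0_def by simp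
  then show ?thesis by (simp add: power_minus[of w0] w0_power)
qed

text \<open>The monic equation of \<open>z\<close>, a rewriting of \<open>z_rel\<close>. Having
  degree \<open>l\<close>, it reduces all powers of \<open>z\<close> to those with exponent below
  \<open>l\<close>.\<close>

definition F :: "((gen \<Rightarrow>\<^sub>0 nat) \<Rightarrow>\<^sub>0 't) poly poly" where
  "F = (Polynomial.monom 1 d - [:cc ^ d:]) ^ r - [:(- 1) ^ r * W:]"

lemma F_monic: "Polynomial.degree F = l" "Polynomial.lead_coeff F = 1"
proof -
  let ?g = "Polynomial.monom 1 d - [:cc ^ d:]"
  have c0: "Polynomial.coeff [:cc ^ d:] d = 0" using d(1) by (intro Polynomial.coeff_eq_0) simp
  have dg: "Polynomial.degree ?g = d" "Polynomial.coeff ?g d = 1"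
  proof -
    show c1: "Polynomial.coeff ?g d = 1" using c0 by simp
    show "Polynomial.degree ?g = d"
    proof (rule antisym)
     show "Polynomial.degree ?g \<le> d" by (intro degree_diff_le) (auto simp: degree_monom_eq)
     show "d \<le> Polynomial.degree ?g" using c1 by (intro le_degree) simp
    qed
  qed
  then have ne: "?g \<noteq> 0" using d(1) by auto
  have g1: "Polynomial.degree (?g ^ r) = l"
    by (simp only: degree_power_eq[OF ne] dg(1) mult.commute[of r] dr[symmetric])
  have "Polynomial.lead_coeff (?g ^ r) = 1" by (simp only: lead_coeff_power dg power_one)
  note g = g1 this
  have "Polynomial.coeff [:(- 1) ^ r * W:] l = 0" using l0 by (intro Polynomial.coeff_eq_0) simp
  then have "Polynomial.coeff F l = 1" using g by (simp add: F_def)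
  moreover have "Polynomial.degree F \<le> l" unfolding F_def using g by (intro degree_diff_le) auto
  ultimately show "Polynomial.degree F = l" "Polynomial.lead_coeff F = 1"
    by (metis antisym le_degree zero_neq_one)+
qed

sublocale ZK: peval_hom \<iota> z
  by unfold_locales (simp_all only: A1.iota_simps \<iota>_z)

lemma F_z: "ZK.pe F = 0"
proof -
  have m1: "\<iota> ((- 1) ^ r) = (- 1) ^ r" by (simp add: A1.iota_simps)
  show ?thesis
    unfolding F_def ZK.pe_diff ZK.pe_power ZK.pe_const ZK.pe_monom A1.iota_simps(2) m1
    by (simp add: A1.iota_simps \<iota>_cc z_rel)
qed

lemma W_S0: "W \<in> A1.S0" unfolding W_def by (intro A1.dm.S0_mult cst_S0 gg_S0 gY gX)

lemma F_S0: "Polynomial.coeff F i \<in> A1.S0"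
proof -
  have mult: "Polynomial.coeff (p * q) i \<in> A1.S0" if "\<And>i. Polynomial.coeff p i \<in> A1.S0" "\<And>i. Polynomial.coeff q i \<in> A1.S0" for p q i
    unfolding Polynomial.coeff_mult using that by (intro A1.dm.S0_sum A1.dm.S0_mult)
  have power: "Polynomial.coeff (p ^ k) i \<in> A1.S0" if "\<And>i. Polynomial.coeff p i \<in> A1.S0" for p k i
    using that by (induction k arbitrary: i) (auto intro: mult simp: Polynomial.coeff_1 A1.dm.S0_one A1.dm.S0_zero)
  have "(- 1) ^ r * W \<in> A1.S0" by (intro A1.dm.S0_mult S0_power A1.dm.S0_uminus A1.dm.S0_one W_S0)
  then show ?thesis unfolding F_def
    by (auto intro!: A1.dm.S0_diff power simp: coeff_pCons S0_power cc_S0 A1.dm.S0_one A1.dm.S0_zero A1.dm.S0_uminus split: nat.splits)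
qed

definition rr :: "nat \<Rightarrow> nat \<Rightarrow> ((gen \<Rightarrow>\<^sub>0 nat) \<Rightarrow>\<^sub>0 't) poly" where
  "rr = rem_coeff l (\<lambda>i. - Polynomial.coeff F i)"

lemma rr_S0: "rr m i \<in> A1.S0"
  unfolding rr_def by (rule rem_coeff_in) (auto intro: A1.dm.S0_add A1.dm.S0_mult A1.dm.S0_one A1.dm.S0_zero A1.dm.S0_uminus F_S0)

lemma z_rr: "z ^ m = (\<Sum>i<l. \<iota> (rr m i) * z ^ i)"
  unfolding rr_def by (rule ZK.rem_coeff[OF l0 ZK.monic_relation[OF F_monic F_z]])

text \<open>Coordinates of \<open>z^m s(z)\<close> in the powers of \<open>z\<close>: a polynomial
  of the smaller algebra is read with \<open>z\<close> for its variable \<open>c'\<close>, while its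
  coefficients become constants of the larger polynomial ring.\<close>

definition red :: "nat \<Rightarrow> ((gen \<Rightarrow>\<^sub>0 nat) \<Rightarrow>\<^sub>0 't) poly \<Rightarrow> nat \<Rightarrow> ((gen \<Rightarrow>\<^sub>0 nat) \<Rightarrow>\<^sub>0 't) poly" where
  "red m s i = (\<Sum>v\<le>Polynomial.degree s. [:Polynomial.coeff s v:] * rr (m + v) i)"

lemma coeff_S0: "s \<in> A2.S0 \<Longrightarrow> [:Polynomial.coeff s v:] \<in> A1.S0"
  by (auto simp: A1.S0_def A2.S0_def over_gens_def coeff_pCons split: nat.splits dest: g21)

lemma red_S0: "s \<in> A2.S0 \<Longrightarrow> red m s i \<in> A1.S0"
  unfolding red_def by (intro A1.dm.S0_sum A1.dm.S0_mult coeff_S0 rr_S0)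

lemma cm_12: "Poly_Mapping.keys \<alpha> \<subseteq> gens 2 n \<Longrightarrow> cm 1 \<alpha> = cm 2 \<alpha>"
proof -
  assume "Poly_Mapping.keys \<alpha> \<subseteq> gens 2 n"
  then have "Poly_Mapping.lookup \<alpha> (Y 1) = 0" "Poly_Mapping.lookup \<alpha> (X 1) = 0"
    by (auto simp: gens_def intro!: lookup_0_gens)
  then show ?thesis unfolding cm_def using omono_first[of 1 n uu \<alpha>] n1 by (simp add: numeral_2_eq_2 One_nat_def)
qed

lemma A2_iota0: "Poly_Mapping.keys a \<subseteq> {\<alpha>. Poly_Mapping.keys \<alpha> \<subseteq> gens 2 n} \<Longrightarrow> A2.iota0 a = \<iota> [:a:]"
  unfolding A1.iota_const A1.iota0_def A2.iota0_def lin_def by (intro sum.cong refl) (auto simp: cm_12)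

lemma A2_iota: "s \<in> A2.S0 \<Longrightarrow> A2.iota s = (\<Sum>v\<le>Polynomial.degree s. \<iota> [:Polynomial.coeff s v:] * z ^ v)"
  unfolding A2.iota_def peval_def zc2
  by (intro sum.cong refl) (subst A2_iota0, auto simp: A2.S0_def over_gens_def)

lemma z_iota2: "s \<in> A2.S0 \<Longrightarrow> z ^ m * A2.iota s = (\<Sum>i<l. \<iota> (red m s i) * z ^ i)"
proof -
  assume s: "s \<in> A2.S0"
  have h: "z ^ m * \<iota> q = \<iota> q * z ^ m" for q using commute_power[of z "\<iota> q" m] \<iota>_z[of q] by simp
  have "z ^ m * A2.iota s = (\<Sum>v\<le>Polynomial.degree s. \<iota> [:Polynomial.coeff s v:] * z ^ (m + v))"
    unfolding A2_iota[OF s] sum_distrib_left power_add mult.assoc[symmetric] h ..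
  also have "\<dots> = (\<Sum>v\<le>Polynomial.degree s. \<Sum>i<l. \<iota> ([:Polynomial.coeff s v:] * rr (m + v) i) * z ^ i)"
    unfolding A1.iota_simps(2) mult.assoc sum_distrib_left[symmetric] z_rr[symmetric] ..
  also have "\<dots> = (\<Sum>i<l. \<Sum>v\<le>Polynomial.degree s. \<iota> ([:Polynomial.coeff s v:] * rr (m + v) i) * z ^ i)"
    by (rule sum.swap)
  finally show ?thesis unfolding red_def A1.iota_simps(6) sum_distrib_right .
qed

end

section \<open>The trace form on the sublattice and its determinant\<close>

context weyl_lattice
begin

lemma f_mult: "fbas (k, p, a) * fbas (k', p', a') = ke (sc k a' p') * (z ^ (a + a') * (b p * b p' * y ^ (k + k')))"
proof -
  have "fbas (k, p, a) * fbas (k', p', a') = z ^ a * (b p * ((y ^ k * (z ^ a' * b p')) * y ^ k'))"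
    by (simp only: fbas_def prod.case mult.assoc)
  also have "\<dots> = ke (sc k a' p') * (z ^ a * (b p * (z ^ a' * (b p' * (y ^ k * y ^ k')))))"
    by (simp only: sc(3) A1.ke_left[of "z ^ a"] A1.ke_left[of "b p"] mult.assoc)
  finally show ?thesis by (simp only: b_z power_add mult.assoc)
qed

text \<open>\<open>z\<close> is the image of \<open>c'\<close> and hence commutes with the whole
  smaller algebra.\<close>

lemma z_A2:
  assumes "A \<in> A2.dm.\<A>"
  shows "A * (z ^ j * w) = z ^ j * (A * w)"
proof -
  have "\<exists>P. (\<forall>\<alpha>\<in>Poly_Mapping.keys P. Poly_Mapping.keys \<alpha> \<subseteq> A2.G) \<and> A = lin A2.sig b P"
    using assms unfolding A2.dm.\<A>_def A2.hh_elem .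
  then obtain Q where Q: "(\<forall>\<alpha>\<in>Poly_Mapping.keys Q. Poly_Mapping.keys \<alpha> \<subseteq> A2.G) \<and> A = lin A2.sig b Q" ..
  note P = conjunct2[OF Q]
  have "A2.sig p * z = z * A2.sig p" for p
    unfolding A2.sig_def zc2 by (rule A2.S.pe_comm[unfolded zc2]) (rule A2.ke_comm[symmetric], rule refl)
  then have "A * z = z * A" unfolding P lin_def
    by (intro commute_sum commute_mult) (simp_all add: z_b)
  then have "z ^ j * A = A * z ^ j" using commute_power[of z A j] by simp
  then show ?thesis by (simp only: mult.assoc[symmetric])
qed

text \<open>The matrix of multiplication by \<open>w z^M A y^K\<close> on the sublattice. The factor
  \<open>y^K\<close> shifts the first index cyclically, which decides whether the diagonal can be
  nonzero.\<close>

definition NN :: "'t \<Rightarrow> nat \<Rightarrow> nat \<Rightarrow> 'k op \<Rightarrow> nat \<times> (gen \<Rightarrow>\<^sub>0 nat) \<times> nat \<Rightarrow> nat \<times> (gen \<Rightarrow>\<^sub>0 nat) \<times> nat \<Rightarrow> ((gen \<Rightarrow>\<^sub>0 nat) \<Rightarrow>\<^sub>0 't) poly" where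
  "NN w K M A = (\<lambda>(m, q, j) (m', u, i). if m' = (K + m) mod l
    then cst (w * sc K j q) * YY ^ ((K + m) div l) * red (M + j) (A2.dm.co Bx b (A * b q) u) i else 0)"

lemma co_A2: "A \<in> A2.dm.\<A> \<Longrightarrow> q \<in> Bx \<Longrightarrow> u \<in> Bx \<Longrightarrow> A2.dm.co Bx b (A * b q) u \<in> A2.S0"
  by (rule A2.dm.co(1)[OF A2.tbasis_Box A2.dm.\<A>_mult[OF _ b_A]])

lemma NN_S0: "A \<in> A2.dm.\<A> \<Longrightarrow> t \<in> I3 \<Longrightarrow> t' \<in> I3 \<Longrightarrow> NN w K M A t t' \<in> A1.S0"
  by (auto simp: NN_def I3_def intro!: A1.dm.S0_mult cst_S0 S0_power gg_S0 gY red_S0 co_A2 A1.dm.S0_zero)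

text \<open>\<open>y^K\<close> moves to the right past \<open>z^j b_q\<close> at the cost of
  \<open>sc\<close>, the product \<open>A b_q\<close> is expanded over the smaller algebra, and
  \<open>red\<close> rewrites the resulting polynomials in \<open>z\<close>.\<close>

lemma NN:
  assumes A: "A \<in> A2.dm.\<A>" and t: "t \<in> I3"
  shows "ke w * (z ^ M * (A * y ^ K)) * fbas t = (\<Sum>t'\<in>I3. \<iota> (NN w K M A t t') * fbas t')"
proof -
  obtain m q j where tt: "t = (m, q, j)" by (metis prod_cases3)
  have m: "m < l" "q \<in> Bx" "j < l" using t by (auto simp: tt I3_def)
  let ?s = "\<lambda>u. A2.dm.co Bx b (A * b q) u"
  have Ab: "A * b q = (\<Sum>u\<in>Bx. A2.iota (?s u) * b u)"
    using A2.dm.co(2)[OF A2.tbasis_Box A2.dm.\<A>_mult[OF A b_A[OF m(2)]]] by simp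
  let ?w = "w * sc K j q" and ?m = "(K + m) mod l" and ?D = "(K + m) div l"
  have "ke w * (z ^ M * (A * y ^ K)) * fbas t = ke w * (z ^ M * (A * ((y ^ K * (z ^ j * b q)) * y ^ m)))"
    by (simp only: tt fbas_def prod.case mult.assoc)
  also have "\<dots> = ke ?w * (z ^ (M + j) * ((A * b q) * y ^ (K + m)))"
    by (simp only: sc(3) A1.ke_left[of "z ^ M"] A1.ke_left[of A] mult.assoc z_A2[OF A] power_add A1.ke_mult)
  also have "\<dots> = ke ?w * (z ^ (M + j) * ((\<Sum>u\<in>Bx. A2.iota (?s u) * b u) * y ^ (K + m)))"
    by (rule arg_cong[OF Ab, of "\<lambda>t. ke ?w * (z ^ (M + j) * (t * y ^ (K + m)))"])
  also have "\<dots> = (\<Sum>u\<in>Bx. ke ?w * ((z ^ (M + j) * A2.iota (?s u)) * (b u * (\<iota> (YY ^ ?D) * y ^ ?m))))"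
    unfolding sum_distrib_left sum_distrib_right by (subst yred) (simp only: mult.assoc)
  also have "\<dots> = (\<Sum>u\<in>Bx. \<Sum>i<l. \<iota> (cst ?w * YY ^ ?D * red (M + j) (?s u) i) * fbas (?m, u, i))"
  proof (intro sum.cong refl)
    fix u assume u: "u \<in> Bx"
    have "ke ?w * ((z ^ (M + j) * A2.iota (?s u)) * (b u * (\<iota> (YY ^ ?D) * y ^ ?m)))
     = (\<Sum>i<l. ke ?w * (\<iota> (red (M + j) (?s u) i) * (\<iota> (YY ^ ?D) * (z ^ i * (b u * y ^ ?m)))))"
     unfolding z_iota2[OF co_A2[OF A m(2) u]] sum_distrib_left sum_distrib_right mult.assoc \<iota>_zb ..
    also have "\<dots> = (\<Sum>i<l. \<iota> (cst ?w * YY ^ ?D * red (M + j) (?s u) i) * fbas (?m, u, i))"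
    proof (intro sum.cong refl)
     fix i
     have "cst ?w * YY ^ ?D * red (M + j) (?s u) i = cst ?w * (red (M + j) (?s u) i * YY ^ ?D)"
      by (simp only: mult_ac)
     then show "ke ?w * (\<iota> (red (M + j) (?s u) i) * (\<iota> (YY ^ ?D) * (z ^ i * (b u * y ^ ?m))))
      = \<iota> (cst ?w * YY ^ ?D * red (M + j) (?s u) i) * fbas (?m, u, i)"
      by (simp only: A1.iota_simps(2) \<iota>_cst fbas_def prod.case mult.assoc)
    qed
    finally show "ke ?w * ((z ^ (M + j) * A2.iota (?s u)) * (b u * (\<iota> (YY ^ ?D) * y ^ ?m)))
     = (\<Sum>i<l. \<iota> (cst ?w * YY ^ ?D * red (M + j) (?s u) i) * fbas (?m, u, i))" .
  qed
  also have "\<dots> = (\<Sum>t'\<in>Pair ?m ` (Bx \<times> {..<l}). \<iota> (NN w K M A t t') * fbas t')"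
    unfolding sum.cartesian_product by (subst sum.reindex) (auto simp: inj_on_def NN_def tt intro!: sum.cong)
  also have "\<dots> = (\<Sum>t'\<in>I3. \<iota> (NN w K M A t t') * fbas t')"
    using l0 by (intro sum.mono_neutral_left fin3) (auto simp: I3_def NN_def tt A1.iota_simps image_iff)
  finally show ?thesis .
qed

lemma detP: "detS I3 P = (\<Prod>k<l. \<Prod>p\<in>Bx. \<Prod>i<l. cst (bsc p k) * pz k i i * YY ^ ((i + k) div l))"
proof -
  let ?A = "\<lambda>k p i a. cst (bsc p k) * pz k i a * YY ^ ((a + k) div l)"
  have "detS I3 P = (\<Prod>k<l. detS (Bx \<times> {..<l}) (\<lambda>(p, i) (q, a). if p = q then ?A k p i a else 0))"
    unfolding I3_def P_def by (rule detS_block_diag) (auto simp: A2.finite_Box)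
  also have "\<dots> = (\<Prod>k<l. \<Prod>p\<in>Bx. detS {..<l} (?A k p))"
    by (intro prod.cong refl detS_block_diag) (auto simp: A2.finite_Box)
  also have "\<dots> = (\<Prod>k<l. \<Prod>p\<in>Bx. \<Prod>i<l. ?A k p i i)"
    by (intro prod.cong refl detS_lower_triangular) (simp add: pz_above)
  finally show ?thesis .
qed

lemma gg_ne: "gg g \<noteq> 0" by (simp add: gg_def) (metis lookup_single_eq lookup_zero zero_neq_one)

lemma e_ne: "e \<noteq> 0" "e - 1 \<noteq> 0" using E_unit[OF one(1,2)] E_ne[OF one(1,2)] by auto

lemma detP_ne: "detS I3 P \<noteq> 0"
proof -
  have "bsc p k \<noteq> 0" for p k using bsc(1)[of p k] by auto
  then show ?thesis unfolding detP pz_diag using e_ne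
    by (auto simp: cst_eq_0 gg_ne A2.finite_Box)
qed

text \<open>The \<open>fbas\<close> form a basis only after inverting \<open>detS I3 P\<close>, but
  a trace computed with them agrees with the internal one by \<open>trace_similar\<close>.\<close>

lemma trace_f:
  assumes a: "a \<in> A1.dm.\<A>" and N: "\<And>i j. i \<in> I3 \<Longrightarrow> j \<in> I3 \<Longrightarrow> N i j \<in> A1.S0"
    and eq: "\<And>i. i \<in> I3 \<Longrightarrow> a * fbas i = (\<Sum>j\<in>I3. \<iota> (N i j) * fbas j)"
  shows "A1.dm.tr I3 ebas a = (\<Sum>i\<in>I3. N i i)"
  unfolding A1.dm.tr_def
proof (rule trace_similar[OF fin3 detP_ne, where M = "\<lambda>i j. A1.dm.co I3 ebas (a * ebas i) j" and N = N])
  fix i j assume i: "i \<in> I3" and j: "j \<in> I3"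
  let ?M = "\<lambda>i j. A1.dm.co I3 ebas (a * ebas i) j"
  have ae: "a * ebas k \<in> A1.dm.\<A>" if "k \<in> I3" for k
    using a that A1.dm.tbasis_in[OF tbasis3] by (intro A1.dm.\<A>_mult) auto
  show "(\<Sum>k\<in>I3. P i k * ?M k j) = (\<Sum>k\<in>I3. N i k * P k j)"
  proof (rule A1.dm.tbasis_unique[OF tbasis3 _ _ _ j])
    show "(\<Sum>k\<in>I3. P i k * ?M k t) \<in> A1.S0" if "t \<in> I3" for t
     using that by (intro A1.dm.S0_sum A1.dm.S0_mult P_S0 A1.dm.co(1)[OF tbasis3] ae) auto
    show "(\<Sum>k\<in>I3. N i k * P k t) \<in> A1.S0" if "t \<in> I3" for t
     using that i by (intro A1.dm.S0_sum A1.dm.S0_mult P_S0 N) auto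
    have "(\<Sum>t\<in>I3. \<iota> (\<Sum>k\<in>I3. P i k * ?M k t) * ebas t) = (\<Sum>k\<in>I3. \<iota> (P i k) * (\<Sum>t\<in>I3. \<iota> (?M k t) * ebas t))"
     unfolding A1.iota_simps(2,6) sum_distrib_left sum_distrib_right mult.assoc by (rule sum.swap)
    also have "\<dots> = (\<Sum>k\<in>I3. a * (\<iota> (P i k) * ebas k))"
     by (intro sum.cong refl) (simp only: A1.dm.co(2)[OF tbasis3 ae] A1.dm.\<A>_scal[OF P_S0 a])
    also have "\<dots> = a * fbas i" unfolding f_P[OF i] sum_distrib_left ..
    also have "\<dots> = (\<Sum>k\<in>I3. \<iota> (N i k) * (\<Sum>t\<in>I3. \<iota> (P k t) * ebas t))"
     unfolding eq[OF i] by (intro sum.cong refl) (simp only: f_P)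
    also have "\<dots> = (\<Sum>t\<in>I3. \<iota> (\<Sum>k\<in>I3. N i k * P k t) * ebas t)"
     unfolding A1.iota_simps(2,6) sum_distrib_left sum_distrib_right mult.assoc by (rule sum.swap)
    finally show "(\<Sum>t\<in>I3. \<iota> (\<Sum>k\<in>I3. P i k * ?M k t) * ebas t) = (\<Sum>t\<in>I3. \<iota> (\<Sum>k\<in>I3. N i k * P k t) * ebas t)" .
  qed
qed

text \<open>The trace of multiplication by \<open>z^M s(z)\<close> on the span of
  \<open>1, z, ..., z^(l-1)\<close> over the centre.\<close>

definition tau :: "nat \<Rightarrow> ((gen \<Rightarrow>\<^sub>0 nat) \<Rightarrow>\<^sub>0 't) poly \<Rightarrow> ((gen \<Rightarrow>\<^sub>0 nat) \<Rightarrow>\<^sub>0 't) poly" where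
  "tau M s = (\<Sum>j<l. red (M + j) s j)"

text \<open>The Gram matrix of the elements \<open>z^a b_p\<close> for the trace on their own
  span.\<close>

definition H :: "(gen \<Rightarrow>\<^sub>0 nat) \<times> nat \<Rightarrow> (gen \<Rightarrow>\<^sub>0 nat) \<times> nat \<Rightarrow> ((gen \<Rightarrow>\<^sub>0 nat) \<Rightarrow>\<^sub>0 't) poly" where
  "H = (\<lambda>(p, a) (p', a'). \<Sum>q\<in>Bx. tau (a + a') (A2.dm.co Bx b (b p * b p' * b q) q))"

text \<open>Multiplication shifts the \<open>y\<close>-index by \<open>k + k'\<close>, so the
  diagonal vanishes unless \<open>l\<close> divides this sum. If it does, moving
  \<open>y^(k + k')\<close> costs no scalar, and each of the \<open>l\<close> values of the index
  contributes the same; hence the factor \<open>of_nat l\<close>.\<close>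

lemma f_trace:
  assumes i: "(k, p, a) \<in> I3" and j: "(k', p', a') \<in> I3"
  shows "A1.dm.tr I3 ebas (fbas (k, p, a) * fbas (k', p', a')) =
    (if l dvd k + k' then of_nat l * cst (sc k a' p') * YY ^ ((k + k') div l) * H (p, a) (p', a') else 0)"
proof -
  let ?A = "b p * b p'" and ?K = "k + k'" and ?w = "sc k a' p'" and ?M = "a + a'"
  have A: "?A \<in> A2.dm.\<A>" using i j by (auto simp: I3_def intro!: A2.dm.\<A>_mult b_A)
  have "A1.dm.tr I3 ebas (fbas (k, p, a) * fbas (k', p', a')) = (\<Sum>t\<in>I3. NN ?w ?K ?M ?A t t)"
  proof (rule trace_f[where N = "NN ?w ?K ?M ?A"])
    show "fbas (k, p, a) * fbas (k', p', a') \<in> A1.dm.\<A>" using i j by (intro A1.dm.\<A>_mult f_A)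
    show "NN ?w ?K ?M ?A t t' \<in> A1.S0" if "t \<in> I3" "t' \<in> I3" for t t' using NN_S0[OF A that] .
    show "fbas (k, p, a) * fbas (k', p', a') * fbas t = (\<Sum>t'\<in>I3. \<iota> (NN ?w ?K ?M ?A t t') * fbas t')" if "t \<in> I3" for t
     unfolding f_mult by (rule NN[OF A that])
  qed
  also have "\<dots> = (\<Sum>m<l. \<Sum>q\<in>Bx. \<Sum>j<l. NN ?w ?K ?M ?A (m, q, j) (m, q, j))"
    unfolding I3_def sum.cartesian_product[symmetric] by (simp add: sum.cartesian_product case_prod_unfold)
  also have "\<dots> = (\<Sum>m<l. if l dvd ?K then cst ?w * YY ^ (?K div l) * H (p, a) (p', a') else 0)"
  proof (intro sum.cong refl)
    fix m assume "m \<in> {..<l}"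
    then have m: "m < l" by simp
    show "(\<Sum>q\<in>Bx. \<Sum>j<l. NN ?w ?K ?M ?A (m, q, j) (m, q, j))
     = (if l dvd ?K then cst ?w * YY ^ (?K div l) * H (p, a) (p', a') else 0)"
    proof (cases "l dvd ?K")
     case True
     then obtain h where h: "?K = l * h" by auto
     have "(?K + m) mod l = m" "(?K + m) div l = ?K div l" using m l0 unfolding h by simp_all
     then show ?thesis using True sc(2)[OF True]
      by (simp add: NN_def H_def tau_def sum_distrib_left)
    next
     case False
     have "m \<noteq> (?K + m) mod l"
     proof
      assume h: "m = (?K + m) mod l"
      have "(m + (?K mod l)) mod l = (?K + m) mod l" by (simp add: mod_add_right_eq add.commute)
      also have "\<dots> = m" by (rule h[symmetric])
      also have "m = (m + 0) mod l" using m by simp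
      finally have "?K mod l = 0" by (rule mod_add_cancel) (use l0 in simp_all)
      then show False using False by (simp add: mod_eq_0_iff_dvd)
     qed
     then show ?thesis using False by (simp add: NN_def)
    qed
  qed
  finally show ?thesis by (simp add: mult.assoc)
qed

definition Gf :: "nat \<times> (gen \<Rightarrow>\<^sub>0 nat) \<times> nat \<Rightarrow> nat \<times> (gen \<Rightarrow>\<^sub>0 nat) \<times> nat \<Rightarrow> ((gen \<Rightarrow>\<^sub>0 nat) \<Rightarrow>\<^sub>0 't) poly" where
  "Gf i j = A1.dm.tr I3 ebas (fbas i * fbas j)"

lemma delta1: "A1.delta = detS I3 (\<lambda>i j. A1.dm.tr I3 ebas (ebas i * ebas j))"
proof -
  have "detS I3 (\<lambda>i j. A1.dm.tr I3 ebas (ebas i * ebas j))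
    = detS I3 (\<lambda>i j. A1.dm.tr A1.Box A1.ev (A1.ev (ix i) * A1.ev (ix j)))"
  proof (rule detS_cong[OF refl])
    fix i j assume i: "i \<in> I3" and j: "j \<in> I3"
    have e: "ebas i = A1.ev (ix i)" "ebas j = A1.ev (ix j)" using i j ev_ix by (auto simp: I3_def)
    have "ebas i * ebas j \<in> A1.dm.\<A>" using i j A1.dm.tbasis_in[OF tbasis3] by (intro A1.dm.\<A>_mult) auto
    from A1.dm.tr_basis_change[OF tbasis3 A1.tbasis_Box this]
    show "A1.dm.tr I3 ebas (ebas i * ebas j) = A1.dm.tr A1.Box A1.ev (A1.ev (ix i) * A1.ev (ix j))"
     unfolding e .
  qed
  also have "\<dots> = detS A1.Box (\<lambda>\<rho> \<tau>. A1.dm.tr A1.Box A1.ev (A1.ev \<rho> * A1.ev \<tau>))"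
    by (rule detS_reindex[OF bij_ix fin3])
  also have "\<dots> = A1.delta" by (rule A1.delta_def[of 1, symmetric]) auto
  finally show ?thesis ..
qed

lemma detGf: "detS I3 Gf = detS I3 P * A1.delta * detS I3 P"
proof -
  let ?T = "\<lambda>i j. A1.dm.tr I3 ebas (ebas i * ebas j)"
  have "detS I3 Gf = detS I3 (\<lambda>i j. \<Sum>k\<in>I3. (\<Sum>m\<in>I3. P i m * ?T m k) * P j k)"
  proof (rule detS_cong[OF refl])
    fix i j assume i: "i \<in> I3" and j: "j \<in> I3"
    note tb = A1.dm.tbasis_in[OF tbasis3]
    have "fbas i * fbas j = (\<Sum>k\<in>I3. \<iota> (P j k) * (fbas i * ebas k))"
     unfolding f_P[OF j] sum_distrib_left by (intro sum.cong refl) (rule A1.dm.\<A>_scal[OF P_S0 f_A[OF i]])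
    then have "Gf i j = (\<Sum>k\<in>I3. P j k * A1.dm.tr I3 ebas (fbas i * ebas k))"
     unfolding Gf_def by (simp only:) (rule A1.dm.tr_lin[OF tbasis3 P_S0], rule A1.dm.\<A>_mult[OF f_A[OF i] tb], assumption)
    also have "\<dots> = (\<Sum>k\<in>I3. P j k * (\<Sum>m\<in>I3. P i m * ?T m k))"
    proof (intro sum.cong refl arg_cong2[of _ _ _ _ "(*)"])
     fix k assume k: "k \<in> I3"
     have "fbas i * ebas k = (\<Sum>m\<in>I3. \<iota> (P i m) * (ebas m * ebas k))"
      unfolding f_P[OF i] sum_distrib_right mult.assoc ..
     then show "A1.dm.tr I3 ebas (fbas i * ebas k) = (\<Sum>m\<in>I3. P i m * ?T m k)"
      by (simp only:) (rule A1.dm.tr_lin[OF tbasis3 P_S0], rule A1.dm.\<A>_mult[OF tb tb], assumption, rule k)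
    qed
    finally show "Gf i j = (\<Sum>k\<in>I3. (\<Sum>m\<in>I3. P i m * ?T m k) * P j k)" by (simp only: mult.commute)
  qed
  also have "\<dots> = detS I3 (\<lambda>i k. \<Sum>m\<in>I3. P i m * ?T m k) * detS I3 (\<lambda>i j. P j i)"
    by (rule detS_mult[OF fin3])
  finally show ?thesis unfolding detS_mult[OF fin3] detS_transpose[OF fin3, of P] delta1 .
qed

text \<open>Every entry of \<open>Gf\<close> then vanishes, whereas \<open>detS I3 P\<close> does
  not.\<close>

lemma delta_zero: "of_nat l = (0 :: 't) \<Longrightarrow> A1.delta = 0"
proof -
  assume z: "of_nat l = (0 :: 't)"
  have "of_nat m = cst (of_nat m)" for m by (induction m) (simp_all add: cst_simps)
  then have z': "of_nat l = (0 :: ((gen \<Rightarrow>\<^sub>0 nat) \<Rightarrow>\<^sub>0 't) poly)" using z by (simp add: cst_simps)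
  have "Gf i j = 0" if "i \<in> I3" "j \<in> I3" for i j
    using that z' f_trace unfolding Gf_def by (cases i; cases j) (auto simp: I3_def)
  moreover have "I3 \<noteq> {}"
  proof -
    have "0 \<in> Bx" using A2.L_pos_G by (auto simp: A2.Box_def)
    then show ?thesis using l0 by (auto simp: I3_def)
  qed
  then obtain j where "j \<in> I3" by blast
  ultimately have "detS I3 Gf = 0" using detS_0_col[OF fin3, of j Gf] by blast
  then show ?thesis using detGf detP_ne by simp
qed

text \<open>Reordering the rows by \<open>k \<mapsto> - k\<close> makes the Gram matrix block diagonal.\<close>

definition neg :: "nat \<Rightarrow> nat" where "neg k = (l - k) mod l"

lemma neg: "k < l \<Longrightarrow> neg k < l" "k < l \<Longrightarrow> neg (neg k) = k"
  "k < l \<Longrightarrow> k' < l \<Longrightarrow> l dvd neg k + k' \<longleftrightarrow> k = k'"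
  "k < l \<Longrightarrow> (neg k + k) div l = (if k = 0 then 0 else 1)"
proof -
  show 1: "neg k < l" if "k < l" for k using l0 by (simp add: neg_def)
  have n: "neg k = (if k = 0 then 0 else l - k)" if "k < l" for k using that l0 by (simp add: neg_def)
  show "k < l \<Longrightarrow> neg (neg k) = k" using n[of k] n[of "neg k"] 1[of k] by (auto split: if_splits)
  show "(neg k + k) div l = (if k = 0 then 0 else 1)" if "k < l" using n[OF that] that l0 by auto
  show "l dvd neg k + k' \<longleftrightarrow> k = k'" if k: "k < l" "k' < l"
  proof
    assume "l dvd neg k + k'"
    then obtain h where h: "neg k + k' = l * h" by auto
    have "l * h < l * 2" using h 1[OF k(1)] k(2) by linarith
    then have "h < 2" by (simp add: l0)
    then have "h = 0 \<or> h = 1" by auto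
    then show "k = k'" using h n[OF k(1)] k by (auto split: if_splits)
  qed (use n[OF k(1)] k in \<open>auto split: if_splits\<close>)
qed

text \<open>The block for \<open>k\<close> is \<open>H\<close> with columns scaled by units and by
  \<open>of_nat l\<close>, and by one factor \<open>YY\<close> unless \<open>k = 0\<close>, because
  \<open>neg k + k\<close> is \<open>0\<close> for \<open>k = 0\<close> and \<open>l\<close>
  otherwise.\<close>

lemma detGf_H: "\<exists>u. u dvd 1 \<and> detS I3 Gf =
   cst u * (\<Prod>k<l. (of_nat l * YY ^ (if k = 0 then 0 else 1)) ^ (card Bx * l) * detS (Bx \<times> {..<l}) H)"
proof -
  let ?s = "\<lambda>i. if i \<in> I3 then (neg (fst i), snd i) else i"
  have s: "?s permutes I3"
  proof (rule bij_imp_permutes)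
    show "bij_betw ?s I3 I3"
     by (rule bij_betw_byWitness[where f' = ?s]) (auto simp: I3_def neg)
  qed auto
  let ?J = "Bx \<times> {..<l}"
  let ?c = "\<lambda>k i. of_nat l * cst (sc (neg k) (snd i) (fst i)) * YY ^ (if k = 0 then 0 else 1)"
  have J: "finite ?J" by (simp add: A2.finite_Box)
  have "of_int (sign ?s) * detS I3 Gf = detS I3 (\<lambda>i j. Gf (?s i) j)" by (rule detS_permute_rows[OF fin3 s, symmetric])
  also have "\<dots> = detS ({..<l} \<times> ?J) (\<lambda>(k, i) (k', j). if k = k' then ?c k j * H i j else 0)"
    unfolding I3_def[symmetric]
  proof (rule detS_cong[OF refl])
    fix i j assume i: "i \<in> I3" and j: "j \<in> I3"
    obtain k p a k' p' a' where ij: "i = (k, p, a)" "j = (k', p', a')" by (metis prod_cases3)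
    have k: "k < l" "k' < l" using i j by (auto simp: ij I3_def)
    have si: "?s i = (neg k, p, a)" "(neg k, p, a) \<in> I3" using i neg(1)[OF k(1)] by (auto simp: ij I3_def)
    have g: "Gf (neg k, p, a) (k', p', a') = (if k = k' then ?c k (p', a') * H (p, a) (p', a') else 0)"
     unfolding Gf_def f_trace[OF si(2) j[unfolded ij(2)]] neg(3)[OF k] using neg(4)[OF k(1)] by auto
    show "Gf (?s i) j = (case i of (k, i) \<Rightarrow> \<lambda>(k', j). if k = k' then ?c k j * H i j else 0) j"
     unfolding si(1) unfolding ij prod.case by (rule g)
  qed
  also have "\<dots> = (\<Prod>k<l. detS ?J (\<lambda>i j. ?c k j * H i j))"
    by (rule detS_block_diag) (simp_all add: A2.finite_Box)
  also have "\<dots> = (\<Prod>k<l. (\<Prod>j\<in>?J. ?c k j) * detS ?J H)"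
  proof (intro prod.cong refl)
    fix k
    have "detS ?J (\<lambda>i j. ?c k j * H i j) = detS ?J (\<lambda>i j. ?c k i * H j i)"
     by (rule detS_transpose[OF J, of "\<lambda>i j. ?c k i * H j i"])
    also have "\<dots> = (\<Prod>j\<in>?J. ?c k j) * detS ?J H" unfolding detS_scale_rows detS_transpose[OF J, of H] ..
    finally show "detS ?J (\<lambda>i j. ?c k j * H i j) = (\<Prod>j\<in>?J. ?c k j) * detS ?J H" .
  qed
  also have "\<dots> = (\<Prod>k<l. cst (\<Prod>j\<in>?J. sc (neg k) (snd j) (fst j)) * ((of_nat l * YY ^ (if k = 0 then 0 else 1)) ^ (card Bx * l) * detS ?J H))"
  proof (intro prod.cong refl)
    fix k
    have "(\<Prod>j\<in>?J. ?c k j) = (\<Prod>j\<in>?J. cst (sc (neg k) (snd j) (fst j)) * (of_nat l * YY ^ (if k = 0 then 0 else 1)))"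
     by (intro prod.cong refl) (simp only: mult_ac)
    also have "\<dots> = cst (\<Prod>j\<in>?J. sc (neg k) (snd j) (fst j)) * (of_nat l * YY ^ (if k = 0 then 0 else 1)) ^ (card Bx * l)"
     unfolding prod.distrib cst_prod prod_constant card_cartesian_product card_lessThan
     by (simp only: power_mult_distrib)
    finally show "(\<Prod>j\<in>?J. ?c k j) * detS ?J H = cst (\<Prod>j\<in>?J. sc (neg k) (snd j) (fst j)) * ((of_nat l * YY ^ (if k = 0 then 0 else 1)) ^ (card Bx * l) * detS ?J H)"
     by (simp only: mult.assoc)
  qed
  also have "\<dots> = cst (\<Prod>k<l. \<Prod>j\<in>?J. sc (neg k) (snd j) (fst j)) * (\<Prod>k<l. (of_nat l * YY ^ (if k = 0 then 0 else 1)) ^ (card Bx * l) * detS ?J H)"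
    unfolding prod.distrib[where h = "\<lambda>k. (of_nat l * YY ^ (if k = 0 then 0 else 1)) ^ (card Bx * l) * detS ?J H"] cst_prod ..
  finally have eq: "of_int (sign ?s) * detS I3 Gf = cst (\<Prod>k<l. \<Prod>j\<in>?J. sc (neg k) (snd j) (fst j)) * (\<Prod>k<l. (of_nat l * YY ^ (if k = 0 then 0 else 1)) ^ (card Bx * l) * detS ?J H)" .
  have PU: "prod f S dvd 1" if "\<And>i. i \<in> S \<Longrightarrow> f i dvd 1" for f :: "'z \<Rightarrow> 't" and S
    using that by (induction S rule: infinite_finite_induct) (auto simp: is_unit_mult_iff)
  let ?X = "\<Prod>k<l. \<Prod>j\<in>?J. sc (neg k) (snd j) (fst j)"
  have u: "?X dvd 1" by (intro PU sc(1))
  show ?thesis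
  proof (cases "sign ?s = 1")
    case True
    then show ?thesis using eq u by auto
  next
    case False
    then have s1: "sign ?s = - 1" using sign_cases[of ?s] by metis
    have m: "cst (- a) = - cst a" for a by (simp add: cst_def single_uminus)
    have "detS I3 Gf = - (of_int (- 1) * detS I3 Gf)"
     by (simp only: of_int_minus of_int_1 mult_minus_left mult_1_left minus_minus)
    also note eq[unfolded s1]
    also note mult_minus_left[symmetric]
    also note m[symmetric]
    finally show ?thesis using u by (intro exI[of _ "- ?X"] conjI) (simp only: minus_dvd_iff)
  qed
qed

text \<open>The powers of \<open>YY\<close> cancel, since \<open>i + k\<close> exceeds \<open>l\<close> for exactly \<open>k\<close> values of \<open>i\<close>.\<close>

lemma sum_carry: "k < l \<Longrightarrow> (\<Sum>i<l. (i + k) div l) = k"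
proof -
  assume k: "k < l"
  have "(\<Sum>i<l. (i + k) div l) = (\<Sum>i\<in>{l - k..<l}. 1)"
  proof (rule sum.mono_neutral_cong_right)
    show "\<forall>i\<in>{..<l} - {l - k..<l}. (i + k) div l = 0" by auto
    fix i assume "i \<in> {l - k..<l}"
    then have "l \<le> i + k" "i + k < l + l" using k by auto
    then show "(i + k) div l = 1" using l0 by (simp add: div_nat_eqI)
  qed auto
  then show ?thesis using k by simp
qed

text \<open>Squaring turns the exponent \<open>0 + ... + (l - 1)\<close> into
  \<open>l (l - 1)\<close>. All factors other than \<open>e - 1\<close> and \<open>YY\<close> are
  units of \<open>T\<close>.\<close>

lemma detP_square: "\<exists>u. u dvd 1 \<and> detS I3 P * detS I3 P = cst (u * (e - 1) ^ ((l - 1) * (l * l * card Bx))) * YY ^ ((l - 1) * l * card Bx)"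
proof -
  let ?u = "\<Prod>k<l. \<Prod>p\<in>Bx. \<Prod>i<l. bsc p k * (\<Prod>b<i. e ^ (b + k))"
  have "(\<Sum>i<k. i) * 2 = k * (k - 1)" for k :: nat
  proof (induction k)
    case (Suc k)
    then show ?case by (cases k) (auto simp: algebra_simps)
  qed simp
  then have S: "(\<Sum>i<l. i) * 2 = l * (l - 1)" .
  have "detS I3 P = (\<Prod>k<l. \<Prod>p\<in>Bx. \<Prod>i<l. cst (bsc p k * (\<Prod>b<i. e ^ (b + k))) * (cst (e - 1) ^ i * YY ^ ((i + k) div l)))"
    unfolding detP pz_diag by (intro prod.cong refl) (simp only: cst_simps cst_power mult_ac)
  also have "\<dots> = cst ?u * ((\<Prod>k<l. \<Prod>p\<in>Bx. \<Prod>i<l. cst (e - 1) ^ i) * (\<Prod>k<l. \<Prod>p\<in>Bx. \<Prod>i<l. YY ^ ((i + k) div l)))"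
    by (simp only: prod.distrib cst_prod cst_simps(1) mult.assoc)
  also have "(\<Prod>k<l. \<Prod>p\<in>Bx. \<Prod>i<l. cst (e - 1) ^ i) = cst (e - 1) ^ ((\<Sum>i<l. i) * card Bx * l)"
    unfolding power_sum[symmetric] by (simp add: mult_ac)
  also have "(\<Prod>k<l. \<Prod>p\<in>Bx. \<Prod>i<l. YY ^ ((i + k) div l)) = YY ^ ((\<Sum>k<l. k) * card Bx)"
    unfolding power_sum[symmetric] prod_constant power_mult[symmetric] sum_distrib_right
    by (intro arg_cong[of _ _ "\<lambda>s. YY ^ s"] sum.cong refl) (simp add: sum_carry mult.commute)
  finally have D: "detS I3 P = cst ?u * (cst (e - 1) ^ ((\<Sum>i<l. i) * card Bx * l) * YY ^ ((\<Sum>k<l. k) * card Bx))" .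
  have sq: "(u * (a ^ m * h ^ k)) * (u * (a ^ m * h ^ k)) = (u * u) * (a ^ (m * 2) * h ^ (k * 2))"
    for u a h :: "((gen \<Rightarrow>\<^sub>0 nat) \<Rightarrow>\<^sub>0 't) poly" and m k
  proof -
    have "a ^ (m * 2) = a ^ m * a ^ m" "h ^ (k * 2) = h ^ k * h ^ k" by (simp_all only: mult_2_right power_add)
    then show ?thesis by (simp only: mult_ac)
  qed
  have "(\<Sum>i<l. i) * card Bx * l * 2 = ((\<Sum>i<l. i) * 2) * card Bx * l" "(\<Sum>i<l. i) * card Bx * 2 = ((\<Sum>i<l. i) * 2) * card Bx"
    by (simp_all only: mult_ac)
  then have n: "(\<Sum>i<l. i) * card Bx * l * 2 = (l - 1) * (l * l * card Bx)" "(\<Sum>i<l. i) * card Bx * 2 = (l - 1) * l * card Bx"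
    unfolding S by (simp_all only: mult_ac)
  have eq: "detS I3 P * detS I3 P = cst (?u * ?u * (e - 1) ^ ((l - 1) * (l * l * card Bx))) * YY ^ ((l - 1) * l * card Bx)"
    unfolding D sq n cst_simps(1) cst_power by (simp only: mult.assoc)
  have PU: "prod f S dvd 1" if "\<And>i. i \<in> S \<Longrightarrow> f i dvd 1" for f :: "'z \<Rightarrow> 't" and S
    using that by (induction S rule: infinite_finite_induct) (auto simp: is_unit_mult_iff)
  obtain v where "e * v = 1" using E_unit[OF one(1,2)] by blast
  then have "e dvd 1" by (metis dvd_triv_left)
  then have ue: "e ^ j dvd 1" for j using dvd_power_same[of e 1 j] by simp
  have "?u dvd 1"
  proof (intro PU)
    fix k p i
    have "(\<Prod>b<i. e ^ (b + k)) dvd 1"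
     by (induction i) (auto simp: is_unit_mult_iff ue)
    then show "bsc p k * (\<Prod>b<i. e ^ (b + k)) dvd 1" using bsc(1) by (simp add: is_unit_mult_iff)
  qed
  then show ?thesis using eq by (intro exI[of _ "?u * ?u"]) (simp add: is_unit_mult_iff)
qed

text \<open>\<open>detGf\<close> and \<open>detGf_H\<close> compute the same determinant; both sides
  carry the same power of \<open>YY\<close>, which cancels. The power of \<open>e - 1\<close> stays
  on the left because it need not be a unit.\<close>

lemma delta_H: "\<exists>u. u dvd 1 \<and> A1.delta * cst ((e - 1) ^ ((l - 1) * (l * l * card Bx))) =
   cst u * (of_nat l ^ (l * l * card Bx) * detS (Bx \<times> {..<l}) H ^ l)"
proof -
  obtain u where u: "u dvd 1" "detS I3 Gf = cst u * (\<Prod>k<l. (of_nat l * YY ^ (if k = 0 then 0 else 1)) ^ (card Bx * l) * detS (Bx \<times> {..<l}) H)"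
    using detGf_H by blast
  obtain v where v: "v dvd 1" "detS I3 P * detS I3 P = cst (v * (e - 1) ^ ((l - 1) * (l * l * card Bx))) * YY ^ ((l - 1) * l * card Bx)"
    using detP_square by blast
  obtain l' where l': "l = Suc l'" using l0 gr0_implies_Suc by blast
  have "(\<Prod>k<l. YY ^ (if k = 0 then 0 else 1)) = YY ^ (l - 1)"
    unfolding l' prod.lessThan_Suc_shift by simp
  then have Y: "(\<Prod>k<l. (of_nat l * YY ^ (if k = 0 then 0 else 1)) ^ (card Bx * l)) = of_nat l ^ (l * l * card Bx) * YY ^ ((l - 1) * l * card Bx)"
    unfolding prod_power_distrib[symmetric] prod.distrib prod_constant card_lessThan power_mult_distrib
    by (simp only: power_mult[symmetric] mult_ac)
  obtain v' where v': "v * v' = 1" using v(1) by (metis dvdE)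
  have "A1.delta * (detS I3 P * detS I3 P) = detS I3 Gf" unfolding detGf by (simp only: mult_ac)
  then have "YY ^ ((l - 1) * l * card Bx) * (A1.delta * cst ((e - 1) ^ ((l - 1) * (l * l * card Bx))) * cst v)
    = YY ^ ((l - 1) * l * card Bx) * (cst u * (of_nat l ^ (l * l * card Bx) * detS (Bx \<times> {..<l}) H ^ l))"
    unfolding u(2) v(2) prod.distrib Y prod_constant card_lessThan cst_simps by (simp only: mult_ac)
  then have "A1.delta * cst ((e - 1) ^ ((l - 1) * (l * l * card Bx))) * cst v = cst u * (of_nat l ^ (l * l * card Bx) * detS (Bx \<times> {..<l}) H ^ l)"
    using mult_left_cancel[OF power_not_zero[OF gg_ne]] by blast
  then have "A1.delta * cst ((e - 1) ^ ((l - 1) * (l * l * card Bx))) * cst v * cst v' = cst u * (of_nat l ^ (l * l * card Bx) * detS (Bx \<times> {..<l}) H ^ l) * cst v'"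
    by (rule arg_cong)
  then have "A1.delta * cst ((e - 1) ^ ((l - 1) * (l * l * card Bx))) = cst (u * v') * (of_nat l ^ (l * l * card Bx) * detS (Bx \<times> {..<l}) H ^ l)"
    unfolding mult.assoc[of _ "cst v" "cst v'"] cst_simps(1)[symmetric] v' cst_simps(2) by (simp add: cst_simps mult_ac)
  moreover have "u * v' dvd 1" using u(1) v' by (metis dvd_triv_right is_unit_mult_iff)
  ultimately show ?thesis by blast
qed

end

section \<open>Passing to the roots of the relation\<close>

text \<open>The square of the Fourier matrix is \<open>N\<close> times a permutation matrix.\<close>

lemma fourier_det:
  fixes q :: "'f::field"
  assumes N: "0 < N" "q ^ N = 1" "\<And>k. 0 < k \<Longrightarrow> k < N \<Longrightarrow> q ^ k \<noteq> 1"
  shows "\<exists>s. (s = 1 \<or> s = - 1) \<and> detS {..<N} (\<lambda>i j. q ^ (i * j)) ^ 2 = s * of_nat N ^ N"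
proof -
  define s where "s k = (if k < N then (N - k) mod N else k)" for k
  have s1: "s k < N" if "k < N" for k using N(1) by (simp add: s_def that)
  have s2: "s (s k) = k" for k
    using N(1) by (cases "k = 0"; cases "k < N") (auto simp: s_def)
  have perm: "s permutes {..<N}"
  proof (rule bij_imp_permutes)
    show "bij_betw s {..<N} {..<N}" by (rule bij_betw_byWitness[where f' = s]) (auto simp: s2 s1)
  qed (auto simp: s_def)
  have G: "(\<Sum>k<N. q ^ (s i * k) * q ^ (k * j)) = (if i = j then of_nat N else 0)" if "i < N" "j < N" for i j
  proof -
    have qs: "q ^ s i * q ^ i = 1"
     using N(1,2) that(1) by (cases "i = 0") (auto simp: s_def power_add[symmetric])
    have eq: "(\<Sum>k<N. q ^ (s i * k) * q ^ (k * j)) = (\<Sum>k<N. (q ^ s i * q ^ j) ^ k)"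
     by (intro sum.cong refl) (simp add: power_mult power_mult_distrib mult.commute[of _ j])
    show ?thesis
    proof (cases "i = j")
     case True
     then show ?thesis unfolding eq using qs by simp
    next
     case False
     have qi: "q ^ i \<noteq> 0" "q \<noteq> 0" using qs N(1,2) by (auto simp: power_0_left)
     have "q ^ s i * q ^ j \<noteq> 1"
     proof
      assume "q ^ s i * q ^ j = 1"
      then have "q ^ s i * q ^ j = q ^ s i * q ^ i" using qs by simp
      then have ij: "q ^ j = q ^ i" using qi(2) by simp
      have "False" if ab: "a < b" "b < N" "q ^ a = q ^ b" for a b
      proof -
       have "q ^ b = q ^ a * q ^ (b - a)" using ab(1) by (simp add: power_add[symmetric])
       then have "q ^ (b - a) = 1" using ab(3) qi(2) by simp
       then show False using N(3)[of "b - a"] ab by auto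
      qed
      from this[of i j] this[of j i] show False using False ij that by (cases "i < j") auto
     qed
     moreover have "(q ^ s i * q ^ j) ^ N = 1"
      by (simp add: power_mult_distrib power_mult[symmetric] mult.commute[of _ N] N(2) power_mult)
     ultimately show ?thesis unfolding eq using geometric_vanish[of "q ^ s i * q ^ j" N] False by simp
    qed
  qed
  let ?D = "detS {..<N} (\<lambda>i j. q ^ (i * j))"
  have "(of_int (sign s) * ?D) * ?D = detS {..<N} (\<lambda>i j. \<Sum>k<N. q ^ (s i * k) * q ^ (k * j))"
    unfolding detS_permute_rows[OF finite_lessThan perm, symmetric] by (rule detS_mult[OF finite_lessThan, symmetric])
  also have "\<dots> = detS {..<N} (\<lambda>i j. if i = j then of_nat N else 0)"
    by (rule detS_cong[OF refl]) (simp add: G)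
  also have "\<dots> = (\<Prod>i<N. of_nat N)" by (subst detS_lower_triangular) auto
  finally have eq: "of_int (sign s) * ?D ^ 2 = of_nat N ^ N" by (simp add: power2_eq_square mult.assoc)
  have sg: "sign s = 1 \<or> sign s = - 1" by (rule sign_cases[of s]) auto
  then have "of_int (sign s) * of_int (sign s) = (1 :: 'f)" by auto
  then have "?D ^ 2 = of_int (sign s) * (of_int (sign s) * ?D ^ 2)" by (simp only: mult.assoc[symmetric] mult_1_left)
  then have "?D ^ 2 = of_int (sign s) * of_nat N ^ N" by (simp only: eq)
  then show ?thesis using sg by (intro exI[of _ "of_int (sign s)"]) auto
qed

lemma sum_lessThan_double: "(\<Sum>i<k. i) * 2 = k * (k - 1 :: nat)"
proof (induction k)
  case (Suc k)
  then show ?case by (cases k) (auto simp: algebra_simps)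
qed simp

lemma poly_linear_prod:
  fixes q a t :: "'f::idom"
  assumes "0 < N" "q ^ N = 1" "\<And>k. 0 < k \<Longrightarrow> k < N \<Longrightarrow> q ^ k \<noteq> 1" "a \<noteq> 0"
  shows "(\<Prod>i<N. t - q ^ i * a) = t ^ N - a ^ N"
proof -
  have "poly (\<Prod>i<N. [:- (q ^ i * a), 1:]) t = poly (Polynomial.monom 1 N - [:a ^ N:]) t"
    by (simp only: roots_of_unity_prod[OF assms])
  then show ?thesis by (simp add: poly_prod poly_monom)
qed

text \<open>The \<open>d r\<close> numbers \<open>t k\<close> solve
  \<open>(t^d - C)^r = (-1)^r \<omega>^r\<close>. They fall into \<open>r\<close> classes with
  common \<open>d\<close>-th power \<open>C - \<zeta>^i \<omega>\<close>; one chosen root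
  \<open>\<tau> i\<close> per class gives the others through powers of
  \<open>\<epsilon>\<close>.\<close>

locale root_data =
  fixes d r :: nat and \<epsilon> \<zeta> C \<omega> :: "'f::field" and \<tau> :: "nat \<Rightarrow> 'f"
  assumes d: "0 < d" "\<epsilon> ^ d = 1" "\<And>k. 0 < k \<Longrightarrow> k < d \<Longrightarrow> \<epsilon> ^ k \<noteq> 1"
    and r: "0 < r" "\<zeta> ^ r = 1" "\<And>k. 0 < k \<Longrightarrow> k < r \<Longrightarrow> \<zeta> ^ k \<noteq> 1"
    and \<omega>: "\<omega> \<noteq> 0"
    and \<tau>: "\<And>i. \<tau> i ^ d = C - \<zeta> ^ i * \<omega>"
begin

definition p :: "nat \<Rightarrow> 'f" where "p i = C - \<zeta> ^ i * \<omega>"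
definition t :: "nat \<Rightarrow> 'f" where "t k = \<epsilon> ^ (k mod d) * \<tau> (k div d)"

lemma prod_p: "(\<Prod>i<r. p i) = C ^ r - \<omega> ^ r"
  unfolding p_def by (rule poly_linear_prod[OF r \<omega>])

lemma t_d: "t k ^ d = p (k div d)"
proof -
  have "(\<epsilon> ^ (k mod d)) ^ d = 1" by (metis d(2) mult.commute power_mult power_one)
  then show ?thesis by (simp add: t_def power_mult_distrib \<tau> p_def)
qed

lemma t_root: "(t k ^ d - C) ^ r = (- 1) ^ r * \<omega> ^ r"
proof -
  have "(t k ^ d - C) ^ r = (- 1) ^ r * (\<zeta> ^ r) ^ (k div d) * \<omega> ^ r"
    unfolding t_d p_def by (simp add: power_minus[of "\<zeta> ^ _ * \<omega>"] power_mult_distrib power_mult[symmetric] mult.commute[of r] mult.assoc)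
  then show ?thesis using r(2) by simp
qed

lemma bij_dr: "bij_betw (\<lambda>(s, i). s + d * i) ({..<d} \<times> {..<r}) {..<d * r}"
proof -
  have sub: "s + d * i < d * r" if "s < d" "i < r" for s i
  proof -
    have "s + d * i < d * Suc i" using that by simp
    also have "\<dots> \<le> d * r" using that by (intro mult_le_mono2) simp
    finally show ?thesis .
  qed
  show ?thesis
    by (rule bij_betw_byWitness[where f' = "\<lambda>k. (k mod d, k div d)"])
     (use d sub in \<open>auto simp: less_mult_imp_div_less mult.commute\<close>)
qed

definition V :: "nat \<Rightarrow> nat \<Rightarrow> 'f" where "V k j = t k ^ j"

text \<open>Writing the exponents as \<open>a + d b\<close> factors the Vandermonde matrix into two
  block matrices. The blocks of the first are Fourier matrices with scaled columns. Those of the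
  second are Vandermonde matrices in \<open>C - \<zeta>^i \<omega>\<close>, each a Fourier matrix
  times a triangular one. Signs stay undetermined, as only the result up to units matters.\<close>

lemma detV: "\<exists>s. (s = 1 \<or> s = - 1) \<and>
  detS {..<d * r} V ^ 2 = s * of_nat (d * r) ^ (d * r) * (C ^ r - \<omega> ^ r) ^ (d - 1) * (\<omega> ^ r) ^ (d * (r - 1))"
proof -
  let ?F = "detS {..<d} (\<lambda>i j. \<epsilon> ^ (i * j))" and ?H = "detS {..<r} (\<lambda>i j. \<zeta> ^ (i * j))"
  let ?I = "{..<d} \<times> {..<r}"
  let ?A = "\<lambda>(s, i) (a, i'). if i = i' then \<tau> i ^ a * \<epsilon> ^ (s * a) else 0"
  let ?B = "\<lambda>(a, i) (a', b). if a = a' then p i ^ b else 0"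
  have "detS {..<d * r} V = detS ?I (\<lambda>i j. V (case i of (s, i) \<Rightarrow> s + d * i) (case j of (s, i) \<Rightarrow> s + d * i))"
    by (rule detS_reindex[OF bij_dr, symmetric]) simp
  \<comment> \<open>The entry \<open>t^(a + d b)\<close> is \<open>t^a p^b\<close> because
    \<open>t^d = p\<close>, and \<open>t^a\<close> is
    \<open>\<epsilon>^(s a) \<tau>^a\<close>.\<close>
  also have "\<dots> = detS ?I (\<lambda>i j. \<Sum>k\<in>?I. ?A i k * ?B k j)"
  proof (rule detS_cong[OF refl])
    fix i j assume i: "i \<in> ?I" and j: "j \<in> ?I"
    obtain s i0 a b where ij: "i = (s, i0)" "j = (a, b)" by (metis prod.exhaust)
    have m: "s < d" "i0 < r" "a < d" "b < r" using i j by (auto simp: ij)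
    have "(\<Sum>k\<in>?I. ?A i k * ?B k j) = (\<Sum>a'<d. \<Sum>i'<r. if i0 = i' then (if a' = a then \<tau> i0 ^ a * \<epsilon> ^ (s * a) * p i0 ^ b else 0) else 0)"
     unfolding ij sum.cartesian_product by (intro sum.cong refl) auto
    also have "\<dots> = \<tau> i0 ^ a * \<epsilon> ^ (s * a) * p i0 ^ b" using m by (simp add: sum.delta)
    also have "\<dots> = V (s + d * i0) (a + d * b)"
    proof -
     have "t (s + d * i0) = \<epsilon> ^ s * \<tau> i0" using m d(1) by (simp add: t_def)
     moreover have "t (s + d * i0) ^ d = p i0" using m d(1) by (simp add: t_d)
     ultimately show ?thesis unfolding V_def power_add power_mult by (simp add: power_mult_distrib power_mult mult_ac)
    qed
    finally show "V (case i of (s, i) \<Rightarrow> s + d * i) (case j of (s, i) \<Rightarrow> s + d * i) = (\<Sum>k\<in>?I. ?A i k * ?B k j)"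
     by (simp add: ij)
  qed
  also have "\<dots> = detS ?I ?A * detS ?I ?B" by (rule detS_mult) simp
  also have "detS ?I ?A = (\<Prod>i<r. detS {..<d} (\<lambda>s a. \<tau> i ^ a * \<epsilon> ^ (s * a)))"
    by (rule detS_block_diag'[of "{..<r}" "{..<d}" "\<lambda>i s a. \<tau> i ^ a * \<epsilon> ^ (s * a)"]) simp_all
  also have "\<dots> = (\<Prod>i<r. \<tau> i ^ (\<Sum>a<d. a)) * ?F ^ r"
  proof -
    have "detS {..<d} (\<lambda>s a. \<tau> i ^ a * \<epsilon> ^ (s * a)) = \<tau> i ^ (\<Sum>a<d. a) * ?F" for i
    proof -
     have "detS {..<d} (\<lambda>s a. \<tau> i ^ a * \<epsilon> ^ (s * a)) = detS {..<d} (\<lambda>s a. \<tau> i ^ s * \<epsilon> ^ (a * s))"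
      by (rule detS_transpose[OF finite_lessThan, of _ "\<lambda>s a. \<tau> i ^ s * \<epsilon> ^ (a * s)"])
     also have "\<dots> = \<tau> i ^ (\<Sum>a<d. a) * ?F"
      unfolding detS_scale_rows detS_transpose[OF finite_lessThan, of _ "\<lambda>s a. \<epsilon> ^ (s * a)"] power_sum ..
     finally show ?thesis .
    qed
    then show ?thesis by (simp add: prod.distrib)
  qed
  also have "detS ?I ?B = (\<Prod>a<d. detS {..<r} (\<lambda>i b. p i ^ b))"
    by (rule detS_block_diag[of "{..<d}" "{..<r}" "\<lambda>a i b. p i ^ b"]) simp_all
  also have "detS {..<r} (\<lambda>i b. p i ^ b) = ?H * (- \<omega>) ^ (\<Sum>b<r. b)"
  proof -
    \<comment> \<open>From the binomial expansion of \<open>(C - \<zeta>^i \<omega>)^b\<close>: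
      powers of \<open>C\<close> occur off the diagonal only and do not affect the
      determinant.\<close>
    let ?U = "\<lambda>b' b. if b' \<le> b then of_nat (b choose b') * C ^ (b - b') * (- \<omega>) ^ b' else 0"
    have "detS {..<r} (\<lambda>i b. p i ^ b) = detS {..<r} (\<lambda>i b. \<Sum>b'<r. \<zeta> ^ (i * b') * ?U b' b)"
    proof (rule detS_cong[OF refl])
     fix i b assume "i \<in> {..<r}" "b \<in> {..<r}"
     then have b: "b < r" by simp
     have "p i ^ b = (\<zeta> ^ i * (- \<omega>) + C) ^ b" by (simp add: p_def)
     also have "\<dots> = (\<Sum>b'\<le>b. of_nat (b choose b') * (\<zeta> ^ i * (- \<omega>)) ^ b' * C ^ (b - b'))" by (rule binomial_ring)
     also have "\<dots> = (\<Sum>b'\<le>b. \<zeta> ^ (i * b') * ?U b' b)"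
      by (intro sum.cong refl) (simp only: power_mult_distrib power_mult[of \<zeta> i] atMost_iff if_True, simp only: mult_ac)
     also have "\<dots> = (\<Sum>b'<r. \<zeta> ^ (i * b') * ?U b' b)"
      using b by (intro sum.mono_neutral_left) auto
     finally show "p i ^ b = (\<Sum>b'<r. \<zeta> ^ (i * b') * ?U b' b)" .
    qed
    also have "\<dots> = ?H * detS {..<r} ?U" by (rule detS_mult) simp
    also have "detS {..<r} ?U = detS {..<r} (\<lambda>b b'. ?U b' b)" by (rule detS_transpose[OF finite_lessThan, symmetric])
    also have "\<dots> = (\<Prod>b<r. (- \<omega>) ^ b)" by (subst detS_lower_triangular) auto
    finally show ?thesis by (simp add: power_sum)
  qed
  finally have D: "detS {..<d * r} V = (\<Prod>i<r. \<tau> i ^ (\<Sum>a<d. a)) * ?F ^ r * (?H * (- \<omega>) ^ (\<Sum>b<r. b)) ^ d"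
    by simp
  obtain s1 where s1: "s1 = 1 \<or> s1 = - 1" "?F ^ 2 = s1 * of_nat d ^ d" using fourier_det[OF d] by blast
  obtain s2 where s2: "s2 = 1 \<or> s2 = - 1" "?H ^ 2 = s2 * of_nat r ^ r" using fourier_det[OF r] by blast
  \<comment> \<open>Doubling \<open>0 + ... + (d - 1)\<close> gives \<open>d (d - 1)\<close>, and
    the product of the \<open>\<tau> i^d\<close> is \<open>C^r - \<omega>^r\<close>.\<close>
  have tau: "(\<Prod>i<r. \<tau> i ^ (\<Sum>a<d. a)) ^ 2 = (C ^ r - \<omega> ^ r) ^ (d - 1)"
    unfolding prod_power_distrib power_mult[symmetric] sum_lessThan_double prod_p[symmetric]
    by (simp add: power_mult \<tau> p_def)
  have "((- \<omega>) ^ (\<Sum>b<r. b)) ^ 2 = (\<omega> ^ (\<Sum>b<r. b)) ^ 2"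
    by (simp only: power2_eq_square power_mult_distrib[symmetric] minus_mult_minus)
  also have "\<dots> = (\<omega> ^ r) ^ (r - 1)"
    by (simp only: power_mult[symmetric] sum_lessThan_double)
  finally have om: "((- \<omega>) ^ (\<Sum>b<r. b)) ^ 2 = (\<omega> ^ r) ^ (r - 1)" .
  have sq: "(A * F ^ r * (H * M) ^ d) ^ 2 = A ^ 2 * (F ^ 2) ^ r * (H ^ 2 * M ^ 2) ^ d" for A F H M :: 'f
    by (simp add: power2_eq_square power_mult_distrib mult_ac)
  have "detS {..<d * r} V ^ 2 = (C ^ r - \<omega> ^ r) ^ (d - 1) * (?F ^ 2) ^ r * (?H ^ 2 * (\<omega> ^ r) ^ (r - 1)) ^ d"
    unfolding D sq tau om ..
  also have "\<dots> = (s1 ^ r * s2 ^ d) * of_nat (d * r) ^ (d * r) * (C ^ r - \<omega> ^ r) ^ (d - 1) * (\<omega> ^ r) ^ (d * (r - 1))"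
  proof -
    have 1: "(of_nat d ^ d) ^ r = (of_nat d ^ (d * r) :: 'f)" "(of_nat r ^ r) ^ d = (of_nat r ^ (d * r) :: 'f)"
     "((\<omega> ^ r) ^ (r - 1)) ^ d = (\<omega> ^ r) ^ (d * (r - 1))"
     by (simp_all only: power_mult[symmetric] mult_ac)
    show ?thesis unfolding s1(2) s2(2) power_mult_distrib 1 of_nat_mult by (simp only: mult_ac)
  qed
  finally have "detS {..<d * r} V ^ 2 = \<dots>" .
  moreover have "s1 ^ r * s2 ^ d = 1 \<or> s1 ^ r * s2 ^ d = - 1"
    using s1(1) s2(1) by (cases "even r"; cases "even d") auto
  ultimately show ?thesis by blast
qed

end

lemma (in peval_hom) pe_pcompose: "pe (pcompose p q) = peval \<psi> (pe q) p"
proof (induction p)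
  case (pCons a p)
  have "pe (q * pcompose p q) = pe (pcompose p q) * pe q" by (simp only: pe_mult[symmetric] mult.commute)
  then have "pe (pcompose (pCons a p) q) = \<psi> a + peval \<psi> (pe q) p * pe q"
    by (simp only: pcompose_pCons pe_add pe_const pCons.IH)
  then show ?case by (simp only: peval_pCons[where \<psi> = \<psi>, OF \<psi>_zero])
qed (simp add: pe_0 peval_0[where \<psi> = \<psi>, OF \<psi>_zero])

section \<open>The trace form split over the roots\<close>

context weyl_lattice
begin

text \<open>\<open>A2.delta\<close> rewritten as a polynomial in \<open>(c')^d\<close>, possible
  because \<open>d\<close> divides every \<open>L j\<close>.\<close>

definition DD :: "((gen \<Rightarrow>\<^sub>0 nat) \<Rightarrow>\<^sub>0 't) poly" where
  "DD = (\<Sum>k\<le>Polynomial.degree A2.delta. Polynomial.monom (Polynomial.coeff A2.delta (d * k)) k)"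

lemma delta2: "A2.delta = detS Bx (\<lambda>\<rho> \<tau>. A2.dm.tr Bx b (b \<rho> * b \<tau>))"
  by (rule A2.delta_def[of 1]) auto

lemma hmon2: "hmon d 0 A2.delta"
  by (rule A2.delta_hmon) (use d d_dvd in auto)

lemma DD: "A2.delta = pcompose DD (Polynomial.monom 1 d)" "Polynomial.coeff DD k = Polynomial.coeff A2.delta (d * k)"
  unfolding DD_def using hmon_pcompose[OF d(1) hmon2] by blast+

lemma W_const: "W = [:Poly_Mapping.single (Poly_Mapping.single (Y 1) 1 + Poly_Mapping.single (X 1) 1) ((1 - e) ^ l):]"
  by (simp add: W_def cst_def gg_def mult_single add.commute)

lemma W_ne: "W \<noteq> 0"
  unfolding W_def using e_ne by (simp add: cst_eq_0 gg_ne)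

lemma ccW_ne: "cc ^ l - W \<noteq> 0"
proof -
  have "cc ^ l = Polynomial.monom 1 l" by (simp add: cc_def Polynomial.monom_altdef)
  moreover have "Polynomial.coeff W l = 0" unfolding W_const using l0 by (intro Polynomial.coeff_eq_0) simp
  ultimately have "Polynomial.coeff (cc ^ l - W) l = 1" by simp
  then show ?thesis by auto
qed

text \<open>The squared Vandermonde determinant appears once for each \<open>p\<close> in
  \<open>Bx\<close>. The Gram determinant at the root \<open>t_k\<close> depends on
  \<open>t_k^d\<close> only, so each of the \<open>r\<close> values of this power accounts for
  \<open>d\<close> equal factors. Injectivity of \<open>\<chi>\<close> keeps \<open>W\<close>,
  \<open>cc^l - W\<close> and the order of \<open>e\<close> intact in the field.\<close>

lemma det_H_roots:
  fixes \<chi> :: "((gen \<Rightarrow>\<^sub>0 nat) \<Rightarrow>\<^sub>0 't) poly \<Rightarrow> 'f::field"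
  assumes hom: "\<And>a b. \<chi> (a + b) = \<chi> a + \<chi> b" "\<And>a b. \<chi> (a * b) = \<chi> a * \<chi> b" "\<chi> 1 = 1"
    and inj: "\<And>a. \<chi> a = 0 \<Longrightarrow> a = 0"
    and \<zeta>: "\<zeta> ^ r = 1" "\<And>k. 0 < k \<Longrightarrow> k < r \<Longrightarrow> \<zeta> ^ k \<noteq> 1"
    and \<omega>: "\<omega> ^ r = \<chi> W" and \<tau>: "\<And>i. \<tau> i ^ d = \<chi> cc ^ d - \<zeta> ^ i * \<omega>"
    and char: "of_nat l \<noteq> (0 :: 't)"
  shows "\<exists>s. (s = 1 \<or> s = - 1) \<and> \<chi> (detS (Bx \<times> {..<l}) H) =
    (s * of_nat l ^ l * \<chi> (cc ^ l - W) ^ (d - 1) * \<chi> W ^ (l - d)) ^ card Bx *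
    (\<Prod>i<r. peval (\<lambda>a. \<chi> [:a:]) (\<chi> cc ^ d - \<zeta> ^ i * \<omega>) DD ^ d)"
proof -
  have "\<chi> 0 + \<chi> 0 = \<chi> 0 + 0" using hom(1)[of 0 0, symmetric] by (simp only: add_0_right)
  then have z: "\<chi> 0 = 0" by (rule add_left_imp_eq)
  have um: "\<chi> (- a) = - \<chi> a" for a using hom(1)[of a "- a"] by (simp add: z eq_neg_iff_add_eq_0 add.commute)
  interpret \<chi>: comm_ring_hom \<chi> by unfold_locales (simp_all add: hom z)
  have df: "\<chi> (a - b) = \<chi> a - \<chi> b" for a b using hom(1)[of a "- b"] by (simp add: um)
  have pw: "\<chi> (a ^ k) = \<chi> a ^ k" for a k by (induction k) (simp_all add: hom)
  have sm: "\<chi> (sum f S) = (\<Sum>i\<in>S. \<chi> (f i))" for f and S :: "'z set"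
    by (induction S rule: infinite_finite_induct) (simp_all add: z hom)
  have e1: "\<chi> (cst e) ^ k = 1 \<longleftrightarrow> d dvd k" for k
  proof -
    have "\<chi> (cst e) ^ k = 1 \<longleftrightarrow> \<chi> (cst (e ^ k) - cst 1) = 0" by (simp add: df cst_power pw cst_simps hom)
    also have "\<dots> \<longleftrightarrow> cst (e ^ k) - cst 1 = 0" using inj z by metis
    also have "cst (e ^ k) - cst 1 = cst (e ^ k - 1)" by (simp add: cst_def single_diff)
    finally show ?thesis unfolding cst_eq_0 using e_pow[of k] by simp
  qed
  have \<omega>0: "\<omega> \<noteq> 0" using \<omega> inj[of W] W_ne r0 by (metis zero_power)
  interpret RD: root_data d r "\<chi> (cst e)" \<zeta> "\<chi> cc ^ d" \<omega> \<tau>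
    by unfold_locales (use d(1) e1 r0 \<zeta> \<omega>0 \<tau> in \<open>auto dest: nat_dvd_not_less\<close>)
  have dr': "d * r = l" using dr by simp
  obtain s where s: "s = 1 \<or> s = - 1"
    "detS {..<l} RD.V ^ 2 = s * of_nat l ^ l * \<chi> (cc ^ l - W) ^ (d - 1) * \<chi> W ^ (l - d)"
  proof -
    have "(\<chi> cc ^ d) ^ r = \<chi> cc ^ l" unfolding power_mult[symmetric] dr' ..
    moreover have "d * (r - 1) = l - d" by (simp add: right_diff_distrib' dr')
    ultimately show thesis using RD.detV that unfolding dr' \<omega> by (auto simp: df pw)
  qed
  have nl: "of_nat l \<noteq> (0 :: 'f)"
  proof -
    have "of_nat k = \<chi> (cst (of_nat k))" for k by (induction k) (simp_all add: cst_simps z hom)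
    then show ?thesis using inj[of "cst (of_nat l)"] char cst_eq_0 by metis
  qed
  have V0: "detS {..<l} RD.V \<noteq> 0"
  proof -
    have "detS {..<l} RD.V ^ 2 \<noteq> 0"
     unfolding s(2) using s(1) nl inj[of W] W_ne inj[of "cc ^ l - W"] ccW_ne by auto
    then show ?thesis by auto
  qed
  have trr: "RD.t k ^ m = (\<Sum>i<l. \<chi> (rr m i) * RD.t k ^ i)" for k m
  proof -
    interpret T: peval_hom \<chi> "RD.t k" by unfold_locales (simp_all add: hom mult.commute)
    have "T.pe F = (RD.t k ^ d - \<chi> cc ^ d) ^ r - (- 1) ^ r * \<chi> W"
     unfolding F_def T.pe_diff T.pe_power T.pe_const T.pe_monom by (simp add: hom pw um)
    then have "T.pe F = 0" using RD.t_root[of k] by (simp add: \<omega>)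
    then show ?thesis unfolding rr_def by (rule T.rem_coeff[OF l0 T.monic_relation[OF F_monic]])
  qed
  \<comment> \<open>Both sides are the trace of \<open>z^m\<close> modulo \<open>F\<close>, on the
    left in the powers of \<open>z\<close>, on the right diagonalized by the Vandermonde matrix,
    which is invertible by \<open>V0\<close>.\<close>
  have newton: "(\<Sum>j<l. \<chi> (rr (m + j) j)) = (\<Sum>k<l. RD.t k ^ m)" for m
  proof -
    have "(\<Sum>j<l. \<chi> (rr (m + j) j)) = (\<Sum>k<l. if k = k then RD.t k ^ m else 0)"
    proof (rule trace_similar[where M = "\<lambda>i j. \<chi> (rr (m + j) i)" and N = "\<lambda>i k. if i = k then RD.t i ^ m else 0", OF _ V0])
     fix i j assume i: "i \<in> {..<l}" and j: "j \<in> {..<l}"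
     have "(\<Sum>k<l. RD.V i k * \<chi> (rr (m + j) k)) = RD.t i ^ (m + j)"
      unfolding RD.V_def trr[of i "m + j"] by (simp only: mult.commute)
     also have "\<dots> = (\<Sum>k<l. if i = k then RD.t i ^ m * RD.V k j else 0)"
      using i by (simp add: RD.V_def power_add)
     also have "\<dots> = (\<Sum>k<l. (if i = k then RD.t i ^ m else 0) * RD.V k j)"
      by (intro sum.cong refl) auto
     finally show "(\<Sum>k<l. RD.V i k * \<chi> (rr (m + j) k)) = (\<Sum>k<l. (if i = k then RD.t i ^ m else 0) * RD.V k j)" .
    qed simp
    then show ?thesis by simp
  qed
  let ?ev = "\<lambda>t. peval (\<lambda>a. \<chi> [:a:]) t"
  have evh: "peval_hom (\<lambda>a. \<chi> [:a:]) t" for t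
  proof unfold_locales
    fix a b
    have "\<chi> ([:a:] + [:b:]) = \<chi> [:a:] + \<chi> [:b:]" "\<chi> ([:a:] * [:b:]) = \<chi> [:a:] * \<chi> [:b:]" by (rule hom)+
    then show "\<chi> [:a + b:] = \<chi> [:a:] + \<chi> [:b:]" "\<chi> [:a * b:] = \<chi> [:a:] * \<chi> [:b:]" by (simp_all add: mult.commute)
    show "\<chi> [:1:] = 1" using hom(3) by (simp add: one_pCons)
  qed (simp add: mult.commute)
  \<comment> \<open>Summing over the coefficients of \<open>g\<close> turns power sums of the roots
    into values of \<open>g\<close> at the roots.\<close>
  have tau: "\<chi> (tau M g) = (\<Sum>k<l. RD.t k ^ M * ?ev (RD.t k) g)" for M g
  proof -
    have "\<chi> (tau M g) = (\<Sum>j<l. \<Sum>v\<le>Polynomial.degree g. \<chi> [:Polynomial.coeff g v:] * \<chi> (rr ((M + v) + j) j))"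
     unfolding tau_def red_def by (simp only: sm hom ac_simps)
    also have "\<dots> = (\<Sum>v\<le>Polynomial.degree g. \<chi> [:Polynomial.coeff g v:] * (\<Sum>k<l. RD.t k ^ (M + v)))"
     unfolding newton[symmetric] sum_distrib_left by (rule sum.swap)
    also have "\<dots> = (\<Sum>k<l. RD.t k ^ M * ?ev (RD.t k) g)"
     unfolding peval_def sum_distrib_left by (subst sum.swap) (intro sum.cong refl, simp add: power_add mult_ac)
    finally show ?thesis .
  qed
  let ?J = "Bx \<times> {..<l}"
  have J: "finite ?J" by (simp add: A2.finite_Box)
  let ?g = "\<lambda>p p'. A2.dm.tr Bx b (b p * b p')"
  have Hx: "\<chi> (H (p, a) (p', a')) = (\<Sum>k<l. RD.t k ^ a * (?ev (RD.t k) (?g p p') * RD.t k ^ a'))" for p a p' a'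
  proof -
    have es: "?ev t (sum f S) = (\<Sum>i\<in>S. ?ev t (f i))" for t f and S :: "(gen \<Rightarrow>\<^sub>0 nat) set"
     by (rule peval_hom.pe_sum[OF evh])
    show ?thesis unfolding H_def prod.case sm tau A2.dm.tr_def es sum_distrib_left sum_distrib_right
     by (subst sum.swap) (simp only: power_add mult_ac)
  qed
  let ?V1 = "\<lambda>(p, k) (p', a). if p = p' then RD.V k a else 0"
  let ?D = "\<lambda>(p, k) (p', k'). if k = k' then ?ev (RD.t k) (?g p p') else 0"
  have "\<chi> (detS ?J H) = detS ?J (\<lambda>i j. \<chi> (H i j))" by (rule \<chi>.hom_detS)
  \<comment> \<open>\<open>H\<close> becomes \<open>V1^T D V1\<close>, with one Vandermonde block
    per \<open>p\<close> in \<open>V1\<close> and one Gram block per root in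
    \<open>D\<close>.\<close>
  also have "\<dots> = detS ?J (\<lambda>i j. \<Sum>m\<in>?J. ?V1 m i * (\<Sum>m'\<in>?J. ?D m m' * ?V1 m' j))"
  proof (rule detS_cong[OF refl])
    fix i j assume i: "i \<in> ?J" and j: "j \<in> ?J"
    obtain p a p' a' where ij: "i = (p, a)" "j = (p', a')" by (metis prod.exhaust)
    have m: "p \<in> Bx" "p' \<in> Bx" using i j by (auto simp: ij)
    have inner: "(\<Sum>m'\<in>?J. ?D (p1, k) m' * ?V1 m' (p', a')) = ?ev (RD.t k) (?g p1 p') * RD.V k a'" if "k < l" for p1 k
    proof -
     have "(\<Sum>m'\<in>?J. ?D (p1, k) m' * ?V1 m' (p', a'))
      = (\<Sum>q\<in>Bx. \<Sum>k'<l. if k = k' then (if q = p' then ?ev (RD.t k) (?g p1 p') * RD.V k a' else 0) else 0)"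
      unfolding sum.cartesian_product by (intro sum.cong refl) auto
     also have "\<dots> = ?ev (RD.t k) (?g p1 p') * RD.V k a'" using that m A2.finite_Box by simp
     finally show ?thesis .
    qed
    have "(\<Sum>m\<in>?J. ?V1 m i * (\<Sum>m'\<in>?J. ?D m m' * ?V1 m' j))
     = (\<Sum>q\<in>Bx. \<Sum>k<l. ?V1 (q, k) (p, a) * (\<Sum>m'\<in>?J. ?D (q, k) m' * ?V1 m' (p', a')))"
     unfolding ij sum.cartesian_product by (intro sum.cong refl) auto
    also have "\<dots> = (\<Sum>q\<in>Bx. \<Sum>k<l. if q = p then RD.V k a * (?ev (RD.t k) (?g p p') * RD.V k a') else 0)"
    proof (intro sum.cong refl)
     fix q k assume "k \<in> {..<l}"
     then have kl: "k < l" by simp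
     show "?V1 (q, k) (p, a) * (\<Sum>m'\<in>?J. ?D (q, k) m' * ?V1 m' (p', a'))
      = (if q = p then RD.V k a * (?ev (RD.t k) (?g p p') * RD.V k a') else 0)"
      unfolding inner[OF kl] by simp
    qed
    also have "\<dots> = (\<Sum>k<l. RD.V k a * (?ev (RD.t k) (?g p p') * RD.V k a'))"
     using m A2.finite_Box by (subst sum.swap) simp
    finally show "\<chi> (H i j) = (\<Sum>m\<in>?J. ?V1 m i * (\<Sum>m'\<in>?J. ?D m m' * ?V1 m' j))"
     unfolding ij Hx RD.V_def by simp
  qed
  also have "\<dots> = detS ?J (\<lambda>i m. ?V1 m i) * (detS ?J ?D * detS ?J ?V1)"
    unfolding detS_mult[OF J] ..
  also have "detS ?J (\<lambda>i m. ?V1 m i) = detS ?J ?V1" by (rule detS_transpose[OF J])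
  also have "detS ?J ?V1 = (\<Prod>p\<in>Bx. detS {..<l} RD.V)"
    by (rule detS_block_diag[of Bx "{..<l}" "\<lambda>_. RD.V"]) (simp_all add: A2.finite_Box)
  also have "detS ?J ?D = (\<Prod>k<l. detS Bx (\<lambda>p p'. ?ev (RD.t k) (?g p p')))"
    by (rule detS_block_diag'[of "{..<l}" Bx "\<lambda>k p p'. ?ev (RD.t k) (?g p p')"]) (simp_all add: A2.finite_Box)
  also have "\<dots> = (\<Prod>k<l. ?ev (RD.p (k div d)) DD)"
  proof (intro prod.cong refl)
    fix k
    interpret T: peval_hom "\<lambda>a. \<chi> [:a:]" "RD.t k" by (rule evh)
    interpret Th: comm_ring_hom T.pe by unfold_locales (simp_all only: T.pe_add T.pe_mult T.pe_one T.pe_0)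
    have "detS Bx (\<lambda>p p'. T.pe (?g p p')) = T.pe A2.delta" unfolding delta2 by (rule Th.hom_detS[symmetric])
    also have "\<dots> = peval (\<lambda>a. \<chi> [:a:]) (T.pe (Polynomial.monom 1 d)) DD" unfolding DD(1) by (rule T.pe_pcompose)
    also have "T.pe (Polynomial.monom 1 d) = RD.p (k div d)"
     unfolding T.pe_monom by (simp add: T.\<psi>_one[simplified] RD.t_d)
    finally show "detS Bx (\<lambda>p p'. T.pe (?g p p')) = peval (\<lambda>a. \<chi> [:a:]) (RD.p (k div d)) DD" .
  qed
  also have "\<dots> = (\<Prod>i<r. ?ev (RD.p i) DD ^ d)"
  proof -
    have "(\<Prod>k<l. ?ev (RD.p (k div d)) DD) = (\<Prod>x\<in>{..<d} \<times> {..<r}. ?ev (RD.p ((case x of (s, i) \<Rightarrow> s + d * i) div d)) DD)"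
     using prod.reindex_bij_betw[OF RD.bij_dr, of "\<lambda>k. ?ev (RD.p (k div d)) DD"] unfolding dr' by simp
    also have "\<dots> = (\<Prod>s<d. \<Prod>i<r. ?ev (RD.p i) DD)"
     unfolding prod.cartesian_product using d(1) by (intro prod.cong refl) auto
    also have "\<dots> = (\<Prod>i<r. ?ev (RD.p i) DD ^ d)" by (simp add: prod_power_distrib)
    finally show ?thesis .
  qed
  finally have "\<chi> (detS ?J H) = (detS {..<l} RD.V ^ 2) ^ card Bx * (\<Prod>i<r. ?ev (RD.p i) DD ^ d)"
    by (simp add: power2_eq_square power_mult_distrib mult_ac)
  then show ?thesis using s unfolding RD.p_def by metis
qed

end

section \<open>Consequences of centrality\<close>

lemma kap_eq_0: "kap a = 0 \<Longrightarrow> a = 0"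
proof -
  assume "kap a = 0"
  then have "app (kap a) (\<lambda>_. 1) (\<lambda>_. 0) = app 0 (\<lambda>_. 1) (\<lambda>_. 0)" by simp
  then show "a = 0" by (simp add: app_simps)
qed

lemma kap_cancel: "kap a * w = 0 \<Longrightarrow> a \<noteq> 0 \<Longrightarrow> w = 0"
proof -
  assume w: "kap a * w = 0" and a: "a \<noteq> 0"
  have "w = kap (1 / a) * (kap a * w)" using a by (simp only: mult.assoc[symmetric] kap_mult[symmetric]) simp
  then show "w = 0" using w by simp
qed

lemma qcomm_power: "a * c = kap q * (c * a) \<Longrightarrow> a ^ k * c = kap (q ^ k) * (c * a ^ k)"
proof (induction k)
  case (Suc k)
  have "a ^ Suc k * c = a * kap (q ^ k) * (c * a ^ k)" by (simp only: power_Suc mult.assoc Suc)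
  also have "\<dots> = kap (q ^ k) * ((a * c) * a ^ k)" by (simp only: kap_comm[of a] mult.assoc)
  also have "\<dots> = kap (q ^ k * q) * (c * a ^ Suc k)" by (simp only: Suc.prems kap_mult mult.assoc power_Suc)
  finally show ?case by (simp only: power_Suc2[of q])
qed simp

lemma power_inverse: "a * a' = 1 \<Longrightarrow> a ^ k * a' ^ k = (1 :: 'a::monoid_mult)"
proof (induction k)
  case (Suc k)
  have "a ^ Suc k * a' ^ Suc k = a * ((a ^ k * a' ^ k) * a')" by (simp only: power_Suc[of a] power_Suc2[of a'] mult.assoc)
  then show ?case using Suc by simp
qed simp

text \<open>Centrality is given in the algebra at \<open>c = 1\<close>, hence the operators with
  \<open>s = 0\<close>, over the fraction field. A central power that also skew-commutes with an
  invertible operator forces the scalar to be 1; the test operators are the \<open>yy\<close>, and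
  \<open>zz j\<close> for equal indices.\<close>

lemma qweyl_orders:
  fixes E :: "nat \<Rightarrow> 't::idom" and B :: "nat \<Rightarrow> nat \<Rightarrow> 't"
  assumes E_unit: "\<And>j. 1 \<le> j \<Longrightarrow> j \<le> n \<Longrightarrow> \<exists>u. E j * u = 1"
    and E_ne: "\<And>j. 1 \<le> j \<Longrightarrow> j \<le> n \<Longrightarrow> E j \<noteq> 1"
    and B_inv: "\<And>j k. 1 \<le> j \<Longrightarrow> j \<le> n \<Longrightarrow> 1 \<le> k \<Longrightarrow> k \<le> n \<Longrightarrow> B j k * B k j = 1"
    and B_diag: "\<And>j. 1 \<le> j \<Longrightarrow> j \<le> n \<Longrightarrow> B j j = 1"
    and central: "\<And>g. g \<in> gens 1 n \<Longrightarrow>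
      qw_class 1 n E B 1 (fgen g) [^]\<^bsub>qweyl 1 n E B 1\<^esub> L (idx g) \<in> ring_center (qweyl 1 n E B 1)"
  shows "1 \<le> j \<Longrightarrow> j \<le> n \<Longrightarrow> 1 \<le> k \<Longrightarrow> k \<le> n \<Longrightarrow> B j k ^ L j = 1"
    and "1 \<le> j \<Longrightarrow> j \<le> k \<Longrightarrow> k \<le> n \<Longrightarrow> E j ^ L k = 1"
proof -
  note One_nat_def [simp del]
  have fr: "to_fract (a ^ i) = to_fract a ^ i" for a :: 't and i by (induction i) (simp_all del: One_nat_def)
  interpret torus n 0 "\<lambda>j. to_fract (E j)" "\<lambda>j k. to_fract (B j k)"
  proof
    show "to_fract (E j) \<noteq> 0" if "1 \<le> j" "j \<le> n" for j using E_unit[OF that] by auto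
    show "to_fract (E j) \<noteq> 1" if "1 \<le> j" "j \<le> n" for j
     using E_ne[OF that] to_fract_eq_iff[of "E j" 1] by (simp del: to_fract_eq_iff)
    show "to_fract (B j k) * to_fract (B k j) = 1" if "1 \<le> j" "j \<le> n" "1 \<le> k" "k \<le> n" for j k
     using B_inv[OF that] by (simp add: to_fract_mult[symmetric] del: to_fract_mult)
    show "to_fract (B j j) = 1" if "1 \<le> j" "j \<le> n" for j using B_diag[OF that] by simp
  qed
  have z0: "zz 0 = 1" unfolding zz_def by (rule mon_1) (simp_all add: zsh_def)
  define E' where "E' j = (SOME u. E j * u = 1)" for j
  let ?s = "\<lambda>a. kap (to_fract a)"
  interpret rep: qw_rep 1 n E B 1 E' ?s vv
  proof
    show "(1::nat) \<le> 1" by simp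
    show "E j * E' j = 1" if "j \<in> {1..n}" for j
     using someI_ex[OF E_unit[of j]] that by (simp add: E'_def)
    show "B j k * B k j = 1" if "j \<in> {1..n}" "k \<in> {1..n}" "j \<noteq> k" for j k using B_inv[of j k] that by simp
    show "?s (a + b) = ?s a + ?s b" "?s (a * b) = ?s a * ?s b" for a b by (simp_all add: kap_add kap_mult)
    show "?s 1 = 1" by simp
    show "?s r * vv g = vv g * ?s r" for g r by (rule kap_comm[symmetric])
    show "vv (Y j) * vv (Y k) = ?s (B j k) * vv (Y k) * vv (Y j)" if "1 \<le> j" "j \<le> n" "1 \<le> k" "k \<le> n" for j k
     using yy_yy[OF that] by simp
    show "vv (X j) * vv (X k) = ?s (E j * B j k) * vv (X k) * vv (X j)" if "1 \<le> j" "j < k" "k \<le> n" for j k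
     using xx_xx[OF that] by (simp add: mult.assoc)
    show "vv (X j) * vv (Y k) = ?s (B k j) * vv (Y k) * vv (X j)" if "1 \<le> j" "j < k" "k \<le> n" for j k
     using xx_yy[of j k] that by (simp add: mult.assoc)
    show "vv (X j) * vv (Y k) = ?s (E k * B k j) * vv (Y k) * vv (X j)" if "1 \<le> k" "k < j" "j \<le> n" for j k
     using xx_yy[of j k] that by (simp add: mult.assoc)
    show "vv (X j) * vv (Y j) - ?s (E j) * vv (Y j) * vv (X j)
     = ?s 1 + (\<Sum>i\<in>{1..<j}. ?s (E i - 1) * vv (Y i) * vv (X i))" if "1 \<le> j" "j \<le> n" for j
    proof -
     have "zz (j - 1) = 1 + (\<Sum>i\<in>{1..<j}. kap (to_fract (E i) - 1) * (yy i * xx i))"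
      using zz_sum[of 1 j] that z0 by simp
     then show ?thesis using xx_yy_same[OF that] by (simp add: mult.assoc)
    qed
    fix P :: "(gen \<Rightarrow>\<^sub>0 nat) \<Rightarrow>\<^sub>0 't"
    assume P: "\<forall>\<alpha>\<in>Poly_Mapping.keys P. Poly_Mapping.keys \<alpha> \<subseteq> gens 1 n" and z: "lin ?s (omono 1 n vv) P = 0"
    let ?S = "Poly_Mapping.keys P \<times> {0::nat}"
    have "(\<Sum>(\<alpha>, k)\<in>?S. kap (to_fract (Poly_Mapping.lookup P \<alpha>)) * (omono 1 n vv \<alpha> * zz (1 - 1) ^ k)) = 0"
     using z unfolding lin_def by (simp add: sum.cartesian_product[symmetric])
    then have "to_fract (Poly_Mapping.lookup P \<alpha>) = 0" if "\<alpha> \<in> Poly_Mapping.keys P" for \<alpha>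
     using pbw_independent[of 1 ?S "\<lambda>\<alpha> _. to_fract (Poly_Mapping.lookup P \<alpha>)" \<alpha> 0] P that by auto
    then have "Poly_Mapping.lookup P \<alpha> = 0" if "\<alpha> \<in> Poly_Mapping.keys P" for \<alpha> using that by simp
    then show "P = 0" by (intro poly_mapping_eqI) (auto simp: in_keys_iff)
  qed
  let ?Q = "qweyl 1 n E B 1" and ?c = "qw_class 1 n E B 1"
  interpret R: ring_embedding ?Q rep.hh by (rule rep.embedding)
  have hg: "rep.hh (?c (fgen g)) = vv g" "?c (fgen g) \<in> carrier ?Q" if "g \<in> gens 1 n" for g
    using that by (auto simp: rep.hh_cls rep.ev_fgen intro: rep.cls_closed)
  interpret Q: ring ?Q by (rule R.ring)
  have comm: "vv g ^ L (idx g) * vv g' = vv g' * vv g ^ L (idx g)" if g: "g \<in> gens 1 n" "g' \<in> gens 1 n" for g g'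
  proof -
    let ?p = "?c (fgen g) [^]\<^bsub>?Q\<^esub> L (idx g)"
    have p: "?p \<in> carrier ?Q" using hg(2)[OF g(1)] by simp
    have "?p \<otimes>\<^bsub>?Q\<^esub> ?c (fgen g') = ?c (fgen g') \<otimes>\<^bsub>?Q\<^esub> ?p"
     using central[OF g(1)] hg(2)[OF g(2)] by (auto simp: ring_center_def)
    from arg_cong[OF this, of rep.hh] show ?thesis
     by (simp add: R.h_mult p hg[OF g(2)] R.h_pow hg[OF g(1)])
  qed
  have XY: "X i \<in> gens 1 n" "Y i \<in> gens 1 n" if "1 \<le> i" "i \<le> n" for i using that by (auto simp: gens_def)
  have BLg: "B j k ^ L j = 1" if jk: "1 \<le> j" "j \<le> n" "1 \<le> k" "k \<le> n" for j k
  proof -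
    let ?q = "to_fract (B j k) ^ L j"
    have "yy j ^ L j * yy k = kap ?q * (yy k * yy j ^ L j)"
     by (rule qcomm_power) (use yy_yy[OF jk] in \<open>simp add: mult.assoc\<close>)
    then have "kap (?q - 1) * (yy k * yy j ^ L j) = 0"
     using comm[OF XY(2)[OF jk(1,2)] XY(2)[OF jk(3,4)]] by (simp add: kap_diff left_diff_distrib)
    then have "kap (?q - 1) * (yy k * (yy j ^ L j * yi j ^ L j) * yi k) = 0" by (simp only: mult.assoc[symmetric] mult_zero_left)
    then have "kap (?q - 1) = 0" using power_inverse[OF yy_yi[OF jk(1,2)]] yy_yi[OF jk(3,4)] by simp
    then have "to_fract (B j k ^ L j) = to_fract 1" using kap_eq_0 fr by fastforce
    then show ?thesis by (simp only: to_fract_eq_iff)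
  qed
  then show "1 \<le> j \<Longrightarrow> j \<le> n \<Longrightarrow> 1 \<le> k \<Longrightarrow> k \<le> n \<Longrightarrow> B j k ^ L j = 1" .
  have xn: "xx k ^ i \<noteq> 0" if "1 \<le> k" "k \<le> n" for k i
    using omono_nonzero[of 1 "Poly_Mapping.single (X k) i"] omono_single[OF XY(1)[OF that], of vv i] by simp
  have scal: "q = 1" if "w * t = kap q * (t * w)" "w * t = t * w" "t' * t = 1" "w \<noteq> 0" for w t t' q
  proof (rule ccontr)
    assume "q \<noteq> 1"
    have "kap (q - 1) * (t * w) = 0" using that(1,2) by (simp add: kap_diff left_diff_distrib)
    from kap_cancel[OF this] have "t * w = 0" using \<open>q \<noteq> 1\<close> by simp
    then have "t' * t * w = 0" by (simp only: mult.assoc mult_zero_right)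
    then show False using that by simp
  qed
  show "E j ^ L k = 1" if jk: "1 \<le> j" "j \<le> k" "k \<le> n"
  proof (cases "j = k")
    case True
    let ?w = "xx j ^ L j"
    have j: "1 \<le> j" "j \<le> n" using jk by auto
    have cw: "vv g' * ?w = ?w * vv g'" if "g' \<in> gens 1 n" for g' using comm[OF XY(1)[OF j] that] by simp
    \<comment> \<open>For \<open>j = k\<close> the test operator is \<open>zz j\<close>: a
      combination of products of generators, hence commuting with \<open>?w\<close>, yet
      skew-commuting with \<open>xx j\<close> by the factor \<open>E j\<close>.\<close>
    have "?w * zz j = kap (to_fract (E j) ^ L j) * (zz j * ?w)"
     by (rule qcomm_power) (use zz_xx[OF j j(2)] in simp)
    moreover have "?w * zz j = zz j * ?w"
    proof -
     have "zz j = 1 + (\<Sum>i\<in>{1..<Suc j}. kap (to_fract (E i) - 1) * (yy i * xx i))"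
      using zz_sum[of 1 "Suc j"] j z0 by simp
     moreover have "(\<Sum>i\<in>{1..<Suc j}. kap (to_fract (E i) - 1) * (yy i * xx i)) * ?w
      = ?w * (\<Sum>i\<in>{1..<Suc j}. kap (to_fract (E i) - 1) * (yy i * xx i))"
     proof (rule commute_sum, rule commute_mult[OF kap_comm[symmetric]], rule commute_mult)
      fix i assume "i \<in> {1..<Suc j}"
      then have "X i \<in> gens 1 n" "Y i \<in> gens 1 n" using j by (auto simp: gens_def)
      from cw[OF this(2)] cw[OF this(1)] show "yy i * ?w = ?w * yy i" "xx i * ?w = ?w * xx i" by simp_all
     qed
     ultimately show ?thesis by (simp add: distrib_left distrib_right)
    qed
    moreover have "mon (\<lambda>_. 1) (\<lambda>g. - zsh j g) * zz j = 1"
     unfolding zz_def mon_mult by (rule mon_1) auto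
    ultimately have "to_fract (E j) ^ L j = 1" using xn[OF j] by (rule scal)
    then have "to_fract (E j ^ L j) = to_fract 1" by (simp add: fr)
    then show ?thesis using True by (simp only: to_fract_eq_iff)
  next
    case False
    then have j: "1 \<le> j" "j \<le> n" "j < k" and k: "1 \<le> k" "k \<le> n" using jk by auto
    let ?w = "xx k ^ L k" and ?q = "to_fract (E j) * to_fract (B j k)"
    have "?w * yy j = kap (?q ^ L k) * (yy j * ?w)"
     by (rule qcomm_power) (use xx_yy[OF k j(1,2)] j(3) in simp)
    moreover have "?w * yy j = yy j * ?w" using comm[OF XY(1)[OF k] XY(2)[OF j(1,2)]] by simp
    ultimately have "?q ^ L k = 1" using yi_yy[OF j(1,2)] xn[OF k] by (rule scal)
    then have "to_fract ((E j * B j k) ^ L k) = to_fract 1" by (simp add: fr)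
    then have "(E j * B j k) ^ L k = 1" by (simp only: to_fract_eq_iff)
    \<comment> \<open>\<open>BLg\<close> provides this power of \<open>B k j\<close>, which is the
      inverse of \<open>B j k\<close>.\<close>
    moreover have "B j k ^ L k = 1"
    proof -
     have "(B j k * B k j) ^ L k = 1" using B_inv[OF j(1,2) k] by simp
     then show ?thesis using BLg[OF k j(1,2)] by (simp add: power_mult_distrib)
    qed
    ultimately show ?thesis by (simp add: power_mult_distrib)
  qed
qed

section \<open>Evaluation and base change\<close>

text \<open>Allows the product over the centre in \<open>cw_eval\<close> to be unfolded one factor
  at a time.\<close>

lemma center_comm_monoid:
  fixes R (structure)
  assumes "ring R"
  shows "comm_monoid (R\<lparr>carrier := ring_center R\<rparr>)"
proof -
  interpret ring R by fact
  have closed: "x \<otimes> y \<in> ring_center R" if "x \<in> ring_center R" "y \<in> ring_center R" for x y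
  proof -
    have x: "x \<in> carrier R" "\<And>a. a \<in> carrier R \<Longrightarrow> x \<otimes> a = a \<otimes> x" and y: "y \<in> carrier R" "\<And>a. a \<in> carrier R \<Longrightarrow> y \<otimes> a = a \<otimes> y"
     using that unfolding ring_center_def by blast+
    have "x \<otimes> y \<otimes> a = a \<otimes> (x \<otimes> y)" if a: "a \<in> carrier R" for a
    proof -
     have "x \<otimes> y \<otimes> a = x \<otimes> (y \<otimes> a)" by (rule m_assoc[OF x(1) y(1) a])
     also have "\<dots> = x \<otimes> a \<otimes> y" unfolding y(2)[OF a] by (rule m_assoc[OF x(1) a y(1), symmetric])
     also have "\<dots> = a \<otimes> (x \<otimes> y)" unfolding x(2)[OF a] by (rule m_assoc[OF a x(1) y(1)])
     finally show ?thesis .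
    qed
    then show ?thesis using m_closed[OF x(1) y(1)] unfolding ring_center_def by blast
  qed
  have car: "x \<in> carrier R" if "x \<in> ring_center R" for x using that unfolding ring_center_def by blast
  show ?thesis
  proof (rule comm_monoidI)
    let ?Z = "R\<lparr>carrier := ring_center R\<rparr>"
    show "x \<otimes>\<^bsub>?Z\<^esub> y \<in> carrier ?Z" if "x \<in> carrier ?Z" "y \<in> carrier ?Z" for x y using closed that by simp
    show "\<one>\<^bsub>?Z\<^esub> \<in> carrier ?Z" by (simp add: ring_center_def)
    show "x \<otimes>\<^bsub>?Z\<^esub> y \<otimes>\<^bsub>?Z\<^esub> z = x \<otimes>\<^bsub>?Z\<^esub> (y \<otimes>\<^bsub>?Z\<^esub> z)"
     if "x \<in> carrier ?Z" "y \<in> carrier ?Z" "z \<in> carrier ?Z" for x y z using that by (simp add: m_assoc car)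
    show "\<one>\<^bsub>?Z\<^esub> \<otimes>\<^bsub>?Z\<^esub> x = x" if "x \<in> carrier ?Z" for x using that by (simp add: car)
    show "x \<otimes>\<^bsub>?Z\<^esub> y = y \<otimes>\<^bsub>?Z\<^esub> x" if xy: "x \<in> carrier ?Z" "y \<in> carrier ?Z" for x y
    proof -
     have "x \<in> ring_center R" "y \<in> carrier R" using xy car by simp_all
     then have "x \<otimes> y = y \<otimes> x" unfolding ring_center_def by blast
     then show ?thesis by simp
    qed
  qed
qed

context weyl_at
begin

lemma cm_single: "g \<in> G \<Longrightarrow> cm m (Poly_Mapping.single g k) = uu g ^ k"
  unfolding cm_def by (rule omono_single)

text \<open>The separate coefficient map \<open>\<psi>\<close> covers evaluation over
  \<open>T\<close> as well as evaluation of a polynomial over \<open>T\<close> in the algebra over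
  the field.\<close>

lemma hh_cw_eval:
  fixes \<psi> :: "'s::zero \<Rightarrow> 't"
  assumes D: "over_gens G D" and s: "s \<in> carrier R"
  shows "hh (cw_eval m n E B L \<psi> D s) = peval (lin (\<lambda>a. ke (\<psi> a)) (cm m)) (hh s) D"
    and "cw_eval m n E B L \<psi> D s \<in> carrier R"
proof -
  interpret R: ring R by (rule emb.ring)
  let ?Z = "R\<lparr>carrier := ring_center R\<rparr>"
  interpret Z: comm_monoid ?Z by (rule center_comm_monoid[OF emb.ring])
  let ?f = "\<lambda>\<alpha> g. (cw_gen m n E B g [^]\<^bsub>R\<^esub> L (idx g)) [^]\<^bsub>R\<^esub> (Poly_Mapping.lookup \<alpha> g :: nat)"
  have fC: "?f \<alpha> g \<in> cw_sub m n E B L" if "g \<in> G" for \<alpha> g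
  proof -
    have "cw_gen m n E B g [^]\<^bsub>R\<^esub> L (idx g) \<in> cw_sub m n E B L"
     unfolding cw_sub_def using that by (auto intro: generate_ring.incl)
    moreover have "c [^]\<^bsub>R\<^esub> (k::nat) \<in> cw_sub m n E B L" if "c \<in> cw_sub m n E B L" for c k
     using that subringE(3,6)[OF subring_cw_sub] by (induction k) auto
    ultimately show ?thesis by blast
  qed
  then have fZ: "?f \<alpha> g \<in> ring_center R" if "g \<in> G" for \<alpha> g using dm.C_center that by blast
  have fR: "?f \<alpha> g \<in> carrier R" "hh (?f \<alpha> g) = uu g ^ Poly_Mapping.lookup \<alpha> g" if "g \<in> G" for \<alpha> g
    using that by (simp_all add: gen_carrier emb.h_pow hh_gen uu_def)
  have fp: "(\<Otimes>\<^bsub>?Z\<^esub>g\<in>T. ?f \<alpha> g) \<in> carrier R \<and> hh (\<Otimes>\<^bsub>?Z\<^esub>g\<in>T. ?f \<alpha> g) = cm m (\<Sum>g\<in>T. Poly_Mapping.single g (Poly_Mapping.lookup \<alpha> g))"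
    if "finite T" "T \<subseteq> G" for T \<alpha>
    using that
  proof (induction T)
    case empty
    then show ?case by (simp add: emb.h_one)
  next
    case (insert g T)
    have gG: "g \<in> G" "T \<subseteq> G" using insert.prems by auto
    have "(\<Otimes>\<^bsub>?Z\<^esub>h\<in>insert g T. ?f \<alpha> h) = ?f \<alpha> g \<otimes>\<^bsub>R\<^esub> (\<Otimes>\<^bsub>?Z\<^esub>h\<in>T. ?f \<alpha> h)"
     using Z.finprod_insert[OF insert.hyps, of "?f \<alpha>"] fZ gG by auto
    then show ?case using insert.IH[OF gG(2)] insert.hyps fR[OF gG(1), of \<alpha>]
     by (simp add: emb.h_mult cm_add[OF m1] cm_single[OF gG(1)])
  qed
  have keysG: "Poly_Mapping.keys \<alpha> \<subseteq> G" if "\<alpha> \<in> Poly_Mapping.keys (Polynomial.coeff D k)" for \<alpha> k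
    using D that by (auto simp: over_gens_def)
  let ?t = "\<lambda>k \<alpha>. cw_const m n E B (\<psi> (Poly_Mapping.lookup (Polynomial.coeff D k) \<alpha>)) \<otimes>\<^bsub>R\<^esub> (\<Otimes>\<^bsub>?Z\<^esub>g\<in>Poly_Mapping.keys \<alpha>. ?f \<alpha> g)"
  have t: "?t k \<alpha> \<in> carrier R" "hh (?t k \<alpha>) = ke (\<psi> (Poly_Mapping.lookup (Polynomial.coeff D k) \<alpha>)) * cm m \<alpha>"
    if "\<alpha> \<in> Poly_Mapping.keys (Polynomial.coeff D k)" for k \<alpha>
    using fp[OF finite_keys keysG[OF that], of \<alpha>]
    by (simp_all add: const_carrier emb.h_mult hh_const poly_mapping_decomp)
  have u: "(\<Oplus>\<^bsub>R\<^esub>\<alpha>\<in>Poly_Mapping.keys (Polynomial.coeff D k). ?t k \<alpha>) \<otimes>\<^bsub>R\<^esub> s [^]\<^bsub>R\<^esub> k \<in> carrier R"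
    "hh ((\<Oplus>\<^bsub>R\<^esub>\<alpha>\<in>Poly_Mapping.keys (Polynomial.coeff D k). ?t k \<alpha>) \<otimes>\<^bsub>R\<^esub> s [^]\<^bsub>R\<^esub> k)
     = lin (\<lambda>a. ke (\<psi> a)) (cm m) (Polynomial.coeff D k) * hh s ^ k" for k
  proof -
    have c: "(\<Oplus>\<^bsub>R\<^esub>\<alpha>\<in>Poly_Mapping.keys (Polynomial.coeff D k). ?t k \<alpha>) \<in> carrier R"
     by (rule R.finsum_closed) (use t(1) in auto)
    then show "(\<Oplus>\<^bsub>R\<^esub>\<alpha>\<in>Poly_Mapping.keys (Polynomial.coeff D k). ?t k \<alpha>) \<otimes>\<^bsub>R\<^esub> s [^]\<^bsub>R\<^esub> k \<in> carrier R" using s by simp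
    have "hh (\<Oplus>\<^bsub>R\<^esub>\<alpha>\<in>Poly_Mapping.keys (Polynomial.coeff D k). ?t k \<alpha>) = (\<Sum>\<alpha>\<in>Poly_Mapping.keys (Polynomial.coeff D k). hh (?t k \<alpha>))"
     by (rule emb.h_finsum) (use t(1) in auto)
    also have "\<dots> = lin (\<lambda>a. ke (\<psi> a)) (cm m) (Polynomial.coeff D k)"
     unfolding lin_def by (intro sum.cong refl) (rule t(2))
    finally show "hh ((\<Oplus>\<^bsub>R\<^esub>\<alpha>\<in>Poly_Mapping.keys (Polynomial.coeff D k). ?t k \<alpha>) \<otimes>\<^bsub>R\<^esub> s [^]\<^bsub>R\<^esub> k)
     = lin (\<lambda>a. ke (\<psi> a)) (cm m) (Polynomial.coeff D k) * hh s ^ k"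
     using c s by (simp add: emb.h_mult emb.h_pow)
  qed
  show "cw_eval m n E B L \<psi> D s \<in> carrier R"
    unfolding cw_eval_def Let_def by (rule R.finsum_closed) (use u(1) in auto)
  have "hh (cw_eval m n E B L \<psi> D s) = (\<Sum>k\<le>Polynomial.degree D. hh ((\<Oplus>\<^bsub>R\<^esub>\<alpha>\<in>Poly_Mapping.keys (Polynomial.coeff D k). ?t k \<alpha>) \<otimes>\<^bsub>R\<^esub> s [^]\<^bsub>R\<^esub> k))"
    unfolding cw_eval_def Let_def by (rule emb.h_finsum) (use u(1) in auto)
  then show "hh (cw_eval m n E B L \<psi> D s) = peval (lin (\<lambda>a. ke (\<psi> a)) (cm m)) (hh s) D"
    unfolding peval_def u(2) .
qed

text \<open>The algebra over \<open>'k\<close> is an instance of the same setting, with the identity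
  as embedding. Its operators are literally those of the algebra over \<open>'t\<close>.\<close>

lemma weyl_image: "weyl (\<lambda>a. a) n ee bb L"
proof
  show "domain_embedding (\<lambda>a :: 'k. a)" by (auto simp: domain_embedding_def)
  show "\<exists>u. ee j * u = 1" if "1 \<le> j" "j \<le> n" for j
    using E_unit[OF that] by (metis \<phi>_mult \<phi>_one)
  show "bb j k * bb k j = 1" if "1 \<le> j" "j \<le> n" "1 \<le> k" "k \<le> n" for j k
    using B_inv[OF that] by (metis \<phi>_mult \<phi>_one)
qed (auto simp: E_ne B_diag L_pos bL eL)

sublocale K: weyl_at "\<lambda>a. a" n ee bb L m
  using weyl_image m1 mn by (simp add: weyl_at_def weyl_at_axioms_def)

declare K.\<phi>_eq_0 [simp del] K.\<phi>_eq_1 [simp del] K.\<phi>_zero [simp del] K.\<phi>_one [simp del]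

lemma K_uu: "K.uu = uu"
  by (simp add: fun_eq_iff K.uu_def uu_def)

lemma K_cm: "K.cm i = cm i"
  by (simp add: K.cm_def cm_def K_uu)

lemma K_sig: "K.sig (map_poly \<phi> p) = sig p"
proof -
  have "Polynomial.degree (map_poly \<phi> p) \<le> Polynomial.degree p" by (rule Polynomial.degree_le) (simp add: coeff_map_poly Polynomial.coeff_eq_0)
  from K.S.pe_bound[OF this] show ?thesis
    unfolding K.sig_def sig_def peval_def[of ke] by (simp add: coeff_map_poly K.ke_def ke_def K.zc_def zc_def)
qed

text \<open>Both algebras act by the same operators, so applying \<open>\<phi>\<close> to
  coefficients does not change the action. Membership in the ideal over the field is tested by
  vanishing of \<open>ev\<close>.\<close>

lemma base_change:
  assumes d: "d \<in> carrier R"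
  shows "cw_base_change m n E B \<phi> d \<in> carrier K.R" "K.hh (cw_base_change m n E B \<phi> d) = hh d"
proof -
  let ?M = "Poly_Mapping.map (map_poly \<phi>) :: (gen word \<Rightarrow>\<^sub>0 't poly) \<Rightarrow> (gen word \<Rightarrow>\<^sub>0 'k poly)"
  have lk: "Poly_Mapping.lookup (?M f) w = map_poly \<phi> (Poly_Mapping.lookup f w)" for f w
    by (simp add: Poly_Mapping.map.rep_eq when_def)
  have mp: "map_poly \<phi> (p + q) = map_poly \<phi> p + map_poly \<phi> q" for p q
    by (rule poly_eqI) (simp add: coeff_map_poly \<phi>_add)
  have Madd: "?M (f + g) = ?M f + ?M g" for f g
    by (rule poly_mapping_eqI) (simp only: lk lookup_add mp)
  have keys: "Poly_Mapping.keys (?M f) \<subseteq> Poly_Mapping.keys f" for f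
    by (auto simp: in_keys_iff lk)
  have Mcar: "?M f \<in> car G" if "f \<in> car G" for f using that keys[of f] by (auto simp: car_iff)
  have Mev: "K.rep.ev (?M f) = rep.ev f" for f
  proof -
    have "K.rep.ev (?M f) = (\<Sum>w\<in>Poly_Mapping.keys f. K.sig (Poly_Mapping.lookup (?M f) w) * prod_list (map vv (letters w)))"
     unfolding K.rep.ev_def by (rule lin_superset[where \<sigma> = K.sig, OF K.sig_simps(4) finite_keys keys])
    then show ?thesis unfolding rep.ev_def lin_def lk K_sig .
  qed
  obtain f where f: "f \<in> car G" "d = rep.cls f" using d unfolding cweyl_Q rep.carrier_Q by blast
  have eq: "cw_base_change m n E B \<phi> d = K.rep.cls (?M f)"
  proof -
    have "cw_base_change m n E B \<phi> d = {i + ?M g |i g. i \<in> K.rep.I \<and> g \<in> rep.cls f}"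
     unfolding cw_base_change_def f(2) set_add_def set_mult_def by (auto simp: free_algebra_def)
    also have "\<dots> = K.rep.cls (?M f)"
    proof (intro Set.equalityI subsetI)
     fix h assume "h \<in> {i + ?M g |i g. i \<in> K.rep.I \<and> g \<in> rep.cls f}"
     then obtain i i' where i: "i \<in> K.rep.I" "i' \<in> rep.I" "h = i + ?M (i' + f)" by (auto simp: rep.cls_alt)
     have "i' \<in> car G" using i(2) rep.I_car by blast
     then have "?M i' \<in> car G" by (rule Mcar)
     moreover have "K.rep.ev (?M i') = 0" unfolding Mev by (rule rep.ev_I[OF i(2)])
     ultimately have "?M i' \<in> K.rep.I" using K.rep.ev_eq_0_iff by blast
     then have "i + ?M i' \<in> K.rep.I" using i(1) K.rep.I_add by blast
     moreover have "h = (i + ?M i') + ?M f" by (simp add: i(3) Madd add.assoc)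
     ultimately show "h \<in> K.rep.cls (?M f)" by (auto simp: K.rep.cls_alt)
    next
     fix h assume "h \<in> K.rep.cls (?M f)"
     then show "h \<in> {i + ?M g |i g. i \<in> K.rep.I \<and> g \<in> rep.cls f}"
      using rep.cls_self[of f] by (auto simp: K.rep.cls_alt)
    qed
    finally show ?thesis .
  qed
  show "cw_base_change m n E B \<phi> d \<in> carrier K.R"
    unfolding eq K.cweyl_Q by (rule K.rep.cls_closed[OF Mcar[OF f(1)]])
  show "K.hh (cw_base_change m n E B \<phi> d) = hh d"
    unfolding eq K.rep.hh_cls[OF Mcar[OF f(1)]] unfolding f(2) rep.hh_cls[OF f(1)] by (rule Mev)
qed

end

section \<open>The recursion\<close>

lemma (in peval_hom) pe_peval: "pe (peval (\<lambda>a. [:\<theta> a:]) u D) = peval (\<lambda>a. \<psi> (\<theta> a)) (pe u) D"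
  unfolding peval_def[of "\<lambda>a. [:\<theta> a:]"] peval_def[of "\<lambda>a. \<psi> (\<theta> a)"]
  by (simp only: pe_sum pe_mult pe_const pe_power)

text \<open>A product over a cyclic orbit only depends on the \<open>r\<close>-th power of the variable.\<close>

lemma cyclic_prod:
  fixes f :: "nat \<Rightarrow> 'c::idom poly" and q :: 'c
  assumes r: "0 < r" "q ^ r = 1" "\<And>k. 0 < k \<Longrightarrow> k < r \<Longrightarrow> q ^ k \<noteq> 1"
    and f: "\<And>i. pcompose (f i) [:0, q:] = f (Suc i)" "f r = f 0"
  shows "\<exists>Q. (\<Prod>i<r. f i) = pcompose Q (Polynomial.monom 1 r)"
proof -
  obtain r' where r': "r = Suc r'" using r(1) gr0_implies_Suc by blast
  let ?p = "\<Prod>i<r. f i"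
  have "pcompose ?p [:0, q:] = (\<Prod>i<r. f (Suc i))" by (simp add: pcompose_prod f(1))
  also have "\<dots> = (\<Prod>i<r'. f (Suc i)) * f 0" using f(2) by (simp add: r')
  also have "\<dots> = ?p" unfolding r' prod.lessThan_Suc_shift by (simp add: mult.commute)
  finally have inv: "pcompose ?p [:0, q:] = ?p" .
  have "hmon r 0 ?p"
    unfolding hmon_def
  proof (intro allI impI)
    fix k assume c: "Polynomial.coeff ?p k \<noteq> 0"
    have "Polynomial.coeff ?p k = q ^ k * Polynomial.coeff ?p k"
     using coeff_pcompose_linear[of ?p q k] inv by simp
    then have qk: "q ^ k = 1" using c by simp
    have "q ^ k = (q ^ r) ^ (k div r) * q ^ (k mod r)" by (simp only: power_mult[symmetric] power_add[symmetric] mult_div_mod_eq)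
    then have "q ^ (k mod r) = 1" using qk r(2) by simp
    moreover have "k mod r < r" using r(1) by simp
    ultimately have "k mod r = 0" using r(3)[of "k mod r"] by auto
    then show "int r dvd int k - 0" by (simp add: mod_0_imp_dvd)
  qed
  from hmon_pcompose(2)[OF r(1) this] show ?thesis by blast
qed

section \<open>Descent from the roots to the operators\<close>

context weyl_lattice
begin

declare A1.K.\<phi>_eq_0 [simp del] A1.K.\<phi>_eq_1 [simp del] A1.K.\<phi>_zero [simp del] A1.K.\<phi>_one [simp del]

text \<open>Coefficientwise application of \<open>\<phi>\<close>, written through \<open>lin\<close>
  so that multiplicativity is inherited; likewise \<open>mK\<close> through
  \<open>peval\<close>.\<close>

definition cmap :: "((gen \<Rightarrow>\<^sub>0 nat) \<Rightarrow>\<^sub>0 't) \<Rightarrow> ((gen \<Rightarrow>\<^sub>0 nat) \<Rightarrow>\<^sub>0 'k)" where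
  "cmap = lin (\<lambda>a. Poly_Mapping.single 0 (\<phi> a)) (\<lambda>\<alpha>. Poly_Mapping.single \<alpha> 1)"
definition mK :: "((gen \<Rightarrow>\<^sub>0 nat) \<Rightarrow>\<^sub>0 't) poly \<Rightarrow> ((gen \<Rightarrow>\<^sub>0 nat) \<Rightarrow>\<^sub>0 'k) poly" where
  "mK = peval (\<lambda>a. [:cmap a:]) [:0, 1:]"
abbreviation "\<kappa> \<equiv> A1.K.iota"

lemma cmap_add: "cmap (p + q) = cmap p + cmap q"
  unfolding cmap_def by (rule lin_add) (simp_all add: \<phi>_add single_add)

lemma cmap_mult: "cmap (p * q) = cmap p * cmap q"
  unfolding cmap_def by (rule lin_mult) (simp_all add: \<phi>_add \<phi>_mult single_add mult_single mult.commute)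

lemma cmap_single: "cmap (Poly_Mapping.single \<alpha> a) = Poly_Mapping.single \<alpha> (\<phi> a)"
  unfolding cmap_def by (subst lin_single) (simp_all add: mult_single)

lemma cmap_1: "cmap 1 = 1"
  using cmap_single[of 0 1] by simp

lemma cmap_lookup: "Poly_Mapping.lookup (cmap a) \<alpha> = \<phi> (Poly_Mapping.lookup a \<alpha>)"
proof -
  have "Poly_Mapping.lookup (cmap a) \<alpha> = (\<Sum>w\<in>Poly_Mapping.keys a. if w = \<alpha> then \<phi> (Poly_Mapping.lookup a \<alpha>) else 0)"
    unfolding cmap_def lin_def lookup_sum by (intro sum.cong refl) (auto simp: mult_single lookup_single when_def)
  then show ?thesis by (simp add: in_keys_iff)
qed

lemma cmap_0: "cmap 0 = 0" by (simp add: cmap_def)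

lemma cmap_eq_0: "cmap a = 0 \<Longrightarrow> a = 0"
proof (rule poly_mapping_eqI)
  fix \<alpha> assume "cmap a = 0"
  then show "Poly_Mapping.lookup a \<alpha> = Poly_Mapping.lookup 0 \<alpha>" using cmap_lookup[of a \<alpha>] by simp
qed

sublocale M: peval_hom "\<lambda>a. [:cmap a:]" "[:0, 1:]"
  by unfold_locales (simp_all add: cmap_add cmap_mult cmap_1 one_pCons mult.commute)

lemma mK_simps: "mK (p + q) = mK p + mK q" "mK (p * q) = mK p * mK q" "mK 1 = 1" "mK 0 = 0" "mK (p ^ k) = mK p ^ k"
  "mK [:a:] = [:cmap a:]"
  unfolding mK_def by (simp_all only: M.pe_add M.pe_mult M.pe_one M.pe_0 M.pe_power M.pe_const)

lemma mK_pCons: "mK (pCons a p) = pCons (cmap a) (mK p)"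
  unfolding mK_def M.pe_pCons by (simp add: mult.commute)

lemma mK_eq_0: "mK p = 0 \<Longrightarrow> p = 0"
  by (induction p) (auto simp: mK_pCons cmap_eq_0)

lemma mK_cc: "mK cc = [:0, 1:]" and mK_cst: "mK (cst a) = [:Poly_Mapping.single 0 (\<phi> a):]"
  by (simp_all add: cc_def cst_def mK_pCons mK_simps cmap_0 cmap_1 cmap_single one_pCons)

lemma K_zc: "A1.K.zc = c" unfolding A1.K.zc_def by simp

lemma K_ke: "A1.K.ke a = kap a" by (simp add: A1.K.ke_def)

lemma K_iota0: "A1.K.iota0 (cmap a) = A1.iota0 a"
proof -
  have "A1.K.iota0 (cmap a) = (\<Sum>\<alpha>\<in>Poly_Mapping.keys a. A1.K.ke (Poly_Mapping.lookup (cmap a) \<alpha>) * cm 1 \<alpha>)"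
    unfolding A1.K.iota0_def A1.K_cm by (rule lin_superset) (auto simp: in_keys_iff cmap_lookup)
  then show ?thesis by (simp add: A1.iota0_def lin_def cmap_lookup K_ke A1.ke_def)
qed

lemma \<kappa>_mK: "\<kappa> (mK p) = \<iota> p"
proof (induction p)
  case 0
  then show ?case by (simp add: mK_simps A1.iota_simps A1.K.iota_simps)
next
  case (pCons a p)
  then show ?case
    unfolding mK_pCons A1.K.iota_def A1.iota_def A1.K.C.pe_pCons A1.C.pe_pCons K_iota0 K_zc zc1 by simp
qed

lemma \<kappa>_const: "\<kappa> [:Poly_Mapping.single 0 a:] = kap a"
  unfolding A1.K.iota_const A1.K.iota0_single by (simp add: K_ke)

lemma \<kappa>_c: "\<kappa> [:0, 1:] = c"
  using \<kappa>_mK[of cc] by (simp add: mK_cc \<iota>_cc)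

lemma \<kappa>_w0: "\<kappa> p * w0 = w0 * \<kappa> p"
proof -
  have "\<kappa> p * y = y * \<kappa> p" "\<kappa> p * x = x * \<kappa> p" using A1.K.iota_vv[OF gY, of p] A1.K.iota_vv[OF gX, of p] by simp_all
  then have "y ^ d * \<kappa> p = \<kappa> p * y ^ d" "x ^ d * \<kappa> p = \<kappa> p * x ^ d"
    using commute_power[of y "\<kappa> p" d] commute_power[of x "\<kappa> p" d] by simp_all
  then have "w0 * \<kappa> p = \<kappa> p * w0"
    unfolding w0_def by (intro commute_mult A1.ke_comm[symmetric])
  then show ?thesis by simp
qed

text \<open>In \<open>det_H_roots\<close> the element \<open>\<omega>\<close> is a root in a field,
  in the claim its place is taken by the operator \<open>w0\<close>. The product over
  \<open>i\<close> is some \<open>Q\<close> evaluated at the \<open>r\<close>-th power of either,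
  and both powers are \<open>W\<close>. The remaining work is the comparison of constants.\<close>

lemma delta_formula:
  fixes \<zeta> :: 'k
  assumes \<zeta>: "\<zeta> ^ r = 1" "\<And>k. 0 < k \<Longrightarrow> k < r \<Longrightarrow> \<zeta> ^ k \<noteq> 1" and char: "of_nat l \<noteq> (0 :: 't)"
  defines "\<Lambda> \<equiv> l * l * card Bx"
  shows "\<exists>u. u dvd 1 \<and> \<iota> A1.delta = kap (\<phi> u) * (kap (disc_theta l d \<Lambda> (\<phi> e)) * x ^ ((l - d) * \<Lambda>) * y ^ ((l - d) * \<Lambda>)
     * \<iota> (cc ^ l - W) ^ ((d - 1) * \<Lambda> div l)
     * prod_list (map (\<lambda>i. peval (\<lambda>a. \<kappa> [:cmap a:]) (c ^ d - kap (\<zeta> ^ i) * w0) DD ^ (d * l)) [0..<r]))"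
proof -
  let ?em = "\<lambda>p :: ((gen \<Rightarrow>\<^sub>0 nat) \<Rightarrow>\<^sub>0 'k) poly. to_ac (to_fract p)"
  have em0: "?em p = ?em p' \<longleftrightarrow> p = p'" for p p' by simp
  have emp: "?em (p ^ k) = ?em p ^ k" for p k by (induction k) simp_all
  let ?\<chi> = "\<lambda>p. ?em (mK p)"
  let ?q = "[:Poly_Mapping.single 0 \<zeta>:] :: ((gen \<Rightarrow>\<^sub>0 nat) \<Rightarrow>\<^sub>0 'k) poly"
  have qk: "?q ^ k = [:Poly_Mapping.single 0 (\<zeta> ^ k):]" for k
    by (induction k) (simp_all add: one_pCons single_one mult_single mult.commute)
  have q1: "?q ^ k = 1 \<longleftrightarrow> \<zeta> ^ k = 1" for k
  proof -
    have "?q ^ k = 1 \<longleftrightarrow> Poly_Mapping.single 0 (\<zeta> ^ k) = Poly_Mapping.single (0 :: gen \<Rightarrow>\<^sub>0 nat) 1"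
     unfolding qk by (simp add: one_pCons single_one)
    then show ?thesis by (metis lookup_single_eq)
  qed
  \<comment> \<open>The roots are taken in the algebraic closure of the fraction field of the
    polynomial ring over \<open>'k\<close>.\<close>
  obtain \<omega> where \<omega>: "\<omega> ^ r = ?\<chi> W" using nth_root_exists[OF r0] by blast
  have "\<forall>i. \<exists>t. t ^ d = ?\<chi> cc ^ d - ?em ?q ^ i * \<omega>" using nth_root_exists[OF d(1)] by blast
  from choice[OF this] obtain \<tau> where \<tau>: "\<And>i. \<tau> i ^ d = ?\<chi> cc ^ d - ?em ?q ^ i * \<omega>" by blast
  have eq1: "?em ?q ^ k = 1 \<longleftrightarrow> \<zeta> ^ k = 1" for k
    unfolding emp[symmetric] using em0[of "?q ^ k" 1] q1[of k] by simp
  have "\<exists>s. (s = 1 \<or> s = - 1) \<and> ?\<chi> (detS (Bx \<times> {..<l}) H) =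
    (s * of_nat l ^ l * ?\<chi> (cc ^ l - W) ^ (d - 1) * ?\<chi> W ^ (l - d)) ^ card Bx *
    (\<Prod>i<r. peval (\<lambda>a. ?\<chi> [:a:]) (?\<chi> cc ^ d - ?em ?q ^ i * \<omega>) DD ^ d)"
  proof (rule det_H_roots[OF _ _ _ _ _ _ \<omega> \<tau> char])
    show "?\<chi> a = 0 \<Longrightarrow> a = 0" for a using mK_eq_0[of a] by simp
  qed (use eq1 \<zeta> in \<open>simp_all add: mK_simps\<close>)
  then obtain s where s: "s = 1 \<or> s = - 1" "?\<chi> (detS (Bx \<times> {..<l}) H) =
    (s * of_nat l ^ l * ?\<chi> (cc ^ l - W) ^ (d - 1) * ?\<chi> W ^ (l - d)) ^ card Bx *
    (\<Prod>i<r. peval (\<lambda>a. ?\<chi> [:a:]) (?\<chi> cc ^ d - ?em ?q ^ i * \<omega>) DD ^ d)" by blast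
  \<comment> \<open>The sign left open by the Vandermonde determinant is the image of a unit of
    \<open>T\<close>.\<close>
  obtain st :: 't where st: "st dvd 1" "?\<chi> (cst st) = s"
  proof -
    have 1: "?\<chi> (cst 1) = 1" by (simp add: cst_simps mK_simps)
    have "?\<chi> (cst (- 1)) + ?\<chi> (cst 1) = ?\<chi> (cst (- 1 + 1))"
     by (simp only: cst_simps(4) mK_simps to_fract_add to_ac_add)
    also have "\<dots> = 0" by (simp add: cst_simps mK_simps)
    finally have "?\<chi> (cst (- 1)) = - 1" unfolding 1 by (simp add: eq_neg_iff_add_eq_0)
    note this 1
    then show thesis using s(1) that[of 1] that[of "- 1"] by auto
  qed
  \<comment> \<open>The \<open>i\<close>-th factor with an indeterminate, the outermost polynomial
    variable, in place of \<open>\<omega>\<close>.\<close>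
  define fac where "fac i = peval (\<lambda>a. [:[:cmap a:]:]) [:[:0, 1:] ^ d, - (?q ^ i):] DD" for i
  have "\<exists>Q. (\<Prod>i<r. fac i) = pcompose Q (Polynomial.monom 1 r)"
  proof (rule cyclic_prod[OF r0, of ?q])
    show "?q ^ r = 1" "0 < k \<Longrightarrow> k < r \<Longrightarrow> ?q ^ k \<noteq> 1" for k using \<zeta> q1 by auto
    have pp: "pcompose (p ^ k) v = pcompose p v ^ k" for p v :: "((gen \<Rightarrow>\<^sub>0 nat) \<Rightarrow>\<^sub>0 'k) poly poly" and k
     by (induction k) (simp_all add: pcompose_mult one_pCons)
    show "pcompose (fac i) [:0, ?q:] = fac (Suc i)" for i
     unfolding fac_def peval_def pcompose_sum pcompose_mult pp
     by (intro sum.cong refl arg_cong2[of _ _ _ _ "(*)"] arg_cong[of _ _ "\<lambda>v. v ^ _"])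
      (simp_all add: pcompose_pCons mult.commute)
    show "fac r = fac 0" using \<zeta>(1) q1[of r] by (simp add: fac_def)
  qed
  then obtain Q where Q: "(\<Prod>i<r. fac i) = pcompose Q (Polynomial.monom 1 r)" by blast
  interpret T: peval_hom ?em \<omega> by unfold_locales (simp_all add: mult.commute)
  interpret Op: peval_hom \<kappa> w0 by unfold_locales (simp_all only: A1.K.iota_simps \<kappa>_w0)
  have pQ: "peval \<psi> (\<psi> v) Q = \<psi> (poly Q v)" if "\<And>a b. \<psi> (a + b) = \<psi> a + \<psi> b" "\<And>a b. \<psi> (a * b) = \<psi> a * \<psi> b" "\<psi> 0 = 0"
    for \<psi> :: "_ \<Rightarrow> 'z::ring_1" and v
  proof (induction Q)
    case (pCons a Q)
    have "peval \<psi> (\<psi> v) (pCons a Q) = \<psi> a + \<psi> (poly Q v * v)" by (simp only: peval_pCons[where \<psi> = \<psi>, OF that(3)] pCons.IH that(2))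
    then show ?case by (simp add: that(1)[symmetric] mult.commute)
  qed (simp add: peval_0[where \<psi> = \<psi>, OF that(3)] that(3))
  let ?W = "poly Q (mK W)"
  have TQ: "(\<Prod>i<r. peval (\<lambda>a. ?\<chi> [:a:]) (?\<chi> cc ^ d - ?em ?q ^ i * \<omega>) DD) = ?em ?W"
  proof -
    have "T.pe (fac i) = peval (\<lambda>a. ?\<chi> [:a:]) (?\<chi> cc ^ d - ?em ?q ^ i * \<omega>) DD" for i
     unfolding fac_def T.pe_peval T.pe_pCons T.pe_0 mK_simps mK_cc by (simp only: emp T.\<psi>_uminus) simp
    then have "(\<Prod>i<r. peval (\<lambda>a. ?\<chi> [:a:]) (?\<chi> cc ^ d - ?em ?q ^ i * \<omega>) DD) = (\<Prod>i<r. T.pe (fac i))" by simp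
    also have "\<dots> = T.pe (\<Prod>i<r. fac i)"
     unfolding prod_lessThan_list T.pe_prod_list by (simp add: comp_def)
    also have "\<dots> = peval ?em (T.pe (Polynomial.monom 1 r)) Q" unfolding Q by (rule T.pe_pcompose)
    also have "T.pe (Polynomial.monom 1 r) = ?em (mK W)" unfolding T.pe_monom using \<omega> by simp
    also have "peval ?em (?em (mK W)) Q = ?em ?W" by (rule pQ) simp_all
    finally show ?thesis .
  qed
  have OQ: "\<kappa> ?W ^ (d * l) = prod_list (map (\<lambda>i. peval (\<lambda>a. \<kappa> [:cmap a:]) (c ^ d - kap (\<zeta> ^ i) * w0) DD ^ (d * l)) [0..<r])"
  proof -
    have "Op.pe (fac i) = peval (\<lambda>a. \<kappa> [:cmap a:]) (c ^ d - kap (\<zeta> ^ i) * w0) DD" for i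
     unfolding fac_def Op.pe_peval Op.pe_pCons Op.pe_const Op.pe_0 Op.\<psi>_uminus A1.K.iota_simps(5) \<kappa>_c qk \<kappa>_const by simp
    then have "prod_list (map (\<lambda>i. peval (\<lambda>a. \<kappa> [:cmap a:]) (c ^ d - kap (\<zeta> ^ i) * w0) DD ^ (d * l)) [0..<r])
     = prod_list (map Op.pe (map (\<lambda>i. fac i ^ (d * l)) [0..<r]))" by (simp add: comp_def Op.pe_power)
    also have "\<dots> = Op.pe ((\<Prod>i<r. fac i) ^ (d * l))"
     unfolding Op.pe_prod_list[symmetric] prod_lessThan_list[symmetric] prod_power_distrib ..
    also have "\<dots> = peval \<kappa> (Op.pe (Polynomial.monom 1 r)) Q ^ (d * l)" unfolding Q Op.pe_power Op.pe_pcompose ..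
    also have "Op.pe (Polynomial.monom 1 r) = \<kappa> (mK W)" unfolding Op.pe_monom A1.K.iota_simps(3) w0_power \<kappa>_mK by simp
    also have "peval \<kappa> (\<kappa> (mK W)) Q = \<kappa> ?W" by (rule pQ) (simp_all only: A1.K.iota_simps)
    finally show ?thesis by simp
  qed
  have on: "of_nat k = cst (of_nat k)" for k by (induction k) (simp_all add: cst_simps)
  have emn: "of_nat k = ?\<chi> (cst (of_nat k))" for k by (induction k) (simp_all add: cst_simps mK_simps)
  obtain u where u: "u dvd 1" "A1.delta * cst ((e - 1) ^ ((l - 1) * \<Lambda>)) = cst u * (of_nat l ^ \<Lambda> * detS (Bx \<times> {..<l}) H ^ l)"
    using delta_H unfolding \<Lambda>_def by blast
  let ?M = "(l - d) * card Bx * l" and ?N = "(d - 1) * card Bx * l"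
  \<comment> \<open>The constants collected: units, \<open>of_nat l\<close> from the traces over the
    powers of \<open>y\<close>, \<open>of_nat l\<close> from the Vandermonde determinants, and
    \<open>1 - e\<close> from the powers of \<open>W\<close>.\<close>
  let ?S = "(u * st ^ (card Bx * l)) * (of_nat l ^ \<Lambda> * of_nat l ^ \<Lambda> * (1 - e) ^ ((l - d) * \<Lambda>))"
  have W2: "mK W ^ ?M = mK (cst ((1 - e) ^ ((l - d) * \<Lambda>)) * (YY * gg (X 1)) ^ ?M)"
  proof -
    have "((1 - e) ^ l) ^ ?M = (1 - e) ^ ((l - d) * \<Lambda>)"
     unfolding power_mult[symmetric] \<Lambda>_def by (intro arg_cong[of _ _ "\<lambda>k. (1 - e) ^ k"]) (simp only: mult_ac)
    then show ?thesis unfolding mK_simps(5)[symmetric] W_def power_mult_distrib[of "cst _"] cst_power[symmetric] by simp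
  qed
  have L2: "(of_nat l ^ l) ^ (card Bx * l) = (of_nat l ^ \<Lambda> :: 'z::comm_semiring_1)"
    unfolding power_mult[symmetric] \<Lambda>_def by (intro arg_cong[of _ _ "\<lambda>k. of_nat l ^ k"]) (simp only: mult_ac)
  have s2: "?\<chi> (detS (Bx \<times> {..<l}) H) = (s * of_nat l ^ l * ?\<chi> (cc ^ l - W) ^ (d - 1) * ?\<chi> W ^ (l - d)) ^ card Bx * ?em ?W ^ d"
    unfolding s(2) prod_power_distrib[symmetric] TQ ..
  have "?\<chi> (A1.delta * cst ((e - 1) ^ ((l - 1) * \<Lambda>)))
    = ?\<chi> (cst u) * (of_nat l ^ \<Lambda> * ((s * of_nat l ^ l * ?\<chi> (cc ^ l - W) ^ (d - 1) * ?\<chi> W ^ (l - d)) ^ card Bx * ?em ?W ^ d) ^ l)"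
    unfolding u(2) on[of l] mK_simps(2,5) to_fract_mult to_ac_mult emp unfolding s2 emn[of l, symmetric] ..
  also have "\<dots> = ?\<chi> (cst u) * s ^ (card Bx * l) * (of_nat l ^ \<Lambda> * (of_nat l ^ l) ^ (card Bx * l)) * ?\<chi> W ^ ?M * ?\<chi> (cc ^ l - W) ^ ?N * ?em ?W ^ (d * l)"
    unfolding power_mult_distrib power_mult[symmetric] by (simp only: mult_ac)
  also have "\<dots> = ?em (mK (cst ?S * (YY * gg (X 1)) ^ ?M * (cc ^ l - W) ^ ?N) * ?W ^ (d * l))"
    unfolding L2 unfolding emn[of l] st(2)[symmetric]
    unfolding emp[symmetric] to_fract_mult[symmetric] to_ac_mult[symmetric] unfolding W2
    unfolding mK_simps cst_simps cst_power by (simp only: mult_ac)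
  finally have "mK (A1.delta * cst ((e - 1) ^ ((l - 1) * \<Lambda>))) = mK (cst ?S * (YY * gg (X 1)) ^ ?M * (cc ^ l - W) ^ ?N) * ?W ^ (d * l)"
    unfolding em0 .
  then have "\<kappa> (mK (A1.delta * cst ((e - 1) ^ ((l - 1) * \<Lambda>)))) = \<kappa> (mK (cst ?S * (YY * gg (X 1)) ^ ?M * (cc ^ l - W) ^ ?N) * ?W ^ (d * l))"
    by (rule arg_cong)
  then have E1: "\<iota> A1.delta * ke ((e - 1) ^ ((l - 1) * \<Lambda>)) = ke ?S * (y ^ l * x ^ l) ^ ?M * \<iota> (cc ^ l - W) ^ ?N * \<kappa> ?W ^ (d * l)"
    unfolding A1.K.iota_simps \<kappa>_mK A1.iota_simps(2,5) \<iota>_cst \<iota>_YY \<iota>_XX .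
  have yx: "(y ^ l * x ^ l) ^ ?M = x ^ ((l - d) * \<Lambda>) * y ^ ((l - d) * \<Lambda>)"
  proof -
    have c: "y ^ l * x ^ l = x ^ l * y ^ l" using uu_uu[OF gY gX] by (simp only: uY uX)
    have "l * ?M = (l - d) * \<Lambda>" unfolding \<Lambda>_def by (simp only: mult_ac)
    then show ?thesis unfolding c commuting_power_mult[OF c[symmetric]] power_mult[symmetric] by (simp only:)
  qed
  have N: "?N = (d - 1) * \<Lambda> div l"
  proof -
    have eq: "(d - 1) * \<Lambda> = l * ?N" unfolding \<Lambda>_def by (simp only: mult_ac)
    have "l \<noteq> 0" using l0 by simp
    then show ?thesis unfolding eq by (rule nonzero_mult_div_cancel_left[symmetric])
  qed
  let ?f = "1 - \<phi> e"
  have f0: "?f \<noteq> 0" using E_ne[OF one(1,2)] by simp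
  have dl: "d \<le> l" using d_dvd[OF one(1,2)] l0 by (simp add: dvd_imp_le)
  \<comment> \<open>Dividing \<open>(1 - e)^(l - d)\<close> by \<open>(1 - e)^(l - 1)\<close> leaves
    the exponent \<open>1 - d\<close>, which is where the negative power in
    \<open>disc_theta\<close> comes from.\<close>
  have pw: "?f ^ (l - 1) * ?f powi (1 - int d) = ?f ^ (l - d)"
  proof -
    have "int (l - 1) + (1 - int d) = int (l - d)" using dl d(1) l0 by (simp add: of_nat_diff)
    note h = this
    have "?f ^ (l - 1) * ?f powi (1 - int d) = ?f powi int (l - 1) * ?f powi (1 - int d)" by (simp only: power_int_of_nat)
    also have "\<dots> = ?f powi (int (l - 1) + (1 - int d))" by (rule power_int_add[symmetric]) (use f0 in auto)
    also have "\<dots> = ?f ^ (l - d)" unfolding h by (rule power_int_of_nat)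
    finally show ?thesis .
  qed
  \<comment> \<open>The transition matrix produces powers of \<open>e - 1\<close>, the formula has
    powers of \<open>1 - e\<close>; this is the sign between them.\<close>
  let ?sg = "(- 1) ^ ((l - 1) * \<Lambda>) :: 't"
  have sgsg: "?sg * ?sg = 1" by (simp only: power_mult_distrib[symmetric]) simp
  let ?u = "u * st ^ (card Bx * l) * ?sg"
  have "\<phi> ?S = \<phi> ((e - 1) ^ ((l - 1) * \<Lambda>)) * (\<phi> ?u * disc_theta l d \<Lambda> (\<phi> e))"
  proof -
    have pn: "\<phi> (of_nat k) = of_nat k" for k by (induction k) (simp_all add: \<phi>_add)
    have e1: "e - 1 = - 1 * (1 - e)" by simp
    have sg2: "\<phi> ?sg * \<phi> ?sg = 1" unfolding \<phi>_mult[symmetric] sgsg by (rule \<phi>_one)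
    have k: "\<phi> ((e - 1) ^ ((l - 1) * \<Lambda>)) = \<phi> ?sg * ?f ^ ((l - 1) * \<Lambda>)"
     unfolding e1 power_mult_distrib \<phi>_mult by (simp add: \<phi>_power \<phi>_diff)
    have t: "disc_theta l d \<Lambda> (\<phi> e) = of_nat l ^ \<Lambda> * of_nat l ^ \<Lambda> * (?f powi (1 - int d)) ^ \<Lambda>"
     unfolding disc_theta_def power_mult_distrib by (simp only: mult_ac)
    have "\<phi> ((e - 1) ^ ((l - 1) * \<Lambda>)) * (\<phi> ?u * disc_theta l d \<Lambda> (\<phi> e))
     = (\<phi> ?sg * \<phi> ?sg) * (\<phi> (u * st ^ (card Bx * l)) * (of_nat l ^ \<Lambda> * of_nat l ^ \<Lambda> * (?f ^ (l - 1) * ?f powi (1 - int d)) ^ \<Lambda>))"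
     unfolding k t unfolding power_mult power_mult_distrib[of "?f ^ (l - 1)"] \<phi>_mult by (simp only: mult_ac)
    also have "\<dots> = \<phi> ?S" unfolding sg2 pw unfolding \<phi>_mult \<phi>_power pn power_mult by (simp add: \<phi>_diff)
    finally show ?thesis by simp
  qed
  then have kS: "ke ?S = ke ((e - 1) ^ ((l - 1) * \<Lambda>)) * (kap (\<phi> ?u) * kap (disc_theta l d \<Lambda> (\<phi> e)))"
    unfolding A1.ke_def by (simp only: kap_mult)
  let ?R = "kap (\<phi> ?u) * (kap (disc_theta l d \<Lambda> (\<phi> e)) * x ^ ((l - d) * \<Lambda>) * y ^ ((l - d) * \<Lambda>)
     * \<iota> (cc ^ l - W) ^ ((d - 1) * \<Lambda> div l)
     * prod_list (map (\<lambda>i. peval (\<lambda>a. \<kappa> [:cmap a:]) (c ^ d - kap (\<zeta> ^ i) * w0) DD ^ (d * l)) [0..<r]))"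
  have "ke ((e - 1) ^ ((l - 1) * \<Lambda>)) * \<iota> A1.delta = ke ((e - 1) ^ ((l - 1) * \<Lambda>)) * ?R"
    using E1 unfolding yx N OQ kS A1.ke_comm[of "\<iota> A1.delta"] by (simp only: mult.assoc)
  then have z: "kap (\<phi> ((e - 1) ^ ((l - 1) * \<Lambda>))) * (\<iota> A1.delta - ?R) = 0"
    by ((simp only: right_diff_distrib A1.ke_def diff_self; fail) | (simp only: right_diff_distrib A1.ke_def, simp))
  have "e \<noteq> 1" using f0 \<phi>_one by (auto | metis diff_self)
  with z have "\<iota> A1.delta - ?R = 0" by - (rule kap_cancel, assumption, simp)
  moreover have "?u dvd 1"
  proof -
    have "?sg dvd 1" using sgsg by (metis dvd_triv_left)
    moreover have "st ^ (card Bx * l) dvd 1" using dvd_power_same[OF st(1), of "card Bx * l"] by simp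
    ultimately show ?thesis using u(1) by (simp only: is_unit_mult_iff)
  qed
  ultimately show ?thesis by (intro exI[of _ ?u]) simp
qed

end

lemma list_product_hom:
  assumes "ring_embedding R h" "\<And>a. a \<in> set as \<Longrightarrow> a \<in> carrier R"
  shows "list_product R as \<in> carrier R \<and> h (list_product R as) = prod_list (map h as)"
proof -
  interpret ring_embedding R h by fact
  interpret ring R by (rule ring)
  show ?thesis using assms(2) unfolding list_product_def by (induction as) (simp_all add: h_one h_mult)
qed

lemma over_gens_pcompose:
  fixes D p :: "((gen \<Rightarrow>\<^sub>0 nat) \<Rightarrow>\<^sub>0 't::comm_ring_1) poly"
  assumes p: "over_gens G p"
  shows "over_gens G D \<Longrightarrow> over_gens G (pcompose D p)"
proof (induction D)
  case (pCons a D)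
  have c: "Poly_Mapping.keys \<alpha> \<subseteq> G" if "\<alpha> \<in> Poly_Mapping.keys (Polynomial.coeff (pCons a D) k)" for \<alpha> k
    using pCons.prems that unfolding over_gens_def by blast
  have a: "over_gens G [:a:]" unfolding over_gens_def
    using c[of _ 0] by (simp add: coeff_pCons split: nat.splits)
  have "over_gens G D" unfolding over_gens_def using c[of _ "Suc k" for k] by simp
  then show ?case unfolding pcompose_pCons by (intro over_gens_add a over_gens_mult p pCons.IH)
qed (simp add: over_gens_0)

section \<open>From the Gram determinant to arbitrary discriminants\<close>

context weyl_at
begin

lemma basis_exists: "\<exists>b. is_basis R (cw_sub m n E B L) (\<Prod>j\<in>{m..n}. (L j)\<^sup>2) b"
  using dm.is_basis_ex[OF tbasis_Box] unfolding card_Box .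

lemma discriminant_exists: "\<exists>d. is_discriminant R (cw_sub m n E B L) d"
  by (rule dm.is_discriminant_ex[OF tbasis_Box])

text \<open>The context of \<open>delta_def\<close> fixes a modulus dividing every
  \<open>L j\<close>; the modulus 1 always qualifies.\<close>

lemma delta_alt: "delta = detS Box (\<lambda>\<rho> \<tau>. dm.tr Box ev (ev \<rho> * ev \<tau>))"
  by (rule delta_def[of 1]) auto

lemma delta_S0: "delta \<in> S0"
proof -
  have "ev \<rho> \<in> dm.\<A>" if "\<rho> \<in> Box" for \<rho> using dm.tbasis_in[OF tbasis_Box that] .
  then show ?thesis unfolding delta_alt by (intro dm.S0_detS dm.tr_S0[OF tbasis_Box] dm.\<A>_mult)
qed

lemma scalar_S0: "[:Poly_Mapping.single 0 a:] \<in> S0"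
  using over_gens_monom[of 0 G a 0] by (simp add: S0_def Polynomial.monom_0)

text \<open>Units of the polynomial ring are constants, so the ambiguity of the discriminant shrinks
  to units of \<open>T\<close>.\<close>

lemma discriminant_delta:
  assumes d: "is_discriminant R (cw_sub m n E B L) d"
  obtains a where "a dvd 1" "d \<in> carrier R" "hh d = iota ([:Poly_Mapping.single 0 a:] * delta)"
proof -
  obtain u v where uv: "u \<in> S0" "v \<in> S0" "u * v = 1"
    "hh d = iota (u * detS Box (\<lambda>\<rho> \<tau>. dm.tr Box ev (ev \<rho> * ev \<tau>)))" "d \<in> carrier R"
    by (rule dm.is_discriminantD[OF d tbasis_Box])
  obtain a where a: "u = [:Poly_Mapping.single 0 a:]" "a dvd 1" by (rule poly_pm_unit[OF uv(3)])
  show thesis by (rule that[OF a(2) uv(5)]) (simp only: uv(4) a(1) delta_alt)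
qed

lemma hh_eval_power:
  assumes D: "over_gens G D"
  shows "hh (cw_eval m n E B L (\<lambda>a. a) D (cw_c m n E B [^]\<^bsub>R\<^esub> q)) = iota (pcompose D (Polynomial.monom 1 q))"
    and "cw_eval m n E B L (\<lambda>a. a) D (cw_c m n E B [^]\<^bsub>R\<^esub> q) \<in> carrier R"
proof -
  interpret R: ring R by (rule emb.ring)
  have c: "cw_c m n E B [^]\<^bsub>R\<^esub> q \<in> carrier R" by (simp add: c_carrier)
  show "cw_eval m n E B L (\<lambda>a. a) D (cw_c m n E B [^]\<^bsub>R\<^esub> q) \<in> carrier R" by (rule hh_cw_eval(2)[OF D c])
  have "hh (cw_eval m n E B L (\<lambda>a. a) D (cw_c m n E B [^]\<^bsub>R\<^esub> q)) = peval iota0 (zc ^ q) D"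
    unfolding hh_cw_eval(1)[OF D c] by (simp add: emb.h_pow c_carrier hh_c iota0_def[abs_def])
  also have "\<dots> = iota (pcompose D (Polynomial.monom 1 q))"
    unfolding iota_def C.pe_pcompose C.pe_monom by (simp add: iota0_1)
  finally show "hh (cw_eval m n E B L (\<lambda>a. a) D (cw_c m n E B [^]\<^bsub>R\<^esub> q)) = iota (pcompose D (Polynomial.monom 1 q))" .
qed

text \<open>A constant factor does not disturb homogeneity of degree 0 modulo \<open>q\<close>. The
  modulus is the gcd of all \<open>L j\<close> for the larger algebra, and \<open>d\<close> for the
  smaller one.\<close>

lemma discriminant_polynomial:
  assumes d: "is_discriminant R (cw_sub m n E B L) d" and q: "0 < q" "\<And>j. j \<in> {m..n} \<Longrightarrow> q dvd L j"
  shows "\<exists>D. over_gens G D \<and> d = cw_eval m n E B L (\<lambda>a. a) D (cw_c m n E B [^]\<^bsub>R\<^esub> q)"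
proof -
  obtain a where a: "d \<in> carrier R" "hh d = iota ([:Poly_Mapping.single 0 a:] * delta)"
    using discriminant_delta[OF d] by blast
  let ?p = "[:Poly_Mapping.single 0 a:] * delta"
  have pS: "?p \<in> S0" by (intro dm.S0_mult scalar_S0 delta_S0)
  have "hmon q 0 [:Poly_Mapping.single (0 :: gen \<Rightarrow>\<^sub>0 nat) a:]" by (auto simp: hmon_def coeff_pCons split: nat.splits)
  from hmon_mult[OF this delta_hmon[OF q]] have h: "hmon q 0 ?p" by simp
  let ?D = "\<Sum>k\<le>Polynomial.degree ?p. Polynomial.monom (Polynomial.coeff ?p (q * k)) k"
  note D = hmon_pcompose[OF q(1) h]
  have oD: "over_gens G ?D" using pS unfolding over_gens_def D(1) S0_def by blast
  have "hh d = hh (cw_eval m n E B L (\<lambda>a. a) ?D (cw_c m n E B [^]\<^bsub>R\<^esub> q))"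
    unfolding hh_eval_power(1)[OF oD] a(2) D(2)[symmetric] ..
  then have "d = cw_eval m n E B L (\<lambda>a. a) ?D (cw_c m n E B [^]\<^bsub>R\<^esub> q)"
    by (rule iffD1[OF emb.h_eq_iff[OF a(1) hh_eval_power(2)[OF oD]]])
  then show ?thesis using oD by blast
qed

end

context weyl_lattice
begin

text \<open>Settles the case in which the characteristic divides \<open>r\<close>: no field
  extension then contains a primitive \<open>r\<close>-th root of unity, but \<open>l = d r\<close>
  is zero in \<open>T\<close>.\<close>

lemma discriminant_zero:
  assumes "of_nat l = (0 :: 't)" and dd: "is_discriminant (cweyl 1 n E B) (cw_sub 1 n E B L) \<delta>"
  shows "\<delta> = \<zero>\<^bsub>cweyl 1 n E B\<^esub>"
proof -
  interpret R: ring "cweyl 1 n E B" by (rule A1.emb.ring)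
  obtain a where a: "\<delta> \<in> carrier (cweyl 1 n E B)" "A1.hh \<delta> = \<iota> ([:Poly_Mapping.single 0 a:] * A1.delta)"
    using A1.discriminant_delta[OF dd] by blast
  have "A1.hh \<delta> = A1.hh \<zero>\<^bsub>cweyl 1 n E B\<^esub>"
    unfolding a(2) delta_zero[OF assms(1)] A1.emb.h_zero by (simp add: A1.iota_simps)
  then show ?thesis using A1.emb.h_eq_iff[OF a(1)] by simp
qed

lemma order_image: "mult_order (\<phi> e) = d"
proof -
  have "\<phi> e ^ k = 1 \<longleftrightarrow> e ^ k = 1" for k using \<phi>_eq_1[of "e ^ k"] by (simp only: \<phi>_power)
  note order = this
  show ?thesis unfolding mult_order_def order ..
qed

lemma Lambda: "(\<Prod>j\<in>{1..n}. (L j)\<^sup>2) = l * l * card Bx"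
  using card_Bx unfolding A1.card_Box by (simp only: mult.assoc)

text \<open>Evaluation is multiplicative because its point commutes with the central coefficients;
  for the part with \<open>w0\<close> this is \<open>\<kappa>_w0\<close>.\<close>

lemma peval_scaled:
  assumes D: "D = cst a * DD"
  shows "peval A1.iota0 (c ^ d - kap t * w0) D = ke a * peval A1.iota0 (c ^ d - kap t * w0) DD"
proof -
  have "A1.iota0 p * (c ^ d - kap t * w0) = (c ^ d - kap t * w0) * A1.iota0 p" for p
  proof -
    have i: "A1.iota0 p = \<iota> [:p:]" by (rule A1.iota_const[symmetric])
    have "\<iota> [:p:] * c ^ d = c ^ d * \<iota> [:p:]"
     unfolding \<iota>_cc[symmetric] A1.iota_simps(2,5)[symmetric] by (simp only: mult.commute)
    moreover have "\<iota> [:p:] * (kap t * w0) = (kap t * w0) * \<iota> [:p:]"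
     using \<kappa>_w0[of "mK [:p:]"] unfolding \<kappa>_mK kap_left[of "\<iota> [:p:]"] by (simp only: mult.assoc)
    ultimately show ?thesis by (simp only: i left_diff_distrib right_diff_distrib)
  qed
  then interpret Z: peval_hom A1.iota0 "c ^ d - kap t * w0"
    by unfold_locales (simp_all add: A1.iota0_add A1.iota0_mult A1.iota0_1)
  show ?thesis unfolding D Z.pe_mult unfolding cst_def Z.pe_const A1.iota0_single by simp
qed

text \<open>The discriminants and \<open>D\<close> are arbitrary representatives:
  \<open>\<delta>\<close> and \<open>\<delta>'\<close> differ from \<open>A1.delta\<close> and
  \<open>A2.delta\<close> by units \<open>a1\<close> and \<open>a2\<close> of \<open>T\<close>, and
  \<open>D\<close> differs from \<open>DD\<close> by \<open>a2\<close>. If \<open>l\<close> is zero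
  in \<open>T\<close>, the left side vanishes by \<open>delta_zero\<close> and the right side
  through \<open>disc_theta\<close>.\<close>

lemma recursion:
  fixes \<zeta> :: 'k
  assumes dd: "is_discriminant (cweyl 1 n E B) (cw_sub 1 n E B L) \<delta>"
    and dd': "is_discriminant (cweyl 2 n E B) (cw_sub 2 n E B L) \<delta>'"
    and D: "over_gens (gens 2 n) D" and \<delta>': "\<delta>' = cw_eval 2 n E B L (\<lambda>a. a) D (cw_c 2 n E B [^]\<^bsub>cweyl 2 n E B\<^esub> d)"
    and \<zeta>: "is_primitive_root_of_unity r \<zeta>"
  shows "\<exists>u. u dvd 1 \<and> cw_base_change 1 n E B \<phi> \<delta> =
     cw_const 1 n (\<lambda>j. \<phi> (E j)) (\<lambda>j k. \<phi> (B j k)) (\<phi> u)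
      \<otimes>\<^bsub>cweyl 1 n (\<lambda>j. \<phi> (E j)) (\<lambda>j k. \<phi> (B j k))\<^esub> disc_rhs n (\<lambda>j. \<phi> (E j)) (\<lambda>j k. \<phi> (B j k)) L \<phi> \<zeta> D"
proof -
  let ?E = "\<lambda>j. \<phi> (E j)" and ?B = "\<lambda>j k. \<phi> (B j k)"
  let ?A = "cweyl 1 n ?E ?B"
  let ?\<Lambda> = "l * l * card Bx"
  let ?N = "r * (d * l)"
  obtain a1 where a1: "a1 dvd 1" "\<delta> \<in> carrier (cweyl 1 n E B)" "A1.hh \<delta> = \<iota> (cst a1 * A1.delta)"
    unfolding cst_def by (rule A1.discriminant_delta[OF dd])
  obtain a2 where a2: "a2 dvd 1" "\<delta>' \<in> carrier (cweyl 2 n E B)" "A2.hh \<delta>' = A2.iota (cst a2 * A2.delta)"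
    unfolding cst_def by (rule A2.discriminant_delta[OF dd'])
  have "A2.iota (pcompose D (Polynomial.monom 1 d)) = A2.iota (cst a2 * A2.delta)"
    using A2.hh_eval_power(1)[OF D, of d] a2(3) by (simp only: \<delta>')
  moreover have "pcompose D (Polynomial.monom 1 d) \<in> A2.S0"
    unfolding A2.S0_def using over_gens_pcompose[OF _ D] over_gens_monom[of 0 "gens 2 n" "1::'t" d]
    by (simp add: single_one)
  moreover have "cst a2 * A2.delta \<in> A2.S0"
    unfolding cst_def by (intro A2.dm.S0_mult A2.scalar_S0 A2.delta_S0)
  ultimately have "pcompose D (Polynomial.monom 1 d) = cst a2 * A2.delta"
    by (rule inj_onD[OF A2.iota_inj])
  also have "\<dots> = pcompose (cst a2 * DD) (Polynomial.monom 1 d)"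
    unfolding DD(1) pcompose_mult by (simp add: cst_def)
  finally have "pcompose (D - cst a2 * DD) (Polynomial.monom 1 d) = 0" by (simp add: pcompose_diff)
  \<comment> \<open>Substituting a monomial of positive degree \<open>d\<close> is injective on
    polynomials.\<close>
  then have "D - cst a2 * DD = 0" by (rule pcompose_eq_0) (simp add: degree_monom_eq d(1))
  then have DDD: "D = cst a2 * DD" by simp
  interpret K: ring ?A by (rule A1.K.emb.ring)
  have g: "Y 1 \<in> gens 1 n" "X 1 \<in> gens 1 n" by (rule gY, rule gX)
  have D1: "over_gens (gens 1 n) D" using D g21 unfolding over_gens_def by blast
  let ?x = "cw_gen 1 n ?E ?B (X 1)" and ?y = "cw_gen 1 n ?E ?B (Y 1)" and ?c = "cw_c 1 n ?E ?B"
  let ?k = "cw_const 1 n ?E ?B"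
  note car = A1.K.gen_carrier[OF g(1)] A1.K.gen_carrier[OF g(2)] A1.K.c_carrier A1.K.const_carrier
  note hhs = A1.K.hh_gen[OF g(1)] A1.K.hh_gen[OF g(2)] A1.K.hh_c A1.K.hh_const
  let ?s = "\<lambda>i. ?c [^]\<^bsub>?A\<^esub> d \<ominus>\<^bsub>?A\<^esub> ?k (\<zeta> ^ i * (1 - \<phi> e) ^ d) \<otimes>\<^bsub>?A\<^esub> ?y [^]\<^bsub>?A\<^esub> d \<otimes>\<^bsub>?A\<^esub> ?x [^]\<^bsub>?A\<^esub> d"
  have kw: "kap (\<zeta> ^ i * (1 - \<phi> e) ^ d) * y ^ d * x ^ d = kap (\<zeta> ^ i) * w0" for i
    unfolding w0_def A1.ke_def by (simp add: kap_mult mult.assoc \<phi>_power \<phi>_diff)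
  have s: "?s i \<in> carrier ?A" "A1.K.hh (?s i) = c ^ d - kap (\<zeta> ^ i) * w0" for i
    using car by (simp_all add: A1.K.emb.h_minus A1.K.emb.h_mult A1.K.emb.h_pow hhs K_zc K_ke kw)
  let ?f = "\<lambda>i. cw_eval 1 n ?E ?B L \<phi> D (?s i) [^]\<^bsub>?A\<^esub> (d * l)"
  let ?P = "\<lambda>i. peval (\<lambda>a. \<kappa> [:cmap a:]) (c ^ d - kap (\<zeta> ^ i) * w0) DD ^ (d * l)"
  have i0: "(\<lambda>a. \<kappa> [:cmap a:]) = A1.iota0" by (simp add: fun_eq_iff A1.K.iota_const K_iota0)
  have i1: "lin (\<lambda>a. A1.K.ke (\<phi> a)) (cm 1) = A1.iota0"
    by (simp add: fun_eq_iff A1.iota0_def K_ke A1.ke_def[abs_def])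
  have f: "?f i \<in> carrier ?A" "A1.K.hh (?f i) = ke (a2 ^ (d * l)) * ?P i" for i
  proof -
    note ce = A1.K.hh_cw_eval[OF D1 s(1), where \<psi> = \<phi>]
    show "?f i \<in> carrier ?A" using ce(2) by simp
    have "A1.K.hh (?f i) = (ke a2 * peval A1.iota0 (c ^ d - kap (\<zeta> ^ i) * w0) DD) ^ (d * l)"
     unfolding A1.K.emb.h_pow[OF ce(2)] ce(1) s(2) A1.K_cm i1 peval_scaled[OF DDD] ..
    also have "\<dots> = ke a2 ^ (d * l) * ?P i"
     unfolding i0 by (rule commuting_power_mult) (rule A1.ke_comm[symmetric])
    also have "ke a2 ^ (d * l) = ke (a2 ^ (d * l))" by (simp only: A1.ke_def \<phi>_power kap_power)
    finally show "A1.K.hh (?f i) = ke (a2 ^ (d * l)) * ?P i" .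
  qed
  let ?L = "list_product ?A (map ?f [0..<r])"
  have L: "?L \<in> carrier ?A" "A1.K.hh ?L = ke (a2 ^ ?N) * prod_list (map ?P [0..<r])"
  proof -
    have lp: "?L \<in> carrier ?A \<and> A1.K.hh ?L = prod_list (map A1.K.hh (map ?f [0..<r]))"
     by (rule list_product_hom[OF A1.K.emb_R]) (use f(1) in auto)
    then show "?L \<in> carrier ?A" by simp
    have "prod_list (map (\<lambda>i. ke w * ?P i) js) = ke (w ^ length js) * prod_list (map ?P js)" for w js
    proof (induction js)
     case (Cons i js)
     have "ke w * ?P i * (ke (w ^ length js) * prod_list (map ?P js)) = ke w * ke (w ^ length js) * (?P i * prod_list (map ?P js))"
      by (simp only: mult.assoc A1.ke_left[of "?P i"])
     then show ?case using Cons.IH by (simp only: list.map prod_list.Cons length_Cons A1.ke_mult[symmetric] power_Suc)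
    qed simp
    note gen = this
    have "A1.K.hh ?L = prod_list (map (\<lambda>i. ke (a2 ^ (d * l)) * ?P i) [0..<r])"
     using lp by (simp only: map_map comp_def f(2))
    also have "\<dots> = ke ((a2 ^ (d * l)) ^ length [0..<r]) * prod_list (map ?P [0..<r])" by (rule gen)
    also have "(a2 ^ (d * l)) ^ length [0..<r] = a2 ^ ?N"
     unfolding length_upt diff_zero power_mult[symmetric] by (simp only: mult_ac)
    finally show "A1.K.hh ?L = ke (a2 ^ ?N) * prod_list (map ?P [0..<r])" .
  qed
  let ?W = "?c [^]\<^bsub>?A\<^esub> l \<ominus>\<^bsub>?A\<^esub> ?k ((1 - \<phi> e) ^ l) \<otimes>\<^bsub>?A\<^esub> ?y [^]\<^bsub>?A\<^esub> l \<otimes>\<^bsub>?A\<^esub> ?x [^]\<^bsub>?A\<^esub> l"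
  have W: "?W \<in> carrier ?A" "A1.K.hh ?W = \<iota> (cc ^ l - W)"
  proof -
    have "\<iota> (cc ^ l - W) = c ^ l - kap ((1 - \<phi> e) ^ l) * y ^ l * x ^ l"
     unfolding W_def A1.iota_simps \<iota>_cc \<iota>_cst \<iota>_YY \<iota>_XX by (simp add: A1.ke_def \<phi>_power \<phi>_diff mult.assoc)
    then show "?W \<in> carrier ?A" "A1.K.hh ?W = \<iota> (cc ^ l - W)"
     using car by (simp_all add: A1.K.emb.h_minus A1.K.emb.h_mult A1.K.emb.h_pow hhs K_zc K_ke)
  qed
  let ?X = "kap (disc_theta l d ?\<Lambda> (\<phi> e)) * x ^ ((l - d) * ?\<Lambda>) * y ^ ((l - d) * ?\<Lambda>) * \<iota> (cc ^ l - W) ^ ((d - 1) * ?\<Lambda> div l)"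
  have rhs: "disc_rhs n ?E ?B L \<phi> \<zeta> D \<in> carrier ?A"
    "A1.K.hh (disc_rhs n ?E ?B L \<phi> \<zeta> D) = kap (\<phi> (a2 ^ ?N)) * (?X * prod_list (map ?P [0..<r]))"
  proof -
    have eq: "disc_rhs n ?E ?B L \<phi> \<zeta> D = ?k (disc_theta l d ?\<Lambda> (\<phi> e)) \<otimes>\<^bsub>?A\<^esub> ?x [^]\<^bsub>?A\<^esub> ((l - d) * ?\<Lambda>)
     \<otimes>\<^bsub>?A\<^esub> ?y [^]\<^bsub>?A\<^esub> ((l - d) * ?\<Lambda>) \<otimes>\<^bsub>?A\<^esub> ?W [^]\<^bsub>?A\<^esub> ((d - 1) * ?\<Lambda> div l) \<otimes>\<^bsub>?A\<^esub> ?L"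
     unfolding disc_rhs_def Let_def Lambda order_image ..
    show "disc_rhs n ?E ?B L \<phi> \<zeta> D \<in> carrier ?A" unfolding eq using car W(1) L(1) by simp
    have "A1.K.hh (disc_rhs n ?E ?B L \<phi> \<zeta> D) = ?X * (ke (a2 ^ ?N) * prod_list (map ?P [0..<r]))"
     unfolding eq using car W(1) L(1)
     by (simp only: A1.K.emb.h_mult A1.K.emb.h_pow hhs K.m_closed K.nat_pow_closed K_ke W(2) L(2) vv_simps)
    then show "A1.K.hh (disc_rhs n ?E ?B L \<phi> \<zeta> D) = kap (\<phi> (a2 ^ ?N)) * (?X * prod_list (map ?P [0..<r]))"
     by (simp only: A1.ke_def kap_left[of ?X])
  qed
  have lhs: "A1.K.hh (cw_base_change 1 n E B \<phi> \<delta>) = kap (\<phi> a1) * \<iota> A1.delta"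
    unfolding A1.base_change(2)[OF a1(2)] a1(3) A1.iota_simps(2) \<iota>_cst A1.ke_def ..
  have fin: ?thesis if u: "u dvd 1" "A1.K.hh (cw_base_change 1 n E B \<phi> \<delta>) = kap (\<phi> u) * A1.K.hh (disc_rhs n ?E ?B L \<phi> \<zeta> D)" for u
  proof -
    have "A1.K.hh (cw_base_change 1 n E B \<phi> \<delta>) = A1.K.hh (?k (\<phi> u) \<otimes>\<^bsub>?A\<^esub> disc_rhs n ?E ?B L \<phi> \<zeta> D)"
     using u(2) by (simp only: A1.K.emb.h_mult[OF car(4) rhs(1)] hhs K_ke)
    then have "cw_base_change 1 n E B \<phi> \<delta> = ?k (\<phi> u) \<otimes>\<^bsub>?A\<^esub> disc_rhs n ?E ?B L \<phi> \<zeta> D"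
     by (rule iffD1[OF A1.K.emb.h_eq_iff[OF A1.base_change(1)[OF a1(2)] K.m_closed[OF car(4) rhs(1)]]])
    then show ?thesis using u(1) by blast
  qed
  show ?thesis
  proof (cases "of_nat l = (0 :: 't)")
    case True
    have pn: "\<phi> (of_nat k) = of_nat k" for k by (induction k) (simp_all add: \<phi>_add)
    have "0 \<in> Bx" using A2.L_pos_G by (auto simp: A2.Box_def)
    then have "card Bx > 0" using A2.finite_Box by (auto simp: card_gt_0_iff)
    then have "?\<Lambda> > 0" using l0 by simp
    moreover have "of_nat l = (0 :: 'k)" using pn[of l] True by simp
    ultimately have "disc_theta l d ?\<Lambda> (\<phi> e) = 0" unfolding disc_theta_def by (simp only: zero_power mult_zero_left)
    then have "A1.K.hh (disc_rhs n ?E ?B L \<phi> \<zeta> D) = 0" unfolding rhs(2) by simp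
    moreover have "A1.K.hh (cw_base_change 1 n E B \<phi> \<delta>) = 0" unfolding lhs delta_zero[OF True] A1.iota_simps by simp
    ultimately have "A1.K.hh (cw_base_change 1 n E B \<phi> \<delta>) = kap (\<phi> 1) * A1.K.hh (disc_rhs n ?E ?B L \<phi> \<zeta> D)"
     by (simp only: mult_zero_right)
    then show ?thesis by (rule fin[OF dvd_refl])
  next
    case False
    have z2: "\<zeta> ^ k \<noteq> 1" if "0 < k" "k < r" for k
     using \<zeta> that unfolding is_primitive_root_of_unity_def by blast
    have z1: "\<zeta> ^ r = 1" using \<zeta> unfolding is_primitive_root_of_unity_def by blast
    obtain u where u0: "u dvd 1 \<and> \<iota> A1.delta = kap (\<phi> u) * (?X * prod_list (map ?P [0..<r]))"
     by (rule exE[OF delta_formula[OF z1 z2 False]])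
    note u = conjunct1[OF u0] conjunct2[OF u0]
    obtain a2' where a2': "a2 * a2' = 1" using a2(1) by (metis dvdE)
    have p1: "a2' ^ ?N * a2 ^ ?N = 1" unfolding power_mult_distrib[symmetric] mult.commute[of a2'] a2' by simp
    \<comment> \<open>Each of the \<open>r\<close> factors contains \<open>D\<close> to the power
      \<open>d l\<close>, so the right side carries \<open>a2\<close> to the power
      \<open>?N\<close>; its inverse compensates.\<close>
    let ?u = "a1 * u * a2' ^ ?N"
    have "kap (\<phi> ?u) * A1.K.hh (disc_rhs n ?E ?B L \<phi> \<zeta> D) = kap (\<phi> (a1 * u * (a2' ^ ?N * a2 ^ ?N))) * (?X * prod_list (map ?P [0..<r]))"
     unfolding rhs(2) \<phi>_mult by (simp only: kap_kap mult.assoc[where 'a = 'k])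
    also have "\<dots> = A1.K.hh (cw_base_change 1 n E B \<phi> \<delta>)"
     unfolding p1 lhs u(2) by (simp only: mult_1_right \<phi>_mult kap_kap)
    finally have "A1.K.hh (cw_base_change 1 n E B \<phi> \<delta>) = kap (\<phi> ?u) * A1.K.hh (disc_rhs n ?E ?B L \<phi> \<zeta> D)" ..
    moreover have "a2' ^ ?N dvd 1" using p1 by (metis dvd_triv_left)
    then have "?u dvd 1" using a1(1) u(1) by (simp only: is_unit_mult_iff)
    ultimately show ?thesis by (rule fin[rotated])
  qed
qed

end

text \<open>A root of unity is inverted by one of its powers, and \<open>qweyl_orders\<close> turns
  centrality into the conditions on orders.\<close>

lemma weyl_latticeI:
  fixes E :: "nat \<Rightarrow> 't::idom" and \<phi> :: "'t \<Rightarrow> 'k::field"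
  assumes n: "n \<ge> 1"
    and E_root: "\<forall>j\<in>{1..n}. is_root_of_unity (E j)"
    and E_ne: "\<forall>j\<in>{1..n}. E j \<noteq> 1"
    and B_inv: "\<forall>j\<in>{1..n}. \<forall>k\<in>{1..n}. j \<noteq> k \<longrightarrow> B j k * B k j = 1"
    and B_diag: "\<forall>j\<in>{1..n}. B j j = 1"
    and L_pos: "\<forall>j\<in>{1..n}. L j > 0"
    and central: "\<forall>g\<in>gens 1 n.
      qw_class 1 n E B 1 (fgen g) [^]\<^bsub>qweyl 1 n E B 1\<^esub> L (idx g) \<in> ring_center (qweyl 1 n E B 1)"
    and \<phi>: "domain_embedding \<phi>"
  shows "weyl_lattice \<phi> n E B L"
proof -
  have Eu: "\<exists>u. E j * u = 1" if "1 \<le> j" "j \<le> n" for j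
  proof -
    have "is_root_of_unity (E j)" using E_root that by simp
    then obtain k where k: "k > 0" "E j ^ k = 1" unfolding is_root_of_unity_def by blast
    then have "E j * E j ^ (k - 1) = 1" by (cases k) auto
    then show ?thesis by blast
  qed
  have Bi: "B j k * B k j = 1" if "1 \<le> j" "j \<le> n" "1 \<le> k" "k \<le> n" for j k
    using B_inv B_diag that by (cases "j = k") auto
  have E1: "E j \<noteq> 1" if "1 \<le> j" "j \<le> n" for j using E_ne that by auto
  have B1: "B j j = 1" if "1 \<le> j" "j \<le> n" for j using B_diag that by auto
  note ord = qweyl_orders[where E = E and B = B and L = L and n = n, OF Eu E1 Bi B1 central[rule_format]]
  show ?thesis
    by unfold_locales (use \<phi> Eu E1 Bi B1 L_pos n ord in auto)
qed

lemma to_fract_embedding: "domain_embedding (to_fract :: 't::idom \<Rightarrow> 't fract)"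
  by (simp add: domain_embedding_def inj_on_def)

theorem theorem7p2:
  fixes n :: nat
    and E :: "nat \<Rightarrow> 't::idom"
    and B :: "nat \<Rightarrow> nat \<Rightarrow> 't"
    and L :: "nat \<Rightarrow> nat"
  assumes n: "n \<ge> 1"
    and E_root: "\<forall>j\<in>{1..n}. is_root_of_unity (E j)"
    and E_ne: "\<forall>j\<in>{1..n}. E j \<noteq> 1"
    and B_root: "\<forall>j\<in>{1..n}. \<forall>k\<in>{1..n}. is_root_of_unity (B j k)"
    and B_inv: "\<forall>j\<in>{1..n}. \<forall>k\<in>{1..n}. j \<noteq> k \<longrightarrow> B j k * B k j = 1"
    and B_diag: "\<forall>j\<in>{1..n}. B j j = 1"
    and L_pos: "\<forall>j\<in>{1..n}. L j > 0"
    and central: "\<forall>g\<in>gens 1 n.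
      qw_class 1 n E B 1 (fgen g) [^]\<^bsub>qweyl 1 n E B 1\<^esub> L (idx g) \<in> ring_center (qweyl 1 n E B 1)"
  shows
    "(\<exists>b. is_basis (cweyl 1 n E B) (cw_sub 1 n E B L) (\<Prod>j\<in>{1..n}. (L j)\<^sup>2) b) \<and>
    (\<exists>b. is_basis (cweyl 2 n E B) (cw_sub 2 n E B L) (\<Prod>j\<in>{2..n}. (L j)\<^sup>2) b) \<and>
    (\<exists>d. is_discriminant (cweyl 1 n E B) (cw_sub 1 n E B L) d) \<and>
    (\<exists>d'. is_discriminant (cweyl 2 n E B) (cw_sub 2 n E B L) d') \<and>
    (\<forall>d. is_discriminant (cweyl 1 n E B) (cw_sub 1 n E B L) d \<longrightarrow>
      (\<exists>D. over_gens (gens 1 n) D \<and>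
        d = cw_eval 1 n E B L (\<lambda>a. a) D (cw_c 1 n E B [^]\<^bsub>cweyl 1 n E B\<^esub> Gcd (L ` {1..n})))) \<and>
    (\<forall>d'. is_discriminant (cweyl 2 n E B) (cw_sub 2 n E B L) d' \<longrightarrow>
      (\<exists>D. over_gens (gens 2 n) D \<and>
        d' = cw_eval 2 n E B L (\<lambda>a. a) D (cw_c 2 n E B [^]\<^bsub>cweyl 2 n E B\<^esub> mult_order (E 1)))) \<and>
    (\<forall>d d' D (\<phi> :: 't \<Rightarrow> 'k::field) \<zeta>.
      is_discriminant (cweyl 1 n E B) (cw_sub 1 n E B L) d \<longrightarrow>
      is_discriminant (cweyl 2 n E B) (cw_sub 2 n E B L) d' \<longrightarrow>
      over_gens (gens 2 n) D \<longrightarrow>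
      d' = cw_eval 2 n E B L (\<lambda>a. a) D (cw_c 2 n E B [^]\<^bsub>cweyl 2 n E B\<^esub> mult_order (E 1)) \<longrightarrow>
      domain_embedding \<phi> \<longrightarrow>
      is_primitive_root_of_unity (L 1 div mult_order (E 1)) \<zeta> \<longrightarrow>
      (\<exists>u. u dvd 1 \<and>
       cw_base_change 1 n E B \<phi> d =
        cw_const 1 n (\<lambda>j. \<phi> (E j)) (\<lambda>j k. \<phi> (B j k)) (\<phi> u)
         \<otimes>\<^bsub>cweyl 1 n (\<lambda>j. \<phi> (E j)) (\<lambda>j k. \<phi> (B j k))\<^esub>
        disc_rhs n (\<lambda>j. \<phi> (E j)) (\<lambda>j k. \<phi> (B j k)) L \<phi> \<zeta> D)) \<and>
    (of_nat (L 1) = (0 :: 't) \<longrightarrow>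
      (\<forall>d. is_discriminant (cweyl 1 n E B) (cw_sub 1 n E B L) d \<longrightarrow> d = \<zero>\<^bsub>cweyl 1 n E B\<^esub>))"
proof -
  note wl = weyl_latticeI[OF n E_root E_ne B_inv B_diag L_pos central]
  \<comment> \<open>The claims that do not mention \<open>\<phi>\<close> are read off over the
    fraction field; the recursion is interpreted anew for each embedding.\<close>
  interpret T: weyl_lattice to_fract n E B L by (rule wl[OF to_fract_embedding])
  have q: "0 < Gcd (L ` {1..n})" "j \<in> {1..n} \<Longrightarrow> Gcd (L ` {1..n}) dvd L j" for j
  proof -
    have "Gcd (L ` {1..n}) dvd L 1" using n by (intro Gcd_dvd) auto
    then show "0 < Gcd (L ` {1..n})" using T.l0 by (metis dvd_0_left_iff neq0_conv)
    show "j \<in> {1..n} \<Longrightarrow> Gcd (L ` {1..n}) dvd L j" by (intro Gcd_dvd) auto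
  qed
  have d2: "mult_order (E 1) dvd L j" if "j \<in> {2..n}" for j using T.d_dvd[of j] that by simp
  show ?thesis
  proof (intro conjI allI impI)
    show "\<exists>b. is_basis (cweyl 1 n E B) (cw_sub 1 n E B L) (\<Prod>j\<in>{1..n}. (L j)\<^sup>2) b" by (rule T.A1.basis_exists)
    show "\<exists>b. is_basis (cweyl 2 n E B) (cw_sub 2 n E B L) (\<Prod>j\<in>{2..n}. (L j)\<^sup>2) b" by (rule T.A2.basis_exists)
    show "\<exists>d. is_discriminant (cweyl 1 n E B) (cw_sub 1 n E B L) d" by (rule T.A1.discriminant_exists)
    show "\<exists>d'. is_discriminant (cweyl 2 n E B) (cw_sub 2 n E B L) d'" by (rule T.A2.discriminant_exists)
  next
    fix d assume "is_discriminant (cweyl 1 n E B) (cw_sub 1 n E B L) d"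
    then show "\<exists>D. over_gens (gens 1 n) D \<and>
      d = cw_eval 1 n E B L (\<lambda>a. a) D (cw_c 1 n E B [^]\<^bsub>cweyl 1 n E B\<^esub> Gcd (L ` {1..n}))"
     by (rule T.A1.discriminant_polynomial[OF _ q])
  next
    fix d' assume "is_discriminant (cweyl 2 n E B) (cw_sub 2 n E B L) d'"
    then show "\<exists>D. over_gens (gens 2 n) D \<and>
      d' = cw_eval 2 n E B L (\<lambda>a. a) D (cw_c 2 n E B [^]\<^bsub>cweyl 2 n E B\<^esub> mult_order (E 1))"
     by (rule T.A2.discriminant_polynomial[OF _ T.d(1) d2])
  next
    fix d d' D and \<phi> :: "'t \<Rightarrow> 'k" and \<zeta> :: 'k
    assume h: "is_discriminant (cweyl 1 n E B) (cw_sub 1 n E B L) d"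
     "is_discriminant (cweyl 2 n E B) (cw_sub 2 n E B L) d'" "over_gens (gens 2 n) D"
     "d' = cw_eval 2 n E B L (\<lambda>a. a) D (cw_c 2 n E B [^]\<^bsub>cweyl 2 n E B\<^esub> mult_order (E 1))"
     "domain_embedding \<phi>" "is_primitive_root_of_unity (L 1 div mult_order (E 1)) \<zeta>"
    interpret F: weyl_lattice \<phi> n E B L by (rule wl[OF h(5)])
    show "\<exists>u. u dvd 1 \<and> cw_base_change 1 n E B \<phi> d =
        cw_const 1 n (\<lambda>j. \<phi> (E j)) (\<lambda>j k. \<phi> (B j k)) (\<phi> u)
         \<otimes>\<^bsub>cweyl 1 n (\<lambda>j. \<phi> (E j)) (\<lambda>j k. \<phi> (B j k))\<^esub>
        disc_rhs n (\<lambda>j. \<phi> (E j)) (\<lambda>j k. \<phi> (B j k)) L \<phi> \<zeta> D"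
     by (rule F.recursion[OF h(1-4,6)])
  next
    fix d assume "of_nat (L 1) = (0 :: 't)" "is_discriminant (cweyl 1 n E B) (cw_sub 1 n E B L) d"
    then show "d = \<zero>\<^bsub>cweyl 1 n E B\<^esub>" by (rule T.discriminant_zero)
  qed
qed

end
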